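(* Let $\Gamma<\operatorname{SO}(d+1,1)^\circ$ be Zariski dense, torsion-free, geometrically finite with parabolic elements, with $\infty$ a parabolic fixed point, $M=\Gamma\backslash\mathbb{H}^{d+1}$, and let $(\Lambda^R,\hat T_t,\hat\nu^R)$ be the hyperbolic skew product flow built from a coding of $\Delta_0$ (see context). Let $\Phi:\Lambda^R\to\operatorname{T}^1(M)$ be the map induced by $$\tilde\Phi:\Lambda^R\to\partial^2(\mathbb{H}^{d+1})\times\mathbb{R},\qquad(x,x_-,s)\mapsto(x,x_-,s-\log(1+|x|^2)),$$ via the Hopf parametrization $\operatorname{T}^1(M)\cong\Gamma\backslash(\partial^2(\mathbb{H}^{d+1})\times\mathbb{R})$. Then $\Phi:(\Lambda^R,\hat T_t,\hat\nu^R)\to(\operatorname{T}^1(M),\mathcal{G}_t,m^{\operatorname{BMS}})$ is a factor map, i.e. $$\Phi_*\hat\nu^R=m^{\operatorname{BMS}}\quad\text{and}\quad\Phi\circ\hat T_t=\mathcal{G}_t\circ\Phi\ \text{ for all }t\ge0.$$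
   Context: Upper half-space model, $o=(0,\dots,0,1)$, $\partial\mathbb{H}^{d+1}=\mathbb{R}^d\cup\{\infty\}$, $\partial^2(\mathbb{H}^{d+1})=\{(x,x_-)\in(\partial\mathbb{H}^{d+1})^2:x\ne x_-\}$; $|g'(x)|$ is Euclidean linear distortion on the boundary, $d_{\mathbb{S}^d}$ the spherical metric on $\partial\mathbb{H}^{d+1}$. $\Lambda_\Gamma$ limit set, $\delta$ critical exponent, $\beta$ Busemann function ($\beta_x(z,z')=\lim_t d(z,x_t)-d(z',x_t)$), $\mu$ the Patterson-Sullivan measure based at $o$. Hopf parametrization: a unit vector $v$ corresponds to $(x,x_-,\beta_x(o,v_* ))$, with $x,x_-$ its forward/backward endpoints, $v_*$ its base point; the geodesic flow $\mathcal{G}_t$ is translation in the last coordinate, and $\gamma(x,x_-,s)=(\gamma x,\gamma x_-,s-\beta_x(o,\gamma^{-1}o))$. $m^{\operatorname{BMS}}$ is the probability measure on $\operatorname{T}^1(M)$ obtained by normalizing the measure induced by $e^{\delta\beta_x(o,x_* )}e^{\delta\beta_{x_-}(o,x_* )}\mathrm{d}\mu(x)\mathrm{d}\mu(x_-)\mathrm{d}s$ ($x_*$ the base point of $(x,x_-,s)$). Fundamental region $\Delta_0$ for $\infty$: by Bieberbach there are a finite-index maximal normal abelian subgroup $\Gamma_\infty$ of $\mathrm{Stab}_\Gamma(\infty)$ and a $\mathrm{Stab}_\Gamma(\infty)$-invariant affine subspace $Z\subset\mathbb{R}^d$ of dimension $k$ on which $\Gamma_\infty$ acts by translations with rank $k$;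 $\mathbb{R}^d=Y\times Z$ orthogonally; $\Delta_0=B_Y(C')\times\Delta'$ with $\Delta'\subset Z$ an open parallelotope fundamental region for $\Gamma_\infty$ and $C'$ such that $\Lambda_\Gamma\subset\{\infty\}\cup\bigcup_{\gamma\in\Gamma_\infty}\gamma(\overline{B_Y(C'/2)\times\Delta'})$. Coding: the paper constructs and fixes constants $C_1>0$, $\lambda,\epsilon_o\in(0,1)$, disjoint open $\Delta_j\subset\Delta_0$ ($j\in\mathbb{N}$) and $T:\sqcup_j\Delta_j\to\Delta_0$ with: (1) $\sum_j\mu(\Delta_j)=\mu(\Delta_0)$; (2) $\Delta_j=\gamma_j\Delta_0$, $T|_{\Delta_j}=\gamma_j^{-1}$ for some $\gamma_j\in\Gamma$; (3) $|\gamma_j'|\le\lambda$ on $\Delta_0$; (4) $|\mathrm{D}\log|\gamma_j'||<C_1$ on $\Delta_0$; (5) $R(x)=\log|\mathrm{D}T(x)|$ satisfies $\int e^{\epsilon_oR}\mathrm{d}\mu<\infty$; (6) there are $\lambda\in(0,1)$ and a neighbourhood $\Lambda_-$ of $\infty$ in $\Lambda_\Gamma$, disjoint from $\overline{\Delta_0}$, with $\gamma_j^{-1}\Lambda_-\subset\Lambda_-$ and $d_{\mathbb{S}^d}(\gamma_j^{-1}y,\gamma_j^{-1}y')\le\lambda d_{\mathbb{S}^d}(y,y')$ for $y,y'\in\Lambda_-$ and all $j$; (7) (UNI) there exist $r,\epsilon_0>0$ such that for any $C>1$ and all large $n_0$ there are finitely many pairs $\gamma_{1j},\gamma_{2j}$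 ($1\le j\le j_0$) of $n_0$-fold products of the $\gamma_i$ with $\sup_{\Delta_0}|\gamma_{mj}'|\le\epsilon_0/C$, and for any $x\in\Lambda_\Gamma\cap\overline{\Delta_0}$ and unit vector $e$ some $j$ with $|\partial_e(\log|\gamma_{1j}'|-\log|\gamma_{2j}'|)|\ge\epsilon_0$ on $B(x,r)$. Skew product flow: $\nu$ is the $T$-invariant ergodic probability measure on $\Delta_0$ absolutely continuous with respect to $\mu$, with positive Lipschitz density bounded away from $0$ and $\infty$ on $\Delta_0\cap\Lambda_\Gamma$. $\Lambda_+=\Lambda_\Gamma\cap\sqcup_j\Delta_j$; $\hat T(x,x_-)=(\gamma_j^{-1}x,\gamma_j^{-1}x_-)$ on $\Lambda_+\times\Lambda_-$ for $x\in\Delta_j$; $\hat\nu$ is the unique $\hat T$-invariant ergodic probability measure on $\Lambda_+\times\Lambda_-$ projecting to $\nu$. Put $R(x,x_-)=R(x)$, $R_n=\sum_{j=0}^{n-1}R\circ\hat T^j$, $\Lambda^R=\{(x,x_-,s)\in\Lambda_+\times\Lambda_-\times\mathbb{R}:0\le s<R(x,x_-)\}$, $\hat T_t(x,x_-,s)=(\hat T^n(x,x_-),s+t-R_n(x,x_-))$ (almost everywhere defined) with $n\ge0$ the integer such that $0\le s+t-R_n(x,x_-)<R(\hat T^n(x,x_-))$, and $\mathrm{d}\hat\nu^R=\mathrm{d}\hat\nu\times\mathrm{d}t/\bar R$ with $\bar R=\int R\,\mathrm{d}\hat\nu$.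
   Formalization: The lift is taken as (x,x_-,s) ↦ (x,x_-,s+log(1+|x|²)) instead of s−log(1+|x|²): with the stated Busemann and Hopf conventions the printed sign would need |Tx|=|x| at returns, so it is not compatible with the flows. *)

theory Defs
  imports "HOL-Algebra.Coset" "HOL-Probability.Probability_Measure" "HOL-Real_Asymp.Real_Asymp"
begin

section \<open>The boundary sphere\<close>

datatype 'a bdry = Fin 'a | Infty

primrec fin_part :: "'a::zero bdry \<Rightarrow> 'a" where
  "fin_part (Fin x) = x"
| "fin_part Infty = 0"

text \<open>Inverse stereographic projection onto the unit sphere; the boundary carries the
  great-circle metric of that sphere.\<close>

primrec sphere_pt :: "'a::real_inner bdry \<Rightarrow> 'a \<times> real" where
  "sphere_pt (Fin x) =
     ((2 / ((norm x)\<^sup>2 + 1)) *\<^sub>R x, ((norm x)\<^sup>2 - 1) / ((norm x)\<^sup>2 + 1))"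
| "sphere_pt Infty = (0, 1)"

lemma norm_sphere_pt [simp]: "norm (sphere_pt \<xi>) = 1"
proof (cases \<xi>)
  case (Fin x)
  define n where "n = (norm x)\<^sup>2"
  have n: "n + 1 > 0" by (simp add: n_def add_nonneg_pos)
  have "(norm (sphere_pt \<xi>))\<^sup>2 = 4 * n / (n + 1)\<^sup>2 + ((n - 1) / (n + 1))\<^sup>2"
    by (simp add: Fin norm_Pair power_mult_distrib n_def power_divide)
  also have "\<dots> = (4 * n + (n - 1)\<^sup>2) / (n + 1)\<^sup>2"
    by (simp add: power_divide add_divide_distrib)
  also have "4 * n + (n - 1)\<^sup>2 = (n + 1)\<^sup>2"
    by (simp add: power2_eq_square algebra_simps)
  also have "(n + 1)\<^sup>2 / (n + 1)\<^sup>2 = 1"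
    using n by simp
  finally show ?thesis
    by (metis norm_ge_zero one_power2 power2_eq_imp_eq zero_le_one)
qed (simp add: norm_Pair)

lemma inj_sphere_pt: "sphere_pt \<xi> = sphere_pt \<eta> \<Longrightarrow> \<xi> = \<eta>"
proof -
  assume eq: "sphere_pt \<xi> = sphere_pt \<eta>"
  have pos: "(norm x)\<^sup>2 + 1 > 0" for x :: 'a by (simp add: add_nonneg_pos)
  have not1: "((norm x)\<^sup>2 - 1) / ((norm x)\<^sup>2 + 1) \<noteq> 1" for x :: 'a
    using pos[of x] by (simp add: field_simps)
  show ?thesis
  proof (cases \<xi>; cases \<eta>)
    fix x y assume xy: "\<xi> = Fin x" "\<eta> = Fin y"
    define a b where "a = (norm x)\<^sup>2" and "b = (norm y)\<^sup>2"
    have ab: "a + 1 > 0" "b + 1 > 0" using pos by (auto simp: a_def b_def)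
    have "(a - 1) / (a + 1) = (b - 1) / (b + 1)" using eq xy by (simp add: a_def b_def)
    then have "a = b" using ab by (simp add: field_simps)
    moreover have "(2 / (a + 1)) *\<^sub>R x = (2 / (b + 1)) *\<^sub>R y"
      using eq xy by (simp add: a_def b_def)
    ultimately show ?thesis using ab xy by simp
  qed (use eq not1 in \<open>auto simp del: divide_eq_1_iff simp: eq_commute[of 1]\<close>)
qed

lemma arccos_inner_triangle:
  fixes u v w :: "'b::real_inner"
  assumes u: "norm u = 1" and v: "norm v = 1" and w: "norm w = 1"
  shows "arccos (u \<bullet> w) \<le> arccos (u \<bullet> v) + arccos (v \<bullet> w)"
proof -
  have bd: "\<bar>p \<bullet> q\<bar> \<le> 1" if "norm p = 1" "norm q = 1" for p q :: 'b
    using Cauchy_Schwarz_ineq2[of p q] that by simp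
  have uu: "u \<bullet> u = 1" "v \<bullet> v = 1" "w \<bullet> w = 1"
    using assms by (simp_all add: dot_square_norm)
  define a b where "a = arccos (u \<bullet> v)" and "b = arccos (v \<bullet> w)"
  have ca: "cos a = u \<bullet> v" "cos b = v \<bullet> w"
    using bd u v w by (simp_all add: a_def b_def cos_arccos_abs)
  have a0: "0 \<le> a" "0 \<le> b" "a \<le> pi" "b \<le> pi"
    using bd[OF u v] bd[OF v w]
    by (auto simp: a_def b_def intro!: arccos_lbound arccos_ubound)
  show ?thesis
  proof (cases "a + b \<le> pi")
    case False
    moreover have "arccos (u \<bullet> w) \<le> pi"
      using bd[OF u w] by (intro arccos_ubound) auto
    ultimately show ?thesis by (simp add: a_def b_def)
  next
    case True
    define p q where "p = u - (u \<bullet> v) *\<^sub>R v" and "q = w - (v \<bullet> w) *\<^sub>R v"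
    have "p \<bullet> p = 1 - (u \<bullet> v)\<^sup>2" "q \<bullet> q = 1 - (v \<bullet> w)\<^sup>2"
      unfolding p_def q_def using uu
      by (simp_all add: inner_diff inner_commute algebra_simps power2_eq_square)
    then have "(norm p)\<^sup>2 = (sin a)\<^sup>2" "(norm q)\<^sup>2 = (sin b)\<^sup>2"
      by (simp_all add: dot_square_norm sin_squared_eq ca)
    then have np: "norm p = sin a" "norm q = sin b"
      using a0 by (auto intro!: power2_eq_imp_eq sin_ge_zero)
    have "p \<bullet> q = u \<bullet> w - (u \<bullet> v) * (v \<bullet> w)"
      unfolding p_def q_def using uu
      by (simp add: inner_diff inner_commute algebra_simps)
    moreover have "p \<bullet> q \<ge> - (norm p * norm q)"
      using Cauchy_Schwarz_ineq2[of p q] by linarith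
    ultimately have "cos (a + b) \<le> u \<bullet> w"
      by (simp add: cos_add ca np)
    then have "arccos (u \<bullet> w) \<le> arccos (cos (a + b))"
      using bd[OF u w] by (intro arccos_le_arccos) auto
    also have "\<dots> = a + b" using True a0 by (intro arccos_cos) auto
    finally show ?thesis by (simp add: a_def b_def)
  qed
qed

instantiation bdry :: (real_inner) metric_space
begin

definition dist_bdry :: "'a bdry \<Rightarrow> 'a bdry \<Rightarrow> real" where
  "dist_bdry \<xi> \<eta> = arccos (sphere_pt \<xi> \<bullet> sphere_pt \<eta>)"

definition uniformity_bdry :: "('a bdry \<times> 'a bdry) filter" where
  "uniformity_bdry = (INF e\<in>{0 <..}. principal {(x, y). dist x y < e})"

definition open_bdry :: "'a bdry set \<Rightarrow> bool" where
  "open_bdry U \<longleftrightarrow> (\<forall>x\<in>U. \<forall>\<^sub>F (x', y) in uniformity. x' = x \<longrightarrow> y \<in> U)"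

instance
proof
  fix \<xi> \<eta> \<zeta> :: "'a bdry"
  have le: "\<bar>sphere_pt \<xi> \<bullet> sphere_pt \<eta>\<bar> \<le> 1" for \<xi> \<eta> :: "'a bdry"
    using Cauchy_Schwarz_ineq2[of "sphere_pt \<xi>" "sphere_pt \<eta>"] by simp
  show "dist \<xi> \<eta> = 0 \<longleftrightarrow> \<xi> = \<eta>"
  proof
    assume "dist \<xi> \<eta> = 0"
    then have "cos (arccos (sphere_pt \<xi> \<bullet> sphere_pt \<eta>)) = 1" by (simp add: dist_bdry_def)
    then have "sphere_pt \<xi> \<bullet> sphere_pt \<eta> = 1" using le by (simp add: cos_arccos_abs)
    then have "(norm (sphere_pt \<xi> - sphere_pt \<eta>))\<^sup>2 = 0"
      by (simp add: power2_norm_eq_inner inner_diff inner_commute)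
        (simp add: dot_square_norm)
    then show "\<xi> = \<eta>" by (simp add: inj_sphere_pt)
  qed (simp add: dist_bdry_def dot_square_norm)
  have "dist \<xi> \<eta> \<le> dist \<xi> \<zeta> + dist \<zeta> \<eta>"
    unfolding dist_bdry_def by (rule arccos_inner_triangle) auto
  then show "dist \<xi> \<eta> \<le> dist \<xi> \<zeta> + dist \<eta> \<zeta>"
    by (simp add: dist_bdry_def inner_commute)
qed (auto simp: uniformity_bdry_def open_bdry_def)

end


section \<open>Hyperbolic space and the group $SO(d+1,1)^\circ$\<close>

text \<open>The upper half-space \<^term>\<open>hspace\<close> is the set of pairs $(x,y)$ with $y>0$.
  The group acts linearly on Minkowski space, with space-like coordinates \<^term>\<open>Inl i\<close> and
  \<^term>\<open>Inr False\<close> and time-like coordinate \<^term>\<open>Inr True\<close>; it acts on half-space and on its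
  boundary through the standard isometry \<^term>\<open>hyp_of\<close> onto the hyperboloid and its
  boundary extension \<^term>\<open>null_of\<close> to the light cone.\<close>

type_synonym 'd mink = "real ^ ('d + bool)"
type_synonym 'd lmat = "real ^ ('d + bool) ^ ('d + bool)"
type_synonym 'd half = "(real ^ 'd) \<times> real"

definition lform :: "'d::finite mink \<Rightarrow> 'd mink \<Rightarrow> real" where
  "lform v w = (\<Sum>i\<in>UNIV. v $ Inl i * w $ Inl i)
     + v $ Inr False * w $ Inr False - v $ Inr True * w $ Inr True"

definition SO_lor :: "'d::finite lmat set" where
  "SO_lor = {A. (\<forall>v w. lform (A *v v) (A *v w) = lform v w) \<and> det A = 1}"

definition SO0 :: "'d::finite lmat monoid" where
  "SO0 = \<lparr>carrier = connected_component_set SO_lor (mat 1), monoid.mult = (**), one = mat 1\<rparr>"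

definition hspace :: "'d::finite half set" where
  "hspace = {z. snd z > 0}"

definition origin :: "'d::finite half" where
  "origin = (0, 1)"

definition hdist :: "'d::finite half \<Rightarrow> 'd half \<Rightarrow> real" where
  "hdist z w = arcosh (1 + (norm (z - w))\<^sup>2 / (2 * snd z * snd w))"

definition mvec :: "real ^ 'd \<Rightarrow> real \<Rightarrow> real \<Rightarrow> 'd::finite mink" where
  "mvec u a b = (\<chi> k. case k of Inl i \<Rightarrow> u $ i | Inr c \<Rightarrow> (if c then b else a))"

definition space_part :: "'d::finite mink \<Rightarrow> real ^ 'd" where
  "space_part v = (\<chi> i. v $ Inl i)"

definition hyp_of :: "'d::finite half \<Rightarrow> 'd mink" where
  "hyp_of z = (let x = fst z; y = snd z in
     mvec ((1 / y) *\<^sub>R x) (((norm x)\<^sup>2 + y\<^sup>2 - 1) / (2 * y)) (((norm x)\<^sup>2 + y\<^sup>2 + 1) / (2 * y)))"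

definition half_of :: "'d::finite mink \<Rightarrow> 'd half" where
  "half_of v = (let h = v $ Inr True - v $ Inr False in ((1 / h) *\<^sub>R space_part v, 1 / h))"

primrec null_of :: "(real ^ 'd) bdry \<Rightarrow> 'd::finite mink" where
  "null_of (Fin x) = mvec x (((norm x)\<^sup>2 - 1) / 2) (((norm x)\<^sup>2 + 1) / 2)"
| "null_of Infty = mvec 0 1 1"

definition bdry_of :: "'d::finite mink \<Rightarrow> (real ^ 'd) bdry" where
  "bdry_of v = (let h = v $ Inr True - v $ Inr False in
     if h = 0 then Infty else Fin ((1 / h) *\<^sub>R space_part v))"

definition act :: "'d::finite lmat \<Rightarrow> 'd half \<Rightarrow> 'd half" where
  "act g z = half_of (g *v hyp_of z)"

definition bact :: "'d::finite lmat \<Rightarrow> (real ^ 'd) bdry \<Rightarrow> (real ^ 'd) bdry" where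
  "bact g \<xi> = bdry_of (g *v null_of \<xi>)"

text \<open>The boundary action in the affine chart; only meaningful where it avoids \<open>\<infinity>\<close>.\<close>

definition eact :: "'d::finite lmat \<Rightarrow> real ^ 'd \<Rightarrow> real ^ 'd" where
  "eact g x = fin_part (bact g (Fin x))"

definition distortion :: "(real ^ 'd \<Rightarrow> real ^ 'd) \<Rightarrow> real ^ 'd::finite \<Rightarrow> real" where
  "distortion f x = onorm (frechet_derivative f (at x))"


section \<open>Kleinian groups\<close>

definition tends_bdry :: "(nat \<Rightarrow> 'd::finite half) \<Rightarrow> (real ^ 'd) bdry \<Rightarrow> bool" where
  "tends_bdry u \<xi> \<longleftrightarrow> (case \<xi> of Fin x \<Rightarrow> u \<longlonglongrightarrow> (x, 0)
                              | Infty \<Rightarrow> filterlim u at_infinity sequentially)"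

definition limit_set :: "'d::finite lmat set \<Rightarrow> (real ^ 'd) bdry set" where
  "limit_set \<Gamma> = {\<xi>. \<exists>g. range g \<subseteq> \<Gamma> \<and> tends_bdry (\<lambda>n. act (g n) origin) \<xi>}"

definition critical_exponent :: "'d::finite lmat set \<Rightarrow> real" where
  "critical_exponent \<Gamma> =
     Inf {s. s \<ge> 0 \<and> (\<lambda>g. exp (- s * hdist origin (act g origin))) summable_on \<Gamma>}"

definition zariski_dense :: "'d::finite lmat set \<Rightarrow> bool" where
  "zariski_dense \<Gamma> \<longleftrightarrow> (\<forall>p. real_polynomial_function p \<and> (\<forall>g\<in>\<Gamma>. p g = 0)
     \<longrightarrow> (\<forall>g\<in>carrier SO0. p g = 0))"

definition torsion_free :: "'d::finite lmat set \<Rightarrow> bool" where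
  "torsion_free \<Gamma> \<longleftrightarrow> (\<forall>g\<in>\<Gamma>. \<forall>n::nat. n > 0 \<and> g [^]\<^bsub>SO0\<^esub> n = mat 1 \<longrightarrow> g = mat 1)"

definition stab :: "'d::finite lmat set \<Rightarrow> (real ^ 'd) bdry \<Rightarrow> 'd lmat set" where
  "stab \<Gamma> \<xi> = {g\<in>\<Gamma>. bact g \<xi> = \<xi>}"

definition parabolic :: "'d::finite lmat \<Rightarrow> bool" where
  "parabolic g \<longleftrightarrow> (\<exists>!\<xi>. bact g \<xi> = \<xi>) \<and> (\<forall>z\<in>hspace. act g z \<noteq> z)"

definition parabolic_fixed_point :: "'d::finite lmat set \<Rightarrow> (real ^ 'd) bdry \<Rightarrow> bool" where
  "parabolic_fixed_point \<Gamma> \<xi> \<longleftrightarrow> (\<exists>g\<in>stab \<Gamma> \<xi>. parabolic g)"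

definition bounded_parabolic :: "'d::finite lmat set \<Rightarrow> (real ^ 'd) bdry \<Rightarrow> bool" where
  "bounded_parabolic \<Gamma> \<xi> \<longleftrightarrow> parabolic_fixed_point \<Gamma> \<xi> \<and>
     (\<exists>K. compact K \<and> K \<subseteq> limit_set \<Gamma> - {\<xi>} \<and> limit_set \<Gamma> - {\<xi>} \<subseteq> (\<Union>g\<in>stab \<Gamma> \<xi>. bact g ` K))"

text \<open>A unit speed (vertical) geodesic ray towards a given boundary point.\<close>

primrec ray :: "(real ^ 'd) bdry \<Rightarrow> real \<Rightarrow> 'd::finite half" where
  "ray (Fin x) = (\<lambda>t. (x, exp (- t)))"
| "ray Infty = (\<lambda>t. (0, exp t))"

definition conical :: "'d::finite lmat set \<Rightarrow> (real ^ 'd) bdry \<Rightarrow> bool" where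
  "conical \<Gamma> \<xi> \<longleftrightarrow> (\<exists>g r. range g \<subseteq> \<Gamma> \<and> tends_bdry (\<lambda>n. act (g n) origin) \<xi> \<and>
     (\<forall>n. \<exists>t\<ge>0. hdist (act (g n) origin) (ray \<xi> t) \<le> r))"

definition geometrically_finite :: "'d::finite lmat set \<Rightarrow> bool" where
  "geometrically_finite \<Gamma> \<longleftrightarrow> discrete \<Gamma> \<and>
     (\<forall>\<xi>\<in>limit_set \<Gamma>. conical \<Gamma> \<xi> \<or> bounded_parabolic \<Gamma> \<xi>)"

definition busemann :: "(real ^ 'd) bdry \<Rightarrow> 'd::finite half \<Rightarrow> 'd half \<Rightarrow> real" where
  "busemann \<xi> z w = Lim at_top (\<lambda>t. hdist z (ray \<xi> t) - hdist w (ray \<xi> t))"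

text \<open>The Patterson-Sullivan measure at the base point is a member of a \<open>\<Gamma>\<close>-invariant conformal
  density whose dimension is the critical exponent. It is unique up to scaling, and no
  normalization is imposed.\<close>

definition conformal_density ::
    "'d::finite lmat set \<Rightarrow> real \<Rightarrow> ('d half \<Rightarrow> (real ^ 'd) bdry measure) \<Rightarrow> bool" where
  "conformal_density \<Gamma> \<delta> m \<longleftrightarrow>
     (\<forall>z\<in>hspace. finite_measure (m z) \<and> sets (m z) = sets borel \<and>
        emeasure (m z) UNIV \<noteq> 0 \<and> emeasure (m z) (- limit_set \<Gamma>) = 0) \<and>
     (\<forall>z\<in>hspace. \<forall>w\<in>hspace. m z = density (m w) (\<lambda>\<xi>. ennreal (exp (- \<delta> * busemann \<xi> z w)))) \<and>
     (\<forall>g\<in>\<Gamma>. \<forall>z\<in>hspace. distr (m z) borel (bact g) = m (act g z))"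

definition patterson_sullivan :: "'d::finite lmat set \<Rightarrow> (real ^ 'd) bdry measure \<Rightarrow> bool" where
  "patterson_sullivan \<Gamma> \<mu> \<longleftrightarrow>
     (\<exists>m. conformal_density \<Gamma> (critical_exponent \<Gamma>) m \<and> m origin = \<mu>)"


section \<open>The unit tangent bundle, the Hopf parametrization and the BMS measure\<close>

text \<open>Unit tangent vectors are written in hyperboloid coordinates, as pairs $(p,w)$ of a base
  point $p$ on the hyperboloid and a unit tangent vector $w$ at $p$. The geodesic through
  $(p,w)$ is $t \mapsto \cosh t\, p + \sinh t\, w$, with end points the light rays through
  $p \pm w$.\<close>

type_synonym 'd uvec = "'d mink \<times> 'd mink"

definition UT :: "'d::finite uvec set" where
  "UT = {(p, w). lform p p = -1 \<and> p $ Inr True > 0 \<and> lform p w = 0 \<and> lform w w = 1}"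

definition base :: "'d::finite uvec \<Rightarrow> 'd half" where
  "base v = half_of (fst v)"

definition geodesic_flow :: "real \<Rightarrow> 'd::finite uvec \<Rightarrow> 'd uvec" where
  "geodesic_flow t = (\<lambda>(p, w). (cosh t *\<^sub>R p + sinh t *\<^sub>R w, sinh t *\<^sub>R p + cosh t *\<^sub>R w))"

type_synonym 'd hopf = "(real ^ 'd) bdry \<times> (real ^ 'd) bdry \<times> real"

definition hopf_space :: "'d::finite hopf set" where
  "hopf_space = {(\<xi>, \<xi>', s). \<xi> \<noteq> \<xi>'}"

definition hopf :: "'d::finite uvec \<Rightarrow> 'd hopf" where
  "hopf v = (let \<xi> = bdry_of (fst v + snd v); \<xi>' = bdry_of (fst v - snd v) in
     (\<xi>, \<xi>', busemann \<xi> origin (base v)))"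

definition hopf_inv :: "'d::finite hopf \<Rightarrow> 'd uvec" where
  "hopf_inv = inv_into UT hopf"

text \<open>Points of \<^term>\<open>T1M \<Gamma>\<close> are \<open>\<Gamma>\<close>-orbits of unit vectors.\<close>

definition orb :: "'d::finite lmat set \<Rightarrow> 'd uvec \<Rightarrow> 'd uvec set" where
  "orb \<Gamma> v = (\<lambda>g. (g *v fst v, g *v snd v)) ` \<Gamma>"

definition T1M :: "'d::finite lmat set \<Rightarrow> 'd uvec set set" where
  "T1M \<Gamma> = orb \<Gamma> ` UT"

definition T1M_flow :: "real \<Rightarrow> 'd::finite uvec set \<Rightarrow> 'd uvec set" where
  "T1M_flow t V = geodesic_flow t ` V"

definition bms_hopf :: "'d::finite lmat set \<Rightarrow> (real ^ 'd) bdry measure \<Rightarrow> 'd hopf measure" where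
  "bms_hopf \<Gamma> \<mu> = density (restrict_space (\<mu> \<Otimes>\<^sub>M (\<mu> \<Otimes>\<^sub>M lborel)) hopf_space)
     (\<lambda>(\<xi>, \<xi>', s). let z = base (hopf_inv (\<xi>, \<xi>', s)); \<delta> = critical_exponent \<Gamma> in
        ennreal (exp (\<delta> * busemann \<xi> origin z) * exp (\<delta> * busemann \<xi>' origin z)))"

definition bms_cover :: "'d::finite lmat set \<Rightarrow> (real ^ 'd) bdry measure \<Rightarrow> 'd uvec measure" where
  "bms_cover \<Gamma> \<mu> = distr (bms_hopf \<Gamma> \<mu>) (restrict_space borel UT) hopf_inv"

text \<open>The measure induced on the quotient assigns to the image of a Borel set that injects into
  the quotient the measure of that set upstairs; the probability measure proportional to it
  is the Bowen-Margulis-Sullivan measure.\<close>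

definition bms_measure ::
    "'d::finite lmat set \<Rightarrow> (real ^ 'd) bdry measure \<Rightarrow> 'd uvec set measure \<Rightarrow> bool" where
  "bms_measure \<Gamma> \<mu> m \<longleftrightarrow> prob_space m \<and> space m = T1M \<Gamma> \<and>
     sets m = {A. A \<subseteq> T1M \<Gamma> \<and> {v\<in>UT. orb \<Gamma> v \<in> A} \<in> sets borel} \<and>
     (\<exists>c::real. c > 0 \<and> (\<forall>B\<in>sets borel. B \<subseteq> UT \<and> inj_on (orb \<Gamma>) B \<longrightarrow>
        emeasure m (orb \<Gamma> ` B) = ennreal c * emeasure (bms_cover \<Gamma> \<mu>) B))"


section \<open>The fundamental region at infinity\<close>

definition tube :: "(real ^ 'd) set \<Rightarrow> (real ^ 'd) set \<Rightarrow> real \<Rightarrow> (real ^ 'd::finite) set" where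
  "tube Z D r = {z + y | z y. z \<in> D \<and> norm y < r \<and> (\<forall>a\<in>Z. \<forall>b\<in>Z. y \<bullet> (a - b) = 0)}"

definition open_parallelotope :: "nat \<Rightarrow> (real ^ 'd::finite) set \<Rightarrow> bool" where
  "open_parallelotope k D \<longleftrightarrow> (\<exists>a B. independent B \<and> card B = k \<and>
     D = {a + (\<Sum>b\<in>B. c b *\<^sub>R b) | c. \<forall>b\<in>B. 0 < c b \<and> c b < 1})"

locale cusp_region =
  fixes \<Gamma> :: "'d::finite lmat set"
    and Ginf :: "'d lmat set"
    and Z :: "(real ^ 'd) set"
    and k :: nat
    and C' :: real
    and D' :: "(real ^ 'd) set"
    and \<Delta>\<^sub>0 :: "(real ^ 'd) set"
  assumes Ginf_normal: "Ginf \<lhd> (SO0\<lparr>carrier := stab \<Gamma> Infty\<rparr>)"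
    and Ginf_abelian: "comm_group (SO0\<lparr>carrier := Ginf\<rparr>)"
    and Ginf_finite_index: "finite (rcosets\<^bsub>SO0\<lparr>carrier := stab \<Gamma> Infty\<rparr>\<^esub> Ginf)"
    and Ginf_maximal: "\<And>N. N \<lhd> (SO0\<lparr>carrier := stab \<Gamma> Infty\<rparr>) \<Longrightarrow>
           comm_group (SO0\<lparr>carrier := N\<rparr>) \<Longrightarrow> Ginf \<subseteq> N \<Longrightarrow> N = Ginf"
    and Z_affine: "affine Z" "aff_dim Z = int k"
    and Z_invariant: "\<And>g. g \<in> stab \<Gamma> Infty \<Longrightarrow> eact g ` Z = Z"
    and Ginf_translations: "\<And>g. g \<in> Ginf \<Longrightarrow> \<exists>v. \<forall>z\<in>Z. eact g z = z + v"
    and Ginf_rank: "dim {v. \<exists>g\<in>Ginf. \<forall>z\<in>Z. eact g z = z + v} = k"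
    and D'_parallelotope: "open_parallelotope k D'" "D' \<subseteq> Z"
    and D'_disjoint: "\<And>g. g \<in> Ginf \<Longrightarrow> g \<noteq> mat 1 \<Longrightarrow> eact g ` D' \<inter> D' = {}"
    and D'_covers: "Z \<subseteq> (\<Union>g\<in>Ginf. eact g ` closure D')"
    and C'_pos: "C' > 0"
    and limit_set_covered:
      "limit_set \<Gamma> \<subseteq> {Infty} \<union> (\<Union>g\<in>Ginf. bact g ` Fin ` closure (tube Z D' (C' / 2)))"
    and \<Delta>0_eq: "\<Delta>\<^sub>0 = tube Z D' C'"


section \<open>The coding\<close>

definition words :: "(nat \<Rightarrow> 'd::finite lmat) \<Rightarrow> nat \<Rightarrow> 'd lmat set" where
  "words \<gamma> n = {foldr (\<lambda>i A. \<gamma> i ** A) l (mat 1) | l. length l = n}"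

definition uni_condition :: "'d::finite lmat set \<Rightarrow> (real ^ 'd) set \<Rightarrow> (nat \<Rightarrow> 'd lmat) \<Rightarrow> bool" where
  "uni_condition \<Gamma> \<Delta>\<^sub>0 \<gamma> \<longleftrightarrow> (\<exists>r>0. \<exists>\<epsilon>\<^sub>0>0. \<forall>C>1. \<exists>N. \<forall>n\<ge>N. \<exists>P.
     finite P \<and> P \<subseteq> words \<gamma> n \<times> words \<gamma> n \<and>
     (\<forall>(g, h)\<in>P. \<forall>x\<in>\<Delta>\<^sub>0. distortion (eact g) x \<le> \<epsilon>\<^sub>0 / C \<and> distortion (eact h) x \<le> \<epsilon>\<^sub>0 / C) \<and>
     (\<forall>x\<in>closure \<Delta>\<^sub>0. Fin x \<in> limit_set \<Gamma> \<longrightarrow> (\<forall>e. norm e = 1 \<longrightarrow> (\<exists>(g, h)\<in>P. \<forall>y\<in>ball x r. \<exists>D.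
        ((\<lambda>u. ln (distortion (eact g) u) - ln (distortion (eact h) u)) has_derivative D) (at y)
        \<and> \<bar>D e\<bar> \<ge> \<epsilon>\<^sub>0))))"

definition roof :: "(real ^ 'd \<Rightarrow> real ^ 'd) \<Rightarrow> real ^ 'd::finite \<Rightarrow> real" where
  "roof T x = ln (distortion T x)"

locale coding =
  fixes \<Gamma> :: "'d::finite lmat set"
    and \<mu> :: "(real ^ 'd) bdry measure"
    and \<Delta>\<^sub>0 :: "(real ^ 'd) set"
    and \<Delta> :: "nat \<Rightarrow> (real ^ 'd) set"
    and \<gamma> :: "nat \<Rightarrow> 'd lmat"
    and T :: "real ^ 'd \<Rightarrow> real ^ 'd"
    and \<Lambda>m :: "(real ^ 'd) bdry set"
    and C\<^sub>1 lam eps lam' :: real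
  assumes constants: "C\<^sub>1 > 0" "0 < lam" "lam < 1" "0 < eps" "eps < 1" "0 < lam'" "lam' < 1"
    and \<Delta>_open: "\<And>j. open (\<Delta> j)"
    and \<Delta>_subset: "\<And>j. \<Delta> j \<subseteq> \<Delta>\<^sub>0"
    and \<Delta>_disjoint: "disjoint_family \<Delta>"
    and full_measure: "(\<Sum>j. emeasure \<mu> (Fin ` \<Delta> j)) = emeasure \<mu> (Fin ` \<Delta>\<^sub>0)"
    and \<gamma>_in: "\<And>j. \<gamma> j \<in> \<Gamma>"
    and \<Delta>_eq: "\<And>j. Fin ` \<Delta> j = bact (\<gamma> j) ` Fin ` \<Delta>\<^sub>0"
    and T_eq: "\<And>j x. x \<in> \<Delta> j \<Longrightarrow> Fin (T x) = bact (matrix_inv (\<gamma> j)) (Fin x)"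
    and contraction: "\<And>j x. x \<in> \<Delta>\<^sub>0 \<Longrightarrow> distortion (eact (\<gamma> j)) x \<le> lam"
    and bounded_log_derivative: "\<And>j x. x \<in> \<Delta>\<^sub>0 \<Longrightarrow>
           \<exists>D. ((\<lambda>u. ln (distortion (eact (\<gamma> j)) u)) has_derivative D) (at x) \<and> onorm D < C\<^sub>1"
    and exponential_tail:
      "(\<integral>\<^sup>+\<xi>. ennreal (exp (eps * roof T (fin_part \<xi>))) * indicator (Fin ` (\<Union>j. \<Delta> j)) \<xi> \<partial>\<mu>) < \<infinity>"
    and \<Lambda>m_nbhd: "\<exists>U. open U \<and> Infty \<in> U \<and> U \<inter> limit_set \<Gamma> \<subseteq> \<Lambda>m" "\<Lambda>m \<subseteq> limit_set \<Gamma>"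
    and \<Lambda>m_disjoint: "\<Lambda>m \<inter> Fin ` closure \<Delta>\<^sub>0 = {}"
    and \<Lambda>m_invariant: "\<And>j. bact (matrix_inv (\<gamma> j)) ` \<Lambda>m \<subseteq> \<Lambda>m"
    and \<Lambda>m_contraction: "\<And>j \<xi> \<eta>. \<xi> \<in> \<Lambda>m \<Longrightarrow> \<eta> \<in> \<Lambda>m \<Longrightarrow>
           dist (bact (matrix_inv (\<gamma> j)) \<xi>) (bact (matrix_inv (\<gamma> j)) \<eta>) \<le> lam' * dist \<xi> \<eta>"
    and UNI: "uni_condition \<Gamma> \<Delta>\<^sub>0 \<gamma>"


section \<open>The skew product flow\<close>

text \<open>Invariance and ergodicity of a measure under a map \<open>f\<close> that is only defined on a set
  \<open>D\<close> of full measure.\<close>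

definition invariant_ae :: "'a measure \<Rightarrow> 'a set \<Rightarrow> ('a \<Rightarrow> 'a) \<Rightarrow> bool" where
  "invariant_ae M D f \<longleftrightarrow> D \<in> sets M \<and> emeasure M (space M - D) = 0 \<and>
     (\<forall>A\<in>sets M. {x\<in>D. f x \<in> A} \<in> sets M \<and> emeasure M {x\<in>D. f x \<in> A} = emeasure M A)"

definition ergodic_ae :: "'a measure \<Rightarrow> 'a set \<Rightarrow> ('a \<Rightarrow> 'a) \<Rightarrow> bool" where
  "ergodic_ae M D f \<longleftrightarrow> (\<forall>A\<in>sets M. (AE x in M. x \<in> D \<longrightarrow> (x \<in> A \<longleftrightarrow> f x \<in> A)) \<longrightarrow>
     emeasure M A = 0 \<or> emeasure M (space M - A) = 0)"

text \<open>The measure \<open>\<nu>\<close> lives on \<open>\<Delta>\<^sub>0\<close>; its density with respect to \<open>\<mu>\<close> is only relevant on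
  the limit set, which carries \<open>\<mu>\<close>.\<close>

locale coding_measure =
  fixes \<Gamma> :: "'d::finite lmat set"
    and \<mu> :: "(real ^ 'd) bdry measure"
    and \<Delta>\<^sub>0 :: "(real ^ 'd) set"
    and \<Delta> :: "nat \<Rightarrow> (real ^ 'd) set"
    and T :: "real ^ 'd \<Rightarrow> real ^ 'd"
    and \<nu> :: "(real ^ 'd) measure"
  assumes prob: "prob_space \<nu>"
    and space_sets: "space \<nu> = \<Delta>\<^sub>0" "sets \<nu> = sets (restrict_space borel \<Delta>\<^sub>0)"
    and invariant: "invariant_ae \<nu> (\<Union>j. \<Delta> j) T"
    and ergodic: "ergodic_ae \<nu> (\<Union>j. \<Delta> j) T"
    and density: "\<exists>f L a b. L-lipschitz_on {x\<in>\<Delta>\<^sub>0. Fin x \<in> limit_set \<Gamma>} f \<and> 0 < a \<and>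
      (\<forall>x\<in>\<Delta>\<^sub>0. Fin x \<in> limit_set \<Gamma> \<longrightarrow> a \<le> f x \<and> f x \<le> b) \<and>
      (\<forall>A\<in>sets \<nu>. emeasure \<nu> A =
         (\<integral>\<^sup>+\<xi>. ennreal (f (fin_part \<xi>)) * indicator (Fin ` A \<inter> limit_set \<Gamma>) \<xi> \<partial>\<mu>))"

definition Lambda_plus :: "'d::finite lmat set \<Rightarrow> (nat \<Rightarrow> (real ^ 'd) set) \<Rightarrow> (real ^ 'd) set" where
  "Lambda_plus \<Gamma> \<Delta> = {x\<in>(\<Union>j. \<Delta> j). Fin x \<in> limit_set \<Gamma>}"

definition skew_space :: "'d::finite lmat set \<Rightarrow> (nat \<Rightarrow> (real ^ 'd) set) \<Rightarrow> (real ^ 'd) bdry set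
    \<Rightarrow> ((real ^ 'd) \<times> (real ^ 'd) bdry) set" where
  "skew_space \<Gamma> \<Delta> \<Lambda>m = Lambda_plus \<Gamma> \<Delta> \<times> \<Lambda>m"

definition skew_map :: "(nat \<Rightarrow> (real ^ 'd) set) \<Rightarrow> (nat \<Rightarrow> 'd lmat)
    \<Rightarrow> (real ^ 'd) \<times> (real ^ 'd) bdry \<Rightarrow> (real ^ 'd::finite) \<times> (real ^ 'd) bdry" where
  "skew_map \<Delta> \<gamma> = (\<lambda>(x, \<eta>). let j = (THE j. x \<in> \<Delta> j) in
     (eact (matrix_inv (\<gamma> j)) x, bact (matrix_inv (\<gamma> j)) \<eta>))"

locale skew_measure =
  fixes \<Gamma> :: "'d::finite lmat set"
    and \<Delta> :: "nat \<Rightarrow> (real ^ 'd) set"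
    and \<gamma> :: "nat \<Rightarrow> 'd lmat"
    and \<Lambda>m :: "(real ^ 'd) bdry set"
    and \<nu> :: "(real ^ 'd) measure"
    and \<nu>' :: "((real ^ 'd) \<times> (real ^ 'd) bdry) measure"
  assumes prob: "prob_space \<nu>'"
    and space_sets: "space \<nu>' = skew_space \<Gamma> \<Delta> \<Lambda>m"
      "sets \<nu>' = sets (restrict_space (borel \<Otimes>\<^sub>M borel) (skew_space \<Gamma> \<Delta> \<Lambda>m))"
    and invariant: "invariant_ae \<nu>' (skew_space \<Gamma> \<Delta> \<Lambda>m) (skew_map \<Delta> \<gamma>)"
    and ergodic: "ergodic_ae \<nu>' (skew_space \<Gamma> \<Delta> \<Lambda>m) (skew_map \<Delta> \<gamma>)"
    and projects: "distr \<nu>' \<nu> fst = \<nu>"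

text \<open>Points $(x,x_-,s)$ of the suspension are encoded as \<open>((x, \<eta>), s)\<close>.\<close>

type_synonym 'd susp = "((real ^ 'd) \<times> (real ^ 'd) bdry) \<times> real"

definition susp_space :: "'d::finite lmat set \<Rightarrow> (nat \<Rightarrow> (real ^ 'd) set) \<Rightarrow> (real ^ 'd) bdry set
    \<Rightarrow> (real ^ 'd \<Rightarrow> real ^ 'd) \<Rightarrow> 'd susp set" where
  "susp_space \<Gamma> \<Delta> \<Lambda>m T = {(q, s). q \<in> skew_space \<Gamma> \<Delta> \<Lambda>m \<and> 0 \<le> s \<and> s < roof T (fst q)}"

definition susp_measure :: "'d::finite lmat set \<Rightarrow> (nat \<Rightarrow> (real ^ 'd) set) \<Rightarrow> (real ^ 'd) bdry set
    \<Rightarrow> (real ^ 'd \<Rightarrow> real ^ 'd) \<Rightarrow> ((real ^ 'd) \<times> (real ^ 'd) bdry) measure \<Rightarrow> 'd susp measure" where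
  "susp_measure \<Gamma> \<Delta> \<Lambda>m T \<nu>' =
     scale_measure (ennreal (1 / (\<integral>q. roof T (fst q) \<partial>\<nu>')))
       (restrict_space (\<nu>' \<Otimes>\<^sub>M lborel) (susp_space \<Gamma> \<Delta> \<Lambda>m T))"

definition roof_sum :: "(nat \<Rightarrow> (real ^ 'd) set) \<Rightarrow> (nat \<Rightarrow> 'd::finite lmat)
    \<Rightarrow> (real ^ 'd \<Rightarrow> real ^ 'd) \<Rightarrow> nat \<Rightarrow> (real ^ 'd) \<times> (real ^ 'd) bdry \<Rightarrow> real" where
  "roof_sum \<Delta> \<gamma> T n q = (\<Sum>j<n. roof T (fst ((skew_map \<Delta> \<gamma> ^^ j) q)))"

text \<open>\<^term>\<open>flow_index \<Gamma> \<Delta> \<gamma> \<Lambda>m T t (q, s) n\<close> says that the first \<open>n\<close> iterates of \<open>q\<close> under the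
  partial map stay in its domain and that \<open>n\<close> is the number of returns up to time \<open>t\<close>.
  Such an \<open>n\<close> is unique, and exists exactly where the flow at time \<open>t\<close> is defined.\<close>

definition flow_index :: "'d::finite lmat set \<Rightarrow> (nat \<Rightarrow> (real ^ 'd) set) \<Rightarrow> (nat \<Rightarrow> 'd lmat)
    \<Rightarrow> (real ^ 'd) bdry set \<Rightarrow> (real ^ 'd \<Rightarrow> real ^ 'd) \<Rightarrow> real \<Rightarrow> 'd susp \<Rightarrow> nat \<Rightarrow> bool" where
  "flow_index \<Gamma> \<Delta> \<gamma> \<Lambda>m T t p n \<longleftrightarrow> (case p of (q, s) \<Rightarrow>
     (\<forall>i\<le>n. (skew_map \<Delta> \<gamma> ^^ i) q \<in> skew_space \<Gamma> \<Delta> \<Lambda>m) \<and>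
     0 \<le> s + t - roof_sum \<Delta> \<gamma> T n q \<and>
     s + t - roof_sum \<Delta> \<gamma> T n q < roof T (fst ((skew_map \<Delta> \<gamma> ^^ n) q)))"

definition flow_dom :: "'d::finite lmat set \<Rightarrow> (nat \<Rightarrow> (real ^ 'd) set) \<Rightarrow> (nat \<Rightarrow> 'd lmat)
    \<Rightarrow> (real ^ 'd) bdry set \<Rightarrow> (real ^ 'd \<Rightarrow> real ^ 'd) \<Rightarrow> real \<Rightarrow> 'd susp set" where
  "flow_dom \<Gamma> \<Delta> \<gamma> \<Lambda>m T t = {p\<in>susp_space \<Gamma> \<Delta> \<Lambda>m T. \<exists>n. flow_index \<Gamma> \<Delta> \<gamma> \<Lambda>m T t p n}"

definition skew_flow :: "'d::finite lmat set \<Rightarrow> (nat \<Rightarrow> (real ^ 'd) set) \<Rightarrow> (nat \<Rightarrow> 'd lmat)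
    \<Rightarrow> (real ^ 'd) bdry set \<Rightarrow> (real ^ 'd \<Rightarrow> real ^ 'd) \<Rightarrow> real \<Rightarrow> 'd susp \<Rightarrow> 'd susp" where
  "skew_flow \<Gamma> \<Delta> \<gamma> \<Lambda>m T t p = (let n = (THE n. flow_index \<Gamma> \<Delta> \<gamma> \<Lambda>m T t p n) in
     ((skew_map \<Delta> \<gamma> ^^ n) (fst p), snd p + t - roof_sum \<Delta> \<gamma> T n (fst p)))"

text \<open>In the Hopf coordinate $\beta_x(o,v_*)$, the unit vector with base point $(x,e^{-s})$
  pointing at $x$ has last coordinate $s+\log(1+|x|^2)$. Since the return time is the
  Euclidean expansion $\log|DT|$, the Euclidean time $s$ corresponds to this Hopf coordinate:
  the sign of the logarithm below is the one for which the map to the quotient is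
  compatible with the two flows. (The source prints $s-\log(1+|x|^2)$, which is not compatible
  with these conventions.)\<close>

lemma busemann_vertical:
  "busemann (Fin x) origin (x, exp (- s)) = s + ln (1 + (norm x)\<^sup>2)"
proof -
  define c where "c = (norm x)\<^sup>2"
  have "c \<ge> 0" by (simp add: c_def)
  then have lim: "((\<lambda>t. arcosh (1 + (c + (1 - exp (- t))\<^sup>2) / (2 * exp (- t))) - t)
      \<longlongrightarrow> ln (1 + c)) at_top"
    unfolding arcosh_def apply simp
    apply real_asymp
    done
  have vert: "arcosh (1 + (exp (- s) - exp (- t))\<^sup>2 / (2 * exp (- s) * exp (- t))) = t - s"
    if "s \<le> t" for t
  proof -
    have "cosh (t - s) = 1 + (exp (- s) - exp (- t))\<^sup>2 / (2 * exp (- s) * exp (- t))"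
      by (simp add: cosh_def field_simps power2_eq_square exp_minus exp_diff)
    then show ?thesis using that arcosh_cosh_real[of "t - s"] by simp
  qed
  have "((\<lambda>t. s + (arcosh (1 + (c + (1 - exp (- t))\<^sup>2) / (2 * exp (- t))) - t))
      \<longlongrightarrow> s + ln (1 + c)) at_top"
    by (intro tendsto_intros lim)
  then have "((\<lambda>t. hdist origin (ray (Fin x) t) - hdist (x, exp (- s)) (ray (Fin x) t))
      \<longlongrightarrow> s + ln (1 + c)) at_top"
    apply (rule Lim_transform_eventually)
    using eventually_ge_at_top[of s]
    by eventually_elim (simp add: hdist_def origin_def norm_Pair vert c_def)
  then show ?thesis
    unfolding busemann_def c_def by (intro tendsto_Lim) auto
qed

definition lift_map :: "'d::finite susp \<Rightarrow> 'd hopf" where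
  "lift_map = (\<lambda>((x, \<eta>), s). (Fin x, \<eta>, s + ln (1 + (norm x)\<^sup>2)))"

definition factor_map :: "'d::finite lmat set \<Rightarrow> 'd susp \<Rightarrow> 'd uvec set" where
  "factor_map \<Gamma> p = orb \<Gamma> (hopf_inv (lift_map p))"

end

theory Submission
  imports Defs
begin

text \<open>On the light cone the normalized null vectors \<open>nhat\<close> of \<open>\<xi>\<close> and \<open>\<eta>\<close> give the Hopf coordinates
  linearly: the unit vector \<open>(p, w)\<close> over \<open>(\<xi>, \<eta>, s)\<close> satisfies \<open>p + w = e\<^sup>s nhat \<xi>\<close> and \<open>p - w\<close> is a positive
  multiple of \<open>nhat \<eta>\<close>. The inverse branch on \<open>\<Delta> j\<close> scales the null vector of \<open>x\<close> by \<open>e\<close> to the power minus the roof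
  function, which is the semiconjugacy.

  The equality of measures is a forward Hopf argument that needs no ergodicity of the flow on the
  quotient. For an invariant, bounded function \<open>f\<close> that is Lipschitz for an invariant distance,
  Birkhoff's theorem for the ergodic skew product shows that the forward averages of \<open>f\<close> converge to
  the integral of \<open>f\<close> over the suspension, almost everywhere. Vectors with the same forward
  endpoint are asymptotic, so this convergence depends on the forward endpoint only; it holds for
  almost every \<open>x\<close> in the coding domain, and by minimality of the action on the boundary and
  quasi-invariance of the Patterson-Sullivan measure for almost every boundary point, hence for almost every
  vector of the quotient. The BMS measure is finite and invariant under the flow, so dominated
  convergence identifies the two integrals of \<open>f\<close>, and such functions determine a measure on
  the quotient.\<close>

section \<open>Birkhoff's ergodic theorem\<close>

text \<open>The conditional measures of \<open>\<nu>'\<close> along backward endpoints are known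
  only implicitly, through invariance and the projection to \<open>\<nu>\<close>, so densities of
  the two measures cannot be compared. A condition on the forward endpoint alone needs only that
  projection, and \<open>\<nu>\<close> has the same null sets as \<open>\<mu>\<close> on the coded
  limit points. Birkhoff sums yield limits at the return times, which vary with the point. An
  integral over the quotient needs times common to all vectors; the multiples of the mean roof
  \<open>Rbar\<close> serve, and convergence along this one sequence is enough. The quotient is a
  bare set of orbits with a sigma-algebra. Its functions and sets are therefore treated as invariant
  objects on \<open>UT\<close>, and its measure is computed by cutting invariant sets into Borel
  pieces that meet each orbit at most once.\<close>

lemma birkhoff_sum_bdd_above:
  fixes h :: "'a \<Rightarrow> real"
  assumes M: "prob_space M" and f: "f \<in> measurable M M" and inv: "distr M M f = M"
    and erg: "\<And>A. A \<in> sets M \<Longrightarrow> f -` A \<inter> space M = A \<Longrightarrow>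
        emeasure M A = 0 \<or> emeasure M (space M - A) = 0"
    and h: "integrable M h" and neg: "(\<integral>x. h x \<partial>M) < 0"
  shows "AE x in M. \<exists>K. \<forall>n. (\<Sum>k<n. h ((f ^^ k) x)) \<le> K"
proof -
  interpret prob_space M by fact
  note f[measurable]
  have [measurable]: "h \<in> borel_measurable M" using h by simp
  define S where "S n x = (\<Sum>k<n. h ((f ^^ k) x))" for n x
  have S_Suc: "S (Suc n) x = h x + S n (f x)" for n x
    unfolding S_def by (subst sum.lessThan_Suc_shift) (simp add: funpow_swap1)
  have fk[measurable]: "(f ^^ k) \<in> measurable M M" for k
    by (induction k) auto
  have [measurable]: "S n \<in> borel_measurable M" for n
    unfolding S_def by measurable
  \<comment> \<open>\<open>m n x\<close> is the maximum of \<open>S k x\<close> over k \<le> n, as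
    in Garsia's proof of the maximal inequality. The recursive form gives integrability and
    monotonicity by induction.\<close>
  define m where "m n = rec_nat (\<lambda>x. 0) (\<lambda>_ g x. max 0 (h x + g (f x))) n" for n
  have m0: "m 0 x = 0" and mS: "m (Suc n) x = max 0 (h x + m n (f x))" for n x
    by (simp_all add: m_def)
  have m_int: "integrable M (m n)" for n
  proof (induction n)
    case 0 then show ?case using m0 by (simp add: m_def)
  next
    case (Suc n)
    have "integrable M (\<lambda>x. m n (f x))"
      using Suc inv f by (metis integrable_distr)
    then have "integrable M (\<lambda>x. max 0 (h x + m n (f x)))" using h by simp
    then show ?case by (simp add: mS[abs_def] m_def)
  qed
  have m_nonneg: "m n x \<ge> 0" for n x by (cases n) (auto simp: m0 mS)
  have m_mono: "m n x \<le> m (Suc n) x" for n x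
  proof (induction n arbitrary: x)
    case (Suc n)
    have "h x + m n (f x) \<le> h x + m (Suc n) (f x)" using Suc[of "f x"] by simp
    then show ?case unfolding mS[of _ x] by (intro max.mono) auto
  qed (simp add: m0 m_nonneg)
  have m_mono': "k \<le> n \<Longrightarrow> m k x \<le> m n x" for k n x
    by (rule lift_Suc_mono_le[of "\<lambda>n. m n x"]) (auto simp: m_mono)
  have S_le: "S n x \<le> m n x" for n x
  proof (induction n arbitrary: x)
    case (Suc n)
    have "h x + S n (f x) \<le> max 0 (h x + m n (f x))"
      using Suc[of "f x"] by (intro max.coboundedI2) simp
    then show ?case by (simp add: mS S_Suc)
  qed (simp add: m0 S_def)
  \<comment> \<open>Unboundedness of the sums is invariant, since \<open>S (Suc n) x\<close> and
    \<open>S n (f x)\<close> differ by \<open>h x\<close>; so \<open>A\<close> is null, as desired,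
    or has full measure, which contradicts \<open>neg\<close>. Bounds \<open>K\<close> in the
    naturals keep \<open>A\<close> measurable.\<close>
  define A where "A = {x\<in>space M. \<forall>K::nat. \<exists>n. S n x > real K}"
  have A[measurable]: "A \<in> sets M" unfolding A_def by measurable
  have A_step: "x \<in> A \<longleftrightarrow> f x \<in> A" if "x \<in> space M" for x
  proof
    assume xA: "x \<in> A"
    have "\<exists>n. S n (f x) > real K" for K :: nat
    proof -
      obtain K' :: nat where K': "real K' \<ge> real K + \<bar>h x\<bar>" using real_arch_simple by blast
      obtain n where n: "S n x > real K'" using xA by (auto simp: A_def)
      then have "n \<noteq> 0" by (cases n) (auto simp: S_def)
      then obtain l where "n = Suc l" by (cases n) auto
      then show ?thesis using n K' by (intro exI[of _ l]) (auto simp: S_Suc)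
    qed
    then show "f x \<in> A" using that measurable_space[OF f] by (auto simp: A_def)
  next
    assume xA: "f x \<in> A"
    have "\<exists>n. S n x > real K" for K :: nat
    proof -
      obtain K' :: nat where K': "real K' \<ge> real K + \<bar>h x\<bar>" using real_arch_simple by blast
      obtain n where n: "S n (f x) > real K'" using xA by (auto simp: A_def)
      then show ?thesis using K' by (intro exI[of _ "Suc n"]) (auto simp: S_Suc)
    qed
    then show "x \<in> A" using that by (auto simp: A_def)
  qed
  have "f -` A \<inter> space M = A" using A_step by (auto simp: A_def)
  then consider "emeasure M A = 0" | "emeasure M (space M - A) = 0" using erg[OF A] by blast
  then show ?thesis
  proof cases
    case 1
    then have "AE x in M. x \<notin> A" using A by (auto intro!: AE_I[of _ _ A])
    then show ?thesis
      by (rule AE_mp) (auto intro!: AE_I2 simp: A_def S_def not_less)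
  next
    case 2
    then have full: "AE x in M. x \<in> A" using A by (auto intro!: AE_I[of _ _ "space M - A"])
    \<comment> \<open>Where the maxima \<open>m n (f x)\<close> tend to infinity, the increments \<open>d n x\<close>, whose integrals are
      nonnegative, decrease to \<open>h x\<close>.\<close>
    define d where "d n x = max (- m n (f x)) (h x)" for n x
    have d_eq: "d n x = m (Suc n) x - m n (f x)" for n x
      unfolding d_def mS by auto
    have mf: "integrable M (\<lambda>x. m n (f x))" "(\<integral>x. m n (f x) \<partial>M) = (\<integral>x. m n x \<partial>M)" for n
    proof -
      show "integrable M (\<lambda>x. m n (f x))" using m_int inv f by (metis integrable_distr)
      have "(\<integral>x. m n x \<partial>distr M M f) = (\<integral>x. m n (f x) \<partial>M)"
        by (rule integral_distr) (use f m_int in auto)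
      then show "(\<integral>x. m n (f x) \<partial>M) = (\<integral>x. m n x \<partial>M)" by (simp add: inv)
    qed
    have "(\<integral>x. d n x \<partial>M) \<ge> 0" for n
    proof -
      have "(\<integral>x. d n x \<partial>M) = (\<integral>x. m (Suc n) x \<partial>M) - (\<integral>x. m n x \<partial>M)"
        unfolding d_eq using mf m_int by simp
      moreover have "(\<integral>x. m (Suc n) x \<partial>M) \<ge> (\<integral>x. m n x \<partial>M)"
        using m_int m_mono by (intro integral_mono) auto
      ultimately show ?thesis by simp
    qed
    moreover have "(\<lambda>n. \<integral>x. d n x \<partial>M) \<longlonglongrightarrow> (\<integral>x. h x \<partial>M)"
    proof (rule integral_dominated_convergence[where w="\<lambda>x. \<bar>h x\<bar>"])
      show "integrable M (\<lambda>x. \<bar>h x\<bar>)" using h by simp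
      show "d n \<in> borel_measurable M" for n
        unfolding d_def using mf(1) by measurable
      show "AE x in M. norm (d n x) \<le> \<bar>h x\<bar>" for n
      proof (intro AE_I2)
        fix x show "norm (d n x) \<le> \<bar>h x\<bar>"
          using m_nonneg[of n "f x"] unfolding d_def by (simp add: max_def)
      qed
      show "AE x in M. (\<lambda>n. d n x) \<longlonglongrightarrow> h x"
        using full AE_space
      proof eventually_elim
        case (elim x)
        then have "f x \<in> A" using A_step by simp
        obtain K :: nat where "real K \<ge> - h x" using real_arch_simple by blast
        obtain n0 where "S n0 (f x) > real K" using \<open>f x \<in> A\<close> by (auto simp: A_def)
        then have n0: "S n0 (f x) > - h x" using \<open>real K \<ge> - h x\<close> by linarith
        have "d n x = h x" if "n \<ge> n0" for n
          using m_mono'[OF that, of "f x"] S_le[of n0 "f x"] n0 unfolding d_def by auto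
        then show ?case
          by (intro tendsto_eventually) (auto simp: eventually_sequentially)
      qed
    qed simp
    ultimately have "(\<integral>x. h x \<partial>M) \<ge> 0"
      by (intro LIMSEQ_le_const) auto
    then show ?thesis using neg by simp
  qed
qed

text \<open>Subtracting \<open>1 / real (Suc N)\<close> from \<plusminus>(g - c) makes the integral
  negative, so these sums stay bounded above. Hence the averages eventually lie within any given
  distance of \<open>c\<close>, from both sides.\<close>

theorem birkhoff_ergodic:
  fixes g :: "'a \<Rightarrow> real"
  assumes M: "prob_space M" and f: "f \<in> measurable M M" and inv: "distr M M f = M"
    and erg: "\<And>A. A \<in> sets M \<Longrightarrow> f -` A \<inter> space M = A \<Longrightarrow>
        emeasure M A = 0 \<or> emeasure M (space M - A) = 0"
    and g: "integrable M g"
  shows "AE x in M. (\<lambda>n. (\<Sum>k<n. g ((f ^^ k) x)) / real n) \<longlonglongrightarrow> (\<integral>x. g x \<partial>M)"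
proof -
  interpret prob_space M by fact
  define c where "c = (\<integral>x. g x \<partial>M)"
  have step: "AE x in M. \<forall>N. \<exists>K. \<forall>n. (\<Sum>k<n. \<sigma> * (g ((f ^^ k) x) - c) - 1 / real (Suc N)) \<le> K" for \<sigma> :: real
  proof (subst AE_all_countable, intro allI)
    fix N
    have "(\<integral>x. \<sigma> * (g x - c) - 1 / real (Suc N) \<partial>M) < 0"
      using g by (simp add: c_def prob_space)
    then show "AE x in M. \<exists>K. \<forall>n. (\<Sum>k<n. \<sigma> * (g ((f ^^ k) x) - c) - 1 / real (Suc N)) \<le> K"
      using g by (intro birkhoff_sum_bdd_above[OF M f inv erg]) auto
  qed
  show ?thesis using step[of 1] step[of "-1"]
  proof eventually_elim
    case (elim x)
    define s where "s n = (\<Sum>k<n. g ((f ^^ k) x))" for n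
    have sums: "(\<Sum>k<n. \<sigma> * (g ((f ^^ k) x) - c) - e) = \<sigma> * (s n - n * c) - n * e" for n \<sigma> e
      by (simp add: sum_subtractf sum_distrib_left[symmetric] s_def)
    show ?case unfolding c_def[symmetric] s_def[symmetric]
    proof (rule LIMSEQ_I)
      fix r :: real assume r: "r > 0"
      obtain N where N: "1 / real (Suc N) < r / 2" using r by (metis half_gt_zero nat_approx_posE)
      define e where "e = 1 / real (Suc N)"
      obtain K1 K2 where K: "\<And>n. 1 * (s n - n * c) - n * e \<le> K1" "\<And>n. (-1) * (s n - n * c) - n * e \<le> K2"
        using elim(1)[rule_format, of N] elim(2)[rule_format, of N]
        unfolding sums e_def[symmetric] by auto
      define K where "K = \<bar>K1\<bar> + \<bar>K2\<bar> + 1"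
      obtain n0 :: nat where n0: "real n0 > 2 * K / r" using reals_Archimedean2 by blast
      have "norm (s n / n - c) < r" if "n \<ge> n0" for n
      proof -
        have "K > 0" by (simp add: K_def add_nonneg_pos)
        then have "real n0 > 0" using n0 r by (intro less_trans[OF _ n0] divide_pos_pos) auto
        then have n: "real n > 0" using that by linarith
        have "K < n * (r / 2)" proof -
          have "2 * K / r < real n" using n0 that by linarith
          then show ?thesis using r by (simp add: field_simps)
        qed
        moreover have "n * e < n * (r/2)" using N n unfolding e_def by (intro mult_strict_left_mono)
        moreover have "\<bar>s n - n * c\<bar> \<le> K + n * e" using K[of n] by (auto simp: K_def)
        ultimately have *: "\<bar>s n - n * c\<bar> < n * r" by (simp add: field_simps)
        have "norm (s n / n - c) = \<bar>s n - n * c\<bar> / n"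
          using n by (simp add: abs_div_pos diff_divide_distrib)
        also have "\<dots> < r" using * n by (simp add: pos_divide_less_eq mult.commute)
        finally show ?thesis .
      qed
      then show "\<exists>n0. \<forall>n\<ge>n0. norm (s n / n - c) < r" by blast
    qed
  qed
qed

text \<open>The points with \<open>Suc n\<close> iterates in \<open>D\<close> form the preimage of
  those with \<open>n\<close>, so invariance propagates full measure, and a countable intersection
  keeps it.\<close>

lemma invariant_ae_orbit:
  assumes "prob_space M" and inv: "invariant_ae M D f"
  defines "E \<equiv> {x. \<forall>i. (f ^^ i) x \<in> D}"
  shows "E \<in> sets M" "AE x in M. x \<in> E"
proof -
  interpret prob_space M by fact
  have D: "D \<in> sets M" "emeasure M (space M - D) = 0"
    and pre: "\<And>A. A \<in> sets M \<Longrightarrow> {x\<in>D. f x \<in> A} \<in> sets M"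
    "\<And>A. A \<in> sets M \<Longrightarrow> emeasure M {x\<in>D. f x \<in> A} = emeasure M A"
    using inv by (auto simp: invariant_ae_def)
  define En where "En n = {x. \<forall>i\<le>n. (f ^^ i) x \<in> D}" for n
  have En_Suc: "En (Suc n) = {x\<in>D. f x \<in> En n}" for n
  proof -
    have "(\<forall>i\<le>Suc n. P i) \<longleftrightarrow> P 0 \<and> (\<forall>i\<le>n. P (Suc i))" for P
      by (metis Suc_le_mono le0 not0_implies_Suc)
    then show ?thesis unfolding En_def by (simp add: funpow_swap1)
  qed
  have 1: "En n \<in> sets M \<and> emeasure M (En n) = 1" for n
  proof (induction n)
    case 0
    have "prob (space M - D) = 0" using D by (simp add: measure_def)
    then have "prob D = 1" using prob_compl[OF D(1)] by simp
    then have "emeasure M D = 1" by (simp add: emeasure_eq_measure)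
    then show ?case using D by (simp add: En_def)
  next
    case (Suc n) then show ?case using pre unfolding En_Suc by auto
  qed
  have E_eq: "E = (\<Inter>n. En n)" by (auto simp: E_def En_def)
  show "E \<in> sets M" unfolding E_eq using 1 by auto
  have "AE x in M. x \<in> En n" for n using 1[of n] AE_in_set_eq_1[of "En n"] by (simp add: measure_def)
  then have "AE x in M. \<forall>n. x \<in> En n" by (simp add: AE_all_countable)
  then show "AE x in M. x \<in> E" by (simp add: E_eq)
qed

text \<open>The values of \<open>f\<close> off \<open>D\<close> are meaningless, so the theorem for
  total maps does not apply to \<open>f\<close> itself; a total map with the same orbits almost
  everywhere is substituted.\<close>

theorem birkhoff_ergodic_ae:
  fixes g :: "'a \<Rightarrow> real"
  assumes M: "prob_space M" and inv: "invariant_ae M D f" and erg: "ergodic_ae M D f"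
    and g: "integrable M g"
  shows "AE x in M. (\<lambda>n. (\<Sum>k<n. g ((f ^^ k) x)) / real n) \<longlonglongrightarrow> (\<integral>x. g x \<partial>M)"
proof -
  interpret prob_space M by fact
  define E where "E = {x. \<forall>i. (f ^^ i) x \<in> D}"
  have E: "E \<in> sets M" "AE x in M. x \<in> E"
    using invariant_ae_orbit[OF M inv] by (auto simp: E_def)
  have pre: "\<And>A. A \<in> sets M \<Longrightarrow> {x\<in>D. f x \<in> A} \<in> sets M"
    "\<And>A. A \<in> sets M \<Longrightarrow> emeasure M {x\<in>D. f x \<in> A} = emeasure M A"
    using inv by (auto simp: invariant_ae_def)
  have fE: "f x \<in> E" if "x \<in> E" for x
    using that unfolding E_def by (auto simp: funpow_swap1) (metis funpow.simps(2) o_apply funpow_swap1)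
  have ED: "x \<in> D" if "x \<in> E" for x using that unfolding E_def by (auto dest: spec[of _ 0])
  \<comment> \<open>The identity off the full orbits keeps \<open>F\<close> measurable and measure
    preserving, because the altered set is null; on \<open>E\<close> all iterates of
    \<open>F\<close> and \<open>f\<close> coincide.\<close>
  define F where "F x = (if x \<in> E then f x else x)" for x
  have F_pow: "(F ^^ k) x = (f ^^ k) x \<and> (f ^^ k) x \<in> E" if "x \<in> E" for x k
    by (induction k) (use that fE in \<open>auto simp: F_def\<close>)
  have F_vim: "F -` A \<inter> space M = ({x\<in>D. f x \<in> A} \<inter> E) \<union> (A - E)" if "A \<in> sets M" for A
    using sets.sets_into_space[OF that] sets.sets_into_space[OF E(1)] ED
    by (auto simp: F_def split: if_splits)
  have F: "F \<in> measurable M M"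
  proof (rule measurableI)
    fix x assume "x \<in> space M" then show "F x \<in> space M"
      using fE sets.sets_into_space[OF E(1)] by (auto simp: F_def)
  next
    fix A assume A: "A \<in> sets M" show "F -` A \<inter> space M \<in> sets M"
      unfolding F_vim[OF A] using pre(1)[OF A] A E(1) by auto
  qed
  have "distr M M F = M"
  proof (rule measure_eqI)
    fix A assume "A \<in> sets (distr M M F)" then have A: "A \<in> sets M" by simp
    have "emeasure (distr M M F) A = emeasure M (F -` A \<inter> space M)"
      using F A by (rule emeasure_distr)
    also have "\<dots> = emeasure M {x\<in>D. f x \<in> A}"
    proof (rule emeasure_eq_AE)
      show "AE x in M. (x \<in> F -` A \<inter> space M) = (x \<in> {x \<in> D. f x \<in> A})"
        using E(2) AE_space by eventually_elim (use ED in \<open>auto simp: F_def\<close>)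
    qed (use measurable_sets[OF F A] pre(1)[OF A] in auto)
    finally show "emeasure (distr M M F) A = emeasure M A" using pre(2)[OF A] by simp
  qed simp
  moreover have "emeasure M A = 0 \<or> emeasure M (space M - A) = 0"
    if A: "A \<in> sets M" and i: "F -` A \<inter> space M = A" for A
  proof -
    have "AE x in M. x \<in> D \<longrightarrow> (x \<in> A \<longleftrightarrow> f x \<in> A)"
      using E(2) AE_space
    proof eventually_elim
      case (elim x)
      then have "x \<in> A \<longleftrightarrow> F x \<in> A" using i by blast
      then show ?case using elim by (simp add: F_def)
    qed
    then show ?thesis using erg A unfolding ergodic_ae_def by blast
  qed
  ultimately have "AE x in M. (\<lambda>n. (\<Sum>k<n. g ((F ^^ k) x)) / real n) \<longlonglongrightarrow> (\<integral>x. g x \<partial>M)"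
    by (rule birkhoff_ergodic[OF M F _ _ g])
  then show ?thesis using E(2)
    by eventually_elim (simp add: F_pow)
qed

section \<open>Minkowski space and its isometries\<close>

abbreviation tm :: "'d::finite mink \<Rightarrow> real" where
  "tm v \<equiv> v $ Inr True"

text \<open>Collecting the space-like coordinates in a Euclidean vector turns the form into an inner
  product minus a product of times, which makes Cauchy-Schwarz available.\<close>

definition spc :: "'d::finite mink \<Rightarrow> (real ^ 'd) \<times> real" where
  "spc v = (space_part v, v $ Inr False)"

definition mk :: "(real ^ 'd) \<times> real \<Rightarrow> real \<Rightarrow> 'd::finite mink" where
  "mk a t = mvec (fst a) (snd a) t"

lemma spc_mk [simp]: "spc (mk a t) = a" and tm_mk [simp]: "tm (mk a t) = t"
  by (simp_all add: spc_def mk_def mvec_def space_part_def)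

lemma mink_eqI: "spc v = spc w \<Longrightarrow> tm v = tm w \<Longrightarrow> v = w"
  apply (simp add: spc_def space_part_def vec_eq_iff)
  by (metis (full_types) sum.exhaust)

lemma spc_add [simp]: "spc (v + w) = spc v + spc w"
  and spc_diff [simp]: "spc (v - w) = spc v - spc w"
  and spc_scale [simp]: "spc (c *\<^sub>R v) = c *\<^sub>R spc v"
  and spc_minus [simp]: "spc (- v) = - spc v"
  and spc_0 [simp]: "spc 0 = 0"
  by (simp_all add: spc_def space_part_def vec_eq_iff zero_prod_def)

lemma lform_spc: "lform v w = spc v \<bullet> spc w - tm v * tm w"
  by (simp add: lform_def spc_def space_part_def inner_vec_def inner_prod_def)

lemma lform_sym: "lform v w = lform w v"
  by (simp add: lform_spc inner_commute mult.commute)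

lemma lform_lin [simp]:
  "lform (v + w) u = lform v u + lform w u" "lform u (v + w) = lform u v + lform u w"
  "lform (v - w) u = lform v u - lform w u" "lform u (v - w) = lform u v - lform u w"
  "lform (c *\<^sub>R v) u = c * lform v u" "lform u (c *\<^sub>R v) = c * lform u v"
  "lform (- v) u = - lform v u" "lform u (- v) = - lform u v"
  "lform 0 u = 0" "lform u 0 = 0"
  by (simp_all add: lform_spc inner_simps algebra_simps)

lemma continuous_spc [continuous_intros]:
  "continuous_on S f \<Longrightarrow> continuous_on S (\<lambda>x. spc (f x))"
  unfolding spc_def space_part_def by (intro continuous_intros)

lemma continuous_mk [continuous_intros]:
  "continuous_on S f \<Longrightarrow> continuous_on S g \<Longrightarrow> continuous_on S (\<lambda>x. mk (f x) (g x))"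
proof -
  assume *: "continuous_on S f" "continuous_on S g"
  have "continuous_on S (\<lambda>x. (\<chi> k. case k of Inl i \<Rightarrow> fst (f x) $ i | Inr c \<Rightarrow> if c then g x else snd (f x)))"
  proof (rule continuous_on_vec_lambda)
    fix k show "continuous_on S (\<lambda>x. case k of Inl i \<Rightarrow> fst (f x) $ i | Inr c \<Rightarrow> if c then g x else snd (f x))"
      using * by (cases k; cases "k = Inr True") (auto intro!: continuous_intros split: if_splits)
  qed
  then show ?thesis by (simp add: mk_def mvec_def)
qed

lemma continuous_lform [continuous_intros]:
  "continuous_on S f \<Longrightarrow> continuous_on S g \<Longrightarrow> continuous_on S (\<lambda>x. lform (f x) (g x))"
  unfolding lform_spc by (intro continuous_intros)

lemma sum_UNIV_Plus:
  "(\<Sum>k\<in>(UNIV :: ('a::finite + 'b::finite) set). g k) = (\<Sum>i\<in>UNIV. g (Inl i)) + (\<Sum>c\<in>UNIV. g (Inr c))"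
  using sum.Plus[of "UNIV :: 'a set" "UNIV :: 'b set" g] by (simp add: comp_def)

lemma norm_mink: "(norm v)\<^sup>2 = (norm (spc v))\<^sup>2 + (tm v)\<^sup>2"
proof -
  have "v \<bullet> v = (\<Sum>i\<in>UNIV. v $ i * v $ i)" by (simp add: inner_vec_def)
  also have "\<dots> = (\<Sum>i\<in>UNIV. v $ Inl i * v $ Inl i) + (\<Sum>c\<in>UNIV. v $ Inr c * v $ Inr c)"
    by (simp add: sum_UNIV_Plus)
  finally show ?thesis
    unfolding power2_norm_eq_inner
    by (simp add: UNIV_bool spc_def space_part_def inner_vec_def inner_prod_def power2_eq_square)
qed

text \<open>The hyperboloid point of the base point \<open>origin\<close>; pairing with it reads off
  minus the time coordinate.\<close>

definition org :: "'d::finite mink" where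
  "org = mk 0 1"

lemma org_simps [simp]: "spc org = 0" "tm org = 1" "lform org org = - 1"
  "lform org v = - tm v" "lform v org = - tm v"
  by (simp_all add: org_def lform_spc)

lemma lform_self: "lform v v = (norm (spc v))\<^sup>2 - (tm v)\<^sup>2"
  unfolding lform_spc power2_norm_eq_inner by (simp add: power2_eq_square)

section \<open>Causal vectors and the time-oriented cone\<close>

lemma causal_norm_le: "lform v v \<le> 0 \<longleftrightarrow> norm (spc v) \<le> \<bar>tm v\<bar>"
  using abs_le_square_iff[of "norm (spc v)" "tm v"] by (simp add: lform_self)

lemma timelike_norm_less: "lform v v < 0 \<longleftrightarrow> norm (spc v) < \<bar>tm v\<bar>"
  using abs_le_square_iff[of "tm v" "norm (spc v)"] by (auto simp: lform_self)

lemma future_lform_less: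
  assumes "lform p p < 0" "tm p > 0" "lform q q \<le> 0" "tm q > 0"
  shows "lform p q < 0"
proof -
  have "norm (spc p) < tm p" "norm (spc q) \<le> tm q"
    using assms by (auto simp: causal_norm_le timelike_norm_less)
  then have "norm (spc p) * norm (spc q) \<le> norm (spc p) * tm q"
    "norm (spc p) * tm q < tm p * tm q"
    using assms by (auto intro: mult_left_mono)
  then show ?thesis using norm_cauchy_schwarz[of "spc p" "spc q"] by (simp add: lform_spc)
qed

text \<open>The time orientation of a causal vector is visible in the sign of its pairing with one
  future time-like vector. The form being invariant, isometries can be tested on \<open>org\<close>
  alone.\<close>

lemma future_of_lform_less:
  assumes "lform p p < 0" "tm p > 0" "lform q q \<le> 0" "lform p q < 0"
  shows "tm q > 0"
proof (rule ccontr)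
  assume "\<not> tm q > 0"
  then consider "tm q = 0" | "tm q < 0" by linarith
  then show False
  proof cases
    case 1
    then have "spc q = 0" using assms by (simp add: causal_norm_le)
    then show ?thesis using assms 1 by (simp add: lform_spc)
  next
    case 2
    then have "lform p (- q) < 0" using assms by - (rule future_lform_less, auto)
    then show ?thesis using assms by simp
  qed
qed

lemma future_lform_le:
  assumes "lform p p \<le> 0" "tm p > 0" "lform q q \<le> 0" "tm q > 0"
  shows "\<bar>lform p q\<bar> \<le> 2 * tm p * tm q"
proof -
  have "norm (spc p) \<le> tm p" "norm (spc q) \<le> tm q"
    using assms by (auto simp: causal_norm_le)
  then have "norm (spc p) * norm (spc q) \<le> tm p * tm q"
    using assms by (intro mult_mono) auto
  moreover have "\<bar>spc p \<bullet> spc q\<bar> \<le> norm (spc p) * norm (spc q)" by (rule Cauchy_Schwarz_ineq2)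
  moreover have "\<bar>tm p * tm q\<bar> = tm p * tm q" using assms by simp
  moreover have "\<bar>lform p q\<bar> \<le> \<bar>spc p \<bullet> spc q\<bar> + \<bar>tm p * tm q\<bar>"
    unfolding lform_spc by (rule abs_triangle_ineq4)
  ultimately show ?thesis by linarith
qed

text \<open>The orthochronous Lorentz group. Preservation of the future cone is imposed at the
  single vector \<open>org\<close> and spreads to all causal vectors in
  \<open>lorp_future\<close>.\<close>

definition lorp :: "'d::finite lmat set" where
  "lorp = {A. (\<forall>v w. lform (A *v v) (A *v w) = lform v w) \<and> tm (A *v org) > 0}"

lemma lorp_lform: "A \<in> lorp \<Longrightarrow> lform (A *v v) (A *v w) = lform v w"
  by (simp add: lorp_def)

lemma lorp_future:
  assumes "A \<in> lorp" "lform q q \<le> 0" "tm q > 0"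
  shows "tm (A *v q) > 0"
proof (rule future_of_lform_less)
  show "lform (A *v org) (A *v org) < 0" "tm (A *v org) > 0"
    "lform (A *v q) (A *v q) \<le> 0"
    using assms by (auto simp: lorp_def)
  show "lform (A *v org) (A *v q) < 0"
    using assms by (simp add: lorp_lform)
qed

lemma lorp_mult:
  assumes "A \<in> lorp" "B \<in> lorp"
  shows "A ** B \<in> lorp"
proof -
  have "lform (A ** B *v v) (A ** B *v w) = lform v w" for v w
    unfolding matrix_vector_mul_assoc[symmetric] using assms by (simp only: lorp_lform)
  moreover have "tm (A ** B *v org) > 0"
    unfolding matrix_vector_mul_assoc[symmetric]
    using assms by (intro lorp_future) (auto simp: lorp_def)
  ultimately show ?thesis by (simp add: lorp_def)
qed

text \<open>This is J A^T J, where J is the diagonal matrix of the form. The explicit entries show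
  that inversion is continuous, which is used for the identity component and for
  discreteness.\<close>

definition lorentz_inv :: "'d::finite lmat \<Rightarrow> 'd lmat" where
  "lorentz_inv A = (\<chi> i j. (if i = Inr True then -1 else 1) * (if j = Inr True then -1 else 1) * A $ j $ i)"

lemma lform_sum: "lform v w = (\<Sum>k\<in>UNIV. (if k = Inr True then -1 else 1) * v $ k * w $ k)"
proof -
  have "(\<Sum>k\<in>UNIV. (if k = Inr True then -1 else 1) * v $ k * w $ k)
    = (\<Sum>i\<in>UNIV. v $ Inl i * w $ Inl i) + (\<Sum>c\<in>UNIV. (if c then -1 else 1) * v $ Inr c * w $ Inr c)"
    by (simp add: sum_UNIV_Plus)
  then show ?thesis by (simp add: lform_def UNIV_bool)
qed

lemma lform_axis: "lform (axis i 1) (axis j 1) = (if i = j then (if i = Inr True then -1 else 1) else 0)"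
proof -
  have "lform (axis i 1) (axis j 1) = (\<Sum>k\<in>UNIV. if k = i then (if i = j then (if i = Inr True then -1 else 1) else 0) else 0)"
    unfolding lform_sum by (intro sum.cong) (auto simp: axis_def)
  then show ?thesis by simp
qed

lemma lorentz_inv_left:
  assumes "\<And>v w. lform (A *v v) (A *v w) = lform v w"
  shows "lorentz_inv A ** A = mat 1"
proof -
  have "(lorentz_inv A ** A) $ i $ j = (if i = j then 1 else 0)" for i j
  proof -
    have "(lorentz_inv A ** A) $ i $ j
      = (if i = Inr True then -1 else 1) * lform (A *v axis i 1) (A *v axis j 1)"
      unfolding lform_sum
      by (simp add: matrix_matrix_mult_def lorentz_inv_def matrix_vector_mult_basis column_def sum_distrib_left ac_simps)
    also have "\<dots> = (if i = j then 1 else 0)"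
      unfolding assms lform_axis by simp
    finally show ?thesis .
  qed
  then show ?thesis by (simp add: vec_eq_iff mat_def)
qed

lemma lorentz_inv_right:
  assumes "\<And>v w. lform (A *v v) (A *v w) = lform v w"
  shows "A ** lorentz_inv A = mat 1"
  using lorentz_inv_left[OF assms] matrix_left_right_inverse by metis

lemma matrix_inv_lorentz:
  assumes "\<And>v w. lform (A *v v) (A *v w) = lform v w"
  shows "matrix_inv A = lorentz_inv A"
proof -
  note inv = lorentz_inv_left[OF assms] lorentz_inv_right[OF assms]
  have "A ** matrix_inv A = mat 1 \<and> matrix_inv A ** A = mat 1"
    unfolding matrix_inv_def by (rule someI[of _ "lorentz_inv A"]) (use inv in simp)
  then show ?thesis using inv by (metis matrix_mul_assoc matrix_mul_lid matrix_mul_rid)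
qed

lemma lorp_inv:
  assumes "A \<in> lorp"
  shows "lorentz_inv A \<in> lorp" "matrix_inv A = lorentz_inv A"
    "A *v (lorentz_inv A *v v) = v" "lorentz_inv A *v (A *v v) = v"
proof -
  have A: "\<And>v w. lform (A *v v) (A *v w) = lform v w" using assms by (simp add: lorp_def)
  note inv = lorentz_inv_left[OF A] lorentz_inv_right[OF A]
  show *: "A *v (lorentz_inv A *v v) = v" "lorentz_inv A *v (A *v v) = v" for v
    using inv by (simp_all add: matrix_vector_mul_assoc)
  show "matrix_inv A = lorentz_inv A" by (rule matrix_inv_lorentz[OF A])
  have "lform (lorentz_inv A *v v) (lorentz_inv A *v w) = lform v w" for v w
    using A[of "lorentz_inv A *v v" "lorentz_inv A *v w"] by (simp add: *)
  moreover have "tm (lorentz_inv A *v org) = tm (A *v org)"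
  proof -
    have "lform (lorentz_inv A *v org) org = lform org (A *v org)"
      using A[of "lorentz_inv A *v org" org] by (simp only: *)
    then show ?thesis by simp
  qed
  ultimately show "lorentz_inv A \<in> lorp" using assms by (simp add: lorp_def)
qed

lemma SO0_simps [simp]: "x \<otimes>\<^bsub>SO0\<^esub> y = x ** y" "\<one>\<^bsub>SO0\<^esub> = mat 1"
  by (simp_all add: SO0_def)

text \<open>The image of \<open>org\<close> stays time-like, so its time coordinate cannot vanish on
  \<open>SO_lor\<close>; on a connected set containing the identity it keeps the sign it has
  there.\<close>

lemma SO0_subset_lorp: "carrier SO0 \<subseteq> (lorp :: 'd::finite lmat set)"
proof
  fix A :: "'d lmat" assume "A \<in> carrier SO0"
  then obtain C where C: "connected C" "C \<subseteq> SO_lor" "mat 1 \<in> C" "A \<in> C"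
    by (auto simp: SO0_def connected_component_def)
  define \<phi> :: "'d lmat \<Rightarrow> real" where "\<phi> B = tm (B *v org)" for B
  have \<phi>_bound: "\<phi> B \<noteq> 0" if "B \<in> SO_lor" for B
  proof
    assume "\<phi> B = 0"
    then have "lform (B *v org) (B *v org) \<ge> 0" by (simp add: lform_spc \<phi>_def)
    then show False using that by (simp add: SO_lor_def)
  qed
  have "continuous_on C \<phi>"
    unfolding \<phi>_def matrix_vector_mult_def by (auto intro!: continuous_intros)
  then have "connected (\<phi> ` C)" using C(1) by (rule connected_continuous_image)
  moreover have "1 \<in> \<phi> ` C" using C(3) by (auto simp: \<phi>_def image_iff intro!: bexI[of _ "mat 1"])
  ultimately have "\<phi> A > 0" if "\<not> \<phi> A > 0 \<Longrightarrow> 0 \<in> \<phi> ` C"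
    using that \<phi>_bound C(2) by fastforce
  moreover have "0 \<in> \<phi> ` C" if "\<not> \<phi> A > 0"
    using connectedD_interval[OF \<open>connected (\<phi> ` C)\<close>, of "\<phi> A" 1 0] that \<open>1 \<in> \<phi> ` C\<close> C(4) by auto
  ultimately have "\<phi> A > 0" by blast
  then show "A \<in> lorp" using C by (auto simp: lorp_def \<phi>_def SO_lor_def)
qed

text \<open>Continuous inversion maps a connected set joining the identity to \<open>A\<close> onto
  one joining the identity to the inverse.\<close>

lemma SO0_inv:
  assumes "A \<in> carrier SO0"
  shows "lorentz_inv A \<in> carrier SO0"
proof -
  obtain C where C: "connected C" "C \<subseteq> SO_lor" "mat 1 \<in> C" "A \<in> C"
    using assms by (auto simp: SO0_def connected_component_def)
  have "continuous_on C lorentz_inv"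
    unfolding lorentz_inv_def by (intro continuous_intros)
  then have "connected (lorentz_inv ` C)" using C(1) by (rule connected_continuous_image)
  moreover have "lorentz_inv ` C \<subseteq> SO_lor"
  proof clarify
    fix B assume "B \<in> C"
    then have B: "\<And>v w. lform (B *v v) (B *v w) = lform v w" "det B = 1"
      using C(2) by (auto simp: SO_lor_def)
    note inv = lorentz_inv_left[OF B(1)] lorentz_inv_right[OF B(1)]
    have *: "B *v (lorentz_inv B *v v) = v" for v
      using inv by (simp add: matrix_vector_mul_assoc)
    have "lform (lorentz_inv B *v v) (lorentz_inv B *v w) = lform v w" for v w
      using B(1)[of "lorentz_inv B *v v" "lorentz_inv B *v w"] by (simp add: *)
    moreover have "det (lorentz_inv B) = 1"
      using arg_cong[OF inv(1), of det] B(2) by (simp add: det_mul)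
    ultimately show "lorentz_inv B \<in> SO_lor" by (simp add: SO_lor_def)
  qed
  moreover have "lorentz_inv (mat 1 :: 'a lmat) = mat 1"
    by (auto simp: lorentz_inv_def mat_def vec_eq_iff)
  ultimately show ?thesis using C(3,4) unfolding SO0_def connected_component_def
    by (auto intro!: exI[of _ "lorentz_inv ` C"]) (metis imageI)
qed

locale lorentz_group =
  fixes \<Gamma> :: "'d::finite lmat set"
  assumes lorp: "\<Gamma> \<subseteq> lorp"
    and one_in: "mat 1 \<in> \<Gamma>"
    and mult_in: "\<And>g h. g \<in> \<Gamma> \<Longrightarrow> h \<in> \<Gamma> \<Longrightarrow> g ** h \<in> \<Gamma>"
    and inv_in: "\<And>g. g \<in> \<Gamma> \<Longrightarrow> lorentz_inv g \<in> \<Gamma>"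

lemma subgroup_SO0_lorentz_group:
  assumes "subgroup \<Gamma> SO0"
  shows "lorentz_group \<Gamma>"
proof
  have sub: "\<Gamma> \<subseteq> carrier SO0" using assms by (rule subgroup.subset)
  then show "\<Gamma> \<subseteq> lorp" using SO0_subset_lorp by blast
  show "mat 1 \<in> \<Gamma>" using subgroup.one_closed[OF assms] by simp
  show "g ** h \<in> \<Gamma>" if "g \<in> \<Gamma>" "h \<in> \<Gamma>" for g h
    using subgroup.m_closed[OF assms that] by simp
  show "lorentz_inv g \<in> \<Gamma>" if g: "g \<in> \<Gamma>" for g
  proof -
    have gl: "g \<in> lorp" "g \<in> carrier SO0" using g sub SO0_subset_lorp by auto
    have A: "\<And>v w. lform (g *v v) (g *v w) = lform v w" using gl by (simp add: lorp_def)
    note inv = lorentz_inv_left[OF A] lorentz_inv_right[OF A]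
    have "inv\<^bsub>SO0\<^esub> g = lorentz_inv g"
      unfolding m_inv_def
    \<comment> \<open>The inverse of the monoid is a definite description, so exhibiting an inverse
      and proving its uniqueness identifies it.\<close>
    proof (rule the_equality)
      show "lorentz_inv g \<in> carrier SO0 \<and> g \<otimes>\<^bsub>SO0\<^esub> lorentz_inv g = \<one>\<^bsub>SO0\<^esub> \<and> lorentz_inv g \<otimes>\<^bsub>SO0\<^esub> g = \<one>\<^bsub>SO0\<^esub>"
        using inv SO0_inv[OF gl(2)] by simp
      fix y assume "y \<in> carrier SO0 \<and> g \<otimes>\<^bsub>SO0\<^esub> y = \<one>\<^bsub>SO0\<^esub> \<and> y \<otimes>\<^bsub>SO0\<^esub> g = \<one>\<^bsub>SO0\<^esub>"
      then show "y = lorentz_inv g" using inv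
        by (metis SO0_simps matrix_mul_assoc matrix_mul_lid matrix_mul_rid)
    qed
    then show ?thesis using subgroup.m_inv_closed[OF assms g] by simp
  qed
qed

section \<open>The boundary as the projectivized light cone\<close>

text \<open>The null vector normalized by the view from the base point. In contrast to
  \<open>null_of\<close>, which is adapted to the affine chart, it treats \<open>Infty\<close> like
  every other point, and its stretching by an isometry is the exponential of a Busemann
  function.\<close>

definition nhat :: "(real ^ 'd) bdry \<Rightarrow> 'd::finite mink" where
  "nhat \<xi> = mk (sphere_pt \<xi>) 1"

lemma spc_nhat [simp]: "spc (nhat \<xi>) = sphere_pt \<xi>" and tm_nhat [simp]: "tm (nhat \<xi>) = 1"
  by (simp_all add: nhat_def)

lemma sphere_pt_inner_self [simp]: "sphere_pt \<xi> \<bullet> sphere_pt \<xi> = 1"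
  by (simp add: dot_square_norm)

lemma nhat_null [simp]: "lform (nhat \<xi>) (nhat \<xi>) = 0"
  by (simp add: lform_spc)

lemma null_of_nhat: "null_of \<xi> = tm (null_of \<xi>) *\<^sub>R nhat \<xi>" and tm_null_of_pos: "tm (null_of \<xi>) > 0"
proof -
  have [simp]: "(norm x)\<^sup>2 + 1 > 0" "(norm x)\<^sup>2 + 1 \<noteq> 0" for x :: "real ^ 'd"
    by (simp_all add: add_nonneg_pos add_nonneg_eq_0_iff)
  show "tm (null_of \<xi>) > 0" by (cases \<xi>) (simp_all add: mvec_def)
  have spcs: "spc (null_of (Fin x)) = (x, ((norm x)\<^sup>2 - 1) / 2)" "spc (null_of Infty) = (0, 1)"
      "tm (null_of (Fin x)) = ((norm x)\<^sup>2 + 1) / 2" "tm (null_of Infty) = 1" for x :: "real ^ 'd"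
    by (simp_all add: mvec_def spc_def space_part_def vec_eq_iff)
  show "null_of \<xi> = tm (null_of \<xi>) *\<^sub>R nhat \<xi>"
  proof (rule mink_eqI)
    show "spc (null_of \<xi>) = spc (tm (null_of \<xi>) *\<^sub>R nhat \<xi>)"
    proof (cases \<xi>)
      case (Fin x)
      define k where "k = (norm x)\<^sup>2 + 1"
      have "k > 0" by (simp add: k_def)
      have "sphere_pt \<xi> = ((2 / k) *\<^sub>R x, (k - 2) / k)" by (simp add: Fin k_def)
      moreover have "spc (null_of \<xi>) = (x, (k - 2) / 2)" "tm (null_of \<xi>) = k / 2"
        by (simp_all add: Fin spcs k_def del: null_of.simps)
      ultimately show ?thesis using \<open>k > 0\<close>
        by (simp only: spc_scale spc_nhat) (simp add: field_simps)
    qed (simp del: null_of.simps add: spcs)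
  qed simp
qed

lemma lform_nhat: "lform (nhat \<xi>) (nhat \<eta>) = sphere_pt \<xi> \<bullet> sphere_pt \<eta> - 1"
  by (simp add: lform_spc)

lemma lform_nhat_neg: "\<xi> \<noteq> \<eta> \<Longrightarrow> lform (nhat \<xi>) (nhat \<eta>) < 0"
proof -
  assume "\<xi> \<noteq> \<eta>"
  then have "norm (sphere_pt \<xi> - sphere_pt \<eta>) > 0" using inj_sphere_pt by force
  then have "(norm (sphere_pt \<xi> - sphere_pt \<eta>))\<^sup>2 > 0" by simp
  then show ?thesis
    by (simp add: lform_nhat power2_norm_eq_inner inner_diff inner_commute)
qed

lemma bdry_of_scale [simp]: "c \<noteq> 0 \<Longrightarrow> bdry_of (c *\<^sub>R v) = bdry_of v"
proof -
  assume "c \<noteq> 0"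
  have 1: "c * tm v - c * v $ Inr False = c * (tm v - v $ Inr False)" by (simp add: algebra_simps)
  have 2: "space_part (c *\<^sub>R v) = c *\<^sub>R space_part v" by (simp add: space_part_def vec_eq_iff)
  show ?thesis using \<open>c \<noteq> 0\<close> by (simp add: bdry_of_def Let_def 1 2)
qed

lemma bdry_of_null_of [simp]: "bdry_of (null_of \<xi>) = \<xi>"
proof (cases \<xi>)
  case (Fin x)
  have "space_part (null_of \<xi>) = x" by (simp add: Fin space_part_def mvec_def)
  then show ?thesis by (simp add: Fin bdry_of_def mvec_def field_simps)
qed (simp add: bdry_of_def mvec_def)

lemma bdry_of_nhat [simp]: "bdry_of (nhat \<xi>) = \<xi>"
  using bdry_of_null_of[of \<xi>] null_of_nhat[of \<xi>] tm_null_of_pos[of \<xi>]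
  by (metis bdry_of_scale less_irrefl)

text \<open>The future light cone is the union of the rays through the vectors
  \<open>nhat \<xi>\<close>, with time as scale. The denominator \<open>h\<close> of the chart
  vanishes exactly on the ray of \<open>Infty\<close>.\<close>

lemma null_future_nhat:
  assumes "lform v v = 0" "tm v > 0"
  shows "v = tm v *\<^sub>R nhat (bdry_of v)"
proof -
  define F T s where "F = v $ Inr False" and "T = tm v" and "s = space_part v"
  define h where "h = T - F"
  have eq: "(norm s)\<^sup>2 + F\<^sup>2 = T\<^sup>2"
    using assms(1) unfolding lform_spc power2_norm_eq_inner
    by (simp add: spc_def F_def T_def s_def power2_eq_square)
  have T: "T > 0" using assms by (simp add: T_def)
  have spc_v: "spc v = (s, F)" by (simp add: spc_def s_def F_def)
  show ?thesis
  proof (rule mink_eqI)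
    show "spc v = spc (tm v *\<^sub>R nhat (bdry_of v))"
    proof (cases "h = 0")
      case True
      then have "s = 0" using eq by (simp add: h_def)
      then show ?thesis using True
        by (simp add: bdry_of_def Let_def h_def spc_v flip: F_def T_def)
    next
      case False
      have "F\<^sup>2 \<le> T\<^sup>2" unfolding eq[symmetric] by simp
      then have "F \<le> T" using T abs_le_square_iff[of F T] by simp
      then have h: "h > 0" using False by (simp add: h_def)
      have n: "(norm ((1 / h) *\<^sub>R s))\<^sup>2 = (T + F) / h"
      proof -
        have "(norm s)\<^sup>2 = (T + F) * h" using eq by (simp add: h_def power2_eq_square algebra_simps)
        then show ?thesis using h by (simp add: power_divide power2_eq_square)
      qed
      have a: "(T + F) / h + 1 = 2 * T / h" "(T + F) / h - 1 = 2 * F / h"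
        using h by (simp_all add: field_simps h_def)
      have b: "bdry_of v = Fin ((1 / h) *\<^sub>R s)"
        using False by (simp add: bdry_of_def Let_def h_def F_def T_def s_def)
      have "spc v = (s, F)" by (simp add: spc_def s_def F_def)
      also have "\<dots> = T *\<^sub>R sphere_pt (Fin ((1 / h) *\<^sub>R s))"
        using T h unfolding sphere_pt.simps n a by simp
      finally show ?thesis by (simp add: b T_def)
    qed
  qed simp
qed

text \<open>The factor \<open>tm (A *v nhat \<xi>)\<close> is the cocycle by which an isometry
  shifts the Hopf time coordinate; isometries permute null rays, so nothing but a factor can
  appear.\<close>

lemma lorp_nhat:
  assumes "A \<in> lorp"
  shows "tm (A *v nhat \<xi>) > 0" "A *v nhat \<xi> = tm (A *v nhat \<xi>) *\<^sub>R nhat (bact A \<xi>)"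
proof -
  show pos: "tm (A *v nhat \<xi>) > 0" using assms by (intro lorp_future) auto
  have "bdry_of (A *v nhat \<xi>) = bact A \<xi>"
    unfolding bact_def using tm_null_of_pos[of \<xi>]
    by (subst null_of_nhat) (simp add: matrix_vector_mult_scaleR)
  moreover have "lform (A *v nhat \<xi>) (A *v nhat \<xi>) = 0" using assms by (simp add: lorp_lform)
  ultimately show "A *v nhat \<xi> = tm (A *v nhat \<xi>) *\<^sub>R nhat (bact A \<xi>)"
    using null_future_nhat[OF _ pos] by simp
qed

lemma bdry_of_lorp: "A \<in> lorp \<Longrightarrow> bdry_of (A *v nhat \<xi>) = bact A \<xi>"
  using lorp_nhat[of A \<xi>] by (metis bdry_of_nhat bdry_of_scale less_irrefl)

lemma bact_mult: "A \<in> lorp \<Longrightarrow> B \<in> lorp \<Longrightarrow> bact (A ** B) \<xi> = bact A (bact B \<xi>)"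
proof -
  assume AB: "A \<in> lorp" "B \<in> lorp"
  have "bact (A ** B) \<xi> = bdry_of (A *v (B *v nhat \<xi>))"
    using AB by (simp add: bdry_of_lorp[symmetric] lorp_mult matrix_vector_mul_assoc)
  also have "\<dots> = bdry_of (A *v nhat (bact B \<xi>))"
    using lorp_nhat[OF AB(2), of \<xi>] by (metis bdry_of_scale less_irrefl matrix_vector_mult_scaleR)
  finally show ?thesis using AB by (simp add: bdry_of_lorp)
qed

lemma bact_1 [simp]: "bact (mat 1) \<xi> = \<xi>"
  by (simp add: bact_def)

lemma bact_inv:
  assumes "A \<in> lorp"
  shows "bact A (bact (lorentz_inv A) \<xi>) = \<xi>" "bact (lorentz_inv A) (bact A \<xi>) = \<xi>"
proof -
  have A: "\<And>v w. lform (A *v v) (A *v w) = lform v w" using assms by (simp add: lorp_def)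
  show "bact A (bact (lorentz_inv A) \<xi>) = \<xi>" "bact (lorentz_inv A) (bact A \<xi>) = \<xi>"
    using lorentz_inv_left[OF A] lorentz_inv_right[OF A] assms lorp_inv(1)[OF assms]
    by (metis bact_mult bact_1)+
qed

section \<open>Measurability on the boundary\<close>

text \<open>A chord is no longer than its arc, by the inequality 1 - t^2/2 \<le> cos t.\<close>

lemma sphere_pt_lipschitz: "norm (sphere_pt \<xi> - sphere_pt \<eta>) \<le> dist \<xi> \<eta>"
proof -
  have le: "\<bar>sphere_pt \<xi> \<bullet> sphere_pt \<eta>\<bar> \<le> 1"
    using Cauchy_Schwarz_ineq2[of "sphere_pt \<xi>" "sphere_pt \<eta>"] by simp
  have "cos (dist \<xi> \<eta>) = sphere_pt \<xi> \<bullet> sphere_pt \<eta>"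
    using le by (simp add: dist_bdry_def cos_arccos_abs)
  moreover have "1 - (dist \<xi> \<eta>)\<^sup>2 / 2 \<le> cos (dist \<xi> \<eta>)"
  proof -
    define t where "t = dist \<xi> \<eta> / 2"
    have "\<bar>sin t\<bar> \<le> \<bar>t\<bar>" by (rule abs_sin_x_le_abs_x)
    then have "(sin t)\<^sup>2 \<le> t\<^sup>2" by (simp add: abs_le_square_iff)
    moreover have "cos (dist \<xi> \<eta>) = 1 - 2 * (sin t)\<^sup>2"
      using cos_double_sin[of t] by (simp add: t_def)
    ultimately show ?thesis by (simp add: t_def power_divide)
  qed
  ultimately have "(norm (sphere_pt \<xi> - sphere_pt \<eta>))\<^sup>2 \<le> (dist \<xi> \<eta>)\<^sup>2"
    by (simp add: power2_norm_eq_inner inner_diff inner_commute)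
  then show ?thesis by (rule power2_le_imp_le) simp
qed

lemma continuous_sphere_pt [continuous_intros]: "continuous_on S sphere_pt"
  unfolding continuous_on_iff
proof (intro ballI allI impI)
  fix \<xi> :: "'a bdry" and e :: real assume "e > 0"
  then show "\<exists>d>0. \<forall>\<eta>\<in>S. dist \<eta> \<xi> < d \<longrightarrow> dist (sphere_pt \<eta>) (sphere_pt \<xi>) < e"
    using sphere_pt_lipschitz by (intro exI[of _ e]) (auto simp: dist_norm intro: le_less_trans)
qed

text \<open>The spherical metric induces the topology of the embedding into Euclidean space, so
  Borel measurability of a boundary-valued map can be checked after
  \<open>sphere_pt\<close>.\<close>

lemma open_bdry_vimage:
  fixes U :: "'a::real_inner bdry set"
  assumes "open U"
  shows "\<exists>W. open W \<and> U = sphere_pt -` W"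
proof -
  have "\<exists>W. open W \<and> sphere_pt \<xi> \<in> W \<and> sphere_pt -` W \<subseteq> U" if \<xi>: "\<xi> \<in> U" for \<xi>
  proof -
    obtain e where e: "e > 0" "\<And>\<eta>. dist \<eta> \<xi> < e \<Longrightarrow> \<eta> \<in> U"
      using bspec[OF assms[unfolded open_dist] \<xi>] by auto
    \<comment> \<open>The cap at \<pi> keeps the radius where cosine is decreasing, so that
      \<open>W\<close>, an open half-space, cuts out a ball of radius \<open>e'\<close> on the
      sphere.\<close>
    define e' where "e' = min e pi"
    have e': "0 < e'" "e' \<le> e" "e' \<le> pi" using e by (auto simp: e'_def)
    define W where "W = {u. cos e' < u \<bullet> sphere_pt \<xi>}"
    have "open W" unfolding W_def by (intro open_Collect_less continuous_intros)
    moreover have "cos e' < 1" using cos_monotone_0_pi[of 0 e'] e' by simp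
    then have "sphere_pt \<xi> \<in> W" by (simp add: W_def)
    moreover have "\<eta> \<in> U" if "sphere_pt \<eta> \<in> W" for \<eta>
    proof -
      have le: "\<bar>sphere_pt \<eta> \<bullet> sphere_pt \<xi>\<bar> \<le> 1"
        using Cauchy_Schwarz_ineq2[of "sphere_pt \<eta>" "sphere_pt \<xi>"] by simp
      have "dist \<eta> \<xi> < arccos (cos e')"
        unfolding dist_bdry_def using that le by (intro arccos_less_arccos) (auto simp: W_def)
      then show ?thesis using e' e by (auto simp: arccos_cos)
    qed
    ultimately show ?thesis by blast
  qed
  then obtain W where W: "\<And>\<xi>. \<xi> \<in> U \<Longrightarrow> open (W \<xi>) \<and> sphere_pt \<xi> \<in> W \<xi> \<and> sphere_pt -` W \<xi> \<subseteq> U"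
    by metis
  have "open (\<Union>\<xi>\<in>U. W \<xi>)" using W by (intro open_UN) blast
  have 1: "\<xi> \<in> sphere_pt -` (\<Union>\<xi>\<in>U. W \<xi>)" if "\<xi> \<in> U" for \<xi> using W[OF that] that by blast
  have 2: "\<xi> \<in> U" if "\<xi> \<in> sphere_pt -` (\<Union>\<xi>\<in>U. W \<xi>)" for \<xi> using W that by (auto simp: subset_eq)
  have "U = sphere_pt -` (\<Union>\<xi>\<in>U. W \<xi>)" using 1 2 by (intro subset_antisym subsetI)
  with \<open>open (\<Union>\<xi>\<in>U. W \<xi>)\<close> show ?thesis by (intro exI conjI)
qed

lemma measurable_bdryI:
  fixes f :: "'b \<Rightarrow> 'a::real_inner bdry"
  assumes "(\<lambda>x. sphere_pt (f x)) \<in> borel_measurable M"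
  shows "f \<in> borel_measurable M"
proof (rule borel_measurableI)
  fix U :: "'a bdry set" assume "open U"
  then obtain W where W: "open W" "U = sphere_pt -` W" using open_bdry_vimage by blast
  then have "f -` U \<inter> space M = (\<lambda>x. sphere_pt (f x)) -` W \<inter> space M" by auto
  then show "f -` U \<inter> space M \<in> sets M"
    using assms W(1) measurable_sets[of "\<lambda>x. sphere_pt (f x)" M borel W] by simp
qed

lemma measurable_sphere_pt [measurable]: "sphere_pt \<in> borel_measurable borel"
  by (intro borel_measurable_continuous_onI continuous_intros)

lemma borel_mk [measurable (raw)]:
  "f \<in> borel_measurable M \<Longrightarrow> g \<in> borel_measurable M \<Longrightarrow> (\<lambda>x. mk (f x) (g x) :: 'd::finite mink) \<in> borel_measurable M"
  by (rule borel_measurable_continuous_Pair[of f M g "\<lambda>x y. mk x y"]) 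
     (auto intro!: continuous_intros)

lemma borel_nhat [measurable]: "nhat \<in> borel_measurable borel"
  unfolding nhat_def by measurable

lemma borel_spc [measurable]: "spc \<in> borel_measurable borel"
  by (intro borel_measurable_continuous_onI continuous_intros)

lemma borel_mat [measurable]: "(\<lambda>v. A *v v :: 'd::finite mink) \<in> borel_measurable borel"
  by (intro borel_measurable_continuous_onI continuous_intros)

lemma borel_tm [measurable]: "(\<lambda>v :: 'd::finite mink. v $ i) \<in> borel_measurable borel"
  by (intro borel_measurable_continuous_onI continuous_intros)

lemma borel_lform [measurable (raw)]:
  "f \<in> borel_measurable M \<Longrightarrow> g \<in> borel_measurable M \<Longrightarrow> (\<lambda>x. lform (f x) (g x) :: real) \<in> borel_measurable M"
  by (rule borel_measurable_continuous_Pair[of f M g "\<lambda>x y. lform x y"]) 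
     (auto intro!: continuous_intros)

lemma borel_bact:
  assumes "A \<in> lorp"
  shows "bact A \<in> borel_measurable borel"
proof (rule measurable_bdryI)
  have "sphere_pt (bact A \<xi>) = (1 / tm (A *v nhat \<xi>)) *\<^sub>R spc (A *v nhat \<xi>)" for \<xi>
    using lorp_nhat[OF assms, of \<xi>]
    by (metis (no_types, lifting) divide_self_if less_irrefl scaleR_one scaleR_scaleR spc_nhat spc_scale times_divide_eq_left mult_1)
  then show "(\<lambda>\<xi>. sphere_pt (bact A \<xi>)) \<in> borel_measurable borel" by simp
qed

lemma fin_part_sphere_pt:
  "fin_part \<xi> = (1 / (1 - snd (sphere_pt \<xi>))) *\<^sub>R fst (sphere_pt \<xi>)"
proof (cases \<xi>)
  case (Fin x)
  define k where "k = (norm x)\<^sup>2 + 1"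
  have k: "k > 0" by (simp add: k_def add_nonneg_pos)
  have "snd (sphere_pt \<xi>) = 1 - 2 / k" using k by (simp add: Fin field_simps k_def)
  moreover have "fst (sphere_pt \<xi>) = (2 / k) *\<^sub>R x" by (simp add: Fin k_def)
  moreover have "fin_part \<xi> = x" by (simp add: Fin)
  ultimately show ?thesis using k by (simp only:) simp
qed simp

lemma borel_fin_part [measurable]: "(fin_part :: (real ^ 'd) bdry \<Rightarrow> _) \<in> borel_measurable borel"
  unfolding fin_part_sphere_pt
  by (intro borel_measurable_scaleR borel_measurable_divide borel_measurable_diff borel_measurable_const
      borel_measurable_continuous_onI continuous_intros)

lemma borel_Fin [measurable]: "(Fin :: real ^ 'd \<Rightarrow> _) \<in> borel_measurable borel"
proof (rule measurable_bdryI)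
  have "(norm x)\<^sup>2 + 1 \<noteq> 0" for x :: "real ^ 'd" by (simp add: add_nonneg_eq_0_iff)
  then have "continuous_on UNIV (\<lambda>x :: real ^ 'd. sphere_pt (Fin x))"
    unfolding sphere_pt.simps by (intro continuous_intros) auto
  then show "(\<lambda>x :: real ^ 'd. sphere_pt (Fin x)) \<in> borel_measurable borel"
    by (rule borel_measurable_continuous_onI)
qed

lemma Fin_image_eq: "Fin ` A = {\<xi>. \<xi> \<noteq> Infty \<and> fin_part \<xi> \<in> A}"
proof -
  have "\<xi> \<in> Fin ` A \<longleftrightarrow> \<xi> \<noteq> Infty \<and> fin_part \<xi> \<in> A" for \<xi>
    by (cases \<xi>) auto
  then show ?thesis by blast
qed

lemma sets_Fin_image:
  assumes "A \<in> sets borel"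
  shows "Fin ` (A :: (real ^ 'd) set) \<in> sets borel"
proof -
  have "Fin ` A = (fin_part -` A \<inter> space borel) - {Infty}" by (auto simp: Fin_image_eq)
  moreover have "fin_part -` A \<inter> space (borel :: (real ^ 'd) bdry measure) \<in> sets borel"
    using assms borel_fin_part by (rule measurable_sets[rotated])
  ultimately show ?thesis by (simp add: borel_closed sets.Diff)
qed

text \<open>A finite limit point \<open>x\<close> is one for which \<open>(x, 0)\<close> lies in the
  closure of the orbit, so the finite part is the image of a closed set; the point
  \<open>Infty\<close> is only a singleton to add or omit.\<close>

lemma sets_limit_set: "limit_set \<Gamma> \<in> sets borel"
proof -
  define S where "S = (\<lambda>g. act g origin) ` \<Gamma>"
  have seq: "(\<exists>g. range g \<subseteq> \<Gamma> \<and> (\<lambda>n::nat. act (g n) origin) \<longlonglongrightarrow> z) \<longleftrightarrow> z \<in> closure S" for z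
  proof
    assume "\<exists>g. range g \<subseteq> \<Gamma> \<and> (\<lambda>n::nat. act (g n) origin) \<longlonglongrightarrow> z"
    then obtain g where "range g \<subseteq> \<Gamma>" "(\<lambda>n::nat. act (g n) origin) \<longlonglongrightarrow> z" by blast
    then show "z \<in> closure S" unfolding closure_sequential S_def
      by (intro exI[of _ "\<lambda>n::nat. act (g n) origin"]) auto
  next
    assume "z \<in> closure S"
    then obtain u where u: "\<And>n. u n \<in> S" "u \<longlonglongrightarrow> z" unfolding closure_sequential by blast
    then obtain g where "\<And>n. g n \<in> \<Gamma> \<and> u n = act (g n) origin" unfolding S_def image_iff by metis
    moreover from this have "u = (\<lambda>n. act (g n) origin)" by auto
    ultimately show "\<exists>g. range g \<subseteq> \<Gamma> \<and> (\<lambda>n::nat. act (g n) origin) \<longlonglongrightarrow> z"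
      using u(2) by (intro exI[of _ g]) auto
  qed
  have "limit_set \<Gamma> - {Infty} = Fin ` {x. (x, 0) \<in> closure S}"
  proof -
    have "\<xi> \<in> limit_set \<Gamma> - {Infty} \<longleftrightarrow> \<xi> \<in> Fin ` {x. (x, 0) \<in> closure S}" for \<xi>
      by (cases \<xi>) (auto simp: limit_set_def tends_bdry_def seq[symmetric])
    then show ?thesis by blast
  qed
  moreover have "closed ((\<lambda>x. (x, 0)) -` closure S)"
    by (intro closed_vimage continuous_intros closed_closure)
  then have "closed {x. (x, 0) \<in> closure S}" by (simp add: vimage_def)
  then have "Fin ` {x. (x, 0) \<in> closure S} \<in> sets borel"
    by (intro sets_Fin_image borel_closed)
  ultimately have *: "limit_set \<Gamma> - {Infty} \<in> sets borel" by simp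
  have "limit_set \<Gamma> = (limit_set \<Gamma> - {Infty}) \<union> (limit_set \<Gamma> \<inter> {Infty})" by blast
  moreover have "limit_set \<Gamma> \<inter> {Infty} \<in> sets borel"
    by (cases "Infty \<in> limit_set \<Gamma>") (auto simp: borel_closed)
  ultimately show ?thesis using * by (metis sets.Un)
qed

section \<open>Busemann functions\<close>

lemma lform_null_hyp:
  assumes "y > 0"
  shows "lform (null_of (Fin x)) (hyp_of (u, y)) = - ((norm (u - x))\<^sup>2 + y\<^sup>2) / (2 * y)"
    "lform (null_of Infty) (hyp_of (u, y)) = - 1 / y"
proof -
  have "lform (null_of (Fin x)) (hyp_of (u, y)) = (x \<bullet> u) / y
     + (norm x ^ 2 - 1) / 2 * ((norm u ^ 2 + y\<^sup>2 - 1) / (2 * y)) - (norm x ^ 2 + 1) / 2 * ((norm u ^ 2 + y\<^sup>2 + 1) / (2 * y))"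
    by (simp add: lform_def hyp_of_def mvec_def inner_vec_def sum_divide_distrib)
  also have "\<dots> = - ((norm (u - x))\<^sup>2 + y\<^sup>2) / (2 * y)"
    unfolding power2_norm_eq_inner using assms
    by (simp add: inner_diff inner_commute field_simps)
  finally show "lform (null_of (Fin x)) (hyp_of (u, y)) = - ((norm (u - x))\<^sup>2 + y\<^sup>2) / (2 * y)" .
  show "lform (null_of Infty) (hyp_of (u, y)) = - 1 / y"
    using assms by (simp add: lform_def hyp_of_def mvec_def field_simps)
qed

lemma half_of_facts:
  assumes "lform p p = -1" "tm p > 0"
  shows "half_of p \<in> hspace" "hyp_of (half_of p) = p"
proof -
  define F T s where "F = p $ Inr False" and "T = tm p" and "s = space_part p"
  define h where "h = T - F"
  have eq: "(norm s)\<^sup>2 = T\<^sup>2 - F\<^sup>2 - 1"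
    using assms(1) unfolding lform_spc power2_norm_eq_inner
    by (simp add: spc_def F_def T_def s_def power2_eq_square)
  have "0 \<le> (norm s)\<^sup>2" by simp
  then have "F\<^sup>2 < T\<^sup>2" using eq by linarith
  then have "\<bar>F\<bar> < \<bar>T\<bar>" using abs_le_square_iff[of T F] by linarith
  then have h: "h > 0" using assms(2) by (simp add: h_def T_def)
  have hp: "half_of p = ((1 / h) *\<^sub>R s, 1 / h)"
    by (simp add: half_of_def Let_def h_def F_def T_def s_def)
  show "half_of p \<in> hspace" using h by (simp add: hp hspace_def)
  have n: "(norm ((1 / h) *\<^sub>R s))\<^sup>2 = (T\<^sup>2 - F\<^sup>2 - 1) / h\<^sup>2"
    using h by (simp add: power_divide eq)
  have TF: "T\<^sup>2 - F\<^sup>2 = h * (T + F)" by (simp add: h_def power2_eq_square algebra_simps)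
  have 1: "((T\<^sup>2 - F\<^sup>2 - 1) / h\<^sup>2 + (1 / h)\<^sup>2 - 1) / (2 * (1 / h)) = F"
       "((T\<^sup>2 - F\<^sup>2 - 1) / h\<^sup>2 + (1 / h)\<^sup>2 + 1) / (2 * (1 / h)) = T"
  proof -
    have "(T\<^sup>2 - F\<^sup>2 - 1) / h\<^sup>2 + (1 / h)\<^sup>2 = (T + F) / h"
      using h unfolding TF by (simp add: field_simps power2_eq_square)
    then show "((T\<^sup>2 - F\<^sup>2 - 1) / h\<^sup>2 + (1 / h)\<^sup>2 - 1) / (2 * (1 / h)) = F"
       "((T\<^sup>2 - F\<^sup>2 - 1) / h\<^sup>2 + (1 / h)\<^sup>2 + 1) / (2 * (1 / h)) = T"
      using h by (simp_all add: h_def field_simps)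
  qed
  have "hyp_of (half_of p) = mvec s F T"
    unfolding hyp_of_def hp Let_def fst_conv snd_conv n 1 using h by simp
  also have "\<dots> = p"
    by (rule mink_eqI) (simp_all add: mvec_def spc_def space_part_def F_def T_def s_def)
  finally show "hyp_of (half_of p) = p" .
qed

lemma hyp_of_origin [simp]: "hyp_of origin = org"
  by (rule mink_eqI) (simp_all add: hyp_of_def origin_def mvec_def spc_def space_part_def org_def mk_def vec_eq_iff zero_prod_def)

lemma origin_hspace [simp]: "origin \<in> hspace"
  by (simp add: origin_def hspace_def)

text \<open>Subtracting \<open>t\<close> from both distances makes each converge separately, to the
  logarithm of twice its leading coefficient, and this coefficient is proportional to a pairing with
  the null vector.\<close>

lemma busemann_lform:
  assumes "z \<in> hspace" "w \<in> hspace"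
  shows "busemann \<xi> z w = ln (lform (null_of \<xi>) (hyp_of z) / lform (null_of \<xi>) (hyp_of w))"
proof -
  obtain u a v b where z: "z = (u, a)" "a > 0" and w: "w = (v, b)" "b > 0"
    using assms by (cases z; cases w) (auto simp: hspace_def)
  \<comment> \<open>Since arcosh y is ln (2 y) up to a term tending to zero, only the coefficient of
    \<open>exp t\<close> survives in the limit.\<close>
  have lim0: "((\<lambda>t. arcosh (a * exp t + d * exp (- t)) - t) \<longlongrightarrow> ln (2 * a)) at_top"
    if "a > 0" "d > 0" for a d :: real
    using that unfolding arcosh_def by real_asymp
  show ?thesis
  proof (cases \<xi>)
    case (Fin x)
    have lim: "((\<lambda>t. arcosh (1 + (c + (b - exp (- t))\<^sup>2) / (2 * b * exp (- t))) - t)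
        \<longlongrightarrow> ln ((c + b\<^sup>2) / b)) at_top" if "c \<ge> 0" "b > 0" for b c :: real
    proof -
      have "1 + (c + (b - exp (- t))\<^sup>2) / (2 * b * exp (- t)) = (c + b\<^sup>2) / (2 * b) * exp t + 1 / (2 * b) * exp (- t)" for t
        using that by (simp add: field_simps power2_eq_square exp_minus)
      moreover have "2 * ((c + b\<^sup>2) / (2 * b)) = (c + b\<^sup>2) / b" using that by (simp add: field_simps)
      ultimately show ?thesis using lim0[of "(c + b\<^sup>2) / (2 * b)" "1 / (2 * b)"] that
        by (simp only:) (simp add: add_nonneg_pos)
    qed
    have hyp_dist: "hdist (u, y) (ray \<xi> t) = arcosh (1 + ((norm (u - x))\<^sup>2 + (y - exp (- t))\<^sup>2) / (2 * y * exp (- t)))" for u y t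
      by (simp add: hdist_def Fin norm_Pair)
    define A B where "A = ((norm (u - x))\<^sup>2 + a\<^sup>2) / a" and "B = ((norm (v - x))\<^sup>2 + b\<^sup>2) / b"
    have AB: "A > 0" "B > 0" using z w by (simp_all add: A_def B_def add_nonneg_pos)
    have "((\<lambda>t. (hdist z (ray \<xi> t) - t) - (hdist w (ray \<xi> t) - t)) \<longlongrightarrow> ln A - ln B) at_top"
      unfolding z w hyp_dist A_def B_def using z w by (intro tendsto_diff lim) auto
    then have "busemann \<xi> z w = ln A - ln B"
      unfolding busemann_def by (intro tendsto_Lim) auto
    also have "\<dots> = ln (A / B)" using AB by (simp add: ln_div)
    also have "A / B = lform (null_of \<xi>) (hyp_of z) / lform (null_of \<xi>) (hyp_of w)"
      unfolding z(1) w(1) Fin lform_null_hyp(1)[OF z(2)] lform_null_hyp(1)[OF w(2)]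
      unfolding minus_divide_left[symmetric] divide_divide_eq_left'[symmetric] A_def[symmetric] B_def[symmetric]
      by simp
    finally show ?thesis .
  next
    case Infty
    have lim: "((\<lambda>t. arcosh (1 + (c + (b - exp t)\<^sup>2) / (2 * b * exp t)) - t)
        \<longlongrightarrow> - ln b) at_top" if "c \<ge> 0" "b > 0" for b c :: real
    proof -
      have "1 + (c + (b - exp t)\<^sup>2) / (2 * b * exp t) = 1 / (2 * b) * exp t + (c + b\<^sup>2) / (2 * b) * exp (- t)" for t
        using that by (simp add: field_simps power2_eq_square exp_minus)
      moreover have "ln (2 * (1 / (2 * b))) = - ln b" using that by (simp add: ln_div)
      ultimately show ?thesis using lim0[of "1 / (2 * b)" "(c + b\<^sup>2) / (2 * b)"] that
        by (simp only:) (simp add: add_nonneg_pos)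
    qed
    have hyp_dist: "hdist (u, y) (ray \<xi> t) = arcosh (1 + ((norm u)\<^sup>2 + (y - exp t)\<^sup>2) / (2 * y * exp t))" for u y t
      by (simp add: hdist_def Infty norm_Pair)
    have "((\<lambda>t. (hdist z (ray \<xi> t) - t) - (hdist w (ray \<xi> t) - t)) \<longlongrightarrow> - ln a - (- ln b)) at_top"
      unfolding z w hyp_dist using z w by (intro tendsto_diff lim) auto
    then have "busemann \<xi> z w = - ln a + ln b"
      unfolding busemann_def by (intro tendsto_Lim) auto
    also have "\<dots> = ln (b / a)" using z w by (simp add: ln_div)
    also have "b / a = lform (null_of \<xi>) (hyp_of z) / lform (null_of \<xi>) (hyp_of w)"
      unfolding z(1) w(1) Infty lform_null_hyp(2)[OF z(2)] lform_null_hyp(2)[OF w(2)]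
      using z w by simp
    finally show ?thesis .
  qed
qed

lemma busemann_nhat:
  assumes "z \<in> hspace" "w \<in> hspace"
  shows "busemann \<xi> z w = ln (lform (nhat \<xi>) (hyp_of z) / lform (nhat \<xi>) (hyp_of w))"
  using tm_null_of_pos[of \<xi>] unfolding busemann_lform[OF assms]
  by (subst (1 2) null_of_nhat) simp

section \<open>Unit vectors and the Hopf parametrization\<close>

lemma UT_iff: "v \<in> UT \<longleftrightarrow> lform (fst v) (fst v) = -1 \<and> tm (fst v) > 0 \<and> lform (fst v) (snd v) = 0
    \<and> lform (snd v) (snd v) = 1"
  by (cases v) (auto simp: UT_def)

lemma UT_null:
  assumes "v \<in> UT"
  shows "lform (fst v + snd v) (fst v + snd v) = 0" "lform (fst v - snd v) (fst v - snd v) = 0"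
    "lform (fst v + snd v) (fst v - snd v) = -2"
    "tm (fst v + snd v) > 0" "tm (fst v - snd v) > 0"
proof -
  have v: "lform (fst v) (fst v) = -1" "tm (fst v) > 0" "lform (fst v) (snd v) = 0"
    "lform (snd v) (fst v) = 0" "lform (snd v) (snd v) = 1"
    using assms by (auto simp: UT_iff lform_sym)
  show 1: "lform (fst v + snd v) (fst v + snd v) = 0" "lform (fst v - snd v) (fst v - snd v) = 0"
    "lform (fst v + snd v) (fst v - snd v) = -2"
    using v by simp_all
  show "tm (fst v + snd v) > 0"
    by (rule future_of_lform_less[of "fst v"]) (use v 1 in simp_all)
  show "tm (fst v - snd v) > 0"
    by (rule future_of_lform_less[of "fst v"]) (use v 1 in simp_all)
qed

lemma half_plus_minus:
  fixes a b :: "'a::real_vector"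
  shows "(1/2) *\<^sub>R (a + b) + (1/2) *\<^sub>R (a - b) = a" "(1/2) *\<^sub>R (a + b) - (1/2) *\<^sub>R (a - b) = b"
    "(1/2) *\<^sub>R ((a + b) + (a - b)) = a" "(1/2) *\<^sub>R ((a + b) - (a - b)) = b"
  by (simp_all add: algebra_simps flip: scaleR_add_left)

text \<open>The positive factor on \<open>nhat \<eta>\<close> is forced by the pairing of p + w with
  p - w, which is -2 for every unit vector.\<close>

definition hinv :: "'d::finite hopf \<Rightarrow> 'd uvec" where
  "hinv = (\<lambda>(\<xi>, \<eta>, s). let a = exp s *\<^sub>R nhat \<xi>; b = (2 / (exp s * - lform (nhat \<xi>) (nhat \<eta>))) *\<^sub>R nhat \<eta>
     in ((1/2) *\<^sub>R (a + b), (1/2) *\<^sub>R (a - b)))"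

lemma hinv_plus: "fst (hinv (\<xi>, \<eta>, s)) + snd (hinv (\<xi>, \<eta>, s)) = exp s *\<^sub>R nhat \<xi>"
  and hinv_minus: "fst (hinv (\<xi>, \<eta>, s)) - snd (hinv (\<xi>, \<eta>, s))
    = (2 / (exp s * - lform (nhat \<xi>) (nhat \<eta>))) *\<^sub>R nhat \<eta>"
  unfolding hinv_def Let_def split_conv fst_conv snd_conv by (rule half_plus_minus)+

lemma hinv_UT:
  assumes "\<xi> \<noteq> \<eta>"
  shows "hinv (\<xi>, \<eta>, s) \<in> UT"
proof -
  define l where "l = - lform (nhat \<xi>) (nhat \<eta>)"
  have l: "l > 0" using lform_nhat_neg[OF assms] by (simp add: l_def)
  have l': "lform (nhat \<xi>) (nhat \<eta>) = - l" "lform (nhat \<eta>) (nhat \<xi>) = - l"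
    by (simp_all add: l_def lform_sym)
  have "hinv (\<xi>, \<eta>, s) = ((1/2) *\<^sub>R (exp s *\<^sub>R nhat \<xi> + (2 / (exp s * l)) *\<^sub>R nhat \<eta>),
      (1/2) *\<^sub>R (exp s *\<^sub>R nhat \<xi> - (2 / (exp s * l)) *\<^sub>R nhat \<eta>))"
    by (simp add: hinv_def Let_def l'(1))
  then show ?thesis using l
    by (simp add: UT_iff l' add_pos_pos)
qed

text \<open>A unit vector is half the sum and half the difference of its two null vectors. The
  factor \<open>c\<close> may be arbitrary because the pairing -2 determines it, so later
  computations need not track the backward scale.\<close>

lemma UT_hinv_eqI:
  assumes v: "v \<in> UT" and p: "fst v + snd v = exp s *\<^sub>R nhat \<xi>" and m: "fst v - snd v = c *\<^sub>R nhat \<eta>"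
  shows "v = hinv (\<xi>, \<eta>, s)" "\<xi> \<noteq> \<eta>"
proof -
  have l: "exp s * c * lform (nhat \<xi>) (nhat \<eta>) = - 2"
    using UT_null(3)[OF v] unfolding p m by (simp add: mult_ac)
  then show "\<xi> \<noteq> \<eta>" by auto
  have "lform (nhat \<xi>) (nhat \<eta>) \<noteq> 0" using l by auto
  then have c: "c = 2 / (exp s * - lform (nhat \<xi>) (nhat \<eta>))" using l by (simp add: field_simps)
  have "v = ((1/2) *\<^sub>R ((fst v + snd v) + (fst v - snd v)), (1/2) *\<^sub>R ((fst v + snd v) - (fst v - snd v)))"
    unfolding half_plus_minus by simp
  then show "v = hinv (\<xi>, \<eta>, s)"
    unfolding p m c by (simp add: hinv_def Let_def)
qed

lemma UT_plus_minus:
  assumes "v \<in> UT"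
  shows "fst v + snd v = tm (fst v + snd v) *\<^sub>R nhat (bdry_of (fst v + snd v))"
    "fst v - snd v = tm (fst v - snd v) *\<^sub>R nhat (bdry_of (fst v - snd v))"
  using UT_null[OF assms] by (intro null_future_nhat; simp)+

lemma hyp_of_base: "v \<in> UT \<Longrightarrow> hyp_of (base v) = fst v" and base_hspace: "v \<in> UT \<Longrightarrow> base v \<in> hspace"
  using half_of_facts[of "fst v"] by (auto simp: base_def UT_iff)

text \<open>Both null vectors pair to -1 with the base point, so the scale of each relative to
  \<open>nhat\<close> is the ratio inside the Busemann logarithm.\<close>

lemma busemann_base:
  assumes "v \<in> UT"
  shows "busemann (bdry_of (fst v + snd v)) origin (base v) = ln (tm (fst v + snd v))"
    "busemann (bdry_of (fst v - snd v)) origin (base v) = ln (tm (fst v - snd v))"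
proof -
  have v: "lform (fst v) (fst v) = -1" "lform (snd v) (fst v) = 0"
    using assms by (auto simp: UT_iff lform_sym)
  have *: "busemann \<xi> origin (base v) = ln c" if "u = c *\<^sub>R nhat \<xi>" "lform u (fst v) = -1" "c > 0" for u c \<xi>
  proof -
    have "c * lform (nhat \<xi>) (fst v) = -1" using that by simp
    then have "lform (nhat \<xi>) (fst v) = - 1 / c" using that(3) by (simp add: field_simps)
    then show ?thesis using assms that(3)
      by (simp add: busemann_nhat base_hspace hyp_of_base)
  qed
  show "busemann (bdry_of (fst v + snd v)) origin (base v) = ln (tm (fst v + snd v))"
    by (rule *[OF UT_plus_minus(1)[OF assms]]) (use v UT_null[OF assms] in simp_all)
  show "busemann (bdry_of (fst v - snd v)) origin (base v) = ln (tm (fst v - snd v))"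
    by (rule *[OF UT_plus_minus(2)[OF assms]]) (use v UT_null[OF assms] in simp_all)
qed

lemma hinv_hopf:
  assumes "v \<in> UT"
  shows "hinv (hopf v) = v" "hopf v \<in> hopf_space"
proof -
  have 1: "fst v + snd v = exp (ln (tm (fst v + snd v))) *\<^sub>R nhat (bdry_of (fst v + snd v))"
    using UT_plus_minus(1)[OF assms] UT_null(4)[OF assms] by simp
  note * = UT_hinv_eqI[OF assms 1 UT_plus_minus(2)[OF assms]]
  have h: "hopf v = (bdry_of (fst v + snd v), bdry_of (fst v - snd v), ln (tm (fst v + snd v)))"
    using busemann_base(1)[OF assms] by (simp add: hopf_def Let_def)
  show "hinv (hopf v) = v" "hopf v \<in> hopf_space"
    unfolding h using * by (auto simp: hopf_space_def)
qed

lemma hopf_hinv: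
  assumes "\<xi> \<noteq> \<eta>"
  shows "hopf (hinv (\<xi>, \<eta>, s)) = (\<xi>, \<eta>, s)"
proof -
  define v where "v = hinv (\<xi>, \<eta>, s)"
  have v: "v \<in> UT" using hinv_UT[OF assms] by (simp add: v_def)
  have p: "fst v + snd v = exp s *\<^sub>R nhat \<xi>" unfolding v_def by (rule hinv_plus)
  have m: "fst v - snd v = (2 / (exp s * - lform (nhat \<xi>) (nhat \<eta>))) *\<^sub>R nhat \<eta>"
    unfolding v_def by (rule hinv_minus)
  have "2 / (exp s * - lform (nhat \<xi>) (nhat \<eta>)) \<noteq> 0" using lform_nhat_neg[OF assms] by simp
  then have "bdry_of (fst v - snd v) = \<eta>" unfolding m by (subst bdry_of_scale) simp_all
  moreover have "bdry_of (fst v + snd v) = \<xi>" unfolding p by (subst bdry_of_scale) simp_all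
  moreover have "ln (tm (fst v + snd v)) = s" unfolding p by simp
  ultimately show ?thesis using busemann_base(1)[OF v] unfolding v_def[symmetric]
    by (simp add: hopf_def Let_def)
qed

text \<open>Replaces a choice of preimage by an explicit formula, on which measurability and
  equivariance can be computed.\<close>

lemma hopf_inv_eq: "\<xi> \<noteq> \<eta> \<Longrightarrow> hopf_inv (\<xi>, \<eta>, s) = hinv (\<xi>, \<eta>, s)"
  unfolding hopf_inv_def
  by (intro inv_into_f_eq inj_onI hopf_hinv hinv_UT) (metis hinv_hopf(1))

section \<open>Isometries and the geodesic flow in Hopf coordinates\<close>

definition gact :: "'d::finite lmat \<Rightarrow> 'd uvec \<Rightarrow> 'd uvec" where
  "gact g v = (g *v fst v, g *v snd v)"

lemma fst_gact [simp]: "fst (gact g v) = g *v fst v" and snd_gact [simp]: "snd (gact g v) = g *v snd v"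
  by (simp_all add: gact_def)

lemma gact_UT: "g \<in> lorp \<Longrightarrow> v \<in> UT \<Longrightarrow> gact g v \<in> UT"
  using lorp_future[of g "fst v"] by (simp add: UT_iff lorp_lform)

lemma gact_mult: "gact g (gact h v) = gact (g ** h) v"
  by (simp add: gact_def matrix_vector_mul_assoc)

lemma gact_1 [simp]: "gact (mat 1) v = v"
  by (simp add: gact_def)

lemma gact_inv: "g \<in> lorp \<Longrightarrow> gact g (gact (lorentz_inv g) v) = v"
  "g \<in> lorp \<Longrightarrow> gact (lorentz_inv g) (gact g v) = v"
  by (simp_all add: gact_def lorp_inv)

lemma orb_gact: "orb \<Gamma> v = (\<lambda>g. gact g v) ` \<Gamma>"
  by (simp add: orb_def gact_def)

text \<open>Linearity: the isometry acts on each null vector separately, and the stretching of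
  \<open>nhat \<xi>\<close> becomes the additive shift of the last coordinate.\<close>

lemma gact_hinv:
  assumes g: "g \<in> lorp" and "\<xi> \<noteq> \<eta>"
  shows "gact g (hinv (\<xi>, \<eta>, s)) = hinv (bact g \<xi>, bact g \<eta>, s + ln (tm (g *v nhat \<xi>)))"
proof (rule UT_hinv_eqI(1))
  let ?v = "hinv (\<xi>, \<eta>, s)"
  show "gact g ?v \<in> UT" using assms by (intro gact_UT hinv_UT)
  have "fst (gact g ?v) + snd (gact g ?v) = g *v (fst ?v + snd ?v)"
    by (simp add: matrix_vector_right_distrib)
  also have "\<dots> = exp s *\<^sub>R (g *v nhat \<xi>)" unfolding hinv_plus by (simp add: matrix_vector_mult_scaleR)
  also have "\<dots> = exp s *\<^sub>R tm (g *v nhat \<xi>) *\<^sub>R nhat (bact g \<xi>)"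
    by (subst (1) lorp_nhat(2)[OF g]) (rule refl)
  also have "\<dots> = exp (s + ln (tm (g *v nhat \<xi>))) *\<^sub>R nhat (bact g \<xi>)"
    using lorp_nhat(1)[OF g] by (simp add: exp_add)
  finally show "fst (gact g ?v) + snd (gact g ?v) = exp (s + ln (tm (g *v nhat \<xi>))) *\<^sub>R nhat (bact g \<xi>)" .
  have "fst (gact g ?v) - snd (gact g ?v) = g *v (fst ?v - snd ?v)"
    by (simp add: matrix_vector_mult_diff_distrib)
  also have "\<dots> = (2 / (exp s * - lform (nhat \<xi>) (nhat \<eta>))) *\<^sub>R (g *v nhat \<eta>)"
    unfolding hinv_minus by (simp only: matrix_vector_mult_scaleR)
  also have "\<dots> = (2 / (exp s * - lform (nhat \<xi>) (nhat \<eta>))) *\<^sub>R tm (g *v nhat \<eta>) *\<^sub>R nhat (bact g \<eta>)"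
    by (subst (1) lorp_nhat(2)[OF g]) (rule refl)
  finally show "fst (gact g ?v) - snd (gact g ?v)
     = ((2 / (exp s * - lform (nhat \<xi>) (nhat \<eta>))) * tm (g *v nhat \<eta>)) *\<^sub>R nhat (bact g \<eta>)" by simp
qed

text \<open>Null directions diagonalize the flow, with eigenvalues \<open>exp t\<close> and
  \<open>exp (- t)\<close>.\<close>

lemma geodesic_flow_simps:
  "fst (geodesic_flow t v) + snd (geodesic_flow t v) = exp t *\<^sub>R (fst v + snd v)"
  "fst (geodesic_flow t v) - snd (geodesic_flow t v) = exp (- t) *\<^sub>R (fst v - snd v)"
proof -
  have e: "exp t = cosh t + sinh t" "exp (- t) = cosh t - sinh t"
    by (simp_all add: cosh_plus_sinh cosh_minus_sinh)
  show "fst (geodesic_flow t v) + snd (geodesic_flow t v) = exp t *\<^sub>R (fst v + snd v)"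
    "fst (geodesic_flow t v) - snd (geodesic_flow t v) = exp (- t) *\<^sub>R (fst v - snd v)"
    unfolding e by (simp_all add: geodesic_flow_def split_beta algebra_simps)
qed

lemma geodesic_flow_UT: "v \<in> UT \<Longrightarrow> geodesic_flow t v \<in> UT"
proof -
  assume v: "v \<in> UT"
  then have l: "lform (fst v) (fst v) = -1" "lform (fst v) (snd v) = 0" "lform (snd v) (fst v) = 0" "lform (snd v) (snd v) = 1"
    by (auto simp: UT_iff lform_sym)
  have "(cosh t)\<^sup>2 - (sinh t)\<^sup>2 = 1" by (simp add: cosh_square_eq)
  then have cs: "cosh t * cosh t - sinh t * sinh t = 1" by (simp add: power2_eq_square)
  let ?w = "geodesic_flow t v"
  have "tm (fst ?w + snd ?w) > 0" "tm (fst ?w - snd ?w) > 0"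
    unfolding geodesic_flow_simps using UT_null[OF v] by simp_all
  then have "tm (fst ?w) > 0" by simp
  then show ?thesis using cs by (simp add: UT_iff geodesic_flow_def split_beta l algebra_simps)
qed

lemma geodesic_flow_hinv:
  assumes "\<xi> \<noteq> \<eta>"
  shows "geodesic_flow t (hinv (\<xi>, \<eta>, s)) = hinv (\<xi>, \<eta>, s + t)"
proof (rule UT_hinv_eqI(1))
  show "geodesic_flow t (hinv (\<xi>, \<eta>, s)) \<in> UT" using assms by (intro geodesic_flow_UT hinv_UT)
  show "fst (geodesic_flow t (hinv (\<xi>, \<eta>, s))) + snd (geodesic_flow t (hinv (\<xi>, \<eta>, s))) = exp (s + t) *\<^sub>R nhat \<xi>"
    unfolding geodesic_flow_simps hinv_plus by (simp add: exp_add mult.commute)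
  show "fst (geodesic_flow t (hinv (\<xi>, \<eta>, s))) - snd (geodesic_flow t (hinv (\<xi>, \<eta>, s)))
     = (exp (- t) * (2 / (exp s * - lform (nhat \<xi>) (nhat \<eta>)))) *\<^sub>R nhat \<eta>"
    unfolding geodesic_flow_simps hinv_minus by simp
qed

lemma geodesic_flow_gact: "geodesic_flow t (gact g v) = gact g (geodesic_flow t v)"
  by (simp add: geodesic_flow_def gact_def split_beta matrix_vector_right_distrib matrix_vector_mult_scaleR)

lemma geodesic_flow_add: "geodesic_flow s (geodesic_flow t v) = geodesic_flow (s + t) v"
  by (simp add: geodesic_flow_def split_beta cosh_add sinh_add algebra_simps)

lemma geodesic_flow_0 [simp]: "geodesic_flow 0 v = v"
  by (simp add: geodesic_flow_def split_beta)

lemma continuous_geodesic_flow [continuous_intros]: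
  "continuous_on S f \<Longrightarrow> continuous_on S g \<Longrightarrow> continuous_on S (\<lambda>x. geodesic_flow (f x) (g x))"
  unfolding geodesic_flow_def split_beta by (intro continuous_intros)

lemma continuous_gact [continuous_intros]:
  "continuous_on S f \<Longrightarrow> continuous_on S (\<lambda>x. gact g (f x))"
  unfolding gact_def matrix_vector_mult_def by (intro continuous_intros)

lemma sets_UT: "UT \<in> sets borel"
proof -
  have "UT = {v. lform (fst v) (fst v) = -1} \<inter> {v. tm (fst v) > 0} \<inter> {v. lform (fst v) (snd v) = 0}
      \<inter> {v. lform (snd v) (snd v) = 1}"
    by (auto simp: UT_iff)
  also have "\<dots> \<in> sets borel"
    by (intro sets.Int borel_closed borel_open closed_Collect_eq open_Collect_less continuous_intros)
  finally show ?thesis .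
qed

lemma borel_hinv: "hinv \<in> measurable (borel \<Otimes>\<^sub>M (borel \<Otimes>\<^sub>M borel)) borel"
proof -
  have "(\<lambda>x. ((1/2) *\<^sub>R (exp (snd (snd x)) *\<^sub>R nhat (fst x) + (2 / (exp (snd (snd x)) * - lform (nhat (fst x)) (nhat (fst (snd x))))) *\<^sub>R nhat (fst (snd x))),
     (1/2) *\<^sub>R (exp (snd (snd x)) *\<^sub>R nhat (fst x) - (2 / (exp (snd (snd x)) * - lform (nhat (fst x)) (nhat (fst (snd x))))) *\<^sub>R nhat (fst (snd x)))))
    \<in> measurable (borel \<Otimes>\<^sub>M (borel \<Otimes>\<^sub>M borel)) borel"
    by measurable
  then show ?thesis by (simp add: hinv_def Let_def split_beta')
qed

section \<open>An invariant distance on unit vectors\<close>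

definition hyps :: "'d::finite mink set" where
  "hyps = {p. lform p p = -1 \<and> tm p > 0}"

definition hyp_dist :: "'d::finite mink \<Rightarrow> 'd mink \<Rightarrow> real" where
  "hyp_dist p q = arcosh (- lform p q)"

lemma hyps_lform_le:
  assumes "p \<in> hyps" "q \<in> hyps"
  shows "lform p q \<le> -1"
proof -
  define a b where "a = norm (spc p)" and "b = norm (spc q)"
  have p: "(tm p)\<^sup>2 = 1 + a\<^sup>2" "tm p > 0" and q: "(tm q)\<^sup>2 = 1 + b\<^sup>2" "tm q > 0"
    using assms by (auto simp: hyps_def lform_self a_def b_def)
  have "(1 + a * b)\<^sup>2 \<le> (1 + a\<^sup>2) * (1 + b\<^sup>2)"
    using zero_le_power2[of "a - b"] by (simp add: power2_eq_square algebra_simps)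
  also have "\<dots> = (tm p * tm q)\<^sup>2" by (simp add: p q power_mult_distrib)
  finally have "1 + a * b \<le> tm p * tm q" using p q by (intro power2_le_imp_le[of "1 + a * b"]) auto
  moreover have "spc p \<bullet> spc q \<le> a * b" unfolding a_def b_def by (rule norm_cauchy_schwarz)
  ultimately show ?thesis by (simp add: lform_spc)
qed

text \<open>The form is positive definite on the orthogonal complement of a time-like vector; this
  makes the tangent space of the hyperboloid Euclidean.\<close>

lemma spacelike_perp:
  assumes "q \<in> hyps" "lform q r = 0" "lform r r \<le> 0"
  shows "r = 0"
proof (rule ccontr)
  assume "r \<noteq> 0"
  have q: "lform q q < 0" "tm q > 0" using assms by (auto simp: hyps_def)
  consider "tm r > 0" | "tm r < 0" | "tm r = 0" by linarith
  then show False
  proof cases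
    case 1 then show ?thesis using future_lform_less[OF q assms(3)] assms(2) by simp
  next
    case 2
    have "lform q (- r) < 0" by (rule future_lform_less[OF q]) (use 2 assms in simp_all)
    then show ?thesis using assms(2) by simp
  next
    case 3
    then have "spc r = 0" using assms(3) by (simp add: causal_norm_le)
    then have "r = 0" using 3 by (intro mink_eqI) auto
    then show ?thesis using \<open>r \<noteq> 0\<close> by simp
  qed
qed

text \<open>The usual discriminant argument with \<open>R *\<^sub>R p - C *\<^sub>R r\<close>,
  available because the form is positive on the complement of \<open>q\<close>.\<close>

lemma perp_Cauchy_Schwarz:
  assumes q: "q \<in> hyps" and "lform q p = 0" "lform q r = 0"
  shows "(lform p r)\<^sup>2 \<le> lform p p * lform r r"
proof (cases "r = 0")
  case False
  define P R C where "P = lform p p" and "R = lform r r" and "C = lform p r"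
  have R: "R > 0" using spacelike_perp[OF q assms(3)] False unfolding R_def by force
  define u where "u = R *\<^sub>R p - C *\<^sub>R r"
  have "lform q u = 0" using assms by (simp add: u_def)
  then have "lform u u \<ge> 0" using spacelike_perp[OF q, of u] by (cases "lform u u \<le> 0") auto
  moreover have "lform u u = R * (P * R - C\<^sup>2)"
    by (simp add: u_def P_def R_def C_def lform_sym[of r p] power2_eq_square algebra_simps)
  ultimately have "P * R - C\<^sup>2 \<ge> 0" using R by (simp add: zero_le_mult_iff)
  then show ?thesis by (simp add: P_def R_def C_def)
qed simp

text \<open>Projecting \<open>p\<close> and \<open>r\<close> to the complement of \<open>q\<close>
  gives vectors of lengths sinh a and sinh b. Cauchy-Schwarz for them is the comparison of the
  hyperbolic law of cosines with its straight case cosh (a + b).\<close>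

lemma hyp_dist_triangle:
  assumes p: "p \<in> hyps" and q: "q \<in> hyps" and r: "r \<in> hyps"
  shows "hyp_dist p r \<le> hyp_dist p q + hyp_dist q r"
proof -
  define A B where "A = - lform p q" and "B = - lform q r"
  have AB: "A \<ge> 1" "B \<ge> 1" using hyps_lform_le[OF p q] hyps_lform_le[OF q r] by (auto simp: A_def B_def)
  define a b where "a = arcosh A" and "b = arcosh B"
  have ab: "cosh a = A" "cosh b = B" "a \<ge> 0" "b \<ge> 0"
    using AB by (auto simp: a_def b_def )
  have self: "lform p p = -1" "lform q q = -1" "lform r r = -1" using p q r by (auto simp: hyps_def)
  define P R where "P = p - A *\<^sub>R q" and "R = r - B *\<^sub>R q"
  have sym: "lform q p = - A" "lform r q = - B" "lform p q = - A" "lform q r = - B" "lform r p = lform p r"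
    by (simp_all add: A_def B_def lform_sym)
  have PR: "lform q P = 0" "lform q R = 0" "lform P P = A\<^sup>2 - 1" "lform R R = B\<^sup>2 - 1"
    "lform P R = lform p r + A * B"
    by (simp_all add: P_def R_def self sym power2_eq_square algebra_simps)
  have "A\<^sup>2 - 1 = (sinh a)\<^sup>2" "B\<^sup>2 - 1 = (sinh b)\<^sup>2" by (simp_all add: ab(1,2)[symmetric] cosh_square_eq)
  then have "(lform P R)\<^sup>2 \<le> (sinh a * sinh b)\<^sup>2"
    using perp_Cauchy_Schwarz[OF q PR(1,2)] PR by (simp add: power_mult_distrib)
  then have "\<bar>lform P R\<bar> \<le> \<bar>sinh a * sinh b\<bar>" by (simp add: abs_le_square_iff)
  then have "- lform p r \<le> cosh (a + b)"
    using ab by (simp add: PR cosh_add abs_le_iff)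
  then have "arcosh (- lform p r) \<le> arcosh (cosh (a + b))"
    using hyps_lform_le[OF p r] arcosh_less_iff_real[of "cosh (a + b)" "- lform p r"]
    by (auto simp: not_less[symmetric] cosh_real_ge_1)
  then show ?thesis using ab by (simp add: hyp_dist_def a_def b_def A_def B_def arcosh_cosh_real)
qed

lemma hyp_dist_nonneg: "p \<in> hyps \<Longrightarrow> q \<in> hyps \<Longrightarrow> hyp_dist p q \<ge> 0"
  using hyps_lform_le[of p q] by (simp add: hyp_dist_def)

lemma hyp_dist_sym: "hyp_dist p q = hyp_dist q p"
  by (simp add: hyp_dist_def lform_sym)

lemma hyp_dist_self: "p \<in> hyps \<Longrightarrow> hyp_dist p p = 0"
  by (simp add: hyp_dist_def hyps_def)

text \<open>Compares the invariant distance with the Euclidean norm around a fixed \<open>p\<close>: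
  the bound is explicit in \<open>L\<close> and vanishes at \<open>L = 1\<close>, so small
  hyperbolic balls are small in the ambient space.\<close>

lemma hyp_dist_norm_bound:
  assumes p: "p \<in> hyps" and q: "q \<in> hyps"
  defines "L \<equiv> - lform p q"
  shows "(norm (q - p))\<^sup>2 \<le> (L - 1) * (2 + (tm p * (1 + 2 * L))\<^sup>2)"
proof -
  have L: "L \<ge> 1" using hyps_lform_le[OF p q] by (simp add: L_def)
  have self: "lform p p = -1" "lform q q = -1" "tm p > 0" "tm q > 0" using p q by (auto simp: hyps_def)
  have sym: "lform p q = - L" "lform q p = - L" by (simp_all add: L_def lform_sym)
  define a b where "a = norm (spc p)" and "b = norm (spc q)"
  have a: "(tm p)\<^sup>2 = 1 + a\<^sup>2" and b: "(tm q)\<^sup>2 = 1 + b\<^sup>2"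
    using self by (auto simp: lform_self a_def b_def)
  have ab: "a < tm p" "b < tm q" "a \<ge> 0" "b \<ge> 0" 
    using timelike_norm_less[of p] timelike_norm_less[of q] self by (auto simp: a_def b_def)
  \<comment> \<open>Multiplying the bound on (tm p - a) tm q by tm p + a uses that the product (tm p
    - a)(tm p + a) is 1; this bounds the height of \<open>q\<close> by that of
    \<open>p\<close>.\<close>
  have tq: "tm q \<le> 2 * tm p * L"
  proof -
    have "tm p * tm q - a * b \<le> L"
      using norm_cauchy_schwarz[of "spc p" "spc q"] by (simp add: L_def lform_spc a_def b_def)
    moreover have "a * b \<le> a * tm q" using ab by (intro mult_left_mono) auto
    ultimately have "(tm p - a) * tm q \<le> L" by (simp add: algebra_simps)
    then have "(tm p + a) * ((tm p - a) * tm q) \<le> (tm p + a) * L"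
      using ab self by (intro mult_left_mono) auto
    moreover have "(tm p + a) * ((tm p - a) * tm q) = ((tm p)\<^sup>2 - a\<^sup>2) * tm q"
      by (simp add: power2_eq_square algebra_simps)
    moreover have "(tm p + a) * L \<le> (2 * tm p) * L" using ab L by (intro mult_right_mono) auto
    ultimately show ?thesis using a by simp
  qed
  \<comment> \<open>Vectors of equal form have orthogonal sum and difference. Orthogonality of
    \<open>s\<close> and \<open>u\<close> bounds the time part of \<open>u\<close>, which the form
    of \<open>u\<close> alone leaves free.\<close>
  define u s where "u = q - p" and "s = p + q"
  have us: "lform s u = 0" "lform u u = 2 * (L - 1)" "lform s s = - (2 + 2 * L)"
    by (simp_all add: u_def s_def self sym)
  have s0: "0 \<le> tm s" "tm s \<le> tm p * (1 + 2 * L)" using tq self by (auto simp: s_def algebra_simps)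
  have ns: "(norm (spc s))\<^sup>2 = (tm s)\<^sup>2 - (2 + 2 * L)" using us(3) by (simp add: lform_self)
  have nu: "(norm (spc u))\<^sup>2 = (tm u)\<^sup>2 + 2 * (L - 1)" using us(2) by (simp add: lform_self)
  have "(tm s * tm u)\<^sup>2 = (spc s \<bullet> spc u)\<^sup>2" using us(1) by (simp add: lform_spc)
  also have "\<dots> \<le> (norm (spc s) * norm (spc u))\<^sup>2"
    using Cauchy_Schwarz_ineq2[of "spc s" "spc u"] by (simp add: abs_le_square_iff[symmetric])
  also have "\<dots> = ((tm s)\<^sup>2 - (2 + 2 * L)) * ((tm u)\<^sup>2 + 2 * (L - 1))"
    by (simp add: power_mult_distrib ns nu)
  finally have "(2 + 2 * L) * ((tm u)\<^sup>2 + 2 * (L - 1)) \<le> (tm s)\<^sup>2 * (2 * (L - 1))"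
    by (simp add: power_mult_distrib algebra_simps)
  moreover have "4 * (tm u)\<^sup>2 \<le> (2 + 2 * L) * ((tm u)\<^sup>2 + 2 * (L - 1))"
    using L by (intro mult_mono) auto
  ultimately have "4 * (tm u)\<^sup>2 \<le> (tm s)\<^sup>2 * (2 * (L - 1))" by linarith
  moreover have "(tm s)\<^sup>2 * (2 * (L - 1)) \<le> (tm p * (1 + 2 * L))\<^sup>2 * (2 * (L - 1))"
    using s0 L by (intro mult_right_mono power_mono) auto
  ultimately have "2 * (tm u)\<^sup>2 \<le> (tm p * (1 + 2 * L))\<^sup>2 * (L - 1)"
    by (simp add: right_diff_distrib)
  then show ?thesis unfolding norm_mink u_def[symmetric] nu by (simp add: algebra_simps)
qed

lemma hyp_dist_norm_small:
  assumes p: "p \<in> hyps" and e: "e > 0"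
  shows "\<exists>d>0. \<forall>q\<in>hyps. hyp_dist p q < d \<longrightarrow> norm (q - p) < e"
proof -
  define F where "F h = (cosh h - 1) * (2 + (tm p * (1 + 2 * cosh h))\<^sup>2)" for h :: real
  have "continuous_on UNIV F" unfolding F_def by (intro continuous_intros)
  then have "isCont F 0" by (simp add: continuous_on_eq_continuous_at)
  then have "\<exists>d>0. \<forall>h. \<bar>h\<bar> < d \<longrightarrow> \<bar>F h - F 0\<bar> < e\<^sup>2"
    using e unfolding continuous_at_eps_delta dist_real_def diff_0_right
    by (metis zero_less_power)
  then obtain d where d: "d > 0" "\<And>h. \<bar>h\<bar> < d \<Longrightarrow> \<bar>F h\<bar> < e\<^sup>2" by (auto simp: F_def)
  show ?thesis
  proof (intro exI conjI ballI impI)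
    fix q assume q: "q \<in> hyps" and h: "hyp_dist p q < d"
    have "\<bar>F (hyp_dist p q)\<bar> < e\<^sup>2" using h hyp_dist_nonneg[OF p q] by (intro d) auto
    moreover have "cosh (hyp_dist p q) = - lform p q"
      using hyps_lform_le[OF p q] by (simp add: hyp_dist_def cosh_arcosh_real)
    then have "(norm (q - p))\<^sup>2 \<le> F (hyp_dist p q)"
      using hyp_dist_norm_bound[OF p q] by (simp add: F_def)
    ultimately have "(norm (q - p))\<^sup>2 < e\<^sup>2" by linarith
    then show "norm (q - p) < e" using e by - (rule power2_less_imp_less, auto)
  qed (rule d)
qed

text \<open>Two base points at unit time distance on the geodesic determine the unit vector.\<close>

definition udist :: "'d::finite uvec \<Rightarrow> 'd uvec \<Rightarrow> real" where
  "udist v w = hyp_dist (fst v) (fst w) + hyp_dist (fst (geodesic_flow 1 v)) (fst (geodesic_flow 1 w))"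

lemma UT_hyps: "v \<in> UT \<Longrightarrow> fst (geodesic_flow t v) \<in> hyps" "v \<in> UT \<Longrightarrow> fst v \<in> hyps"
  using geodesic_flow_UT[of v t] by (auto simp: UT_iff hyps_def)

lemma udist_nonneg: "v \<in> UT \<Longrightarrow> w \<in> UT \<Longrightarrow> udist v w \<ge> 0"
  by (simp add: udist_def hyp_dist_nonneg UT_hyps)

lemma udist_sym: "udist v w = udist w v"
  by (simp add: udist_def hyp_dist_sym)

lemma udist_self: "v \<in> UT \<Longrightarrow> udist v v = 0"
  by (simp add: udist_def hyp_dist_self UT_hyps)

lemma udist_triangle:
  assumes "u \<in> UT" "v \<in> UT" "w \<in> UT"
  shows "udist u w \<le> udist u v + udist v w"
  using assms hyp_dist_triangle[of "fst u" "fst v" "fst w"]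
    hyp_dist_triangle[of "fst (geodesic_flow 1 u)" "fst (geodesic_flow 1 v)" "fst (geodesic_flow 1 w)"]
  by (simp add: udist_def UT_hyps)

lemma udist_gact: "g \<in> lorp \<Longrightarrow> udist (gact g v) (gact g w) = udist v w"
  by (simp add: udist_def geodesic_flow_gact hyp_dist_def lorp_lform)

lemma continuous_udist:
  assumes "w \<in> UT"
  shows "continuous_on UT (\<lambda>v. udist v w)"
proof -
  have "1 \<le> - lform (fst v) (fst w)" "1 \<le> - lform (fst (geodesic_flow 1 v)) (fst (geodesic_flow 1 w))"
    if "v \<in> UT" for v
    using hyps_lform_le[of "fst v" "fst w"] assms that
      hyps_lform_le[of "fst (geodesic_flow 1 v)" "fst (geodesic_flow 1 w)"] by (auto simp: UT_hyps)
  moreover have "continuous_on UT (\<lambda>v. - lform (fst v) (fst w))"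
    "continuous_on UT (\<lambda>v. - lform (fst (geodesic_flow 1 v)) (fst (geodesic_flow 1 w)))"
    by (intro continuous_intros)+
  ultimately show ?thesis unfolding udist_def hyp_dist_def
    by (intro continuous_on_add continuous_on_compose2[OF continuous_on_arcosh[OF order.refl]]) auto
qed

text \<open>Euclidean neighbourhoods contain balls of the invariant distance. The direction of a
  vector is recovered from two base points, as sinh 1 times it is the later base point minus cosh 1
  times the earlier one.\<close>

lemma udist_open:
  assumes v: "v \<in> UT" and U: "open U" "v \<in> U"
  shows "\<exists>d>0. \<forall>w\<in>UT. udist v w < d \<longrightarrow> w \<in> U"
proof -
  obtain e where e: "e > 0" "\<And>w. dist w v < e \<Longrightarrow> w \<in> U" using U unfolding open_dist by blast
  \<comment> \<open>An error \<open>e1\<close> in both base points becomes an error below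
    \<open>K * e1\<close> in the direction.\<close>
  define K :: real where "K = (1 + cosh 1) / sinh 1"
  have sh: "sinh (1::real) > 0" by simp
  have K: "K > 0" using sh by (simp add: K_def add_pos_pos cosh_real_pos)
  define e1 where "e1 = e / (1 + K)"
  have e1: "e1 > 0" "e1 + K * e1 = e" proof -
    show "e1 > 0" using e K by (simp add: e1_def)
    have "e1 + K * e1 = e1 * (1 + K)" by (simp add: algebra_simps)
    also have "\<dots> = e" using K by (simp add: e1_def)
    finally show "e1 + K * e1 = e" .
  qed
  obtain d1 where d1: "d1 > 0" "\<And>q. q \<in> hyps \<Longrightarrow> hyp_dist (fst v) q < d1 \<Longrightarrow> norm (q - fst v) < e1"
    using hyp_dist_norm_small[OF UT_hyps(2)[OF v] e1(1)] by blast
  obtain d2 where d2: "d2 > 0" "\<And>q. q \<in> hyps \<Longrightarrow> hyp_dist (fst (geodesic_flow 1 v)) q < d2 \<Longrightarrow> norm (q - fst (geodesic_flow 1 v)) < e1"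
    using hyp_dist_norm_small[OF UT_hyps(1)[OF v] e1(1)] by blast
  show ?thesis
  proof (intro exI[of _ "min d1 d2"] conjI ballI impI)
    show "0 < min d1 d2" using d1 d2 by simp
    fix w assume w: "w \<in> UT" and h: "udist v w < min d1 d2"
    have n: "hyp_dist (fst v) (fst w) \<ge> 0" "hyp_dist (fst (geodesic_flow 1 v)) (fst (geodesic_flow 1 w)) \<ge> 0"
      using v w by (simp_all add: hyp_dist_nonneg UT_hyps)
    have a: "norm (fst w - fst v) < e1" using h n w by (intro d1 UT_hyps) (auto simp: udist_def)
    have b: "norm (fst (geodesic_flow 1 w) - fst (geodesic_flow 1 v)) < e1"
      using h n w by (intro d2 UT_hyps) (auto simp: udist_def)
    have "sinh 1 *\<^sub>R (snd w - snd v) = (fst (geodesic_flow 1 w) - fst (geodesic_flow 1 v)) - cosh 1 *\<^sub>R (fst w - fst v)"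
      by (simp add: geodesic_flow_def split_beta algebra_simps)
    then have "norm (sinh 1 *\<^sub>R (snd w - snd v)) \<le> norm (fst (geodesic_flow 1 w) - fst (geodesic_flow 1 v)) + norm (cosh 1 *\<^sub>R (fst w - fst v))"
      by (metis norm_triangle_ineq4)
    then have "sinh 1 * norm (snd w - snd v) \<le> norm (fst (geodesic_flow 1 w) - fst (geodesic_flow 1 v)) + cosh 1 * norm (fst w - fst v)"
      using sh by (simp add: cosh_real_nonneg)
    also have "\<dots> < e1 + cosh 1 * e1"
      using a b by (intro add_less_le_mono mult_left_mono) (auto simp: cosh_real_nonneg)
    finally have c: "norm (snd w - snd v) < K * e1"
      using sh by (simp add: K_def field_simps)
    have "dist w v \<le> norm (fst w - fst v) + norm (snd w - snd v)"
      using norm_Pair_le[of "fst w - fst v" "snd w - snd v"]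
      by (simp add: dist_norm minus_prod_def)
    also have "\<dots> < e" using a c e1 by linarith
    finally show "w \<in> U" by (rule e)
  qed
qed

text \<open>Equal forward null vectors, scale included, mean a common horosphere. The growing terms
  then cancel because the common vector is null, and what remains of the pairing is -1 plus a
  multiple of exp (-2 t).\<close>

lemma udist_flow_tendsto:
  assumes v: "v \<in> UT" and w: "w \<in> UT" and eq: "fst v + snd v = fst w + snd w"
  shows "((\<lambda>t. udist (geodesic_flow t v) (geodesic_flow t w)) \<longlongrightarrow> 0) at_top"
proof -
  define c where "c = lform (fst v - snd v) (fst w - snd w) / 4"
  have l: "- lform (fst (geodesic_flow t v)) (fst (geodesic_flow t w)) = 1 - exp (- (2 * t)) * c" for t
  proof -
    define P V W where "P = fst v + snd v" and "V = fst v - snd v" and "W = fst w - snd w"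
    have 0: "lform P P = 0" "lform P W = -2" "lform V P = -2"
      using UT_null[OF v] UT_null[OF w] eq unfolding P_def V_def W_def by (simp_all only: lform_sym)
    have fst_eq: "fst u = (1/2) *\<^sub>R ((fst u + snd u) + (fst u - snd u))" for u :: "'a uvec"
      unfolding half_plus_minus ..
    have 1: "fst (geodesic_flow t v) = (1/2) *\<^sub>R (exp t *\<^sub>R P + exp (- t) *\<^sub>R V)"
      unfolding P_def V_def geodesic_flow_simps[symmetric] by (rule fst_eq)
    have 2: "fst (geodesic_flow t w) = (1/2) *\<^sub>R (exp t *\<^sub>R P + exp (- t) *\<^sub>R W)"
      unfolding P_def W_def eq geodesic_flow_simps[symmetric] by (rule fst_eq)
    have "exp t * exp (- t) = 1" "exp (- t) * exp (- t) = exp (- (2 * t))"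
      using exp_add[of t "- t"] exp_add[of "- t" "- t"] by simp_all
    then show ?thesis unfolding 1 2 lform_lin 0 c_def V_def[symmetric] W_def[symmetric]
      by (simp add: algebra_simps)
  qed
  have lim: "((\<lambda>t. arcosh (1 - exp (- (2 * (t + a))) * c)) \<longlongrightarrow> 0) at_top" for a
  proof -
    have "((\<lambda>t. 1 - exp (- (2 * (t + a))) * c) \<longlongrightarrow> 1) at_top" by real_asymp
    moreover have "1 - exp (- (2 * t)) * c \<ge> 1" for t
      using hyps_lform_le[OF UT_hyps(1)[OF v, of t] UT_hyps(1)[OF w, of t]] unfolding l[symmetric] by simp
    then have "1 - exp (- (2 * (t + a))) * c \<ge> 1" for t by blast
    ultimately have "((\<lambda>t. arcosh (1 - exp (- (2 * (t + a))) * c)) \<longlongrightarrow> arcosh 1) at_top"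
      by (intro tendsto_arcosh_strong) (simp_all only: eventually_True order.refl)
    then show ?thesis by simp
  qed
  have "udist (geodesic_flow t v) (geodesic_flow t w)
      = arcosh (1 - exp (- (2 * (t + 0))) * c) + arcosh (1 - exp (- (2 * (t + 1))) * c)" for t
    unfolding udist_def hyp_dist_def geodesic_flow_add l by (simp add: add.commute)
  then show ?thesis using tendsto_add[OF lim[of 0] lim[of 1]] by simp
qed

section \<open>Discrete groups acting on unit vectors\<close>

text \<open>The displacement of the base point controls the whole matrix: a column has form at most
  1, so its norm is bounded through its time entry, and the time row is controlled by the
  inverse.\<close>

lemma lorp_entry_bound:
  fixes g :: "'d::finite lmat"
  assumes g: "g \<in> lorp"
  shows "\<bar>g $ i $ j\<bar> \<le> 1 + 2 * tm (g *v org)"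
proof -
  define t where "t = tm (g *v org)"
  have t: "t > 0" using g by (simp add: lorp_def t_def)
  have col: "(norm (h *v axis k 1))\<^sup>2 \<le> 1 + 2 * (tm (h *v axis k 1))\<^sup>2" if "h \<in> lorp" for h :: "'d lmat" and k
  proof -
    have "lform (h *v axis k 1) (h *v axis k 1) \<le> 1" using that by (simp add: lorp_lform lform_axis)
    then show ?thesis by (simp add: norm_mink lform_self)
  qed
  have org: "(org :: 'd mink) = axis (Inr True) 1"
  proof (rule mink_eqI)
    have "spc (axis (Inr True) 1 :: 'd mink) = 0"
      by (simp add: spc_def space_part_def axis_def vec_eq_iff zero_prod_def)
    then show "spc (org :: 'd mink) = spc (axis (Inr True) 1)" by simp
  qed (simp add: axis_def)
  have ent: "(h *v axis k 1) $ l = h $ l $ k" for h :: "'d lmat" and k l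
    by (simp add: matrix_vector_mult_basis column_def)
  \<comment> \<open>Up to signs the time row of \<open>g\<close> is the time column of the inverse,
    a time-like unit vector with the same time entry \<open>t\<close>.\<close>
  have row: "(g $ Inr True $ k)\<^sup>2 \<le> 2 * t\<^sup>2" for k
  proof -
    let ?h = "lorentz_inv g"
    have h: "?h \<in> lorp" by (rule lorp_inv(1)[OF g])
    have th: "tm (?h *v org) = t" 
      by (simp add: org ent lorentz_inv_def t_def)
    have "(g $ Inr True $ k)\<^sup>2 = ((?h *v org) $ k)\<^sup>2"
      by (simp add: org ent lorentz_inv_def)
    also have "\<dots> \<le> (norm (?h *v org))\<^sup>2"
      using component_le_norm_cart[of "?h *v org" k] by (simp add: abs_le_square_iff[symmetric])
    also have "lform (?h *v org) (?h *v org) = -1" using h by (simp add: lorp_lform)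
    then have "(norm (?h *v org))\<^sup>2 \<le> 2 * t\<^sup>2" using th by (simp add: norm_mink lform_self)
    finally show ?thesis .
  qed
  have "(g $ i $ j)\<^sup>2 = ((g *v axis j 1) $ i)\<^sup>2" by (simp add: ent)
  also have "\<dots> \<le> (norm (g *v axis j 1))\<^sup>2"
    using component_le_norm_cart[of "g *v axis j 1" i] by (simp add: abs_le_square_iff[symmetric])
  also have "\<dots> \<le> 1 + 2 * (g $ Inr True $ j)\<^sup>2" using col[OF g, of j] by (simp add: ent)
  also have "\<dots> \<le> 1 + 2 * (2 * t\<^sup>2)" using row[of j] by simp
  also have "\<dots> \<le> (1 + 2 * t)\<^sup>2" using t by (simp add: power2_eq_square algebra_simps)
  finally have "\<bar>g $ i $ j\<bar> \<le> \<bar>1 + 2 * t\<bar>" by (simp add: abs_le_square_iff)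
  then show ?thesis using t by (simp add: t_def)
qed

lemma lorp_norm_bound:
  fixes g :: "'d::finite lmat"
  assumes g: "g \<in> lorp"
  shows "norm g \<le> real CARD('d + bool) * (real CARD('d + bool) * (1 + 2 * tm (g *v org)))"
proof -
  have "norm (g $ i) \<le> real CARD('d + bool) * (1 + 2 * tm (g *v org))" for i
  proof -
    have "norm (g $ i) \<le> (\<Sum>j\<in>UNIV. \<bar>g $ i $ j\<bar>)" by (rule norm_le_l1_cart)
    also have "\<dots> \<le> of_nat (card (UNIV :: ('d + bool) set)) * (1 + 2 * tm (g *v org))"
      by (rule sum_bounded_above) (rule lorp_entry_bound[OF g])
    finally show ?thesis by simp
  qed
  moreover have "norm g \<le> (\<Sum>i\<in>UNIV. norm (g $ i))"
    unfolding norm_vec_def by (rule L2_set_le_sum) simp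
  moreover have "(\<Sum>i\<in>UNIV. norm (g $ i)) \<le> of_nat (card (UNIV :: ('d + bool) set)) * (real CARD('d + bool) * (1 + 2 * tm (g *v org)))"
    by (rule sum_bounded_above) (rule calculation(1))
  ultimately show ?thesis by linarith
qed

locale kleinian = lorentz_group +
  assumes discrete: "discrete \<Gamma>" and torsion_free: "torsion_free \<Gamma>"
begin

text \<open>Isolation of the identity becomes uniform separation on bounded sets, because (g, h)
  \<mapsto> g^{-1} h is uniformly continuous on compacta.\<close>

lemma finite_bounded: "finite {g \<in> \<Gamma>. norm g \<le> r}"
proof -
  obtain e where e: "e > 0" "\<And>g. g \<in> \<Gamma> \<Longrightarrow> dist (mat 1) g < e \<Longrightarrow> g = mat 1"
    using discrete one_in unfolding discrete_def isolated_in_dist_Ex_iff by (metis dist_commute)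
  define \<phi> :: "'a lmat \<times> 'a lmat \<Rightarrow> 'a lmat" where "\<phi> x = lorentz_inv (fst x) ** snd x" for x
  have "continuous_on (cball 0 r \<times> cball 0 r) \<phi>"
    unfolding \<phi>_def lorentz_inv_def matrix_matrix_mult_def by (intro continuous_intros)
  then have "uniformly_continuous_on (cball 0 r \<times> cball 0 r) \<phi>"
    by (intro compact_uniformly_continuous compact_Times compact_cball)
  then obtain d where d: "d > 0" "\<And>x y. x \<in> cball 0 r \<times> cball 0 r \<Longrightarrow> y \<in> cball 0 r \<times> cball 0 r
      \<Longrightarrow> dist y x < d \<Longrightarrow> dist (\<phi> y) (\<phi> x) < e"
    using e(1) unfolding uniformly_continuous_on_def by metis
  have "g = h" if g: "g \<in> \<Gamma>" "norm g \<le> r" and h: "h \<in> \<Gamma>" "norm h \<le> r" and "dist g h < d" for g h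
  proof -
    have gl: "g \<in> lorp" using g lorp by auto
    then have A: "\<And>v w. lform (g *v v) (g *v w) = lform v w" by (simp add: lorp_def)
    have "dist (\<phi> (g, g)) (\<phi> (g, h)) < e"
      using that by (intro d) (auto simp: dist_Pair_Pair)
    then have "dist (mat 1) (lorentz_inv g ** h) < e"
      using lorentz_inv_left[OF A] by (simp add: \<phi>_def)
    then have "lorentz_inv g ** h = mat 1" using g h by (intro e) (auto intro: mult_in inv_in)
    then have "g ** (lorentz_inv g ** h) = g ** mat 1" by simp
    then show ?thesis using lorentz_inv_right[OF A]
      by (simp add: matrix_mul_assoc)
  qed
  then have "uniform_discrete {g \<in> \<Gamma>. norm g \<le> r}"
    using d(1) unfolding uniform_discrete_def by blast
  moreover have "bounded {g \<in> \<Gamma>. norm g \<le> r}" by (auto simp: bounded_iff)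
  ultimately show ?thesis using uniform_discrete_finite_iff by blast
qed

lemma finite_displacement: "finite {g \<in> \<Gamma>. tm (g *v org) \<le> t}"
proof (rule finite_subset[OF _ finite_bounded])
  show "{g \<in> \<Gamma>. tm (g *v org) \<le> t} \<subseteq>
     {g \<in> \<Gamma>. norm g \<le> real CARD('a + bool) * (real CARD('a + bool) * (1 + 2 * t))}"
  proof clarify
    fix g assume g: "g \<in> \<Gamma>" "tm (g *v org) \<le> t"
    have "norm g \<le> real CARD('a + bool) * (real CARD('a + bool) * (1 + 2 * tm (g *v org)))"
      using g lorp by (intro lorp_norm_bound) auto
    also have "\<dots> \<le> real CARD('a + bool) * (real CARD('a + bool) * (1 + 2 * t))"
      using g by (intro mult_left_mono) auto
    finally show "norm g \<le> real CARD('a + bool) * (real CARD('a + bool) * (1 + 2 * t))" .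
  qed
qed

lemma countable: "countable \<Gamma>"
proof -
  have "countable (\<Union>n::nat. {g \<in> \<Gamma>. tm (g *v org) \<le> real n})"
    using finite_displacement by (intro countable_UN) (auto intro: countable_finite)
  moreover have "\<Gamma> \<subseteq> (\<Union>n::nat. {g \<in> \<Gamma>. tm (g *v org) \<le> real n})"
    using real_arch_simple by auto
  ultimately show ?thesis by (rule countable_subset[rotated])
qed

lemma org_hyps [simp]: "org \<in> hyps"
  by (simp add: hyps_def)

text \<open>A point of height at most \<open>t\<close> lies within \<open>arcosh t\<close> of
  \<open>org\<close>. Passing through such a \<open>p\<close> and its image bounds the displacement
  of \<open>org\<close> uniformly in \<open>p\<close>.\<close>

lemma displacement_le:
  assumes "g \<in> \<Gamma>" "p \<in> hyps" "tm p \<le> t" "tm (g *v p) \<le> t"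
  shows "tm (g *v org) \<le> cosh (2 * arcosh t)"
proof -
  have g: "g \<in> lorp" using assms lorp by auto
  have gh: "g *v q \<in> hyps" if "q \<in> hyps" for q
    using that lorp_future[OF g, of q] by (auto simp: hyps_def lorp_lform[OF g])
  have a: "hyp_dist org q \<le> arcosh t" if "q \<in> hyps" "tm q \<le> t" for q
    using hyps_lform_le[OF org_hyps that(1)] that(2) arcosh_less_iff_real[of t "tm q"]
    by (simp add: hyp_dist_def not_less[symmetric])
  have "hyp_dist org (g *v org) \<le> hyp_dist org (g *v p) + hyp_dist (g *v p) (g *v org)"
    by (intro hyp_dist_triangle gh assms org_hyps)
  also have "hyp_dist (g *v p) (g *v org) = hyp_dist org p" by (simp add: hyp_dist_def lorp_lform[OF g])
  also have "hyp_dist org (g *v p) + hyp_dist org p \<le> arcosh t + arcosh t"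
    using assms by (intro add_mono a gh) auto
  finally have "hyp_dist org (g *v org) \<le> 2 * arcosh t" by simp
  moreover have "hyp_dist org (g *v org) \<ge> 0" by (intro hyp_dist_nonneg gh org_hyps)
  ultimately have "cosh (hyp_dist org (g *v org)) \<le> cosh (2 * arcosh t)"
    by (subst cosh_real_nonneg_le_iff) auto
  moreover have "cosh (hyp_dist org (g *v org)) = tm (g *v org)"
    using hyps_lform_le[OF org_hyps gh[OF org_hyps]] by (simp add: hyp_dist_def)
  ultimately show ?thesis by simp
qed

text \<open>All powers of \<open>g\<close> fix the base point, so they displace \<open>org\<close>
  boundedly and form a finite set; two powers coincide and torsion-freeness applies.\<close>

lemma gact_free:
  assumes g: "g \<in> \<Gamma>" and v: "v \<in> UT" and fixed: "gact g v = v"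
  shows "g = mat 1"
proof -
  define pw where "pw n = g [^]\<^bsub>SO0\<^esub> (n::nat)" for n
  have pw_0: "pw 0 = mat 1" and pw_Suc: "pw (Suc n) = pw n ** g" for n
    by (simp_all add: pw_def nat_pow_def)
  have pw_in: "pw n \<in> \<Gamma>" for n by (induction n) (simp_all add: pw_0 pw_Suc one_in mult_in g)
  have pw_add: "pw (m + n) = pw m ** pw n" for m n
    by (induction n) (simp_all add: pw_0 pw_Suc matrix_mul_assoc)
  have pw_fix: "pw n *v fst v = fst v" for n
  proof (induction n)
    case (Suc n)
    have "g *v fst v = fst v" using arg_cong[OF fixed, of fst] by simp
    then show ?case using Suc by (simp add: pw_Suc matrix_vector_mul_assoc[symmetric])
  qed (simp add: pw_0)
  have "range pw \<subseteq> {g \<in> \<Gamma>. tm (g *v org) \<le> cosh (2 * arcosh (tm (fst v)))}"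
    using displacement_le[OF pw_in UT_hyps(2)[OF v]] pw_in by (auto simp: pw_fix)
  then have "finite (range pw)" using finite_displacement finite_subset by blast
  then have "\<not> inj pw" using finite_imageD infinite_UNIV_nat by blast
  then obtain i j where ij: "i < j" "pw i = pw j" unfolding inj_def by (metis linorder_neqE_nat)
  define k where "k = j - i"
  have k: "k > 0" "pw (i + k) = pw i" using ij by (auto simp: k_def)
  have "pw i \<in> lorp" using pw_in lorp by blast
  then have A: "\<And>v w. lform (pw i *v v) (pw i *v w) = lform v w" by (simp add: lorp_def)
  have "lorentz_inv (pw i) ** (pw i ** pw k) = lorentz_inv (pw i) ** pw i" using k(2) by (simp add: pw_add)
  then have "pw k = mat 1" using lorentz_inv_left[OF A] by (simp add: matrix_mul_assoc)
  then show ?thesis using torsion_free g k(1) unfolding torsion_free_def pw_def by blast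
qed

text \<open>Near \<open>v\<close> only finitely many group elements can return, and the action is
  free, so Hausdorff separation from each of these images suffices.\<close>

lemma wandering:
  assumes v: "v \<in> UT"
  shows "\<exists>U. open U \<and> v \<in> U \<and> (\<forall>g\<in>\<Gamma>. \<forall>u\<in>U \<inter> UT. gact g u \<in> U \<longrightarrow> g = mat 1)"
proof -
  \<comment> \<open>Any height above that of \<open>v\<close> would do; the condition
    \<open>tm (fst u) < t\<close> defines a neighbourhood on which \<open>displacement_le\<close>
    applies.\<close>
  define t where "t = tm (fst v) + 1"
  define F where "F = {g \<in> \<Gamma>. tm (g *v org) \<le> cosh (2 * arcosh t)} - {mat 1}"
  have F: "finite F" using finite_displacement by (simp add: F_def)
  have "\<exists>U. open U \<and> v \<in> U \<and> (\<forall>u\<in>U. gact g u \<notin> U)" if "g \<in> F" for g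
  proof -
    have "gact g v \<noteq> v" using gact_free[OF _ v] that by (auto simp: F_def)
    then obtain A B where AB: "open A" "open B" "gact g v \<in> A" "v \<in> B" "A \<inter> B = {}"
      using hausdorff by metis
    have "open (gact g -` A)" using AB(1) by (intro open_vimage continuous_intros)
    then show ?thesis using AB by (intro exI[of _ "B \<inter> gact g -` A"]) auto
  qed
  then obtain U where U: "\<And>g. g \<in> F \<Longrightarrow> open (U g)" "\<And>g. g \<in> F \<Longrightarrow> v \<in> U g"
    "\<And>g u. g \<in> F \<Longrightarrow> u \<in> U g \<Longrightarrow> gact g u \<notin> U g" by metis
  define W where "W = {u. tm (fst u) < t} \<inter> (\<Inter>g\<in>F. U g)"
  have "open W" unfolding W_def using F U(1)
    by (intro open_Int open_INT open_Collect_less continuous_intros ballI)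
  moreover have "v \<in> W" using U(2) by (auto simp: W_def t_def)
  moreover have "g = mat 1" if "g \<in> \<Gamma>" "u \<in> W" "u \<in> UT" "gact g u \<in> W" for g u
  proof (rule ccontr)
    assume "g \<noteq> mat 1"
    then have "g \<in> F" using that displacement_le[OF that(1) UT_hyps(2)[OF that(3)], of t]
      by (auto simp: F_def W_def)
    then show False using that U(3)[OF \<open>g \<in> F\<close>, of u] by (auto simp: W_def)
  qed
  ultimately show ?thesis by blast
qed

section \<open>Orbits, saturations and pieces injecting into the quotient\<close>

lemma orb_self: "v \<in> orb \<Gamma> v"
  unfolding orb_gact using one_in by (intro image_eqI[of _ _ "mat 1"]) auto

lemma orb_gact_eq: "g \<in> \<Gamma> \<Longrightarrow> orb \<Gamma> (gact g v) = orb \<Gamma> v"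
proof -
  have sub: "orb \<Gamma> (gact g v) \<subseteq> orb \<Gamma> v" if "g \<in> \<Gamma>" for g v
    using that mult_in unfolding orb_gact by (auto simp: gact_mult)
  assume g: "g \<in> \<Gamma>"
  then have "gact (lorentz_inv g) (gact g v) = v" using lorp by (intro gact_inv) auto
  then show ?thesis using sub[OF g, of v] sub[OF inv_in[OF g], of "gact g v"] by auto
qed

lemma orb_eq_iff: "orb \<Gamma> v = orb \<Gamma> w \<longleftrightarrow> (\<exists>g\<in>\<Gamma>. w = gact g v)"
proof
  assume "orb \<Gamma> v = orb \<Gamma> w"
  then have "w \<in> orb \<Gamma> v" using orb_self by auto
  then show "\<exists>g\<in>\<Gamma>. w = gact g v" by (auto simp: orb_gact)
qed (auto simp: orb_gact_eq)

lemma gact_UT': "g \<in> \<Gamma> \<Longrightarrow> v \<in> UT \<Longrightarrow> gact g v \<in> UT"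
  using lorp gact_UT by blast

definition satur :: "'a uvec set \<Rightarrow> 'a uvec set" where
  "satur E = {v \<in> UT. orb \<Gamma> v \<in> orb \<Gamma> ` E}"

lemma satur_eq: "satur E = UT \<inter> (\<Union>g\<in>\<Gamma>. gact g -` E)"
proof -
  have "orb \<Gamma> v \<in> orb \<Gamma> ` E \<longleftrightarrow> (\<exists>g\<in>\<Gamma>. gact g v \<in> E)" for v
  proof -
    have "orb \<Gamma> v \<in> orb \<Gamma> ` E \<longleftrightarrow> (\<exists>e\<in>E. orb \<Gamma> v = orb \<Gamma> e)" by auto
    then show ?thesis unfolding orb_eq_iff by auto
  qed
  then have "v \<in> satur E \<longleftrightarrow> v \<in> UT \<inter> (\<Union>g\<in>\<Gamma>. gact g -` E)" for v by (simp add: satur_def)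
  then show ?thesis by blast
qed

lemma borel_gact: "gact g \<in> borel_measurable borel"
  by (intro borel_measurable_continuous_onI continuous_intros)

lemma sets_satur: "E \<in> sets borel \<Longrightarrow> satur E \<in> sets borel"
  unfolding satur_eq using countable sets_UT measurable_sets[OF borel_gact, of E]
  by (intro sets.Int sets.countable_UN') auto

text \<open>Lindelof extracts countably many of the wandering neighbourhoods; on each of them two
  vectors of one orbit coincide.\<close>

lemma countable_cover:
  obtains U :: "nat \<Rightarrow> 'a uvec set" where "\<And>i. open (U i)" "UT \<subseteq> (\<Union>i. U i)"
    "\<And>i. inj_on (orb \<Gamma>) (U i \<inter> UT)"
proof -
  define \<U> where "\<U> = {U. open U \<and> (\<forall>g\<in>\<Gamma>. \<forall>u\<in>U \<inter> UT. gact g u \<in> U \<longrightarrow> g = mat 1)}"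
  have "\<And>S. S \<in> \<U> \<Longrightarrow> open S" by (auto simp: \<U>_def)
  then obtain \<V> where V: "\<V> \<subseteq> \<U>" "countable \<V>" "\<Union>\<V> = \<Union>\<U>" by (rule Lindelof) auto
  have "UT \<subseteq> \<Union>\<U>" using wandering by (fastforce simp: \<U>_def)
  have inj: "inj_on (orb \<Gamma>) (U \<inter> UT)" if "U \<in> \<U>" for U
  proof (rule inj_onI)
    fix x y assume xy: "x \<in> U \<inter> UT" "y \<in> U \<inter> UT" "orb \<Gamma> x = orb \<Gamma> y"
    then obtain g where "g \<in> \<Gamma>" "y = gact g x" by (auto simp: orb_eq_iff)
    then have "g = mat 1" using xy that by (auto simp: \<U>_def)
    then show "x = y" using \<open>y = gact g x\<close> by simp
  qed
  have "{} \<in> \<U>" by (auto simp: \<U>_def)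
  \<comment> \<open>The empty set is added so that the family to be enumerated is nonempty.\<close>
  define U where "U = from_nat_into (insert {} \<V>)"
  have r: "range U = insert {} \<V>" unfolding U_def using V(2) by (intro range_from_nat_into) auto
  have UU: "U i \<in> \<U>" for i
  proof -
    have "U i \<in> insert {} \<V>" unfolding r[symmetric] by (rule rangeI)
    then show ?thesis using V(1) \<open>{} \<in> \<U>\<close> by auto
  qed
  have "UT \<subseteq> (\<Union>i. U i)" using \<open>UT \<subseteq> \<Union>\<U>\<close> V(3) r by auto
  moreover have "open (U i)" "inj_on (orb \<Gamma>) (U i \<inter> UT)" for i
    using inj[OF UU] UU[of i] by (simp_all add: \<U>_def)
  ultimately show thesis by (intro that[of U])
qed

text \<open>These sets correspond to the measurable sets of the quotient, by taking preimages under
  \<open>orb \<Gamma>\<close>.\<close>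

definition invset :: "'a uvec set \<Rightarrow> bool" where
  "invset A \<longleftrightarrow> A \<in> sets borel \<and> A \<subseteq> UT \<and> (\<forall>g\<in>\<Gamma>. \<forall>v\<in>A. gact g v \<in> A)"

lemma satur_invset: "invset A \<Longrightarrow> satur A = A"
  using inv_in lorp one_in unfolding satur_eq invset_def
  by (auto intro!: bexI[of _ "mat 1"]) (metis gact_inv(2) subsetD)

text \<open>\<open>bms_measure\<close> prescribes the measure only of sets that inject into the
  quotient; a general invariant set must first be cut into countably many such pieces.\<close>

lemma invset_decompose:
  assumes A: "invset A"
  obtains E :: "nat \<Rightarrow> 'a uvec set" where "\<And>i. E i \<in> sets borel" "\<And>i. E i \<subseteq> A" "\<And>i. inj_on (orb \<Gamma>) (E i)"
    "disjoint_family (\<lambda>i. orb \<Gamma> ` E i)" "orb \<Gamma> ` A = (\<Union>i. orb \<Gamma> ` E i)"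
proof -
  obtain U :: "nat \<Rightarrow> 'a uvec set" where U: "\<And>i. open (U i)" "UT \<subseteq> (\<Union>i. U i)"
    "\<And>i. inj_on (orb \<Gamma>) (U i \<inter> UT)"
    using countable_cover by metis
  have AUT: "A \<subseteq> UT" "A \<in> sets borel" using A by (auto simp: invset_def)
  \<comment> \<open>Subtracting the saturations of the earlier pieces, not just the pieces, makes
    the images in the quotient disjoint.\<close>
  define E where "E i = A \<inter> U i - (\<Union>j<i. satur (A \<inter> U j))" for i
  have E1: "E i \<in> sets borel" for i
    unfolding E_def using AUT U(1) sets_satur by (intro sets.Diff sets.Int sets.finite_UN) auto
  have "inj_on (orb \<Gamma>) (E i)" for i
    using U(3)[of i] AUT by (rule_tac inj_on_subset) (auto simp: E_def)
  moreover have "disjoint_family (\<lambda>i. orb \<Gamma> ` E i)"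
  proof -
    have "orb \<Gamma> ` E i \<inter> orb \<Gamma> ` E j = {}" if "i < j" for i j
    proof -
      have "orb \<Gamma> u \<noteq> orb \<Gamma> v" if u: "u \<in> E i" and v: "v \<in> E j" for u v
      proof
        assume eq: "orb \<Gamma> u = orb \<Gamma> v"
        have "u \<in> A \<inter> U i" "v \<in> UT" using u v AUT by (auto simp: E_def)
        then have "v \<in> satur (A \<inter> U i)"
          unfolding satur_def eq[symmetric] mem_Collect_eq using eq by (metis imageI)
        then show False using v \<open>i < j\<close> unfolding E_def by blast
      qed
      then show ?thesis by blast
    qed
    then show ?thesis unfolding disjoint_family_on_def by (metis Int_commute linorder_neqE_nat)
  qed
  moreover have "orb \<Gamma> ` A = (\<Union>i. orb \<Gamma> ` E i)"
  proof (intro equalityI subsetI)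
    fix V assume "V \<in> orb \<Gamma> ` A"
    then obtain v where v: "v \<in> A" "V = orb \<Gamma> v" by auto
    obtain k where "v \<in> U k" using v(1) AUT U(2) by blast
    then have "v \<in> satur (A \<inter> U k)" using v(1) AUT by (auto simp: satur_def)
    then have "\<exists>i. v \<in> satur (A \<inter> U i) \<and> (\<forall>j<i. v \<notin> satur (A \<inter> U j))"
      using exists_least_iff[of "\<lambda>i. v \<in> satur (A \<inter> U i)"] by blast
    then obtain i where i: "v \<in> satur (A \<inter> U i)" "\<And>j. j < i \<Longrightarrow> v \<notin> satur (A \<inter> U j)" by blast
    then obtain u where u: "u \<in> A \<inter> U i" "orb \<Gamma> v = orb \<Gamma> u" by (auto simp: satur_def)
    have "u \<notin> satur (A \<inter> U j)" if "j < i" for j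
      using i(2)[OF that] u v AUT by (auto simp: satur_def)
    then have "u \<in> E i" using u by (auto simp: E_def)
    then show "V \<in> (\<Union>i. orb \<Gamma> ` E i)" using u v by auto
  qed (auto simp: E_def)
  ultimately show thesis using that[of E] E1 by (auto simp: E_def)
qed

end

section \<open>The Bowen-Margulis-Sullivan measure\<close>

lemma sets_hopf_space: "hopf_space \<in> sets (borel \<Otimes>\<^sub>M (borel \<Otimes>\<^sub>M borel))"
proof -
  have "hopf_space = {x \<in> space (borel \<Otimes>\<^sub>M (borel \<Otimes>\<^sub>M (borel :: real measure))).
      lform (nhat (fst x)) (nhat (fst (snd x))) \<noteq> 0}"
    using lform_nhat_neg by (fastforce simp: hopf_space_def space_pair_measure dest: less_imp_neq)
  also have "\<dots> \<in> sets (borel \<Otimes>\<^sub>M (borel \<Otimes>\<^sub>M borel))" by measurable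
  finally show ?thesis .
qed

text \<open>The two Busemann functions are s and ln (2 / l) - s, where l is minus the pairing of the
  normalized null vectors, so the density does not depend on s.\<close>

definition bms_weight :: "'d::finite lmat set \<Rightarrow> (real ^ 'd) bdry \<Rightarrow> (real ^ 'd) bdry \<Rightarrow> ennreal" where
  "bms_weight \<Gamma> \<xi> \<eta> = ennreal (exp (critical_exponent \<Gamma> * ln (2 / - lform (nhat \<xi>) (nhat \<eta>))))"

text \<open>The iterated form with time innermost and the forward endpoint outermost yields both
  later uses: flow invariance by a translation in s, and vanishing when the forward endpoints lie in
  a null set.\<close>

lemma emeasure_bms_cover:
  fixes \<Gamma> :: "'d::finite lmat set" and \<mu> :: "(real ^ 'd) bdry measure"
  assumes \<mu>: "finite_measure \<mu>" "sets \<mu> = sets borel" and E: "E \<in> sets borel" "E \<subseteq> UT"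
  shows "emeasure (bms_cover \<Gamma> \<mu>) E =
    (\<integral>\<^sup>+\<xi>. \<integral>\<^sup>+\<eta>. \<integral>\<^sup>+s. bms_weight \<Gamma> \<xi> \<eta> * indicator hopf_space (\<xi>, \<eta>, s) * indicator E (hinv (\<xi>, \<eta>, s)) \<partial>lborel \<partial>\<mu> \<partial>\<mu>)"
proof -
  interpret \<mu>: finite_measure \<mu> by fact
  interpret P: pair_sigma_finite \<mu> "lborel :: real measure" ..
  have sf: "sigma_finite_measure (\<mu> \<Otimes>\<^sub>M (lborel :: real measure))" by unfold_locales
  define N where "N = \<mu> \<Otimes>\<^sub>M (\<mu> \<Otimes>\<^sub>M (lborel :: real measure))"
  define B where "B = (borel :: (real ^ 'd) bdry measure) \<Otimes>\<^sub>M ((borel :: (real ^ 'd) bdry measure) \<Otimes>\<^sub>M (borel :: real measure))"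
  have sN: "sets N = sets B"
    unfolding N_def B_def by (intro sets_pair_measure_cong \<mu>) simp
  have sp: "space N = UNIV" using sets_eq_imp_space_eq[OF sN] by (simp add: B_def space_pair_measure)
  have meas: "f \<in> measurable N M \<longleftrightarrow> f \<in> measurable B M" for f and M :: "'c measure"
    using sN by (simp cong: measurable_cong_sets)
  have hs: "hopf_space \<in> sets N" using sets_hopf_space by (simp add: sN B_def)
  define R where "R = restrict_space N hopf_space"
  have spR: "space R = hopf_space" by (simp add: R_def space_restrict_space sp)
  define W where "W x = bms_weight \<Gamma> (fst x) (fst (snd x))" for x :: "'d hopf"
  have "(\<lambda>x. lform (nhat (fst x)) (nhat (fst (snd x)))) \<in> borel_measurable B"
    unfolding B_def by measurable
  then have WB: "W \<in> borel_measurable B" unfolding W_def bms_weight_def by measurable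
  then have WN: "W \<in> borel_measurable N" by (simp add: meas)
  then have WR: "W \<in> borel_measurable R" unfolding R_def by (rule measurable_restrict_space1)
  have hN: "hinv \<in> measurable N borel" using borel_hinv by (simp add: meas B_def)
  have hR: "hinv \<in> measurable R (restrict_space borel UT)"
  proof (rule measurable_restrict_space2)
    show "hinv \<in> space R \<rightarrow> UT" unfolding spR by (auto simp: hopf_space_def hinv_UT)
    show "hinv \<in> measurable R borel" unfolding R_def using hN by (rule measurable_restrict_space1)
  qed
  have heq: "hopf_inv x = hinv x" if "x \<in> hopf_space" for x :: "'d hopf"
    using that by (auto simp: hopf_space_def hopf_inv_eq)
  \<comment> \<open>\<open>hopf_inv\<close> is an arbitrary preimage off \<open>hopf_space\<close>,
    so measurability is inherited from \<open>hinv\<close> only after restriction.\<close>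
  have hR': "hopf_inv \<in> measurable R (restrict_space borel UT)"
    using hR by (subst measurable_cong[where g=hinv]) (auto simp: spR heq)
  define G :: "'d hopf \<Rightarrow> ennreal" where "G = (\<lambda>(\<xi>, \<xi>', s). let z = base (hopf_inv (\<xi>, \<xi>', s)); \<delta> = critical_exponent \<Gamma> in
        ennreal (exp (\<delta> * busemann \<xi> origin z) * exp (\<delta> * busemann \<xi>' origin z)))"
  have GW: "G x = W x" if "x \<in> hopf_space" for x :: "'d hopf"
  proof -
    obtain \<xi> \<eta> s where x: "x = (\<xi>, \<eta>, s)" "\<xi> \<noteq> \<eta>" using \<open>x \<in> hopf_space\<close> by (cases x) (auto simp: hopf_space_def)
    define v where "v = hinv (\<xi>, \<eta>, s)"
    define l where "l = - lform (nhat \<xi>) (nhat \<eta>)"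
    have l: "l > 0" using lform_nhat_neg[OF x(2)] by (simp add: l_def)
    have v: "v \<in> UT" using hinv_UT[OF x(2)] by (simp add: v_def)
    have p: "fst v + snd v = exp s *\<^sub>R nhat \<xi>" unfolding v_def by (rule hinv_plus)
    have m: "fst v - snd v = (2 / (exp s * l)) *\<^sub>R nhat \<eta>" unfolding v_def l_def by (rule hinv_minus)
    have b1: "busemann \<xi> origin (base v) = s"
      using busemann_base(1)[OF v] unfolding p by simp
    have b2: "busemann \<eta> origin (base v) = ln (2 / (exp s * l))"
      using busemann_base(2)[OF v] l unfolding m by (subst (asm) bdry_of_scale) simp_all
    have "2 / (exp s * l) = exp (ln (2 / l) - s)" using l by (simp add: exp_diff)
    then have "s + ln (2 / (exp s * l)) = ln (2 / l)" by (simp only: ln_exp)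
    then show ?thesis
      by (simp add: G_def W_def bms_weight_def x hopf_inv_eq[OF x(2)] Let_def v_def[symmetric] b1 b2
          exp_add[symmetric] distrib_left[symmetric] l_def[symmetric])
  qed
  have GR: "G \<in> borel_measurable R"
    using WR by (subst measurable_cong[where g=W]) (auto simp: spR GW)
  have Esub: "E \<in> sets (restrict_space borel UT)"
    unfolding sets_restrict_space using E by (intro image_eqI[of _ _ E]) auto
  define F where "F x = W x * indicator hopf_space x * indicator E (hinv x)" for x :: "'d hopf"
  have F: "F \<in> borel_measurable N"
    unfolding F_def using WN hs hN E(1) by measurable
  have "emeasure (bms_cover \<Gamma> \<mu>) E = emeasure (density R G) (hopf_inv -` E \<inter> space (density R G))"
    unfolding bms_cover_def bms_hopf_def G_def[symmetric] N_def[symmetric] R_def[symmetric]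
    by (rule emeasure_distr) (use hR' Esub in auto)
  also have "hopf_inv -` E \<inter> space (density R G) = hinv -` E \<inter> hopf_space"
    using heq by (auto simp: spR)
  also have "emeasure (density R G) (hinv -` E \<inter> hopf_space) = (\<integral>\<^sup>+x. G x * indicator (hinv -` E \<inter> hopf_space) x \<partial>R)"
    using measurable_sets[OF hR Esub] GR by (intro emeasure_density) (auto simp: spR)
  also have "\<dots> = (\<integral>\<^sup>+x. W x * indicator E (hinv x) \<partial>R)"
    by (intro nn_integral_cong) (auto simp: spR GW indicator_def)
  also have "\<dots> = (\<integral>\<^sup>+x. W x * indicator E (hinv x) * indicator hopf_space x \<partial>N)"
    unfolding R_def using hs by (subst nn_integral_restrict_space) (auto simp: sp)
  also have "\<dots> = (\<integral>\<^sup>+x. F x \<partial>N)" by (simp add: F_def mult_ac)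
  also have "\<dots> = (\<integral>\<^sup>+\<xi>. \<integral>\<^sup>+y. F (\<xi>, y) \<partial>(\<mu> \<Otimes>\<^sub>M lborel) \<partial>\<mu>)"
    using F unfolding N_def by (rule sigma_finite_measure.nn_integral_fst[OF sf, symmetric])
  also have "\<dots> = (\<integral>\<^sup>+\<xi>. \<integral>\<^sup>+\<eta>. \<integral>\<^sup>+s. F (\<xi>, \<eta>, s) \<partial>lborel \<partial>\<mu> \<partial>\<mu>)"
  proof (rule nn_integral_cong)
    fix \<xi> assume "\<xi> \<in> space \<mu>"
    then have "(\<lambda>y. F (\<xi>, y)) \<in> borel_measurable (\<mu> \<Otimes>\<^sub>M lborel)"
      by (rule measurable_Pair2[OF F[unfolded N_def]])
    then show "(\<integral>\<^sup>+y. F (\<xi>, y) \<partial>(\<mu> \<Otimes>\<^sub>M lborel)) = (\<integral>\<^sup>+\<eta>. \<integral>\<^sup>+s. F (\<xi>, \<eta>, s) \<partial>lborel \<partial>\<mu>)"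
      by (rule lborel.nn_integral_fst[symmetric])
  qed
  finally show ?thesis by (simp add: F_def W_def)
qed

text \<open>The flow translates s, Lebesgue measure is invariant under translation and the weight is
  constant in s.\<close>

lemma bms_cover_flow:
  fixes \<Gamma> :: "'d::finite lmat set" and \<mu> :: "(real ^ 'd) bdry measure"
  assumes \<mu>: "finite_measure \<mu>" "sets \<mu> = sets borel" and E: "E \<in> sets borel" "E \<subseteq> UT"
  shows "emeasure (bms_cover \<Gamma> \<mu>) (geodesic_flow t ` E) = emeasure (bms_cover \<Gamma> \<mu>) E"
proof -
  have im: "v \<in> geodesic_flow t ` E \<longleftrightarrow> geodesic_flow (- t) v \<in> E" for v :: "'d uvec"
  proof
    assume "v \<in> geodesic_flow t ` E"
    then obtain w where "w \<in> E" "v = geodesic_flow t w" by (rule imageE)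
    then show "geodesic_flow (- t) v \<in> E" by (simp add: geodesic_flow_add)
  next
    assume "geodesic_flow (- t) v \<in> E"
    then have "geodesic_flow t (geodesic_flow (- t) v) \<in> geodesic_flow t ` E" by (rule imageI)
    then show "v \<in> geodesic_flow t ` E" by (simp add: geodesic_flow_add)
  qed
  have "geodesic_flow t ` E = geodesic_flow (- t) -` E \<inter> space borel"
    by (simp add: set_eq_iff im)
  also have "\<dots> \<in> sets borel" using E(1)
    by (intro measurable_sets[OF borel_measurable_continuous_onI]) (auto intro!: continuous_intros)
  finally have s: "geodesic_flow t ` E \<in> sets borel" .
  have sub: "geodesic_flow t ` E \<subseteq> UT" using E(2) geodesic_flow_UT by blast
  have ind: "indicator hopf_space (\<xi>, \<eta>, s) * indicator (geodesic_flow t ` E) (hinv (\<xi>, \<eta>, s))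
      = (indicator hopf_space (\<xi>, \<eta>, s - t) * indicator E (hinv (\<xi>, \<eta>, s - t)) :: ennreal)" for \<xi> \<eta> s
    using geodesic_flow_hinv[of \<xi> \<eta> "- t" s] by (auto simp: hopf_space_def indicator_def im)
  have shift: "(\<integral>\<^sup>+s. f (s - t) \<partial>lborel) = (\<integral>\<^sup>+s. f s \<partial>lborel)" if [measurable]: "f \<in> borel_measurable borel" for f :: "real \<Rightarrow> ennreal"
  proof -
    have "(\<integral>\<^sup>+s. f s \<partial>lborel) = (\<integral>\<^sup>+s. f s \<partial>distr lborel borel ((+) (- t)))"
      by (simp add: lborel_distr_plus)
    also have "\<dots> = (\<integral>\<^sup>+s. f (s - t) \<partial>lborel)" by (subst nn_integral_distr) auto
    finally show ?thesis by simp
  qed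
  have [measurable]: "(\<lambda>s. indicator hopf_space (\<xi>, \<eta>, s) :: ennreal) \<in> borel_measurable borel"
    "(\<lambda>s. hinv (\<xi>, \<eta>, s)) \<in> borel_measurable borel" for \<xi> \<eta>
  proof -
    show "(\<lambda>s. indicator hopf_space (\<xi>, \<eta>, s) :: ennreal) \<in> borel_measurable borel"
      by (cases "\<xi> = \<eta>") (auto simp: hopf_space_def indicator_def)
    show "(\<lambda>s. hinv (\<xi>, \<eta>, s)) \<in> borel_measurable borel"
      by (rule measurable_compose[OF _ borel_hinv]) measurable
  qed
  note E(1)[measurable]
  have integrand: "(\<lambda>s. bms_weight \<Gamma> \<xi> \<eta> * (indicator hopf_space (\<xi>, \<eta>, s) * indicator E (hinv (\<xi>, \<eta>, s)))) \<in> borel_measurable borel" for \<xi> \<eta>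
    by measurable
  show ?thesis unfolding emeasure_bms_cover[OF \<mu> E] emeasure_bms_cover[OF \<mu> s sub]
  proof (rule nn_integral_cong, rule nn_integral_cong)
    fix \<xi> \<eta>
    show "(\<integral>\<^sup>+s. bms_weight \<Gamma> \<xi> \<eta> * indicator hopf_space (\<xi>, \<eta>, s) * indicator (geodesic_flow t ` E) (hinv (\<xi>, \<eta>, s)) \<partial>lborel)
      = (\<integral>\<^sup>+s. bms_weight \<Gamma> \<xi> \<eta> * indicator hopf_space (\<xi>, \<eta>, s) * indicator E (hinv (\<xi>, \<eta>, s)) \<partial>lborel)"
      unfolding mult.assoc ind by (rule shift[OF integrand])
  qed
qed

lemma bms_cover_null:
  fixes \<Gamma> :: "'d::finite lmat set" and \<mu> :: "(real ^ 'd) bdry measure"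
  assumes \<mu>: "finite_measure \<mu>" "sets \<mu> = sets borel" and E: "E \<in> sets borel" "E \<subseteq> UT"
    and N: "N \<in> null_sets \<mu>" "\<And>v. v \<in> E \<Longrightarrow> bdry_of (fst v + snd v) \<in> N"
  shows "emeasure (bms_cover \<Gamma> \<mu>) E = 0"
proof -
  have z: "indicator hopf_space (\<xi>, \<eta>, s) * indicator E (hinv (\<xi>, \<eta>, s)) = (0 :: ennreal)" if "\<xi> \<notin> N" for \<xi> \<eta> s
  proof (cases "hinv (\<xi>, \<eta>, s) \<in> E")
    case True
    then have "bdry_of (exp s *\<^sub>R nhat \<xi>) \<in> N" using N(2) hinv_plus by metis
    then show ?thesis using that by simp
  qed simp
  have "AE \<xi> in \<mu>. \<xi> \<notin> N" using N(1) by (rule AE_not_in)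
  then have "AE \<xi> in \<mu>. (\<integral>\<^sup>+\<eta>. \<integral>\<^sup>+s. bms_weight \<Gamma> \<xi> \<eta> * indicator hopf_space (\<xi>, \<eta>, s) * indicator E (hinv (\<xi>, \<eta>, s)) \<partial>lborel \<partial>\<mu>) = 0"
    by eventually_elim (simp add: mult.assoc z)
  then show ?thesis unfolding emeasure_bms_cover[OF \<mu> E]
    by (subst nn_integral_cong_AE[where v="\<lambda>_. 0"]) auto
qed

section \<open>The measure on the quotient\<close>

locale bms = kleinian \<Gamma> for \<Gamma> :: "'d::finite lmat set" +
  fixes \<mu> :: "(real ^ 'd) bdry measure" and m :: "'d uvec set measure"
  assumes \<mu>: "finite_measure \<mu>" "sets \<mu> = sets borel" and m: "bms_measure \<Gamma> \<mu> m"
begin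

lemma prob_m: "prob_space m" and space_m: "space m = T1M \<Gamma>"
  and sets_m: "A \<in> sets m \<longleftrightarrow> A \<subseteq> T1M \<Gamma> \<and> {v\<in>UT. orb \<Gamma> v \<in> A} \<in> sets borel"
  using m by (auto simp: bms_measure_def)

lemma sets_m_orb: "invset A \<Longrightarrow> orb \<Gamma> ` A \<in> sets m"
  using satur_invset[of A] unfolding sets_m satur_def T1M_def invset_def by auto

lemma sets_m_invset:
  assumes "A \<in> sets m"
  shows "invset {v\<in>UT. orb \<Gamma> v \<in> A}" "A = orb \<Gamma> ` {v\<in>UT. orb \<Gamma> v \<in> A}"
  using assms by (auto simp: sets_m invset_def orb_gact_eq gact_UT' T1M_def)

text \<open>The normalizing constant is obtained before the pieces, so that measures computed from
  different decompositions can be compared.\<close>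

lemma emeasure_m_decompose:
  obtains c where "c > 0" "\<And>E :: nat \<Rightarrow> 'd uvec set. (\<And>i. E i \<in> sets borel) \<Longrightarrow> (\<And>i. E i \<subseteq> UT) \<Longrightarrow>
    (\<And>i. inj_on (orb \<Gamma>) (E i)) \<Longrightarrow> disjoint_family (\<lambda>i. orb \<Gamma> ` E i) \<Longrightarrow>
    emeasure m (\<Union>i. orb \<Gamma> ` E i) = (\<Sum>i. ennreal c * emeasure (bms_cover \<Gamma> \<mu>) (E i))"
proof -
  obtain c where c: "c > 0" "\<And>B. B \<in> sets borel \<Longrightarrow> B \<subseteq> UT \<Longrightarrow> inj_on (orb \<Gamma>) B \<Longrightarrow>
        emeasure m (orb \<Gamma> ` B) = ennreal c * emeasure (bms_cover \<Gamma> \<mu>) B"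
    using m by (auto simp: bms_measure_def)
  have "emeasure m (\<Union>i. orb \<Gamma> ` E i) = (\<Sum>i. ennreal c * emeasure (bms_cover \<Gamma> \<mu>) (E i))"
    if E: "\<And>i. E i \<in> sets borel" "\<And>i. E i \<subseteq> UT" "\<And>i. inj_on (orb \<Gamma>) (E i)"
      "disjoint_family (\<lambda>i. orb \<Gamma> ` E i)" for E :: "nat \<Rightarrow> 'd uvec set"
  proof -
    have "orb \<Gamma> ` E i \<in> sets m" for i
      using sets_satur[OF E(1)[of i]] E(2)[of i] by (auto simp: sets_m satur_def T1M_def)
    then have "emeasure m (\<Union>i. orb \<Gamma> ` E i) = (\<Sum>i. emeasure m (orb \<Gamma> ` E i))"
      using E(4) by (intro suminf_emeasure[symmetric]) auto
    then show ?thesis using c(2) E by simp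
  qed
  then show thesis using that c(1) by blast
qed

lemma m_null:
  assumes A: "invset A" and N: "N \<in> null_sets \<mu>" "\<And>v. v \<in> A \<Longrightarrow> bdry_of (fst v + snd v) \<in> N"
  shows "emeasure m (orb \<Gamma> ` A) = 0"
proof -
  obtain E :: "nat \<Rightarrow> 'd uvec set" where E: "\<And>i. E i \<in> sets borel" "\<And>i. E i \<subseteq> A" "\<And>i. inj_on (orb \<Gamma>) (E i)"
    "disjoint_family (\<lambda>i. orb \<Gamma> ` E i)" "orb \<Gamma> ` A = (\<Union>i. orb \<Gamma> ` E i)"
    using invset_decompose[OF A] by metis
  have EU: "E i \<subseteq> UT" for i using E(2) A by (auto simp: invset_def)
  obtain c where c: "emeasure m (\<Union>i. orb \<Gamma> ` E i) = (\<Sum>i. ennreal c * emeasure (bms_cover \<Gamma> \<mu>) (E i))"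
    using emeasure_m_decompose E EU by metis
  have "emeasure (bms_cover \<Gamma> \<mu>) (E i) = 0" for i
    by (rule bms_cover_null[OF \<mu> E(1) EU N(1)]) (use N(2) E(2) in blast)
  then show ?thesis by (simp add: E(5) c)
qed

lemma orb_flow: "T1M_flow t (orb \<Gamma> v) = orb \<Gamma> (geodesic_flow t v)"
  by (simp add: T1M_flow_def orb_gact image_image geodesic_flow_gact)

lemma T1M_flow_T1M: "V \<in> T1M \<Gamma> \<Longrightarrow> T1M_flow t V \<in> T1M \<Gamma>"
  by (auto simp: T1M_def orb_flow geodesic_flow_UT)

lemma flow_vimage_borel:
  assumes "A \<in> sets borel"
  shows "{v \<in> UT. geodesic_flow t v \<in> A} \<in> sets borel"
proof -
  have "{v \<in> UT. geodesic_flow t v \<in> A} = UT \<inter> (geodesic_flow t -` A \<inter> space borel)" by auto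
  moreover have "geodesic_flow t -` A \<inter> space borel \<in> sets borel" using assms
    by (intro measurable_sets[OF borel_measurable_continuous_onI]) (auto intro!: continuous_intros)
  ultimately show ?thesis using sets_UT by auto
qed

lemma T1M_flow_measurable: "T1M_flow t \<in> measurable m m"
proof (rule measurableI)
  fix V assume "V \<in> space m" then show "T1M_flow t V \<in> space m" by (simp add: space_m T1M_flow_T1M)
next
  fix A assume A: "A \<in> sets m"
  have "{v \<in> UT. orb \<Gamma> v \<in> T1M_flow t -` A \<inter> space m} = {v\<in>UT. geodesic_flow t v \<in> {v\<in>UT. orb \<Gamma> v \<in> A}}"
    by (auto simp: space_m orb_flow geodesic_flow_UT T1M_def)
  also have "\<dots> \<in> sets borel" using A by (intro flow_vimage_borel) (simp add: sets_m)
  finally show "T1M_flow t -` A \<inter> space m \<in> sets m" by (auto simp: sets_m space_m)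
qed

text \<open>The flow commutes with the group, hence moves a decomposition of a set to one of its
  preimage, piece by piece with equal measure upstairs.\<close>

lemma distr_T1M_flow: "distr m m (T1M_flow t) = m"
proof (rule measure_eqI)
  fix A assume "A \<in> sets (distr m m (T1M_flow t))"
  then have A: "A \<in> sets m" by simp
  define A' where "A' = {v\<in>UT. orb \<Gamma> v \<in> A}"
  have A': "invset A'" "A = orb \<Gamma> ` A'" using sets_m_invset[OF A] by (auto simp: A'_def)
  have A'U: "A' \<subseteq> UT" by (auto simp: A'_def)
  obtain E :: "nat \<Rightarrow> 'd uvec set" where E: "\<And>i. E i \<in> sets borel" "\<And>i. E i \<subseteq> A'" "\<And>i. inj_on (orb \<Gamma>) (E i)"
    "disjoint_family (\<lambda>i. orb \<Gamma> ` E i)" "orb \<Gamma> ` A' = (\<Union>i. orb \<Gamma> ` E i)"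
    using invset_decompose[OF A'(1)] by metis
  have EU: "E i \<subseteq> UT" for i using E(2) A'U by auto
  define F where "F i = geodesic_flow (- t) ` E i" for i
  have inv: "geodesic_flow t (geodesic_flow (- t) v) = v" "geodesic_flow (- t) (geodesic_flow t v) = v" for v :: "'d uvec"
    by (simp_all add: geodesic_flow_add)
  have orbF: "orb \<Gamma> ` F i = T1M_flow (- t) ` orb \<Gamma> ` E i" for i
    by (simp add: F_def image_image orb_flow)
  have flow_inv: "T1M_flow t (T1M_flow (- t) V) = V" "T1M_flow (- t) (T1M_flow t V) = V" for V :: "'d uvec set"
    by (simp_all add: T1M_flow_def image_image inv)
  have FU: "F i \<subseteq> UT" for i using EU[of i] geodesic_flow_UT unfolding F_def by blast
  have F_eq: "F i = {v \<in> UT. geodesic_flow t v \<in> E i}" for i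
    using FU[of i] by (auto simp: F_def inv image_iff) (metis inv(2) surj_pair)
  have Fs: "F i \<in> sets borel" for i unfolding F_eq by (rule flow_vimage_borel[OF E(1)])
  have Fi: "inj_on (orb \<Gamma>) (F i)" for i
  proof (rule inj_onI)
    fix x y assume "x \<in> F i" "y \<in> F i" "orb \<Gamma> x = orb \<Gamma> y"
    then obtain a b where ab: "a \<in> E i" "b \<in> E i" "x = geodesic_flow (- t) a" "y = geodesic_flow (- t) b"
      "T1M_flow (- t) (orb \<Gamma> a) = T1M_flow (- t) (orb \<Gamma> b)" by (auto simp: F_def orb_flow)
    then have "orb \<Gamma> a = orb \<Gamma> b" using flow_inv(1) by metis
    then show "x = y" using ab E(3)[of i] by (auto dest: inj_onD)
  qed
  have Fd: "disjoint_family (\<lambda>i. orb \<Gamma> ` F i)"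
  proof -
    have "inj (T1M_flow (- t) :: 'd uvec set \<Rightarrow> _)" by (metis injI flow_inv(1))
    then show ?thesis using E(4) unfolding orbF disjoint_family_on_def by (simp add: image_Int[symmetric])
  qed
  have pre: "T1M_flow t -` A \<inter> space m = (\<Union>i. orb \<Gamma> ` F i)"
  proof -
    have "(\<Union>i. orb \<Gamma> ` F i) = T1M_flow (- t) ` A" unfolding A'(2) E(5) orbF by auto
    also have "\<dots> = T1M_flow t -` A \<inter> space m"
    proof (intro equalityI subsetI)
      fix V assume "V \<in> T1M_flow (- t) ` A"
      then show "V \<in> T1M_flow t -` A \<inter> space m"
        using sets.sets_into_space[OF A] T1M_flow_T1M by (auto simp: flow_inv space_m)
    next
      fix V assume "V \<in> T1M_flow t -` A \<inter> space m"
      then show "V \<in> T1M_flow (- t) ` A" using flow_inv(2)[of V] by (metis IntE image_eqI vimageE)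
    qed
    finally show ?thesis by simp
  qed
  obtain c where c: "\<And>E :: nat \<Rightarrow> 'd uvec set. (\<And>i. E i \<in> sets borel) \<Longrightarrow> (\<And>i. E i \<subseteq> UT) \<Longrightarrow>
    (\<And>i. inj_on (orb \<Gamma>) (E i)) \<Longrightarrow> disjoint_family (\<lambda>i. orb \<Gamma> ` E i) \<Longrightarrow>
    emeasure m (\<Union>i. orb \<Gamma> ` E i) = (\<Sum>i. ennreal c * emeasure (bms_cover \<Gamma> \<mu>) (E i))"
    using emeasure_m_decompose by metis
  have "emeasure (distr m m (T1M_flow t)) A = emeasure m (T1M_flow t -` A \<inter> space m)"
    by (rule emeasure_distr[OF T1M_flow_measurable A])
  also have "\<dots> = (\<Sum>i. ennreal c * emeasure (bms_cover \<Gamma> \<mu>) (F i))"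
    unfolding pre by (rule c[OF Fs FU Fi Fd])
  also have "\<dots> = (\<Sum>i. ennreal c * emeasure (bms_cover \<Gamma> \<mu>) (E i))"
    unfolding F_def bms_cover_flow[OF \<mu> E(1) EU] ..
  also have "\<dots> = emeasure m A" unfolding A'(2) E(5) by (rule c[OF E(1) EU E(3,4), symmetric])
  finally show "emeasure (distr m m (T1M_flow t)) A = emeasure m A" .
qed simp

text \<open>An arbitrary representative. No measurability of \<open>rep\<close> is claimed; it only
  enters through functions and conditions that are invariant under \<Gamma>.\<close>

definition rep :: "'d uvec set \<Rightarrow> 'd uvec" where
  "rep V = (SOME v. v \<in> UT \<and> orb \<Gamma> v = V)"

lemma rep: "V \<in> T1M \<Gamma> \<Longrightarrow> rep V \<in> UT \<and> orb \<Gamma> (rep V) = V"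
  unfolding rep_def by (rule someI_ex) (auto simp: T1M_def)

definition inv_fun :: "('d uvec \<Rightarrow> real) \<Rightarrow> bool" where
  "inv_fun f \<longleftrightarrow> (\<forall>g\<in>\<Gamma>. \<forall>v\<in>UT. f (gact g v) = f v)"

lemma inv_fun_rep: "inv_fun f \<Longrightarrow> v \<in> UT \<Longrightarrow> f (rep (orb \<Gamma> v)) = f v"
proof -
  assume f: "inv_fun f" and v: "v \<in> UT"
  then have "orb \<Gamma> v \<in> T1M \<Gamma>" by (auto simp: T1M_def)
  then obtain g where "g \<in> \<Gamma>" "rep (orb \<Gamma> v) = gact g v" using rep orb_eq_iff by metis
  then show ?thesis using f v by (auto simp: inv_fun_def)
qed

lemma inv_fun_measurable:
  assumes f: "inv_fun f" "f \<in> borel_measurable (restrict_space borel UT)"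
  shows "(\<lambda>V. f (rep V)) \<in> borel_measurable m"
proof (rule measurableI)
  fix S :: "real set" assume S: "S \<in> sets borel"
  have "{v \<in> UT. orb \<Gamma> v \<in> (\<lambda>V. f (rep V)) -` S \<inter> space m} = f -` S \<inter> space (restrict_space borel UT)"
    using inv_fun_rep[OF f(1)] by (auto simp: space_m T1M_def space_restrict_space)
  also have "\<dots> \<in> sets borel"
    using measurable_sets[OF f(2) S] by (simp add: sets_restrict_space_iff sets_UT)
  finally show "(\<lambda>V. f (rep V)) -` S \<inter> space m \<in> sets m" by (auto simp: sets_m space_m)
qed auto

lemma forward_gact:
  assumes "g \<in> \<Gamma>" "v \<in> UT"
  shows "bdry_of (fst (gact g v) + snd (gact g v)) = bact g (bdry_of (fst v + snd v))"
proof -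
  have gl: "g \<in> lorp" using assms lorp by auto
  have t: "tm (fst v + snd v) > 0" using UT_null[OF assms(2)] by simp
  have "fst (gact g v) + snd (gact g v) = g *v (fst v + snd v)" by (simp add: matrix_vector_right_distrib)
  also have "\<dots> = tm (fst v + snd v) *\<^sub>R (g *v nhat (bdry_of (fst v + snd v)))"
    by (subst UT_plus_minus(1)[OF assms(2)]) (rule matrix_vector_mult_scaleR)
  finally have "bdry_of (fst (gact g v) + snd (gact g v)) = bdry_of (g *v nhat (bdry_of (fst v + snd v)))"
    using t bdry_of_scale[of "tm (fst v + snd v)"] by (metis less_irrefl)
  then show ?thesis using bdry_of_lorp[OF gl] by simp
qed

text \<open>Invariance of \<open>N\<close> makes the set of vectors pointing into it invariant,
  hence a measurable set downstairs, and makes the condition independent of the chosen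
  representative.\<close>

lemma AE_m_forward:
  assumes N: "N \<in> null_sets \<mu>" "\<And>g \<xi>. g \<in> \<Gamma> \<Longrightarrow> \<xi> \<in> N \<Longrightarrow> bact g \<xi> \<in> N"
  shows "AE V in m. bdry_of (fst (rep V) + snd (rep V)) \<notin> N"
proof -
  have NB: "N \<in> sets borel" using N(1) \<mu>(2) by auto
  define A where "A = {v \<in> UT. bdry_of (fst v + snd v) \<in> N}"
  have fw: "(\<lambda>v. bdry_of (fst v + snd v)) \<in> borel_measurable (restrict_space borel (UT :: 'd uvec set))"
  proof (rule measurable_bdryI)
    have "sphere_pt (bdry_of (fst v + snd v)) = (1 / tm (fst v + snd v)) *\<^sub>R spc (fst v + snd v)" if "v \<in> UT" for v :: "'d uvec"
    proof -
      have t: "tm (fst v + snd v) > 0" using UT_null[OF that] by simp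
      show ?thesis using arg_cong[OF UT_plus_minus(1)[OF that], of spc] t
        by (simp only: spc_scale spc_nhat) simp
    qed
    moreover have "(\<lambda>v :: 'd uvec. (1 / tm (fst v + snd v)) *\<^sub>R spc (fst v + snd v)) \<in> borel_measurable (restrict_space borel UT)"
      by (intro measurable_restrict_space1 borel_measurable_scaleR borel_measurable_divide
          borel_measurable_const borel_measurable_continuous_onI continuous_intros)
    ultimately show "(\<lambda>v :: 'd uvec. sphere_pt (bdry_of (fst v + snd v))) \<in> borel_measurable (restrict_space borel UT)"
      by (subst measurable_cong[where g="\<lambda>v. (1 / tm (fst v + snd v)) *\<^sub>R spc (fst v + snd v)"])
        (auto simp: space_restrict_space)
  qed
  have "A = (\<lambda>v. bdry_of (fst v + snd v)) -` N \<inter> space (restrict_space borel UT)"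
    by (auto simp: A_def space_restrict_space)
  then have "A \<in> sets borel" using measurable_sets[OF fw NB] by (simp add: sets_restrict_space_iff sets_UT)
  then have A: "invset A" using N(2) forward_gact by (auto simp: invset_def A_def gact_UT')
  have "emeasure m (orb \<Gamma> ` A) = 0"
    by (rule m_null[OF A N(1)]) (auto simp: A_def)
  then have "AE V in m. V \<notin> orb \<Gamma> ` A" using sets_m_orb[OF A] by (intro AE_not_in) auto
  then show ?thesis using AE_space
  proof eventually_elim
    case (elim V)
    then have r: "rep V \<in> UT" "orb \<Gamma> (rep V) = V" using rep by (auto simp: space_m)
    then have "rep V \<notin> A" using elim by auto
    then show ?case using r by (auto simp: A_def)
  qed
qed

end

section \<open>The conformal factor of the boundary action\<close>

text \<open>The denominator of the Moebius map in the affine chart: the factor between the image of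
  the null vector over \<open>x\<close> and the null vector over the image of
  \<open>x\<close>.\<close>

definition hgt :: "'d::finite lmat \<Rightarrow> real ^ 'd \<Rightarrow> real" where
  "hgt A x = tm (A *v null_of (Fin x)) - (A *v null_of (Fin x)) $ Inr False"

lemma hgt_null_of: "tm (null_of (Fin x)) - null_of (Fin x) $ Inr False = 1"
  by (simp add: mvec_def field_simps)

lemma lorp_null_of:
  assumes A: "A \<in> lorp"
  obtains c where "c > 0" "A *v null_of \<xi> = c *\<^sub>R null_of (bact A \<xi>)"
proof -
  define a b where "a = tm (null_of \<xi>)" and "b = tm (null_of (bact A \<xi>))"
  have ab: "a > 0" "b > 0" by (simp_all add: a_def b_def tm_null_of_pos)
  have 1: "null_of \<xi> = a *\<^sub>R nhat \<xi>" "null_of (bact A \<xi>) = b *\<^sub>R nhat (bact A \<xi>)"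
    unfolding a_def b_def by (rule null_of_nhat)+
  have "A *v null_of \<xi> = a *\<^sub>R (A *v nhat \<xi>)" by (simp add: 1 matrix_vector_mult_scaleR)
  also have "\<dots> = a *\<^sub>R tm (A *v nhat \<xi>) *\<^sub>R nhat (bact A \<xi>)"
    by (subst (1) lorp_nhat(2)[OF A]) (rule refl)
  also have "\<dots> = (a * tm (A *v nhat \<xi>) / b) *\<^sub>R null_of (bact A \<xi>)"
    unfolding 1(2) using ab by simp
  finally show thesis
    by (rule that[rotated]) (use ab lorp_nhat(1)[OF A, of \<xi>] in simp)
qed

lemma hgt_pos:
  assumes A: "A \<in> lorp" and "bact A (Fin x) = Fin y"
  shows "hgt A x > 0" "A *v null_of (Fin x) = hgt A x *\<^sub>R null_of (Fin y)"
proof -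
  obtain c where c: "c > 0" "A *v null_of (Fin x) = c *\<^sub>R null_of (Fin y)"
    using lorp_null_of[OF A, of "Fin x"] assms(2) by metis
  have "hgt A x = c * (tm (null_of (Fin y)) - null_of (Fin y) $ Inr False)"
    unfolding hgt_def c(2) by (simp only: vector_scaleR_component real_scaleR_def right_diff_distrib)
  then have "hgt A x = c" by (simp only: hgt_null_of mult_1_right)
  with c show "hgt A x > 0" "A *v null_of (Fin x) = hgt A x *\<^sub>R null_of (Fin y)" by simp_all
qed

lemma lform_null_of_Fin: "lform (null_of (Fin x)) (null_of (Fin y)) = - (norm (x - y))\<^sup>2 / 2"
proof -
  have s: "spc (null_of (Fin z)) = (z, ((norm z)\<^sup>2 - 1) / 2)" "tm (null_of (Fin z)) = ((norm z)\<^sup>2 + 1) / 2" for z :: "real ^ 'a"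
    by (simp_all add: mvec_def spc_def space_part_def vec_eq_iff)
  show ?thesis unfolding lform_spc s power2_norm_eq_inner
    by (simp add: inner_diff inner_commute field_simps)
qed

lemma hgt_pos_iff: "A \<in> lorp \<Longrightarrow> hgt A x \<noteq> 0 \<longleftrightarrow> bact A (Fin x) \<noteq> Infty"
  unfolding hgt_def bact_def bdry_of_def Let_def by simp

lemma Fin_eact: "bact A (Fin x) \<noteq> Infty \<Longrightarrow> bact A (Fin x) = Fin (eact A x)"
  by (cases "bact A (Fin x)") (auto simp: eact_def)

lemma eact_formula: "eact A x = (1 / hgt A x) *\<^sub>R space_part (A *v null_of (Fin x))"
  unfolding eact_def bact_def bdry_of_def Let_def hgt_def by simp

text \<open>The pairing of two chart-normalized null vectors is minus half the squared Euclidean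
  distance, and the isometry preserves it up to the two factors \<open>hgt\<close>.\<close>

lemma eact_dist:
  assumes A: "A \<in> lorp" and "hgt A x \<noteq> 0" "hgt A y \<noteq> 0"
  shows "(norm (eact A x - eact A y))\<^sup>2 = (norm (x - y))\<^sup>2 / (hgt A x * hgt A y)"
proof -
  have x: "bact A (Fin x) = Fin (eact A x)" and y: "bact A (Fin y) = Fin (eact A y)"
    using assms by (simp_all add: Fin_eact hgt_pos_iff)
  have "lform (A *v null_of (Fin x)) (A *v null_of (Fin y)) = lform (null_of (Fin x)) (null_of (Fin y))"
    by (rule lorp_lform[OF A])
  then have "hgt A x * hgt A y * (norm (eact A x - eact A y))\<^sup>2 = (norm (x - y))\<^sup>2"
    unfolding hgt_pos(2)[OF A x] hgt_pos(2)[OF A y] lform_lin lform_null_of_Fin by (simp add: mult_ac)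
  then show ?thesis using assms by (simp add: field_simps)
qed

lemma continuous_null_of_Fin [continuous_intros]: "continuous_on S (\<lambda>x. null_of (Fin x))"
proof -
  have "null_of (Fin x) = mk (x, ((norm x)\<^sup>2 - 1) / 2) (((norm x)\<^sup>2 + 1) / 2)" for x :: "real ^ 'a"
    by (simp add: mk_def)
  then show ?thesis by (simp only:) (intro continuous_intros, simp_all)
qed

lemma continuous_hgt: "continuous_on S (hgt A)"
  unfolding hgt_def matrix_vector_mult_def by (intro continuous_intros)

lemma eact_differentiable:
  assumes A: "A \<in> lorp" and "hgt A x \<noteq> 0"
  shows "eact A differentiable (at x)"
proof -
  have E: "linear (\<lambda>u. mvec u 0 0 :: 'a mink)"
    by (rule linearI) (simp_all add: mvec_def vec_eq_iff split: sum.splits)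
  have dec: "null_of (Fin u) = mvec u 0 0 + (u \<bullet> u) *\<^sub>R mvec 0 (1/2) (1/2) + mvec 0 (-1/2) (1/2)" for u :: "real ^ 'a"
    unfolding null_of.simps power2_norm_eq_inner by (simp add: mvec_def vec_eq_iff field_simps split: sum.splits)
  have d: "(\<lambda>u. null_of (Fin u) :: 'a mink) differentiable (at x)"
    unfolding dec by (intro differentiable_add differentiable_scaleR differentiable_inner
      linear_imp_differentiable[OF E] differentiable_ident differentiable_const)
  have L: "(\<lambda>u. f (null_of (Fin u))) differentiable (at x)" if "linear f" for f :: "'a mink \<Rightarrow> 'b::real_normed_vector"
    by (rule differentiable_compose[OF linear_imp_differentiable[OF that] d])
  have l1: "linear (\<lambda>v. space_part (A *v v))"
    by (rule linearI) (simp_all add: space_part_def vec_eq_iff matrix_vector_right_distrib matrix_vector_mult_scaleR)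
  have l2: "linear (\<lambda>v. tm (A *v v) - (A *v v) $ Inr False)"
    by (rule linearI) (simp_all add: matrix_vector_right_distrib matrix_vector_mult_scaleR algebra_simps)
  have "(\<lambda>u. (1 / hgt A u) *\<^sub>R space_part (A *v null_of (Fin u))) differentiable (at x)"
    using L[OF l1] L[OF l2] assms(2) unfolding hgt_def
    by (intro differentiable_scaleR differentiable_divide differentiable_const) auto
  then show ?thesis unfolding eact_formula[symmetric] by (simp add: eta_contract_eq)
qed

text \<open>The exact distance formula makes the derivative a similarity of ratio
  \<open>1 / hgt A x\<close>. Agreement on an open set is the hypothesis because the coding map is a
  boundary isometry only on each \<open>\<Delta> j\<close> separately.\<close>

lemma distortion_eact_local:
  fixes A :: "'d::finite lmat"
  assumes A: "A \<in> lorp" and h: "hgt A x > 0" and S: "open S" "x \<in> S" "\<And>y. y \<in> S \<Longrightarrow> f y = eact A y"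
  shows "distortion f x = 1 / hgt A x"
proof -
  obtain D where D: "(eact A has_derivative D) (at x)"
    using eact_differentiable[OF A, of x] h unfolding differentiable_def by auto
  then have "(f has_derivative D) (at x)"
    by (rule has_derivative_transform_within_open[OF _ S(1,2)]) (simp add: S(3))
  then have fd: "frechet_derivative f (at x) = D" by (rule frechet_derivative_at[symmetric])
  interpret D: bounded_linear D using D by (rule has_derivative_bounded_linear)
  \<comment> \<open>Two limits of the squared difference quotient are compared, one from
    differentiability and one from \<open>eact_dist\<close> with continuity of
    \<open>hgt\<close>.\<close>
  have nD: "norm (D v) = norm v / hgt A x" for v
  proof (cases "v = 0")
    case False
    have l0: "((\<lambda>t::real. x + t *\<^sub>R v) \<longlongrightarrow> x) (at 0)"
      by (auto intro!: tendsto_eq_intros)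
    have "((\<lambda>t. (eact A (x + t *\<^sub>R v) - eact A x) /\<^sub>R t) \<longlongrightarrow> D v) (at 0)"
    proof -
      have "((\<lambda>h. norm (eact A (x + h) - eact A x - D h) / norm h) \<longlongrightarrow> 0) (at 0)"
        using D unfolding has_derivative_at by simp
      moreover have "filterlim (\<lambda>t::real. t *\<^sub>R v) (at 0) (at 0)"
        unfolding filterlim_at using False
        by (auto intro!: tendsto_eq_intros simp: eventually_at_filter)
      ultimately have "((\<lambda>t::real. norm (eact A (x + t *\<^sub>R v) - eact A x - D (t *\<^sub>R v)) / norm (t *\<^sub>R v)) \<longlongrightarrow> 0) (at 0)"
        by (rule filterlim_compose)
      then have "((\<lambda>t::real. norm v * (norm (eact A (x + t *\<^sub>R v) - eact A x - D (t *\<^sub>R v)) / norm (t *\<^sub>R v))) \<longlongrightarrow> norm v * 0) (at 0)"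
        by (intro tendsto_mult tendsto_const)
      moreover have "\<forall>\<^sub>F t in at 0. norm v * (norm (eact A (x + t *\<^sub>R v) - eact A x - D (t *\<^sub>R v)) / norm (t *\<^sub>R v))
          = norm ((eact A (x + t *\<^sub>R v) - eact A x) /\<^sub>R t - D v)"
        unfolding eventually_at_filter
      proof (intro always_eventually allI impI)
        fix t :: real assume t: "t \<noteq> 0"
        have "(eact A (x + t *\<^sub>R v) - eact A x) /\<^sub>R t - D v = (eact A (x + t *\<^sub>R v) - eact A x - D (t *\<^sub>R v)) /\<^sub>R t"
          using t by (simp add: D.scaleR scaleR_diff_right)
        then show "norm v * (norm (eact A (x + t *\<^sub>R v) - eact A x - D (t *\<^sub>R v)) / norm (t *\<^sub>R v))
          = norm ((eact A (x + t *\<^sub>R v) - eact A x) /\<^sub>R t - D v)"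
          using False t by (simp only: norm_scaleR) (simp add: divide_inverse)
      qed
      ultimately have "((\<lambda>t. norm ((eact A (x + t *\<^sub>R v) - eact A x) /\<^sub>R t - D v)) \<longlongrightarrow> 0) (at 0)"
        by (simp add: filterlim_cong)
      then show ?thesis by (simp add: tendsto_norm_zero_iff LIM_zero_iff)
    qed
    then have 1: "((\<lambda>t. (norm ((eact A (x + t *\<^sub>R v) - eact A x) /\<^sub>R t))\<^sup>2) \<longlongrightarrow> (norm (D v))\<^sup>2) (at 0)"
      by (intro tendsto_intros)
    have hc: "((\<lambda>t. hgt A (x + t *\<^sub>R v)) \<longlongrightarrow> hgt A x) (at 0)"
      using continuous_on_tendsto_compose[OF continuous_hgt[of UNIV A] l0] by simp
    then have ev: "\<forall>\<^sub>F t in at 0. hgt A (x + t *\<^sub>R v) > 0"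
      using h by (rule order_tendstoD(1))
    have "((\<lambda>t. (norm v)\<^sup>2 / (hgt A (x + t *\<^sub>R v) * hgt A x)) \<longlongrightarrow> (norm v)\<^sup>2 / (hgt A x * hgt A x)) (at 0)"
      using h by (intro tendsto_intros hc) auto
    moreover have "\<forall>\<^sub>F t in at 0. (norm v)\<^sup>2 / (hgt A (x + t *\<^sub>R v) * hgt A x) = (norm ((eact A (x + t *\<^sub>R v) - eact A x) /\<^sub>R t))\<^sup>2"
      using ev eventually_neq_at_within[of "0::real" 0 UNIV]
    proof eventually_elim
      case (elim t)
      have "(norm ((eact A (x + t *\<^sub>R v) - eact A x) /\<^sub>R t))\<^sup>2 = (norm (eact A (x + t *\<^sub>R v) - eact A x))\<^sup>2 / t\<^sup>2"
        by (simp add: power_mult_distrib power_inverse divide_inverse mult.commute)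
      also have "\<dots> = (norm (t *\<^sub>R v))\<^sup>2 / (hgt A (x + t *\<^sub>R v) * hgt A x) / t\<^sup>2"
        using eact_dist[OF A, of "x + t *\<^sub>R v" x] elim h by simp
      also have "\<dots> = (norm v)\<^sup>2 / (hgt A (x + t *\<^sub>R v) * hgt A x)"
        using elim by (simp add: power_mult_distrib)
      finally show ?case by simp
    qed
    ultimately have "((\<lambda>t. (norm ((eact A (x + t *\<^sub>R v) - eact A x) /\<^sub>R t))\<^sup>2) \<longlongrightarrow> (norm v)\<^sup>2 / (hgt A x * hgt A x)) (at 0)"
      by (rule Lim_transform_eventually)
    then have "(norm (D v))\<^sup>2 = (norm v / hgt A x)\<^sup>2"
      using tendsto_unique[OF _ 1] by (simp add: power_divide power2_eq_square)
    then show ?thesis using h by - (rule power2_eq_imp_eq, auto)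
  qed (simp add: D.zero)
  have "onorm D = 1 / hgt A x"
  proof (rule antisym)
    show "onorm D \<le> 1 / hgt A x" using h by (intro onorm_bound) (auto simp: nD)
    \<comment> \<open>Some unit vector, available since index types are nonempty; it shows that the
      operator norm attains the bound.\<close>
    define e :: "real ^ 'd" where "e = axis undefined 1"
    have "norm (D e) \<le> onorm D * norm e"
      by (rule onorm[OF has_derivative_bounded_linear[OF D]])
    then show "1 / hgt A x \<le> onorm D" by (simp add: nD e_def)
  qed
  then show ?thesis by (simp add: distortion_def fd)
qed

lemma distortion_eact: "A \<in> lorp \<Longrightarrow> hgt A x > 0 \<Longrightarrow> distortion (eact A) x = 1 / hgt A x"
  by (rule distortion_eact_local[where S=UNIV]) auto

lemma nhat_Fin: "nhat (Fin y) = (2 / (1 + (norm y)\<^sup>2)) *\<^sub>R null_of (Fin y)" for y :: "real ^ 'd::finite"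
proof -
  define c where "c = 1 + (norm y)\<^sup>2"
  have c: "c > 0" by (simp add: c_def add_pos_nonneg)
  have t: "tm (null_of (Fin y)) = c / 2" by (simp add: mvec_def c_def)
  have "nhat (Fin y) = (2 / c) *\<^sub>R (c / 2) *\<^sub>R nhat (Fin y)" using c by simp
  also have "(c / 2) *\<^sub>R nhat (Fin y) = null_of (Fin y)"
    unfolding t[symmetric] by (rule null_of_nhat[symmetric])
  finally show ?thesis by (simp only: c_def)
qed

section \<open>The coding semiconjugacy\<close>

locale coded = kleinian \<Gamma> + coding \<Gamma> \<mu> \<Delta>\<^sub>0 \<Delta> \<gamma> T \<Lambda>m C\<^sub>1 lam eps lam'
  for \<Gamma> :: "'d::finite lmat set" and \<mu> \<Delta>\<^sub>0 \<Delta> \<gamma> T \<Lambda>m C\<^sub>1 lam eps lam'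
begin

abbreviation \<Delta>u :: "(real ^ 'd) set" where "\<Delta>u \<equiv> \<Union>j. \<Delta> j"

abbreviation ginv :: "nat \<Rightarrow> 'd lmat" where "ginv j \<equiv> lorentz_inv (\<gamma> j)"

lemma \<gamma>_lorp: "\<gamma> j \<in> lorp" and ginv_in: "ginv j \<in> \<Gamma>" and ginv_lorp: "ginv j \<in> lorp"
  and matrix_inv_\<gamma>: "matrix_inv (\<gamma> j) = ginv j"
  using \<gamma>_in[of j] inv_in[of "\<gamma> j"] lorp lorp_inv(2) by auto

text \<open>Collects the local form of the coding map: a boundary isometry whose factor
  \<open>hgt\<close> is the exponential of minus the roof function, and is at most
  \<open>lam\<close> by the contraction of the inverse branch.\<close>

lemma coding_point:
  assumes x: "x \<in> \<Delta> j"
  shows "bact (ginv j) (Fin x) = Fin (T x)" "eact (ginv j) x = T x" "T x \<in> \<Delta>\<^sub>0" "hgt (ginv j) x > 0"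
    "ginv j *v null_of (Fin x) = hgt (ginv j) x *\<^sub>R null_of (Fin (T x))"
    "roof T x = - ln (hgt (ginv j) x)" "hgt (ginv j) x \<le> lam"
proof -
  show 1: "bact (ginv j) (Fin x) = Fin (T x)" using T_eq[OF x] by (simp add: matrix_inv_\<gamma>)
  show 2: "eact (ginv j) x = T x" by (simp add: eact_def 1)
  have "Fin x \<in> bact (\<gamma> j) ` Fin ` \<Delta>\<^sub>0" using x \<Delta>_eq[of j] by blast
  then obtain y where y: "y \<in> \<Delta>\<^sub>0" "Fin x = bact (\<gamma> j) (Fin y)" by auto
  then have "bact (ginv j) (Fin x) = Fin y" using bact_inv(2)[OF \<gamma>_lorp] by simp
  then show 3: "T x \<in> \<Delta>\<^sub>0" using y 1 by simp
  show 4: "hgt (ginv j) x > 0" by (rule hgt_pos(1)[OF ginv_lorp 1])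
  show 5: "ginv j *v null_of (Fin x) = hgt (ginv j) x *\<^sub>R null_of (Fin (T x))"
    by (rule hgt_pos(2)[OF ginv_lorp 1])
  have "eact (ginv j) y = T y" if "y \<in> \<Delta> j" for y
    using T_eq[OF that] by (simp add: eact_def matrix_inv_\<gamma>[symmetric] flip: T_eq[OF that])
  then have "distortion T x = 1 / hgt (ginv j) x"
    by (intro distortion_eact_local[OF ginv_lorp 4 \<Delta>_open x]) simp
  then show "roof T x = - ln (hgt (ginv j) x)" using 4 by (simp add: roof_def ln_div)
  have "\<gamma> j *v (ginv j *v null_of (Fin x)) = null_of (Fin x)" by (rule lorp_inv(3)[OF \<gamma>_lorp])
  then have e: "null_of (Fin x) = hgt (ginv j) x *\<^sub>R (\<gamma> j *v null_of (Fin (T x)))"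
    unfolding 5 by (simp only: matrix_vector_mult_scaleR)
  \<comment> \<open>The chain rule for the factor: applying \<open>\<gamma> j\<close> to the image
    null vector returns the original one, so the two factors multiply to 1.\<close>
  have "1 = hgt (ginv j) x * hgt (\<gamma> j) (T x)"
    unfolding hgt_null_of[of x, symmetric] e hgt_def[of "\<gamma> j"]
    by (simp only: vector_scaleR_component real_scaleR_def right_diff_distrib)
  then have h: "hgt (\<gamma> j) (T x) = 1 / hgt (ginv j) x" using 4 by (simp add: field_simps)
  have "distortion (eact (\<gamma> j)) (T x) = hgt (ginv j) x"
    using 4 by (subst distortion_eact[OF \<gamma>_lorp]) (simp_all add: h)
  then show "hgt (ginv j) x \<le> lam" using contraction[OF 3, of j] by simp
qed

text \<open>The uniform lower bound makes return times grow at least linearly, so flow times are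
  never exhausted by infinitely many returns.\<close>

lemma roof_ge: "x \<in> \<Delta>u \<Longrightarrow> roof T x \<ge> - ln lam" and minus_ln_lam_pos: "- ln lam > 0"
proof -
  show "x \<in> \<Delta>u \<Longrightarrow> roof T x \<ge> - ln lam"
    using coding_point constants by fastforce
  show "- ln lam > 0" using constants by simp
qed

lemma skew_map_eq:
  assumes "x \<in> \<Delta> j"
  shows "skew_map \<Delta> \<gamma> (x, \<eta>) = (T x, bact (ginv j) \<eta>)"
proof -
  have "(THE j. x \<in> \<Delta> j) = j"
    using assms \<Delta>_disjoint by (intro the_equality) (auto simp: disjoint_family_on_def)
  then show ?thesis using coding_point(2)[OF assms] by (simp add: skew_map_def Let_def matrix_inv_\<gamma>)
qed

abbreviation X :: "((real ^ 'd) \<times> (real ^ 'd) bdry) set" where "X \<equiv> skew_space \<Gamma> \<Delta> \<Lambda>m"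

abbreviation F :: "(real ^ 'd) \<times> (real ^ 'd) bdry \<Rightarrow> (real ^ 'd) \<times> (real ^ 'd) bdry" where "F \<equiv> skew_map \<Delta> \<gamma>"

definition lv :: "(real ^ 'd) \<times> (real ^ 'd) bdry \<Rightarrow> real \<Rightarrow> 'd uvec" where
  "lv q s = hinv (lift_map (q, s))"

lemma X_D: "q \<in> X \<Longrightarrow> fst q \<in> \<Delta>u \<and> Fin (fst q) \<noteq> snd q \<and> Fin (fst q) \<in> limit_set \<Gamma>"
  using \<Lambda>m_disjoint \<Delta>_subset closure_subset[of \<Delta>\<^sub>0] by (fastforce simp: skew_space_def Lambda_plus_def)

lemma lift_map_eq: "lift_map (q, s) = (Fin (fst q), snd q, s + ln (1 + (norm (fst q))\<^sup>2))"
  by (cases q) (simp add: lift_map_def)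

lemma hopf_inv_lift: "q \<in> X \<Longrightarrow> hopf_inv (lift_map (q, s)) = lv q s"
  using X_D[of q] by (simp add: lift_map_eq lv_def hopf_inv_eq)

lemma lv_UT: "q \<in> X \<Longrightarrow> lv q s \<in> UT"
  using X_D[of q] by (simp add: lift_map_eq lv_def hinv_UT)

lemma lv_flow: "q \<in> X \<Longrightarrow> geodesic_flow t (lv q s) = lv q (s + t)"
  using X_D[of q] by (simp add: lift_map_eq lv_def geodesic_flow_hinv add_ac)

lemma lv_plus: "fst (lv q s) + snd (lv q s) = (exp s * (1 + (norm (fst q))\<^sup>2)) *\<^sub>R nhat (Fin (fst q))"
  unfolding lv_def lift_map_eq hinv_plus by (simp add: exp_add add_pos_nonneg)

text \<open>One return of the base map with the roof subtracted from the time is the action of the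
  group element \<open>ginv j\<close> upstairs, so the identification at the roof disappears in the
  quotient.\<close>

lemma lv_step:
  assumes q: "q \<in> X"
  shows "\<exists>g\<in>\<Gamma>. lv (F q) (s - roof T (fst q)) = gact g (lv q s)"
proof -
  obtain x \<eta> where qx: "q = (x, \<eta>)" by (cases q)
  obtain j where j: "x \<in> \<Delta> j" using X_D[OF q] qx by auto
  have ne: "Fin x \<noteq> \<eta>" using X_D[OF q] qx by auto
  note c = coding_point[OF j]
  have k: "1 + (norm y)\<^sup>2 > 0" for y :: "real ^ 'd" by (simp add: add_pos_nonneg)
  have "ginv j *v nhat (Fin x) = (2 / (1 + (norm x)\<^sup>2) * hgt (ginv j) x) *\<^sub>R null_of (Fin (T x))"
    unfolding nhat_Fin matrix_vector_mult_scaleR c(5) by simp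
  moreover have "tm (null_of (Fin (T x))) = (1 + (norm (T x))\<^sup>2) / 2" by (simp add: mvec_def)
  ultimately have "tm (ginv j *v nhat (Fin x)) = hgt (ginv j) x * (1 + (norm (T x))\<^sup>2) / (1 + (norm x)\<^sup>2)"
    by (simp del: null_of.simps)
  then have "ln (tm (ginv j *v nhat (Fin x))) = ln (hgt (ginv j) x) + ln (1 + (norm (T x))\<^sup>2) - ln (1 + (norm x)\<^sup>2)"
    using k[of x] k[of "T x"] c(4) by (simp add: ln_div ln_mult)
  \<comment> \<open>The logarithms of 1 + |x|^2 and 1 + |T x|^2 come from passing between
    \<open>nhat\<close> and \<open>null_of\<close>; the shift in \<open>lift_map\<close> cancels
    them, leaving just the roof.\<close>
  then have eq: "s + ln (1 + (norm x)\<^sup>2) + ln (tm (ginv j *v nhat (Fin x))) = s - roof T x + ln (1 + (norm (T x))\<^sup>2)"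
    by (simp add: c(6))
  then have "gact (ginv j) (lv q s) = lv (F q) (s - roof T (fst q))"
    unfolding lv_def qx lift_map_eq skew_map_eq[OF j] fst_conv snd_conv gact_hinv[OF ginv_lorp ne] c(1) eq
    by simp
  then show ?thesis using ginv_in by metis
qed

abbreviation Rn :: "nat \<Rightarrow> (real ^ 'd) \<times> (real ^ 'd) bdry \<Rightarrow> real" where "Rn \<equiv> roof_sum \<Delta> \<gamma> T"

lemma Rn_0 [simp]: "Rn 0 q = 0" and Rn_Suc: "Rn (Suc n) q = Rn n q + roof T (fst ((F ^^ n) q))"
  by (simp_all add: roof_sum_def)

lemma lv_iterate:
  assumes "\<And>i. i \<le> n \<Longrightarrow> (F ^^ i) q \<in> X"
  shows "\<exists>g\<in>\<Gamma>. lv ((F ^^ n) q) (s - Rn n q) = gact g (lv q s)"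
  using assms
proof (induction n)
  case 0 then show ?case using one_in by (auto intro!: bexI[of _ "mat 1"])
next
  case (Suc n)
  then obtain g where g: "g \<in> \<Gamma>" "lv ((F ^^ n) q) (s - Rn n q) = gact g (lv q s)" by auto
  obtain h where h: "h \<in> \<Gamma>" "lv (F ((F ^^ n) q)) (s - Rn n q - roof T (fst ((F ^^ n) q))) = gact h (lv ((F ^^ n) q) (s - Rn n q))"
    using lv_step[of "(F ^^ n) q"] Suc.prems by (meson le_SucI order_refl)
  then have "lv ((F ^^ Suc n) q) (s - Rn (Suc n) q) = gact (h ** g) (lv q s)"
    by (simp add: g(2) gact_mult Rn_Suc diff_diff_eq)
  then show ?case using mult_in[OF h(1) g(1)] by blast
qed

lemma Rn_mono:
  assumes "\<And>i. i \<le> n' \<Longrightarrow> (F ^^ i) q \<in> X" "n \<le> n'"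
  shows "Rn n q \<le> Rn n' q"
  using assms(2,1)
proof (induction n' rule: dec_induct)
  case (step k)
  then have "roof T (fst ((F ^^ k) q)) \<ge> - ln lam" using X_D by (intro roof_ge) auto
  then show ?case using step minus_ln_lam_pos by (force simp: Rn_Suc)
qed simp

text \<open>The time \<open>s + t\<close> lies in the half-open interval from \<open>Rn n q\<close>
  to \<open>Rn (Suc n) q\<close>, and these are disjoint because the roof sums increase along the
  orbit.\<close>

lemma flow_index_unique:
  assumes "flow_index \<Gamma> \<Delta> \<gamma> \<Lambda>m T t (q, s) n" "flow_index \<Gamma> \<Delta> \<gamma> \<Lambda>m T t (q, s) n'"
  shows "n = n'"
proof -
  have "\<not> n < n'" if "flow_index \<Gamma> \<Delta> \<gamma> \<Lambda>m T t (q, s) n" "flow_index \<Gamma> \<Delta> \<gamma> \<Lambda>m T t (q, s) n'" for n n'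
  proof
    assume "n < n'"
    then have "Rn (Suc n) q \<le> Rn n' q" using that by (intro Rn_mono) (auto simp: flow_index_def)
    then show False using that by (auto simp: flow_index_def Rn_Suc)
  qed
  then show ?thesis using assms by (meson linorder_neqE_nat)
qed

lemma factor_map_lv: "q \<in> X \<Longrightarrow> factor_map \<Gamma> (q, s) = orb \<Gamma> (lv q s)"
  by (simp add: factor_map_def hopf_inv_lift)

theorem semiconjugacy:
  assumes p: "p \<in> flow_dom \<Gamma> \<Delta> \<gamma> \<Lambda>m T t"
  shows "factor_map \<Gamma> (skew_flow \<Gamma> \<Delta> \<gamma> \<Lambda>m T t p) = T1M_flow t (factor_map \<Gamma> p)"
proof -
  obtain q s where ps: "p = (q, s)" by (cases p)
  obtain n where n: "flow_index \<Gamma> \<Delta> \<gamma> \<Lambda>m T t (q, s) n" and q: "q \<in> X"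
    using p by (auto simp: flow_dom_def ps susp_space_def)
  have it: "\<And>i. i \<le> n \<Longrightarrow> (F ^^ i) q \<in> X" using n by (auto simp: flow_index_def)
  have "(THE n. flow_index \<Gamma> \<Delta> \<gamma> \<Lambda>m T t (q, s) n) = n"
    using n flow_index_unique by blast
  then have "skew_flow \<Gamma> \<Delta> \<gamma> \<Lambda>m T t p = ((F ^^ n) q, s + t - Rn n q)"
    by (simp add: skew_flow_def ps Let_def)
  then have "factor_map \<Gamma> (skew_flow \<Gamma> \<Delta> \<gamma> \<Lambda>m T t p) = orb \<Gamma> (lv ((F ^^ n) q) (s + t - Rn n q))"
    using it[of n] by (simp add: factor_map_lv)
  also have "\<dots> = orb \<Gamma> (lv q (s + t))"
    using lv_iterate[OF it, of n "s + t"] by (auto simp: orb_gact_eq)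
  also have "\<dots> = orb \<Gamma> (geodesic_flow t (lv q s))" using q by (simp add: lv_flow)
  also have "\<dots> = T1M_flow t (orb \<Gamma> (lv q s))"
    by (simp add: T1M_flow_def orb_gact image_image geodesic_flow_gact)
  finally show ?thesis using q by (simp add: ps factor_map_lv)
qed

end

section \<open>Quasi-invariance of the Patterson-Sullivan measure\<close>

lemma act_origin: "g \<in> lorp \<Longrightarrow> act g origin \<in> hspace \<and> hyp_of (act g origin) = g *v org"
  using half_of_facts[of "g *v org"] by (simp add: act_def lorp_lform) (simp add: lorp_def)

text \<open>Moving the base point to \<open>act g origin\<close> both pushes the measure forward by
  \<open>g\<close> and multiplies it by a density, so the push-forward is absolutely continuous with
  respect to \<open>\<mu>\<close>.\<close>

lemma patterson_sullivan_facts: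
  assumes ps: "patterson_sullivan \<Gamma> \<mu>" and lorp: "\<Gamma> \<subseteq> lorp"
  shows "finite_measure \<mu>" "sets \<mu> = sets borel" "- limit_set \<Gamma> \<in> null_sets \<mu>"
    "\<And>g N. g \<in> \<Gamma> \<Longrightarrow> N \<in> null_sets \<mu> \<Longrightarrow> bact g -` N \<in> null_sets \<mu>"
proof -
  obtain M where M: "conformal_density \<Gamma> (critical_exponent \<Gamma>) M" "M origin = \<mu>"
    using ps by (auto simp: patterson_sullivan_def)
  have "finite_measure \<mu> \<and> sets \<mu> = sets borel \<and> emeasure \<mu> (- limit_set \<Gamma>) = 0"
    using M unfolding conformal_density_def by (metis origin_hspace)
  then show fin: "finite_measure \<mu>" and sets: "sets \<mu> = sets borel" and "- limit_set \<Gamma> \<in> null_sets \<mu>"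
    using sets_limit_set[of \<Gamma>] by (auto simp: null_sets_def borel_comp)
  fix g N assume g: "g \<in> \<Gamma>" and N: "N \<in> null_sets \<mu>"
  have gl: "g \<in> lorp" using g lorp by auto
  have NB: "N \<in> sets borel" using N sets by auto
  have bm: "bact g \<in> measurable \<mu> borel" using borel_bact[OF gl] sets by (simp cong: measurable_cong_sets)
  have z: "act g origin \<in> hspace" using act_origin[OF gl] by simp
  have d1: "distr \<mu> borel (bact g) = M (act g origin)"
    using M g origin_hspace unfolding conformal_density_def by metis
  have d2: "M (act g origin) = density \<mu> (\<lambda>\<xi>. ennreal (exp (- critical_exponent \<Gamma> * busemann \<xi> (act g origin) origin)))"
    using M z origin_hspace unfolding conformal_density_def by metis
  have "(\<lambda>\<xi>. ennreal (exp (- critical_exponent \<Gamma> * busemann \<xi> (act g origin) origin))) \<in> borel_measurable borel"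
    unfolding busemann_nhat[OF z origin_hspace] by measurable
  then have dm: "(\<lambda>\<xi>. ennreal (exp (- critical_exponent \<Gamma> * busemann \<xi> (act g origin) origin))) \<in> borel_measurable \<mu>"
    using sets by (simp cong: measurable_cong_sets)
  have "N \<in> null_sets (density \<mu> (\<lambda>\<xi>. ennreal (exp (- critical_exponent \<Gamma> * busemann \<xi> (act g origin) origin))))"
    using N AE_not_in[OF N] unfolding null_sets_density_iff[OF dm] by (auto elim: AE_mp)
  then have "emeasure (distr \<mu> borel (bact g)) N = 0" by (simp add: d1 d2 null_sets_def)
  then have "emeasure \<mu> (bact g -` N \<inter> space \<mu>) = 0" using emeasure_distr[OF bm NB] by simp
  moreover have "space \<mu> = UNIV" using sets_eq_imp_space_eq[OF sets] by simp
  ultimately show "bact g -` N \<in> null_sets \<mu>"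
    using measurable_sets[OF bm NB] by (simp add: null_sets_def)
qed

section \<open>Minimality\<close>

lemma nhat_Infty: "nhat (Infty :: (real ^ 'a::finite) bdry) = null_of Infty"
proof -
  have "tm (null_of Infty :: 'a mink) = 1" by (simp add: mvec_def)
  then show ?thesis using null_of_nhat[of "Infty :: (real ^ 'a) bdry"] by (simp del: null_of.simps)
qed

text \<open>Seen from a point just above \<open>x\<close>, every boundary point far from
  \<open>x\<close> has a very negative pairing; a lower bound on the pairing therefore forces
  \<zeta> to be finite and close to \<open>x\<close>.\<close>

lemma near_boundary_point:
  assumes z: "lform (nhat \<zeta>) (hyp_of (x, y)) \<ge> - 1 / \<kappa>" and y: "0 < y" "y < \<kappa> / 4"
  obtains w where "\<zeta> = Fin w" "(norm (x - w))\<^sup>2 \<le> 2 * y * (1 + 2 * (norm x)\<^sup>2) / \<kappa>"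
proof (cases \<zeta>)
  case Infty
  have "- 1 / y \<ge> - 1 / \<kappa>"
    using z unfolding Infty nhat_Infty lform_null_hyp(2)[OF y(1)] .
  then have "\<kappa> \<le> y" using y by (simp add: field_simps)
  then show ?thesis using y by simp
next
  case (Fin w)
  define n k where "n = (norm (x - w))\<^sup>2" and "k = 1 + (norm w)\<^sup>2"
  have k: "k > 0" by (simp add: k_def add_pos_nonneg)
  have \<kappa>: "\<kappa> > 0" using y by simp
  have "- 1 / \<kappa> \<le> 2 / k * (- (n + y\<^sup>2) / (2 * y))"
    using z unfolding Fin nhat_Fin lform_lin lform_null_hyp(1)[OF y(1)] n_def k_def .
  also have "\<dots> = - ((n + y\<^sup>2) / (k * y))" using k y by (simp add: field_simps)
  finally have "(n + y\<^sup>2) / (k * y) \<le> 1 / \<kappa>" by simp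
  then have "\<kappa> * (n + y\<^sup>2) \<le> k * y" using k y \<kappa> by (simp add: field_simps)
  moreover have "\<kappa> * n \<le> \<kappa> * (n + y\<^sup>2)" using \<kappa> by simp
  ultimately have 1: "\<kappa> * n \<le> k * y" by linarith
  have "norm w \<le> norm x + norm (x - w)"
    using norm_triangle_ineq4[of x "x - w"] by simp
  then have "(norm w)\<^sup>2 \<le> (norm x + norm (x - w))\<^sup>2" by (intro power_mono) auto
  also have "\<dots> \<le> 2 * (norm x)\<^sup>2 + 2 * n"
    unfolding n_def using zero_le_power2[of "norm x - norm (x - w)"]
    by (simp add: power2_eq_square algebra_simps)
  finally have "k * y \<le> (1 + 2 * (norm x)\<^sup>2 + 2 * n) * y" using y unfolding k_def by (intro mult_right_mono) auto
  \<comment> \<open>The hypothesis on \<open>y\<close> lets the term in \<open>n\<close> on the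
    right be absorbed by half of the left side.\<close>
  moreover have "2 * n * y \<le> 2 * n * (\<kappa> / 4)" using y by (intro mult_left_mono) (auto simp: n_def)
  ultimately have "\<kappa> * n \<le> 2 * (y * (1 + 2 * (norm x)\<^sup>2))" using 1 by (simp add: algebra_simps)
  then have "n \<le> 2 * y * (1 + 2 * (norm x)\<^sup>2) / \<kappa>" using \<kappa> by (simp add: field_simps)
  then show ?thesis using that Fin by (simp add: n_def)
qed

text \<open>If \<open>g n\<close> sends the base point towards \<open>x0\<close>, a boundary point
  whose normalized null vector is not shrunk much by \<open>g n\<close> is also sent near
  \<open>x0\<close>. Of two distinct boundary points at least one has this property, and
  \<open>h\<close> supplies a second point of the orbit.\<close>

lemma (in lorentz_group) orbit_near_limit_point:
  assumes x0: "Fin x0 \<in> limit_set \<Gamma>" and h: "h \<in> \<Gamma>" "bact h \<xi> \<noteq> \<xi>" and e: "e > 0"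
  shows "\<exists>g\<in>\<Gamma>. \<exists>w\<in>ball x0 e. bact g \<xi> = Fin w"
proof -
  obtain g where g: "range g \<subseteq> \<Gamma>" "(\<lambda>n::nat. act (g n) origin) \<longlonglongrightarrow> (x0, 0)"
    using x0 by (auto simp: limit_set_def tends_bdry_def)
  define x y where "x n = fst (act (g n) origin)" and "y n = snd (act (g n) origin)" for n
  have lims: "x \<longlonglongrightarrow> x0" "y \<longlonglongrightarrow> 0"
    unfolding x_def y_def using tendsto_fst[OF g(2)] tendsto_snd[OF g(2)] by simp_all
  have gl: "g n \<in> lorp" "g n \<in> \<Gamma>" for n using g(1) lorp by auto
  have hy: "hyp_of (x n, y n) = g n *v org" "y n > 0" for n
    using act_origin[OF gl(1)[of n]] by (simp_all add: x_def y_def hspace_def)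
  define l where "l = - lform (nhat \<xi>) (nhat (bact h \<xi>))"
  have l: "l > 0" using lform_nhat_neg[of \<xi> "bact h \<xi>"] h by (simp add: l_def)
  \<comment> \<open>Normalized null vectors pair to at most 2 in absolute value, so the stretching
    factors of the two points have product at least l / 2; the square root bounds one of
    them.\<close>
  define \<kappa> where "\<kappa> = sqrt (l / 2)"
  have \<kappa>: "\<kappa> > 0" "\<kappa> * \<kappa> = l / 2" using l by (simp_all add: \<kappa>_def)
  define M where "M = norm x0 + 1"
  \<comment> \<open>Chosen so that at height \<open>B\<close> over a point of norm at most
    \<open>M\<close> the estimate of \<open>near_boundary_point\<close> is exactly the square of
    \<open>e / 2\<close>.\<close>
  define B where "B = \<kappa> * (e / 2)\<^sup>2 / (2 * (1 + 2 * M\<^sup>2))"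
  have M1: "1 + 2 * M\<^sup>2 > 0" by (simp add: add_pos_nonneg)
  have B: "B > 0" unfolding B_def using \<kappa>(1) e M1 by (intro divide_pos_pos mult_pos_pos) auto
  have "\<forall>\<^sub>F n in sequentially. dist (x n) x0 < min 1 (e / 2)"
    using lims(1) e by (intro tendstoD) auto
  moreover have "\<forall>\<^sub>F n in sequentially. y n < min (\<kappa> / 4) B"
    using lims(2) \<kappa>(1) B by (intro order_tendstoD(2)) auto
  ultimately have "\<forall>\<^sub>F n in sequentially. dist (x n) x0 < min 1 (e / 2) \<and> y n < min (\<kappa> / 4) B"
    by (rule eventually_conj)
  then obtain n where n: "dist (x n) x0 < 1" "dist (x n) x0 < e / 2" "y n < \<kappa> / 4" "y n < B"
    by (auto simp: eventually_sequentially)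
  define t where "t \<zeta> = tm (g n *v nhat \<zeta>)" for \<zeta>
  have t: "t \<zeta> > 0" "g n *v nhat \<zeta> = t \<zeta> *\<^sub>R nhat (bact (g n) \<zeta>)" for \<zeta>
    unfolding t_def using lorp_nhat[OF gl(1)] by blast+
  have near: "\<exists>w\<in>ball x0 e. bact (g n) \<zeta> = Fin w" if "t \<zeta> \<ge> \<kappa>" for \<zeta>
  proof -
    have "lform (g n *v nhat \<zeta>) (g n *v org) = -1" by (simp add: lorp_lform[OF gl(1)])
    then have "t \<zeta> * lform (nhat (bact (g n) \<zeta>)) (hyp_of (x n, y n)) = -1"
      unfolding t(2) hy(1) by simp
    then have "lform (nhat (bact (g n) \<zeta>)) (hyp_of (x n, y n)) = - 1 / t \<zeta>" using t(1)[of \<zeta>] by (simp add: field_simps)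
    then have "lform (nhat (bact (g n) \<zeta>)) (hyp_of (x n, y n)) \<ge> - 1 / \<kappa>"
      using that \<kappa>(1) by (simp add: frac_le)
    then obtain w where w: "bact (g n) \<zeta> = Fin w" "(norm (x n - w))\<^sup>2 \<le> 2 * y n * (1 + 2 * (norm (x n))\<^sup>2) / \<kappa>"
      using near_boundary_point hy(2) n(3) by metis
    have "norm (x n) \<le> M" using n(1) norm_triangle_ineq2[of "x n" x0] by (simp add: M_def dist_norm)
    then have "1 + 2 * (norm (x n))\<^sup>2 \<le> 1 + 2 * M\<^sup>2" by (simp add: power_mono)
    then have "2 * y n * (1 + 2 * (norm (x n))\<^sup>2) / \<kappa> \<le> 2 * y n * (1 + 2 * M\<^sup>2) / \<kappa>"
      using hy(2)[of n] \<kappa>(1) by (intro divide_right_mono mult_left_mono) auto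
    also have "\<dots> < 2 * B * (1 + 2 * M\<^sup>2) / \<kappa>"
      using n(4) \<kappa>(1) M1 by (intro divide_strict_right_mono mult_strict_right_mono) auto
    also have "\<dots> = (e / 2)\<^sup>2"
    proof -
      define k where "k = 1 + 2 * M\<^sup>2"
      show ?thesis using \<kappa>(1) M1 unfolding B_def k_def[symmetric] by simp
    qed
    finally have "(norm (x n - w))\<^sup>2 < (e / 2)\<^sup>2" using w(2) by linarith
    then have "norm (x n - w) < e / 2" using e by - (rule power2_less_imp_less, auto)
    then have "dist x0 w < e" using n(2) dist_triangle[of x0 w "x n"] by (simp add: dist_norm norm_minus_commute)
    then show ?thesis using w(1) by auto
  qed
  \<comment> \<open>\<open>\<xi>\<close> itself may be the repelling direction of \<open>g n\<close>, but then \<open>bact h \<xi>\<close> is not.\<close>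
  have "t \<xi> * t (bact h \<xi>) \<ge> \<kappa> * \<kappa>"
  proof -
    have "l = - lform (g n *v nhat \<xi>) (g n *v nhat (bact h \<xi>))"
      by (simp add: l_def lorp_lform[OF gl(1)])
    also have "\<dots> = t \<xi> * t (bact h \<xi>) * - lform (nhat (bact (g n) \<xi>)) (nhat (bact (g n) (bact h \<xi>)))"
      unfolding t(2) by simp
    also have "\<dots> \<le> t \<xi> * t (bact h \<xi>) * 2"
      using future_lform_le[of "nhat (bact (g n) \<xi>)" "nhat (bact (g n) (bact h \<xi>))"] t(1)
      by (intro mult_left_mono) (auto simp: less_imp_le)
    finally show ?thesis by (simp add: \<kappa>(2))
  qed
  then have "t \<xi> \<ge> \<kappa> \<or> t (bact h \<xi>) \<ge> \<kappa>"
    using mult_strict_mono[of "t \<xi>" \<kappa> "t (bact h \<xi>)" \<kappa>] t(1) \<kappa>(1) by (force simp: not_le less_imp_le)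
  then consider "\<exists>w\<in>ball x0 e. bact (g n) \<xi> = Fin w" | "\<exists>w\<in>ball x0 e. bact (g n) (bact h \<xi>) = Fin w"
    using near by blast
  then show ?thesis
  proof cases
    case 2
    moreover have "h \<in> lorp" using h lorp by auto
    ultimately show ?thesis using gl[of n] h mult_in[OF gl(2)[of n] h(1)] by (metis bact_mult)
  qed (use gl in blast)
qed

text \<open>An isometry fixing \<open>Infty\<close> acts on the chart by a similarity: pairing with
  the fixed null vector shows that the conformal factor is constant.\<close>

lemma hgt_fix_Infty:
  assumes g: "g \<in> lorp" and fixed: "bact g Infty = Infty"
  shows "\<exists>c>0. \<forall>u. hgt g u = c"
proof -
  obtain c where c: "c > 0" "g *v null_of Infty = c *\<^sub>R null_of Infty"
    using lorp_null_of[OF g, of Infty] fixed by metis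
  have h: "lform v (null_of Infty) = - (tm v - v $ Inr False)" for v :: "'a mink"
    by (simp add: lform_def mvec_def)
  have "hgt g u = 1 / c" for u
  proof -
    have "lform (g *v null_of (Fin u)) (g *v null_of Infty) = lform (null_of (Fin u)) (null_of Infty)"
      by (rule lorp_lform[OF g])
    then have "c * hgt g u = 1" unfolding c(2) lform_lin h hgt_def hgt_null_of by (simp del: null_of.simps add: algebra_simps)
    then show ?thesis using c by (simp add: field_simps)
  qed
  then show ?thesis using c by (intro exI[of _ "1 / c"]) auto
qed

section \<open>Null sets of the coding measure and of the boundary measure\<close>

locale skew_system = coded \<Gamma> \<mu> \<Delta>\<^sub>0 \<Delta> \<gamma> T \<Lambda>m C\<^sub>1 lam eps lam'
  + cm: coding_measure \<Gamma> \<mu> \<Delta>\<^sub>0 \<Delta> T \<nu> + sm: skew_measure \<Gamma> \<Delta> \<gamma> \<Lambda>m \<nu> \<nu>'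
  for \<Gamma> :: "'d::finite lmat set" and \<mu> \<Delta>\<^sub>0 \<Delta> \<gamma> T \<Lambda>m C\<^sub>1 lam eps lam' \<nu> \<nu>' +
  assumes parab: "parabolic_fixed_point \<Gamma> Infty" and ps: "patterson_sullivan \<Gamma> \<mu>"
begin

lemmas \<mu>_facts = patterson_sullivan_facts[OF ps lorp]

lemma sets_\<Delta>u: "\<Delta>u \<in> sets borel"
  using \<Delta>_open by (intro borel_open) auto

lemma space_\<mu>: "space \<mu> = UNIV"
  using sets_eq_imp_space_eq[OF \<mu>_facts(2)] by simp

lemma \<nu>_\<Delta>u: "\<Delta>u \<in> sets \<nu>" "emeasure \<nu> (space \<nu> - \<Delta>u) = 0" "AE x in \<nu>. x \<in> \<Delta>u"
proof -
  show *: "\<Delta>u \<in> sets \<nu>" "emeasure \<nu> (space \<nu> - \<Delta>u) = 0"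
    using cm.invariant by (auto simp: invariant_ae_def)
  then have "space \<nu> - \<Delta>u \<in> null_sets \<nu>" by auto
  then show "AE x in \<nu>. x \<in> \<Delta>u" by (auto dest: AE_not_in)
qed

lemma sets_\<nu>_borel: "A \<in> sets borel \<Longrightarrow> A \<inter> \<Delta>u \<in> sets \<nu>"
proof -
  assume "A \<in> sets borel"
  then have "A \<inter> \<Delta>u \<in> sets borel" using sets_\<Delta>u by auto
  then show ?thesis unfolding cm.space_sets(2) sets_restrict_space
    using \<Delta>_subset by (intro image_eqI[of _ _ "A \<inter> \<Delta>u"]) auto
qed

text \<open>The limit points in the coding domain, where the density of \<open>\<nu>\<close> is
  bounded on both sides; measures on the chart and on the boundary are compared through this
  set.\<close>

definition lam_image :: "(real ^ 'd) set \<Rightarrow> (real ^ 'd) bdry set" where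
  "lam_image A = Fin ` (A \<inter> \<Delta>u) \<inter> limit_set \<Gamma>"

lemma sets_lam_image: "A \<in> sets borel \<Longrightarrow> lam_image A \<in> sets \<mu>"
  unfolding \<mu>_facts(2) lam_image_def using sets_\<Delta>u
  by (intro sets.Int sets_Fin_image sets_limit_set)

lemma \<nu>_bounds:
  obtains a b :: real where "a > 0" "b > 0"
    "\<And>A. A \<in> sets borel \<Longrightarrow> ennreal a * emeasure \<mu> (lam_image A) \<le> emeasure \<nu> (A \<inter> \<Delta>u)"
    "\<And>A. A \<in> sets borel \<Longrightarrow> emeasure \<nu> (A \<inter> \<Delta>u) \<le> ennreal b * emeasure \<mu> (lam_image A)"
proof -
  obtain f a b where f: "0 < a" "\<And>x. x \<in> \<Delta>\<^sub>0 \<Longrightarrow> Fin x \<in> limit_set \<Gamma> \<Longrightarrow> a \<le> f x \<and> f x \<le> b"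
    "\<And>A. A \<in> sets \<nu> \<Longrightarrow> emeasure \<nu> A = (\<integral>\<^sup>+\<xi>. ennreal (f (fin_part \<xi>)) * indicator (Fin ` A \<inter> limit_set \<Gamma>) \<xi> \<partial>\<mu>)"
    using cm.density by blast
  have *: "ennreal a * indicator (lam_image A) \<xi> \<le> ennreal (f (fin_part \<xi>)) * indicator (Fin ` (A \<inter> \<Delta>u) \<inter> limit_set \<Gamma>) \<xi>"
    "ennreal (f (fin_part \<xi>)) * indicator (Fin ` (A \<inter> \<Delta>u) \<inter> limit_set \<Gamma>) \<xi> \<le> ennreal (max 1 b) * indicator (lam_image A) \<xi>" for A \<xi>
  proof -
    have "a \<le> f (fin_part \<xi>) \<and> f (fin_part \<xi>) \<le> b" if "\<xi> \<in> lam_image A"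
    proof -
      obtain x where x: "\<xi> = Fin x" "x \<in> \<Delta>u" "Fin x \<in> limit_set \<Gamma>" using \<open>\<xi> \<in> lam_image A\<close> by (auto simp: lam_image_def)
      then have "x \<in> \<Delta>\<^sub>0" using \<Delta>_subset by blast
      then show ?thesis using f(2) x by simp
    qed
    then show "ennreal a * indicator (lam_image A) \<xi> \<le> ennreal (f (fin_part \<xi>)) * indicator (Fin ` (A \<inter> \<Delta>u) \<inter> limit_set \<Gamma>) \<xi>"
      "ennreal (f (fin_part \<xi>)) * indicator (Fin ` (A \<inter> \<Delta>u) \<inter> limit_set \<Gamma>) \<xi> \<le> ennreal (max 1 b) * indicator (lam_image A) \<xi>"
      unfolding lam_image_def[symmetric] by (auto simp: indicator_def intro!: ennreal_leI)
  qed
  have c: "(\<integral>\<^sup>+\<xi>. ennreal k * indicator (lam_image A) \<xi> \<partial>\<mu>) = ennreal k * emeasure \<mu> (lam_image A)" if "A \<in> sets borel" for k A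
    using sets_lam_image[OF that] by (rule nn_integral_cmult_indicator)
  show thesis
  \<comment> \<open>The upper bound \<open>b\<close> of the density is not known to be positive
    before a coded limit point is found, hence the maximum with 1.\<close>
  proof (rule that[of a "max 1 b"])
    fix A :: "(real ^ 'd) set" assume A: "A \<in> sets borel"
    show "ennreal a * emeasure \<mu> (lam_image A) \<le> emeasure \<nu> (A \<inter> \<Delta>u)"
      unfolding f(3)[OF sets_\<nu>_borel[OF A]] c[OF A, symmetric] by (intro nn_integral_mono *)
    show "emeasure \<nu> (A \<inter> \<Delta>u) \<le> ennreal (max 1 b) * emeasure \<mu> (lam_image A)"
      unfolding f(3)[OF sets_\<nu>_borel[OF A]] c[OF A, symmetric] by (intro nn_integral_mono *)
  qed (use f(1) in auto)
qed

lemma \<mu>_null_of_\<nu>_null: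
  assumes "A \<in> sets borel" "emeasure \<nu> (A \<inter> \<Delta>u) = 0"
  shows "lam_image A \<in> null_sets \<mu>"
proof -
  obtain a b :: real where ab: "a > 0" "ennreal a * emeasure \<mu> (lam_image A) \<le> emeasure \<nu> (A \<inter> \<Delta>u)"
    using \<nu>_bounds assms(1) by metis
  then have "ennreal a * emeasure \<mu> (lam_image A) = 0" using assms(2) by simp
  then have "emeasure \<mu> (lam_image A) = 0" using ab(1) by simp
  then show ?thesis using sets_lam_image[OF assms(1)] by auto
qed

text \<open>Without such a point the density formula would make the probability measure
  \<open>\<nu>\<close> vanish on a set of full measure.\<close>

lemma limit_point_in_\<Delta>u: "\<exists>x\<in>\<Delta>u. Fin x \<in> limit_set \<Gamma>"
proof (rule ccontr)
  assume "\<not> (\<exists>x\<in>\<Delta>u. Fin x \<in> limit_set \<Gamma>)"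
  then have "lam_image UNIV = {}" by (auto simp: lam_image_def)
  moreover obtain b :: real where "emeasure \<nu> (UNIV \<inter> \<Delta>u) \<le> ennreal b * emeasure \<mu> (lam_image UNIV)"
    using \<nu>_bounds[of thesis] by (metis (no_types, lifting) \<nu>_bounds sets.top space_borel)
  ultimately have "emeasure \<nu> \<Delta>u = 0" by simp
  then have "\<Delta>u \<in> null_sets \<nu>" using \<nu>_\<Delta>u by auto
  then have "AE x in \<nu>. x \<notin> \<Delta>u" by (rule AE_not_in)
  then have "AE x in \<nu>. False" using \<nu>_\<Delta>u(3) by eventually_elim simp
  then show False using cm.prob by (simp add: prob_space.AE_False)
qed

lemma words_in: "words \<gamma> n \<subseteq> \<Gamma>"
proof -
  have "foldr (\<lambda>i A. \<gamma> i ** A) l (mat 1) \<in> \<Gamma>" for l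
    by (induction l) (auto intro: one_in mult_in \<gamma>_in)
  then show ?thesis by (auto simp: words_def)
qed

text \<open>A finite point is moved by the parabolic element, whose only fixed point is
  \<open>Infty\<close>. If the whole group fixed \<open>Infty\<close>, all its elements would be
  similarities, and the derivative demanded by the non-integrability condition would be
  zero.\<close>

lemma no_fixed_point: "\<exists>h\<in>\<Gamma>. bact h \<xi> \<noteq> \<xi>"
proof (cases \<xi>)
  case (Fin x)
  obtain g where "g \<in> \<Gamma>" "bact g Infty = Infty" "parabolic g"
    using parab by (auto simp: parabolic_fixed_point_def stab_def)
  then show ?thesis using Fin unfolding parabolic_def by (intro bexI[of _ g]) auto
next
  case Infty
  show ?thesis
  proof (rule ccontr)
    assume "\<not> (\<exists>h\<in>\<Gamma>. bact h \<xi> \<noteq> \<xi>)"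
    then have fixed: "bact h Infty = Infty" if "h \<in> \<Gamma>" for h using Infty that by auto
    have const: "\<exists>k. \<forall>u. distortion (eact h) u = k" if hh: "h \<in> \<Gamma>" for h
    proof -
      have hl: "h \<in> lorp" using hh lorp by auto
      obtain c where "c > 0" "\<And>u. hgt h u = c" using hgt_fix_Infty[OF hl fixed[OF hh]] by auto
      then show ?thesis using distortion_eact[OF hl] by (intro exI[of _ "1 / c"]) auto
    qed
    obtain x where x: "x \<in> \<Delta>u" "Fin x \<in> limit_set \<Gamma>" using limit_point_in_\<Delta>u by auto
    then have xc: "x \<in> closure \<Delta>\<^sub>0" using \<Delta>_subset closure_subset[of \<Delta>\<^sub>0] by blast
    \<comment> \<open>Naming the body of the non-integrability condition keeps its quantifiers
      manageable; below, the constant 2 is an arbitrary choice of \<open>C > 1\<close>.\<close>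
    define \<Psi> where "\<Psi> r e0 C n P \<longleftrightarrow> finite P \<and> P \<subseteq> words \<gamma> n \<times> words \<gamma> n \<and>
     (\<forall>(g, h)\<in>P. \<forall>x\<in>\<Delta>\<^sub>0. distortion (eact g) x \<le> e0 / C \<and> distortion (eact h) x \<le> e0 / C) \<and>
     (\<forall>x\<in>closure \<Delta>\<^sub>0. Fin x \<in> limit_set \<Gamma> \<longrightarrow> (\<forall>e. norm e = 1 \<longrightarrow> (\<exists>(g, h)\<in>P. \<forall>y\<in>ball x r. \<exists>D.
        ((\<lambda>u. ln (distortion (eact g) u) - ln (distortion (eact h) u)) has_derivative D) (at y)
        \<and> \<bar>D e\<bar> \<ge> e0)))" for r e0 C :: real and n P
    have "\<exists>r>0. \<exists>e0>0. \<forall>C>1. \<exists>N. \<forall>n\<ge>N. \<exists>P. \<Psi> r e0 C n P"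
      using UNI unfolding uni_condition_def \<Psi>_def .
    then obtain r e0 where r: "r > 0" "e0 > 0" and "\<forall>C>1. \<exists>N. \<forall>n\<ge>N. \<exists>P. \<Psi> r e0 C n P" by blast
    then have "\<exists>N. \<forall>n\<ge>N. \<exists>P. \<Psi> r e0 2 n P" by simp
    then obtain n P where \<Psi>: "\<Psi> r e0 2 n P" by blast
    define e :: "real ^ 'd" where "e = axis undefined 1"
    have "norm e = 1" by (simp add: e_def)
    then have "\<exists>(g, h)\<in>P. \<forall>y\<in>ball x r. \<exists>D.
        ((\<lambda>u. ln (distortion (eact g) u) - ln (distortion (eact h) u)) has_derivative D) (at y)
        \<and> \<bar>D e\<bar> \<ge> e0"
      using \<Psi>[unfolded \<Psi>_def] xc x(2) by simp
    then obtain g h where gh: "(g, h) \<in> P" and all: "\<forall>y\<in>ball x r. \<exists>D.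
        ((\<lambda>u. ln (distortion (eact g) u) - ln (distortion (eact h) u)) has_derivative D) (at y)
        \<and> \<bar>D e\<bar> \<ge> e0"
      by (elim bexE case_prodE) simp
    have "x \<in> ball x r" using r(1) by simp
    from bspec[OF all this] obtain D where D: "((\<lambda>u. ln (distortion (eact g) u) - ln (distortion (eact h) u)) has_derivative D) (at x)"
      "\<bar>D e\<bar> \<ge> e0" by (elim exE conjE)
    have P: "P \<subseteq> words \<gamma> n \<times> words \<gamma> n" using \<Psi>[unfolded \<Psi>_def] by simp
    have "g \<in> \<Gamma>" "h \<in> \<Gamma>" using gh P words_in by blast+
    then obtain a b where "\<And>u. distortion (eact g) u = a" "\<And>u. distortion (eact h) u = b" using const by metis
    then have "((\<lambda>u. ln a - ln b) has_derivative D) (at x)" using D(1) by simp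
    then have "D = (\<lambda>_. 0)" using has_derivative_const has_derivative_unique by blast
    then show False using D(2) r(2) by simp
  qed
qed

text \<open>The form of minimality that is needed: the coding domain is open and contains a limit
  point, near which every orbit passes.\<close>

theorem orbit_meets_\<Delta>u: "\<exists>g\<in>\<Gamma>. \<exists>w\<in>\<Delta>u. bact g \<xi> = Fin w"
proof -
  obtain x j where x: "x \<in> \<Delta> j" "Fin x \<in> limit_set \<Gamma>" using limit_point_in_\<Delta>u by auto
  obtain e where e: "e > 0" "ball x e \<subseteq> \<Delta> j"
    using bspec[OF \<Delta>_open[of j, unfolded open_contains_ball] x(1)] by auto
  obtain h where "h \<in> \<Gamma>" "bact h \<xi> \<noteq> \<xi>" using no_fixed_point by blast
  then obtain g w where "g \<in> \<Gamma>" "w \<in> ball x e" "bact g \<xi> = Fin w"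
    using orbit_near_limit_point[OF x(2) _ _ e(1)] by metis
  then show ?thesis using e(2) by (intro bexI[of _ g] bexI[of _ w]) auto
qed

text \<open>The exceptional set is enlarged to a countable union of group translates, which stays
  null by quasi-invariance. The complement of the limit set is included so that a translate outside
  it is a limit point, where null sets of \<open>\<nu>\<close> and \<open>\<mu>\<close>
  correspond.\<close>

lemma spread_null:
  assumes A: "A \<in> sets borel" "emeasure \<nu> (A \<inter> \<Delta>u) = 0"
  obtains N where "N \<in> null_sets \<mu>" "\<And>g \<xi>. g \<in> \<Gamma> \<Longrightarrow> \<xi> \<in> N \<Longrightarrow> bact g \<xi> \<in> N"
    "\<And>\<xi>. \<xi> \<notin> N \<Longrightarrow> \<exists>g\<in>\<Gamma>. \<exists>w\<in>\<Delta>u. bact g \<xi> = Fin w \<and> w \<notin> A"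
proof -
  define B where "B = lam_image A \<union> - limit_set \<Gamma>"
  have B: "B \<in> null_sets \<mu>" unfolding B_def using \<mu>_null_of_\<nu>_null[OF A] \<mu>_facts(3) by (rule null_sets.Un)
  define N where "N = (\<Union>g\<in>\<Gamma>. bact g -` B)"
  have "N \<in> null_sets \<mu>" unfolding N_def
    using countable \<mu>_facts(4)[OF _ B] by (intro null_sets_UN') auto
  moreover have "bact g \<xi> \<in> N" if g: "g \<in> \<Gamma>" and \<xi>: "\<xi> \<in> N" for g \<xi>
  proof -
    obtain h where h: "h \<in> \<Gamma>" "bact h \<xi> \<in> B" using \<xi> by (auto simp: N_def)
    have l: "g \<in> lorp" "h \<in> lorp" "lorentz_inv g \<in> lorp" using g h lorp inv_in by auto
    have "bact (h ** lorentz_inv g) (bact g \<xi>) = bact h \<xi>"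
      using l by (simp add: bact_mult bact_inv)
    then show ?thesis unfolding N_def using h g by (auto intro!: bexI[of _ "h ** lorentz_inv g"] mult_in inv_in)
  qed
  moreover have "\<exists>g\<in>\<Gamma>. \<exists>w\<in>\<Delta>u. bact g \<xi> = Fin w \<and> w \<notin> A" if "\<xi> \<notin> N" for \<xi>
  proof -
    obtain g w where gw: "g \<in> \<Gamma>" "w \<in> \<Delta>u" "bact g \<xi> = Fin w" using orbit_meets_\<Delta>u by metis
    have "Fin w \<notin> B" using that gw by (auto simp: N_def)
    then have "w \<notin> A" using gw(2) by (auto simp: B_def lam_image_def)
    then show ?thesis using gw by blast
  qed
  ultimately show thesis using that by blast
qed

end

section \<open>Averages along the flow\<close>

lemma integral_bounds_01:
  fixes f :: "real \<Rightarrow> real"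
  assumes "continuous_on UNIV f" "\<And>x. 0 \<le> f x" "\<And>x. f x \<le> 1" "a \<le> b"
  shows "0 \<le> integral {a..b} f" "integral {a..b} f \<le> b - a"
proof -
  have i: "f integrable_on {a..b}" using assms(1) by (intro integrable_continuous_real) (auto intro: continuous_on_subset)
  show "0 \<le> integral {a..b} f" using i assms by (intro integral_nonneg) auto
  have "integral {a..b} f \<le> integral {a..b} (\<lambda>_. 1)" using i assms by (intro integral_le) auto
  then show "integral {a..b} f \<le> b - a" using assms by simp
qed

lemma integral_shift_close:
  fixes f :: "real \<Rightarrow> real"
  assumes f: "continuous_on UNIV f" "\<And>x. 0 \<le> f x" "\<And>x. f x \<le> 1" and t: "0 \<le> t"
  shows "\<bar>integral {0..t} (\<lambda>u. f (u + s)) - integral {0..t} f\<bar> \<le> \<bar>s\<bar>"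
proof -
  have i: "f integrable_on {a..b}" for a b using f(1) by (intro integrable_continuous_real) (auto intro: continuous_on_subset)
  have sh: "integral {0..t} (\<lambda>u. f (u + s)) = integral {s..t + s} f"
    using integral_shift_Icc_real[of 0 t f s] by (simp add: o_def add.commute)
  show ?thesis
  proof (cases "s \<ge> 0")
    case True
    have "integral {0..s} f + integral {s..t + s} f = integral {0..t + s} f"
      "integral {0..t} f + integral {t..t + s} f = integral {0..t + s} f"
      using True t by (auto intro!: Henstock_Kurzweil_Integration.integral_combine i)
    then show ?thesis using integral_bounds_01[OF f, of 0 s] integral_bounds_01[OF f, of t "t + s"] True
      by (simp add: sh abs_le_iff)
  next
    case False
    have "integral {s..0} f + integral {0..t} f = integral {s..t} f"
      "integral {s..t + s} f + integral {t + s..t} f = integral {s..t} f"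
      using False t by (auto intro!: Henstock_Kurzweil_Integration.integral_combine i)
    then show ?thesis using integral_bounds_01[OF f, of s 0] integral_bounds_01[OF f, of "t + s" t] False
      by (simp add: sh abs_le_iff)
  qed
qed

text \<open>The initial stretch and the time shift cost a constant \<open>K\<close>, and the
  remainder a small multiple of the elapsed time; only the latter survives division by the
  time.\<close>

lemma average_asymptotic:
  fixes \<phi> \<psi> :: "real \<Rightarrow> real" and t :: "nat \<Rightarrow> real"
  assumes \<phi>: "continuous_on UNIV \<phi>" "\<And>x. 0 \<le> \<phi> x" "\<And>x. \<phi> x \<le> 1"
    and \<psi>: "continuous_on UNIV \<psi>" "\<And>x. 0 \<le> \<psi> x" "\<And>x. \<psi> x \<le> 1"
    and close: "((\<lambda>u. \<phi> u - \<psi> (u + s)) \<longlongrightarrow> 0) at_top"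
    and t: "filterlim t at_top sequentially"
    and lim: "(\<lambda>n. integral {0..t n} \<psi> / t n) \<longlonglongrightarrow> I"
  shows "(\<lambda>n. integral {0..t n} \<phi> / t n) \<longlonglongrightarrow> I"
proof -
  have ps: "continuous_on UNIV (\<lambda>u. \<psi> (u + s))"
    by (intro continuous_on_compose2[OF \<psi>(1)] continuous_intros) auto
  have "(\<lambda>n. integral {0..t n} \<phi> / t n - integral {0..t n} \<psi> / t n) \<longlonglongrightarrow> 0"
  proof (rule LIMSEQ_I)
    fix e :: real assume e: "e > 0"
    obtain U0 where U0: "\<And>u. u \<ge> U0 \<Longrightarrow> \<bar>\<phi> u - \<psi> (u + s)\<bar> < e / 2"
      using tendstoD[OF close, of "e / 2"] e by (auto simp: eventually_at_top_linorder dist_real_def)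
    define U where "U = max U0 0"
    have U: "U \<ge> 0" "\<And>u. u \<ge> U \<Longrightarrow> \<bar>\<phi> u - \<psi> (u + s)\<bar> \<le> e / 2" using U0 by (auto simp: U_def less_imp_le)
    define K where "K = U + \<bar>s\<bar>"
    have bound: "\<bar>integral {0..T} \<phi> - integral {0..T} \<psi>\<bar> \<le> K + T * (e / 2)" if T: "T \<ge> U" for T
    proof -
      define d where "d u = \<phi> u - \<psi> (u + s)" for u
      have dc: "continuous_on UNIV d" unfolding d_def using \<phi>(1) ps by (intro continuous_intros)
      have i: "d integrable_on {a..b}" "\<phi> integrable_on {a..b}" "(\<lambda>u. \<psi> (u + s)) integrable_on {a..b}" for a b
        using dc \<phi>(1) ps by (auto intro!: integrable_continuous_real intro: continuous_on_subset)
      have d1: "\<bar>d u\<bar> \<le> 1" for u using \<phi>(2,3)[of u] \<psi>(2,3)[of "u + s"] by (auto simp: d_def abs_le_iff)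
      have "integral {0..T} d = integral {0..U} d + integral {U..T} d"
        using T U by (intro Henstock_Kurzweil_Integration.integral_combine[symmetric] i) auto
      moreover have "norm (integral {0..U} d) \<le> 1 * (U - 0)"
        using U d1 dc by (intro integral_bound) (auto intro: continuous_on_subset)
      moreover have "norm (integral {U..T} d) \<le> e / 2 * (T - U)"
        using T U dc by (intro integral_bound) (auto simp: d_def intro: continuous_on_subset)
      moreover have "e / 2 * (T - U) \<le> T * (e / 2)" using e U by (simp add: algebra_simps)
      ultimately have "\<bar>integral {0..T} d\<bar> \<le> U + T * (e / 2)" by (auto simp: abs_le_iff)
      moreover have "integral {0..T} d = integral {0..T} \<phi> - integral {0..T} (\<lambda>u. \<psi> (u + s))"
        unfolding d_def by (intro Henstock_Kurzweil_Integration.integral_diff i)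
      moreover have "\<bar>integral {0..T} (\<lambda>u. \<psi> (u + s)) - integral {0..T} \<psi>\<bar> \<le> \<bar>s\<bar>"
        using T U by (intro integral_shift_close \<psi>) auto
      ultimately show ?thesis unfolding K_def by (auto simp: abs_le_iff)
    qed
    have "\<forall>\<^sub>F n in sequentially. t n \<ge> max U (2 * K / e + 1)"
      using t unfolding filterlim_at_top by blast
    then obtain n0 where n0: "\<And>n. n \<ge> n0 \<Longrightarrow> t n \<ge> max U (2 * K / e + 1)" by (auto simp: eventually_sequentially)
    have "norm (integral {0..t n} \<phi> / t n - integral {0..t n} \<psi> / t n - 0) < e" if "n \<ge> n0" for n
    proof -
      have tn: "t n \<ge> U" "t n \<ge> 2 * K / e + 1" using n0[OF that] by auto
      have "K \<ge> 0" using U by (simp add: K_def)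
      then have "2 * K / e \<ge> 0" using e by simp
      then have tp: "t n > 0" "t n > 2 * K / e" using tn by auto
      then have "K < t n * (e / 2)" using e by (simp add: field_simps)
      then have "\<bar>integral {0..t n} \<phi> - integral {0..t n} \<psi>\<bar> < t n * e" using bound[OF tn(1)] by linarith
      then have "\<bar>integral {0..t n} \<phi> - integral {0..t n} \<psi>\<bar> / t n < e" using tp by (simp add: pos_divide_less_eq mult.commute)
      moreover have "norm (integral {0..t n} \<phi> / t n - integral {0..t n} \<psi> / t n - 0) = \<bar>integral {0..t n} \<phi> - integral {0..t n} \<psi>\<bar> / t n"
        using tp(1) unfolding diff_divide_distrib[symmetric] by simp
      ultimately show ?thesis by simp
    qed
    then show "\<exists>n0. \<forall>n\<ge>n0. norm (integral {0..t n} \<phi> / t n - integral {0..t n} \<psi> / t n - 0) < e" by blast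
  qed
  from tendsto_add[OF this lim] show ?thesis by simp
qed

text \<open>Turns averages at return times, which depend on the point, into averages at times common
  to all points. The integral is 1-Lipschitz in its upper end, and the two times differ by
  o(n).\<close>

lemma average_at_multiple:
  fixes \<phi> :: "real \<Rightarrow> real" and r :: "nat \<Rightarrow> real"
  assumes \<phi>: "continuous_on UNIV \<phi>" "\<And>x. 0 \<le> \<phi> x" "\<And>x. \<phi> x \<le> 1"
    and r: "\<And>n. r n \<ge> 0" "(\<lambda>n. r n / real n) \<longlonglongrightarrow> R" "R > 0"
    and J: "(\<lambda>n. integral {0..r n} \<phi> / real n) \<longlonglongrightarrow> J"
  shows "(\<lambda>n. integral {0..real n * R} \<phi> / (real n * R)) \<longlonglongrightarrow> J / R"
proof -
  have i: "\<phi> integrable_on {a..b}" for a b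
    using \<phi>(1) by (intro integrable_continuous_real) (auto intro: continuous_on_subset)
  have close: "\<bar>integral {0..a} \<phi> - integral {0..b} \<phi>\<bar> \<le> \<bar>a - b\<bar>" if "0 \<le> a" "0 \<le> b" for a b
  proof -
    have *: "\<bar>integral {0..a} \<phi> - integral {0..b} \<phi>\<bar> \<le> \<bar>a - b\<bar>" if "0 \<le> a" "a \<le> b" for a b
    proof -
      have "integral {0..a} \<phi> + integral {a..b} \<phi> = integral {0..b} \<phi>"
        using that by (intro Henstock_Kurzweil_Integration.integral_combine i)
      then show ?thesis using integral_bounds_01[OF \<phi> that(2)] that by (simp add: abs_le_iff)
    qed
    show ?thesis using *[of a b] *[of b a] that by (cases "a \<le> b") (auto simp: abs_minus_commute)
  qed
  have "(\<lambda>n. (integral {0..real n * R} \<phi> - integral {0..r n} \<phi>) / real n) \<longlonglongrightarrow> 0"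
  proof (rule Lim_null_comparison)
    show "\<forall>\<^sub>F n in sequentially. norm ((integral {0..real n * R} \<phi> - integral {0..r n} \<phi>) / real n) \<le> \<bar>R - r n / real n\<bar>"
      using eventually_gt_at_top[of 0]
    proof eventually_elim
      case (elim n)
      have "\<bar>integral {0..real n * R} \<phi> - integral {0..r n} \<phi>\<bar> \<le> \<bar>real n * R - r n\<bar>"
        using r by (intro close) auto
      then have "\<bar>integral {0..real n * R} \<phi> - integral {0..r n} \<phi>\<bar> / real n \<le> \<bar>real n * R - r n\<bar> / real n"
        by (intro divide_right_mono) auto
      also have "\<dots> = \<bar>(real n * R - r n) / real n\<bar>" by simp
      also have "(real n * R - r n) / real n = R - r n / real n" using elim by (simp add: diff_divide_distrib)
      finally show ?case by simp
    qed
    have "(\<lambda>n. \<bar>R - r n / real n\<bar>) \<longlonglongrightarrow> \<bar>R - R\<bar>" by (intro tendsto_intros r)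
    then show "(\<lambda>n. \<bar>R - r n / real n\<bar>) \<longlonglongrightarrow> 0" by simp
  qed
  from tendsto_add[OF this J] have "(\<lambda>n. integral {0..real n * R} \<phi> / real n) \<longlonglongrightarrow> J"
    by (simp add: diff_divide_distrib)
  then have "(\<lambda>n. integral {0..real n * R} \<phi> / real n / R) \<longlonglongrightarrow> J / R"
    using r(3) by (intro tendsto_intros) auto
  then show ?thesis by (simp add: divide_divide_eq_left)
qed

lemma nn_integral_initial_segment:
  fixes \<phi> :: "real \<Rightarrow> real"
  assumes \<phi>: "continuous_on UNIV \<phi>" "\<And>x. 0 \<le> \<phi> x"
  shows "(\<integral>\<^sup>+s. ennreal (\<phi> s) * indicator {0..<T} s \<partial>lborel) = ennreal (integral {0..T} \<phi>)"
proof -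
  have m: "\<phi> \<in> borel_measurable borel" by (rule borel_measurable_continuous_onI[OF \<phi>(1)])
  have "(\<integral>\<^sup>+s. ennreal (\<phi> s) * indicator {0..<T} s \<partial>lborel) = (\<integral>\<^sup>+s. ennreal (indicator {0..T} s * \<phi> s) \<partial>lborel)"
  proof (rule nn_integral_cong_AE)
    have "AE s in lborel. s \<noteq> T" by (rule AE_lborel_singleton)
    then show "AE s in lborel. ennreal (\<phi> s) * indicator {0..<T} s = ennreal (indicator {0..T} s * \<phi> s)"
      by eventually_elim (auto simp: indicator_def)
  qed
  also have "\<dots> = ennreal (integral {0..T} \<phi>)"
  proof (rule nn_integral_has_integral_lborel)
    show "(\<lambda>s. indicator {0..T} s * \<phi> s) \<in> borel_measurable borel" using m by measurable
    have "\<phi> integrable_on {0..T}" using \<phi>(1) by (intro integrable_continuous_real) (auto intro: continuous_on_subset)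
    then have "(\<phi> has_integral integral {0..T} \<phi>) {0..T}" by (rule integrable_integral)
    moreover have "(\<lambda>s. indicator {0..T} s * \<phi> s) = (\<lambda>s. if s \<in> {0..T} then \<phi> s else 0)"
      by (auto simp: indicator_def)
    ultimately show "((\<lambda>s. indicator {0..T} s * \<phi> s) has_integral integral {0..T} \<phi>) UNIV"
      by (simp only: has_integral_restrict_UNIV)
  qed (use \<phi>(2) in auto)
  finally show ?thesis .
qed

section \<open>Test functions on the quotient\<close>

declare split_paired_All [simp del] split_paired_Ex [simp del]

context bms
begin

text \<open>A Lipschitz bound for the invariant distance, being uniform, makes the values along
  asymptotic orbits merge. The value 0 off \<open>UT\<close> makes the functions Borel on the
  ambient space.\<close>

definition test_fun :: "('d uvec \<Rightarrow> real) \<Rightarrow> bool" where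
  "test_fun f \<longleftrightarrow> (\<forall>v. 0 \<le> f v \<and> f v \<le> 1) \<and> (\<forall>v. v \<notin> UT \<longrightarrow> f v = 0) \<and> inv_fun f
     \<and> (\<exists>C\<ge>0. \<forall>v\<in>UT. \<forall>w\<in>UT. \<bar>f v - f w\<bar> \<le> C * udist v w)"

lemma test_fun_bounds: "test_fun f \<Longrightarrow> 0 \<le> f v" "test_fun f \<Longrightarrow> f v \<le> 1"
  by (auto simp: test_fun_def)

lemma test_fun_continuous:
  assumes "test_fun f"
  shows "continuous_on UT f"
  unfolding continuous_on_def
proof
  fix v :: "'d uvec" assume v: "v \<in> UT"
  obtain C where C: "\<And>v w. v \<in> UT \<Longrightarrow> w \<in> UT \<Longrightarrow> \<bar>f v - f w\<bar> \<le> C * udist v w"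
    using assms unfolding test_fun_def by blast
  have "((\<lambda>w. C * udist w v) \<longlongrightarrow> C * udist v v) (at v within UT)"
    using continuous_udist[OF v] v by (intro tendsto_intros) (auto simp: continuous_on_def)
  then have "((\<lambda>w. C * udist w v) \<longlongrightarrow> 0) (at v within UT)" using v by (simp add: udist_self)
  moreover have "\<forall>\<^sub>F w in at v within UT. norm (f w - f v) \<le> C * udist w v"
    using C v by (auto simp: eventually_at_filter)
  ultimately have "((\<lambda>w. f w - f v) \<longlongrightarrow> 0) (at v within UT)" by (rule Lim_null_comparison[rotated])
  then show "(f \<longlongrightarrow> f v) (at v within UT)" by (simp add: LIM_zero_iff)
qed

lemma test_fun_borel:
  assumes "test_fun f"
  shows "f \<in> borel_measurable borel"
proof -
  have "(\<lambda>v. indicator UT v *\<^sub>R f v) \<in> borel_measurable borel"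
    using test_fun_continuous[OF assms] sets_UT by (intro borel_measurable_continuous_on_indicator) auto
  moreover have "(\<lambda>v. indicator UT v *\<^sub>R f v) = f"
    using assms by (auto simp: test_fun_def indicator_def fun_eq_iff)
  ultimately show ?thesis by simp
qed

lemma test_fun_flow_continuous:
  assumes f: "test_fun f" and v: "v \<in> UT"
  shows "continuous_on UNIV (\<lambda>u. f (geodesic_flow u v))"
  by (rule continuous_on_compose2[OF test_fun_continuous[OF f]])
     (auto intro!: continuous_intros simp: geodesic_flow_UT v )

text \<open>Vectors with the same forward endpoint lie on horospheres differing by a time
  \<open>s\<close>; flowing \<open>w\<close> by \<open>s\<close> makes the forward null vectors
  equal.\<close>

lemma test_fun_stable:
  assumes f: "test_fun f" and v: "v \<in> UT" "w \<in> UT" and eq: "fst v + snd v = exp s *\<^sub>R (fst w + snd w)"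
  shows "((\<lambda>u. f (geodesic_flow u v) - f (geodesic_flow (u + s) w)) \<longlongrightarrow> 0) at_top"
proof -
  obtain C where C: "\<And>v w. v \<in> UT \<Longrightarrow> w \<in> UT \<Longrightarrow> \<bar>f v - f w\<bar> \<le> C * udist v w"
    using f unfolding test_fun_def by blast
  let ?w = "geodesic_flow s w"
  have "((\<lambda>u. udist (geodesic_flow u v) (geodesic_flow u ?w)) \<longlongrightarrow> 0) at_top"
    using v by (intro udist_flow_tendsto geodesic_flow_UT) (simp_all only: geodesic_flow_simps eq)
  then have "((\<lambda>u. C * udist (geodesic_flow u v) (geodesic_flow u ?w)) \<longlongrightarrow> C * 0) at_top"
    by (intro tendsto_mult tendsto_const)
  then have lim: "((\<lambda>u. C * udist (geodesic_flow u v) (geodesic_flow u ?w)) \<longlongrightarrow> 0) at_top"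
    by (simp only: mult_zero_right)
  have "\<forall>\<^sub>F u in at_top. norm (f (geodesic_flow u v) - f (geodesic_flow (u + s) w))
      \<le> C * udist (geodesic_flow u v) (geodesic_flow u ?w)"
  proof (rule always_eventually, rule allI)
    fix u
    show "norm (f (geodesic_flow u v) - f (geodesic_flow (u + s) w)) \<le> C * udist (geodesic_flow u v) (geodesic_flow u ?w)"
      using C[OF geodesic_flow_UT[OF v(1), of u] geodesic_flow_UT[OF v(2), of "u + s"]]
      unfolding geodesic_flow_add real_norm_def .
  qed
  then show ?thesis using lim by (rule Lim_null_comparison)
qed

text \<open>The distance to an invariant set is invariant and 1-Lipschitz, and truncation keeps the
  Lipschitz constant.\<close>

lemma test_fun_dist:
  assumes K: "K \<subseteq> UT" "K \<noteq> {}" "\<And>g v. g \<in> \<Gamma> \<Longrightarrow> v \<in> K \<Longrightarrow> gact g v \<in> K"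
  shows "test_fun (\<lambda>v. if v \<in> UT then min 1 (real n * (INF k\<in>K. udist v k)) else 0)"
proof -
  define D where "D v = (INF k\<in>K. udist v k)" for v
  have nn: "udist v k \<ge> 0" if "v \<in> UT" "k \<in> K" for v k
    using udist_nonneg[OF that(1)] that(2) K(1) by blast
  have bdd: "bdd_below ((\<lambda>k. udist v k) ` K)" if "v \<in> UT" for v
    using nn[OF that] by (intro bdd_belowI2[of _ 0])
  have D0: "D v \<ge> 0" if "v \<in> UT" for v
    unfolding D_def using nn[OF that] by (rule cINF_greatest[OF K(2)])
  have Dlip: "D v \<le> udist v w + D w" if vw: "v \<in> UT" "w \<in> UT" for v w
  proof -
    have "D v - udist v w \<le> D w"
      unfolding D_def[of w]
    proof (rule cINF_greatest[OF K(2)])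
      fix k assume k: "k \<in> K"
      have "D v \<le> udist v k" unfolding D_def using bdd[OF vw(1)] k by (rule cINF_lower)
      also have "\<dots> \<le> udist v w + udist w k" using udist_triangle[OF vw, of k] k K(1) by auto
      finally show "D v - udist v w \<le> udist w k" by simp
    qed
    then show ?thesis by simp
  qed
  have Dinv: "D (gact g v) = D v" if g: "g \<in> \<Gamma>" and v: "v \<in> UT" for g v
  proof -
    have le: "D (gact g v) \<le> D v" if g: "g \<in> \<Gamma>" and v: "v \<in> UT" for g v
      unfolding D_def[of v]
    proof (rule cINF_greatest[OF K(2)])
      fix k assume k: "k \<in> K"
      have "D (gact g v) \<le> udist (gact g v) (gact g k)"
        unfolding D_def using bdd[OF gact_UT'[OF g v]] K(3)[OF g k] by (rule cINF_lower)
      then show "D (gact g v) \<le> udist v k" using g lorp by (simp add: udist_gact subset_iff)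
    qed
    have "D (gact (lorentz_inv g) (gact g v)) \<le> D (gact g v)"
      using g v by (intro le inv_in gact_UT')
    moreover have "gact (lorentz_inv g) (gact g v) = v" using g lorp by (intro gact_inv) auto
    ultimately show ?thesis using le[OF g v] by simp
  qed
  show ?thesis unfolding test_fun_def D_def[symmetric]
  proof (intro conjI allI)
    show "inv_fun (\<lambda>v. if v \<in> UT then min 1 (real n * D v) else 0)"
      by (auto simp: inv_fun_def gact_UT' Dinv)
    show "\<exists>C\<ge>0. \<forall>v\<in>UT. \<forall>w\<in>UT. \<bar>(if v \<in> UT then min 1 (real n * D v) else 0)
         - (if w \<in> UT then min 1 (real n * D w) else 0)\<bar> \<le> C * udist v w"
    proof (intro exI[of _ "real n"] conjI ballI)
      fix v w :: "'d uvec" assume vw: "v \<in> UT" "w \<in> UT"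
      have "\<bar>D v - D w\<bar> \<le> udist v w"
        using Dlip[OF vw] Dlip[OF vw(2,1)] by (simp add: udist_sym abs_le_iff)
      then have "real n * \<bar>D v - D w\<bar> \<le> real n * udist v w" by (intro mult_left_mono) auto
      then have "\<bar>real n * D v - real n * D w\<bar> \<le> real n * udist v w"
        by (simp add: abs_mult right_diff_distrib[symmetric])
      then show "\<bar>(if v \<in> UT then min 1 (real n * D v) else 0)
         - (if w \<in> UT then min 1 (real n * D w) else 0)\<bar> \<le> real n * udist v w"
        using vw by (simp add: min_def abs_le_iff)
    qed simp
  qed (use D0 in auto)
qed

text \<open>The open sets of the quotient topology, expressed through their preimages in
  \<open>UT\<close>.\<close>

definition open_generator :: "'d uvec set set set" where
  "open_generator = {A. A \<subseteq> T1M \<Gamma> \<and> (\<exists>U. open U \<and> {v\<in>UT. orb \<Gamma> v \<in> A} = UT \<inter> U)}"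

lemma open_generator_sets: "open_generator \<subseteq> sets m"
proof
  fix A assume "A \<in> open_generator"
  then obtain U where "A \<subseteq> T1M \<Gamma>" "open U" "{v\<in>UT. orb \<Gamma> v \<in> A} = UT \<inter> U"
    unfolding open_generator_def by blast
  then show "A \<in> sets m" unfolding sets_m using sets.Int[OF sets_UT borel_open[of U]] by simp
qed

text \<open>The sigma-algebra of the quotient is defined by Borel preimages, and that it is
  generated by open sets needs proof. The induction over Borel sets runs inside one piece of the
  cover at a time.\<close>

lemma sets_m_generator: "sets m = sigma_sets (T1M \<Gamma>) open_generator"
proof
  interpret S: sigma_algebra "T1M \<Gamma>" "sigma_sets (T1M \<Gamma>) open_generator"
    by (rule sigma_algebra_sigma_sets) (auto simp: open_generator_def)
  show "sigma_sets (T1M \<Gamma>) open_generator \<subseteq> sets m"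
    using sets.sigma_sets_subset[OF open_generator_sets] by (simp add: space_m)
  show "sets m \<subseteq> sigma_sets (T1M \<Gamma>) open_generator"
  proof
    fix A assume A: "A \<in> sets m"
    define A' where "A' = {v\<in>UT. orb \<Gamma> v \<in> A}"
    have A': "A' \<in> sets borel" "A' \<subseteq> UT" "A = orb \<Gamma> ` A'"
      using sets_m_invset[OF A] by (auto simp: A'_def invset_def)
    obtain U :: "nat \<Rightarrow> 'd uvec set" where U: "\<And>i. open (U i)" "UT \<subseteq> (\<Union>i. U i)"
      "\<And>i. inj_on (orb \<Gamma>) (U i \<inter> UT)"
      using countable_cover by metis
    have basic: "orb \<Gamma> ` (E \<inter> (U i \<inter> UT)) \<in> sigma_sets (T1M \<Gamma>) open_generator" if "open E" for E i
    proof (rule sigma_sets.Basic)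
      define W where "W = (\<Union>g\<in>\<Gamma>. gact g -` (E \<inter> U i))"
      have "open W" unfolding W_def using that U(1)
        by (intro open_UN ballI open_vimage open_Int continuous_intros)
      moreover have "satur (E \<inter> (U i \<inter> UT)) = UT \<inter> W"
        unfolding satur_eq W_def using gact_UT' by blast
      then have "{v\<in>UT. orb \<Gamma> v \<in> orb \<Gamma> ` (E \<inter> (U i \<inter> UT))} = UT \<inter> W" by (simp add: satur_def)
      moreover have "orb \<Gamma> ` (E \<inter> (U i \<inter> UT)) \<subseteq> T1M \<Gamma>" by (auto simp: T1M_def)
      ultimately show "orb \<Gamma> ` (E \<inter> (U i \<inter> UT)) \<in> open_generator" unfolding open_generator_def by blast
    qed
    have piece: "orb \<Gamma> ` (E \<inter> (U i \<inter> UT)) \<in> sigma_sets (T1M \<Gamma>) open_generator" if "E \<in> sets borel" for E i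
    proof -
      have "E \<in> sigma_sets UNIV {S. open S}" using that by (simp add: borel_def)
      then show ?thesis
      proof (induction E rule: sigma_sets.induct)
        case (Basic E) then show ?case using basic by simp
      next
        case Empty then show ?case by (simp add: sigma_sets.Empty)
      next
        case (Compl E)
        \<comment> \<open>Images commute with complements only under an injective map; this is the
          reason for the intersection with \<open>U i\<close>.\<close>
        have "orb \<Gamma> ` ((UNIV - E) \<inter> (U i \<inter> UT)) = orb \<Gamma> ` (UNIV \<inter> (U i \<inter> UT)) - orb \<Gamma> ` (E \<inter> (U i \<inter> UT))"
        proof -
          have "(UNIV - E) \<inter> (U i \<inter> UT) = U i \<inter> UT - E \<inter> (U i \<inter> UT)" by blast
          then show ?thesis using inj_on_image_set_diff[OF U(3)[of i], of "U i \<inter> UT" "E \<inter> (U i \<inter> UT)"] by auto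
        qed
        then show ?case using S.Diff[OF basic[of UNIV i] Compl(2)] by simp
      next
        case (Union E)
        have "orb \<Gamma> ` ((\<Union>(range E)) \<inter> (U i \<inter> UT)) = (\<Union>k. orb \<Gamma> ` (E k \<inter> (U i \<inter> UT)))" by blast
        then show ?case using Union by (auto intro: sigma_sets.Union)
      qed
    qed
    have "A' = (\<Union>i. A' \<inter> (U i \<inter> UT))" using A'(2) U(2) by blast
    then have "A = (\<Union>i. orb \<Gamma> ` (A' \<inter> (U i \<inter> UT)))" using A'(3) by (metis image_UN)
    then show "A \<in> sigma_sets (T1M \<Gamma>) open_generator" using piece[OF A'(1)] by (auto intro: sigma_sets.Union)
  qed
qed

text \<open>Multiples of the distance to the complement, truncated at 1, converge to the indicator
  of an open set, so test functions determine measures on an intersection-stable generator.\<close>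

theorem measure_eq_test_fun:
  assumes M: "sets M = sets m" "emeasure M (T1M \<Gamma>) = 1"
    and eq: "\<And>f. test_fun f \<Longrightarrow> (\<integral>\<^sup>+V. ennreal (f (rep V)) \<partial>M) = (\<integral>\<^sup>+V. ennreal (f (rep V)) \<partial>m)"
  shows "M = m"
proof (rule measure_eqI_generator_eq[where E=open_generator and \<Omega>="T1M \<Gamma>" and A="\<lambda>_::nat. T1M \<Gamma>"])
  show "Int_stable open_generator"
  proof (rule Int_stableI)
    fix A B assume "A \<in> open_generator" "B \<in> open_generator"
    then obtain U W where "A \<subseteq> T1M \<Gamma>" "open U" "{v\<in>UT. orb \<Gamma> v \<in> A} = UT \<inter> U"
      "open W" "{v\<in>UT. orb \<Gamma> v \<in> B} = UT \<inter> W" by (auto simp: open_generator_def)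
    then have "A \<inter> B \<subseteq> T1M \<Gamma>" "open (U \<inter> W)" "{v\<in>UT. orb \<Gamma> v \<in> A \<inter> B} = UT \<inter> (U \<inter> W)" by auto
    then show "A \<inter> B \<in> open_generator" unfolding open_generator_def by blast
  qed
  show "open_generator \<subseteq> Pow (T1M \<Gamma>)" by (auto simp: open_generator_def)
  show "sets M = sigma_sets (T1M \<Gamma>) open_generator" "sets m = sigma_sets (T1M \<Gamma>) open_generator"
    using M(1) sets_m_generator by simp_all
  show "range (\<lambda>_::nat. T1M \<Gamma>) \<subseteq> open_generator"
    by (auto simp: open_generator_def T1M_def intro!: exI[of _ UNIV])
  show "(\<Union>i::nat. T1M \<Gamma>) = T1M \<Gamma>" by simp
  show "emeasure M (T1M \<Gamma>) \<noteq> \<infinity>" using M(2) by simp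
  fix A assume A: "A \<in> open_generator"
  have sA: "A \<in> sets m" "A \<in> sets M" using A open_generator_sets M(1) by auto
  obtain U where U: "open U" "{v\<in>UT. orb \<Gamma> v \<in> A} = UT \<inter> U" "A \<subseteq> T1M \<Gamma>"
    using A by (auto simp: open_generator_def)
  define K where "K = UT - U"
  show "emeasure M A = emeasure m A"
  \<comment> \<open>There is no distance to an empty complement; in that case the set is the whole
    space and the total masses decide.\<close>
  proof (cases "K = {}")
    case True
    then have "UT \<inter> U = UT" by (auto simp: K_def)
    then have "A = T1M \<Gamma>" using U(2,3) by (auto simp: T1M_def)
    then show ?thesis using M(2) prob_space.emeasure_space_1[OF prob_m] by (simp add: space_m)
  next
    case False
    have KI: "gact g v \<in> K" if "g \<in> \<Gamma>" "v \<in> K" for g v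
    proof -
      have "v \<in> UT" "orb \<Gamma> v \<notin> A" using that(2) U(2) by (auto simp: K_def)
      then have "gact g v \<in> UT" "orb \<Gamma> (gact g v) \<notin> A" using that(1) by (auto simp: gact_UT' orb_gact_eq)
      then show ?thesis using U(2) by (auto simp: K_def)
    qed
    define f where "f n v = (if v \<in> UT then min 1 (real n * (INF k\<in>K. udist v k)) else 0)" for n v
    have tf: "test_fun (f n)" for n
      unfolding f_def using False KI by (intro test_fun_dist) (auto simp: K_def)
    have lim: "(\<lambda>n. f n v) \<longlonglongrightarrow> indicator U v" if v: "v \<in> UT" for v
    proof -
      have nn: "udist v k \<ge> 0" if "k \<in> K" for k
        using udist_nonneg[OF v] that unfolding K_def by blast
      have bdd: "bdd_below ((\<lambda>k. udist v k) ` K)"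
        using nn by (intro bdd_belowI2[of _ 0])
      show ?thesis
      proof (cases "v \<in> U")
        case True
        obtain d where d: "d > 0" "\<And>w. w \<in> UT \<Longrightarrow> udist v w < d \<Longrightarrow> w \<in> U"
          using udist_open[OF v U(1) True] by blast
        have "d \<le> (INF k\<in>K. udist v k)"
          using False d(2) by (intro cINF_greatest) (auto simp: K_def not_less[symmetric])
        then have pos: "(INF k\<in>K. udist v k) > 0" using d(1) by simp
        obtain n0 :: nat where n0: "real n0 * (INF k\<in>K. udist v k) > 1"
          using reals_Archimedean3[OF pos] by blast
        have "f n v = 1" if "n \<ge> n0" for n
        proof -
          have "real n0 * (INF k\<in>K. udist v k) \<le> real n * (INF k\<in>K. udist v k)"
            using that pos by (intro mult_right_mono) auto
          then show ?thesis using n0 v by (simp add: f_def)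
        qed
        then show ?thesis using True by (intro tendsto_eventually) (auto simp: eventually_sequentially)
      next
        case notU: False
        then have "v \<in> K" using v by (simp add: K_def)
        then have "(INF k\<in>K. udist v k) \<le> 0" using cINF_lower[OF bdd, of v] v by (simp add: udist_self)
        moreover have "(INF k\<in>K. udist v k) \<ge> 0"
          using nn by (rule cINF_greatest[OF False])
        ultimately have "(INF k\<in>K. udist v k) = 0" by simp
        then show ?thesis using notU v by (simp add: f_def)
      qed
    qed
    have conv: "(\<lambda>n. \<integral>\<^sup>+V. ennreal (f n (rep V)) \<partial>L) \<longlonglongrightarrow> emeasure L A" if L: "sets L = sets m" "emeasure L (T1M \<Gamma>) = 1" for L
    proof -
      have spL: "space L = T1M \<Gamma>" using sets_eq_imp_space_eq[OF L(1)] space_m by simp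
      have meas: "(\<lambda>V. f n (rep V)) \<in> borel_measurable L" for n
        unfolding measurable_cong_sets[OF L(1) refl] using tf[of n]
        by (intro inv_fun_measurable measurable_restrict_space1 test_fun_borel) (auto simp: test_fun_def)
      have AL: "A \<in> sets L" using sA L(1) by simp
      have "(\<lambda>n. \<integral>\<^sup>+V. ennreal (f n (rep V)) \<partial>L) \<longlonglongrightarrow> (\<integral>\<^sup>+V. indicator A V \<partial>L)"
      proof (rule nn_integral_dominated_convergence[where w="\<lambda>_. 1"])
        show "(\<lambda>V. ennreal (f n (rep V))) \<in> borel_measurable L" for n using meas by measurable
        show "indicator A \<in> borel_measurable L" using AL by simp
        show "AE V in L. ennreal (f n (rep V)) \<le> 1" for n
          using test_fun_bounds[OF tf] by (auto intro!: AE_I2 simp: ennreal_le_1)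
        show "(\<integral>\<^sup>+V. 1 \<partial>L) < \<infinity>" using L(2) spL by simp
        show "AE V in L. (\<lambda>n. ennreal (f n (rep V))) \<longlonglongrightarrow> indicator A V"
        proof (rule AE_I2)
          fix V assume "V \<in> space L"
          then have r: "rep V \<in> UT" "orb \<Gamma> (rep V) = V" using rep spL by auto
          have "rep V \<in> UT \<and> orb \<Gamma> (rep V) \<in> A \<longleftrightarrow> rep V \<in> UT \<and> rep V \<in> U"
            using arg_cong[OF U(2), of "\<lambda>S. rep V \<in> S"] by simp
          then have "V \<in> A \<longleftrightarrow> rep V \<in> U" using r by simp
          then have ind: "indicator A V = ennreal (indicator U (rep V))"
            by (cases "V \<in> A") simp_all
          show "(\<lambda>n. ennreal (f n (rep V))) \<longlonglongrightarrow> indicator A V"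
            unfolding ind by (rule tendsto_ennrealI[OF lim[OF r(1)]])
        qed
      qed simp
      then show ?thesis using AL by simp
    qed
    have "emeasure m (T1M \<Gamma>) = 1" using prob_space.emeasure_space_1[OF prob_m] by (simp add: space_m)
    from conv[OF refl this] conv[OF M] eq[OF tf] show ?thesis
      by (simp add: LIMSEQ_unique)
  qed
qed

section \<open>Time averages and the invariant measure\<close>

text \<open>\<open>rep\<close> cannot be composed measurably, but for each fixed time the function
  is invariant and measurable, and it is continuous in time. Sampling at multiples of 1 / (k + 1)
  gives measurable functions converging to it.\<close>

lemma flow_joint_measurable:
  assumes f: "test_fun f"
  shows "(\<lambda>p. f (geodesic_flow (snd p) (rep (fst p)))) \<in> borel_measurable (m \<Otimes>\<^sub>M lborel)"
proof -
  have 1: "(\<lambda>V. f (geodesic_flow c (rep V))) \<in> borel_measurable m" for c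
  proof (rule inv_fun_measurable)
    show "inv_fun (\<lambda>v. f (geodesic_flow c v))"
      using f by (auto simp: inv_fun_def test_fun_def geodesic_flow_gact geodesic_flow_UT )
    have "geodesic_flow c \<in> borel_measurable borel"
      by (intro borel_measurable_continuous_onI continuous_intros)
    then show "(\<lambda>v. f (geodesic_flow c v)) \<in> borel_measurable (restrict_space borel UT)"
      using test_fun_borel[OF f] by (intro measurable_restrict_space1) (rule measurable_compose)
  qed
  show ?thesis
  proof (rule borel_measurable_LIMSEQ_real[where
        u="\<lambda>k p. f (geodesic_flow (real_of_int \<lfloor>real (Suc k) * snd p\<rfloor> / real (Suc k)) (rep (fst p)))"])
    fix k :: nat
    have "(\<lambda>p. (\<lambda>i p. f (geodesic_flow (real_of_int i / real (Suc k)) (rep (fst p)))) \<lfloor>real (Suc k) * snd p\<rfloor> p)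
        \<in> borel_measurable (m \<Otimes>\<^sub>M lborel)"
    proof (rule measurable_compose_countable[where g="\<lambda>p. \<lfloor>real (Suc k) * snd p\<rfloor>"
          and f="\<lambda>i p. f (geodesic_flow (real_of_int i / real (Suc k)) (rep (fst p)))"])
      show "(\<lambda>p. f (geodesic_flow (real_of_int i / real (Suc k)) (rep (fst p)))) \<in> borel_measurable (m \<Otimes>\<^sub>M lborel)" for i
        by (rule measurable_compose[OF measurable_fst 1])
      show "(\<lambda>p. \<lfloor>real (Suc k) * snd p\<rfloor>) \<in> measurable (m \<Otimes>\<^sub>M lborel) (count_space UNIV)" by measurable
    qed
    then show "(\<lambda>p. f (geodesic_flow (real_of_int \<lfloor>real (Suc k) * snd p\<rfloor> / real (Suc k)) (rep (fst p)))) \<in> borel_measurable (m \<Otimes>\<^sub>M lborel)"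
      by simp
  next
    fix p assume "p \<in> space (m \<Otimes>\<^sub>M (lborel :: real measure))"
    then have "fst p \<in> T1M \<Gamma>" by (auto simp: space_pair_measure space_m)
    then have r: "rep (fst p) \<in> UT" using rep by blast
    have "(\<lambda>k. real_of_int \<lfloor>real (Suc k) * snd p\<rfloor> / real (Suc k)) \<longlonglongrightarrow> snd p"
    proof (rule tendsto_sandwich)
      show "\<forall>\<^sub>F k in sequentially. snd p - 1 / real (Suc k) \<le> real_of_int \<lfloor>real (Suc k) * snd p\<rfloor> / real (Suc k)"
      proof (intro always_eventually allI)
        fix k
        have "real (Suc k) * snd p - 1 \<le> real_of_int \<lfloor>real (Suc k) * snd p\<rfloor>" by linarith
        then have "(real (Suc k) * snd p - 1) / real (Suc k) \<le> real_of_int \<lfloor>real (Suc k) * snd p\<rfloor> / real (Suc k)"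
          by (intro divide_right_mono) auto
        then show "snd p - 1 / real (Suc k) \<le> real_of_int \<lfloor>real (Suc k) * snd p\<rfloor> / real (Suc k)"
          by (simp add: diff_divide_distrib del: of_nat_Suc)
      qed
      show "\<forall>\<^sub>F k in sequentially. real_of_int \<lfloor>real (Suc k) * snd p\<rfloor> / real (Suc k) \<le> snd p"
      proof (intro always_eventually allI)
        fix k
        have "real_of_int \<lfloor>real (Suc k) * snd p\<rfloor> / real (Suc k) \<le> (real (Suc k) * snd p) / real (Suc k)"
          by (intro divide_right_mono) auto
        then show "real_of_int \<lfloor>real (Suc k) * snd p\<rfloor> / real (Suc k) \<le> snd p" by (simp del: of_nat_Suc)
      qed
      show "(\<lambda>k. snd p - 1 / real (Suc k)) \<longlonglongrightarrow> snd p" by real_asymp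
    qed simp
    then show "(\<lambda>k. f (geodesic_flow (real_of_int \<lfloor>real (Suc k) * snd p\<rfloor> / real (Suc k)) (rep (fst p)))) \<longlonglongrightarrow> f (geodesic_flow (snd p) (rep (fst p)))"
      using continuous_on_tendsto_compose[OF test_fun_flow_continuous[OF f r]] by simp
  qed
qed

text \<open>Fubini exchanges time and space, and invariance of the measure makes the inner integral
  constant in time.\<close>

lemma nn_integral_flow_average:
  assumes f: "test_fun f" and t: "t \<ge> 0"
  shows "(\<integral>\<^sup>+V. ennreal (integral {0..t} (\<lambda>u. f (geodesic_flow u (rep V)))) \<partial>m)
     = ennreal t * (\<integral>\<^sup>+V. ennreal (f (rep V)) \<partial>m)"
    "(\<lambda>V. integral {0..t} (\<lambda>u. f (geodesic_flow u (rep V)))) \<in> borel_measurable m"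
proof -
  interpret prob_space m by (rule prob_m)
  interpret P: pair_sigma_finite m "lborel :: real measure" ..
  define h where "h V u = indicator {0..t} u * f (geodesic_flow u (rep V))" for V u
  have hm: "(\<lambda>p. h (fst p) (snd p)) \<in> borel_measurable (m \<Otimes>\<^sub>M lborel)"
    unfolding h_def using flow_joint_measurable[OF f] by measurable
  have hn: "h V u \<ge> 0" for V u using test_fun_bounds[OF f] by (simp add: h_def)
  have hi: "((\<lambda>u. f (geodesic_flow u (rep V))) has_integral integral {0..t} (\<lambda>u. f (geodesic_flow u (rep V)))) {0..t}" if "V \<in> space m" for V
  proof -
    have "rep V \<in> UT" using that rep by (simp add: space_m)
    then have "continuous_on {0..t} (\<lambda>u. f (geodesic_flow u (rep V)))"
      using test_fun_flow_continuous[OF f] continuous_on_subset by blast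
    then show ?thesis by (intro integrable_integral integrable_continuous_real)
  qed
  have eq: "(\<integral>\<^sup>+u. ennreal (h V u) \<partial>lborel) = ennreal (integral {0..t} (\<lambda>u. f (geodesic_flow u (rep V))))"
    and eq': "(\<integral>u. h V u \<partial>lborel) = integral {0..t} (\<lambda>u. f (geodesic_flow u (rep V)))" if V: "V \<in> space m" for V
  proof -
    have hV: "h V \<in> borel_measurable lborel" using measurable_Pair2[OF hm V] by simp
    have "((\<lambda>u. h V u) has_integral integral {0..t} (\<lambda>u. f (geodesic_flow u (rep V)))) UNIV"
    proof -
      have "h V = (\<lambda>u. if u \<in> {0..t} then f (geodesic_flow u (rep V)) else 0)"
        by (auto simp: h_def indicator_def)
      then show ?thesis using hi[OF V] by (simp only: has_integral_restrict_UNIV)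
    qed
    then show "(\<integral>\<^sup>+u. ennreal (h V u) \<partial>lborel) = ennreal (integral {0..t} (\<lambda>u. f (geodesic_flow u (rep V))))"
      using hV hn by (intro nn_integral_has_integral_lborel) auto
    then show "(\<integral>u. h V u \<partial>lborel) = integral {0..t} (\<lambda>u. f (geodesic_flow u (rep V)))"
      using hV hn has_integral_nonneg[OF hi[OF V]] test_fun_bounds(1)[OF f]
      by (subst integral_eq_nn_integral) auto
  qed
  have "(\<lambda>V. \<integral>u. h V u \<partial>lborel) \<in> borel_measurable m"
    using hm by (intro lborel.borel_measurable_lebesgue_integral) (simp add: split_beta')
  then show "(\<lambda>V. integral {0..t} (\<lambda>u. f (geodesic_flow u (rep V)))) \<in> borel_measurable m"
    by (subst measurable_cong[where g="\<lambda>V. \<integral>u. h V u \<partial>lborel"]) (auto simp: eq')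
  have fr: "(\<lambda>V. f (rep V)) \<in> borel_measurable m"
    using f by (intro inv_fun_measurable measurable_restrict_space1 test_fun_borel) (auto simp: test_fun_def)
  have inv: "(\<integral>\<^sup>+V. ennreal (f (geodesic_flow u (rep V))) \<partial>m) = (\<integral>\<^sup>+V. ennreal (f (rep V)) \<partial>m)" for u
  proof -
    have "(\<integral>\<^sup>+V. ennreal (f (rep V)) \<partial>m) = (\<integral>\<^sup>+V. ennreal (f (rep V)) \<partial>distr m m (T1M_flow u))"
      by (simp add: distr_T1M_flow)
    also have "\<dots> = (\<integral>\<^sup>+V. ennreal (f (rep (T1M_flow u V))) \<partial>m)"
      using fr T1M_flow_measurable by (subst nn_integral_distr) auto
    also have "\<dots> = (\<integral>\<^sup>+V. ennreal (f (geodesic_flow u (rep V))) \<partial>m)"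
    proof (rule nn_integral_cong)
      fix V assume "V \<in> space m"
      then have r: "rep V \<in> UT" "orb \<Gamma> (rep V) = V" using rep by (auto simp: space_m)
      then have "T1M_flow u V = orb \<Gamma> (geodesic_flow u (rep V))" by (metis orb_flow)
      then show "ennreal (f (rep (T1M_flow u V))) = ennreal (f (geodesic_flow u (rep V)))"
        using inv_fun_rep[of f] f geodesic_flow_UT[OF r(1)] by (simp add: test_fun_def)
    qed
    finally show ?thesis by simp
  qed
  have "(\<integral>\<^sup>+V. ennreal (integral {0..t} (\<lambda>u. f (geodesic_flow u (rep V)))) \<partial>m)
     = (\<integral>\<^sup>+V. \<integral>\<^sup>+u. ennreal (h V u) \<partial>lborel \<partial>m)" by (intro nn_integral_cong) (simp add: eq)
  also have "\<dots> = (\<integral>\<^sup>+u. \<integral>\<^sup>+V. ennreal (h V u) \<partial>m \<partial>lborel)"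
    using hm by (intro P.Fubini'[symmetric]) (simp add: split_beta')
  also have "\<dots> = (\<integral>\<^sup>+u. indicator {0..t} u * (\<integral>\<^sup>+V. ennreal (f (rep V)) \<partial>m) \<partial>lborel)"
    by (intro nn_integral_cong) (auto simp: h_def indicator_def inv)
  also have "\<dots> = (\<integral>\<^sup>+V. ennreal (f (rep V)) \<partial>m) * emeasure lborel {0..t}"
    by (subst mult.commute) (rule nn_integral_cmult_indicator, simp)
  finally show "(\<integral>\<^sup>+V. ennreal (integral {0..t} (\<lambda>u. f (geodesic_flow u (rep V)))) \<partial>m)
     = ennreal t * (\<integral>\<^sup>+V. ennreal (f (rep V)) \<partial>m)" using t by (simp add: mult.commute)
qed

text \<open>The averages have constant integral and lie between 0 and 1 on a probability space, so
  their almost sure limit must be that integral.\<close>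

lemma nn_integral_of_averages:
  assumes f: "test_fun f" and t: "filterlim t at_top sequentially" "\<And>n. t n \<ge> 0"
    and lim: "AE V in m. (\<lambda>n. integral {0..t n} (\<lambda>u. f (geodesic_flow u (rep V))) / t n) \<longlonglongrightarrow> I"
  shows "(\<integral>\<^sup>+V. ennreal (f (rep V)) \<partial>m) = ennreal I"
proof -
  interpret prob_space m by (rule prob_m)
  have b: "0 \<le> integral {0..t n} (\<lambda>u. f (geodesic_flow u (rep V))) / t n"
    "integral {0..t n} (\<lambda>u. f (geodesic_flow u (rep V))) / t n \<le> 1" if "V \<in> space m" for V n
  proof -
    have "rep V \<in> UT" using that rep by (simp add: space_m)
    from integral_bounds_01[OF test_fun_flow_continuous[OF f this] test_fun_bounds[OF f] t(2)[of n]]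
    show "0 \<le> integral {0..t n} (\<lambda>u. f (geodesic_flow u (rep V))) / t n"
      "integral {0..t n} (\<lambda>u. f (geodesic_flow u (rep V))) / t n \<le> 1"
      using t(2)[of n] by (auto simp: divide_le_eq_1)
  qed
  have "(\<lambda>n. \<integral>\<^sup>+V. ennreal (integral {0..t n} (\<lambda>u. f (geodesic_flow u (rep V))) / t n) \<partial>m) \<longlonglongrightarrow> (\<integral>\<^sup>+V. ennreal I \<partial>m)"
  proof (rule nn_integral_dominated_convergence[where w="\<lambda>_. 1"])
    show "(\<lambda>V. ennreal (integral {0..t n} (\<lambda>u. f (geodesic_flow u (rep V))) / t n)) \<in> borel_measurable m" for n
      using nn_integral_flow_average(2)[OF f t(2)] by measurable
    show "AE V in m. ennreal (integral {0..t n} (\<lambda>u. f (geodesic_flow u (rep V))) / t n) \<le> 1" for n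
      using b by (auto intro!: AE_I2 simp: ennreal_le_1)
    show "AE V in m. (\<lambda>n. ennreal (integral {0..t n} (\<lambda>u. f (geodesic_flow u (rep V))) / t n)) \<longlonglongrightarrow> ennreal I"
      using lim by eventually_elim (rule tendsto_ennrealI)
  qed (simp_all add: emeasure_space_1)
  moreover have "\<forall>\<^sub>F n in sequentially. (\<integral>\<^sup>+V. ennreal (integral {0..t n} (\<lambda>u. f (geodesic_flow u (rep V))) / t n) \<partial>m) = (\<integral>\<^sup>+V. ennreal (f (rep V)) \<partial>m)"
    using filterlim_at_top_dense[THEN iffD1, OF t(1), rule_format, of 0]
  proof eventually_elim
    case (elim n)
    have "(\<integral>\<^sup>+V. ennreal (integral {0..t n} (\<lambda>u. f (geodesic_flow u (rep V))) / t n) \<partial>m)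
      = (\<integral>\<^sup>+V. ennreal (1 / t n) * ennreal (integral {0..t n} (\<lambda>u. f (geodesic_flow u (rep V)))) \<partial>m)"
      using elim by (intro nn_integral_cong) (simp add: ennreal_mult'[symmetric])
    also have "\<dots> = ennreal (1 / t n) * (ennreal (t n) * (\<integral>\<^sup>+V. ennreal (f (rep V)) \<partial>m))"
      using nn_integral_flow_average[OF f t(2)[of n]] by (subst nn_integral_cmult) simp_all
    also have "\<dots> = (\<integral>\<^sup>+V. ennreal (f (rep V)) \<partial>m)"
      using elim by (simp add: mult.assoc[symmetric] ennreal_mult'[symmetric])
    finally show ?case .
  qed
  ultimately have "(\<lambda>n. \<integral>\<^sup>+V. ennreal (f (rep V)) \<partial>m) \<longlonglongrightarrow> (\<integral>\<^sup>+V. ennreal I \<partial>m)"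
    by (rule Lim_transform_eventually)
  then have "(\<integral>\<^sup>+V. ennreal (f (rep V)) \<partial>m) = (\<integral>\<^sup>+V. ennreal I \<partial>m)" by (simp add: LIMSEQ_const_iff)
  then show ?thesis by (simp add: emeasure_space_1)
qed

end

section \<open>The suspension measure\<close>

locale bms_system = skew_system \<Gamma> \<mu> \<Delta>\<^sub>0 \<Delta> \<gamma> T \<Lambda>m C\<^sub>1 lam eps lam' \<nu> \<nu>' + bms \<Gamma> \<mu> m
  for \<Gamma> :: "'d::finite lmat set" and \<mu> \<Delta>\<^sub>0 \<Delta> \<gamma> T \<Lambda>m C\<^sub>1 lam eps lam' \<nu> \<nu>' m
begin

lemma measurable_\<nu>':
  assumes "g \<in> measurable (borel \<Otimes>\<^sub>M borel) N"
  shows "g \<in> measurable \<nu>' N"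
  unfolding measurable_cong_sets[OF sm.space_sets(2) refl] using assms by (rule measurable_restrict_space1)

lemma fst_\<nu>' [measurable]: "fst \<in> borel_measurable \<nu>'" and snd_\<nu>' [measurable]: "snd \<in> borel_measurable \<nu>'"
  by (rule measurable_\<nu>', measurable)+

lemma fst_\<nu>'_\<nu>: "fst \<in> measurable \<nu>' \<nu>"
  unfolding measurable_cong_sets[OF refl cm.space_sets(2)]
proof (rule measurable_restrict_space2)
  show "fst \<in> space \<nu>' \<rightarrow> \<Delta>\<^sub>0" unfolding sm.space_sets(1) using X_D \<Delta>_subset by blast
qed (rule fst_\<nu>')

text \<open>The roof function cut off outside the coding domain, where \<^term>\<open>roof T\<close> need not be measurable.\<close>

definition rf :: "real ^ 'd \<Rightarrow> real" where
  "rf x = indicator \<Delta>u x * roof T x"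

lemma rf_eq: "x \<in> \<Delta>u \<Longrightarrow> rf x = roof T x"
  by (simp add: rf_def)

lemma rf_nonneg: "rf x \<ge> 0"
  using roof_ge[of x] minus_ln_lam_pos by (cases "x \<in> \<Delta>u") (auto simp: rf_def)

lemma rf_borel [measurable]: "rf \<in> borel_measurable borel"
proof (rule measurable_piecewise_restrict[where C="insert (- \<Delta>u) (range \<Delta>)"])
  show "countable (insert (- \<Delta>u) (range \<Delta>))" by simp
  show "\<Omega> \<inter> space borel \<in> sets borel" if "\<Omega> \<in> insert (- \<Delta>u) (range \<Delta>)" for \<Omega>
    using that \<Delta>_open sets_\<Delta>u by (auto intro: borel_open borel_comp)
  show "space borel \<subseteq> \<Union>(insert (- \<Delta>u) (range \<Delta>))" by auto
  fix \<Omega> assume "\<Omega> \<in> insert (- \<Delta>u) (range \<Delta>)"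
  then consider "\<Omega> = - \<Delta>u" | j where "\<Omega> = \<Delta> j" by auto
  then show "rf \<in> borel_measurable (restrict_space borel \<Omega>)"
  proof cases
    case 1
    then show ?thesis
      by (subst measurable_cong[where g="\<lambda>_. 0"]) (auto simp: space_restrict_space rf_def)
  next
    case (2 j)
    have "hgt (ginv j) \<in> borel_measurable borel"
      by (rule borel_measurable_continuous_onI[OF continuous_hgt])
    then have "(\<lambda>x. - ln (hgt (ginv j) x)) \<in> borel_measurable (restrict_space borel \<Omega>)"
      by (intro measurable_restrict_space1) measurable
    moreover have "rf x = - ln (hgt (ginv j) x)" if "x \<in> \<Delta> j" for x
      using coding_point(6)[OF that] that by (subst rf_eq) auto
    ultimately show ?thesis
      by (subst measurable_cong[where g="\<lambda>x. - ln (hgt (ginv j) x)"]) (auto simp: space_restrict_space 2)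
  qed
qed

text \<open>The exponential tail is stated for \<open>\<mu>\<close>, whereas the mean roof is an
  integral over \<open>\<nu>'\<close>; the projection to \<open>\<nu>\<close> and the upper density
  bound link them.\<close>

lemma nn_integral_rf_finite: "(\<integral>\<^sup>+q. ennreal (rf (fst q)) \<partial>\<nu>') < \<infinity>"
proof -
  obtain b :: real where b: "b > 0"
    "\<And>A. A \<in> sets borel \<Longrightarrow> emeasure \<nu> (A \<inter> \<Delta>u) \<le> ennreal b * emeasure \<mu> (lam_image A)"
    using \<nu>_bounds by metis
  \<comment> \<open>Both measures are transported to the Borel sets of the chart, where the
    inequality between them can be integrated.\<close>
  define M1 where "M1 = distr \<nu> borel (\<lambda>x. x)"
  define M2 where "M2 = distr (restrict_space \<mu> (lam_image UNIV)) borel fin_part"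
  have LU: "lam_image UNIV \<in> sets \<mu>" by (rule sets_lam_image) simp
  have id: "(\<lambda>x. x) \<in> measurable \<nu> borel"
    unfolding measurable_cong_sets[OF cm.space_sets(2) refl] by (rule measurable_restrict_space1) simp
  have fp\<mu>: "fin_part \<in> borel_measurable \<mu>"
    unfolding measurable_cong_sets[OF \<mu>_facts(2) refl] by (rule borel_fin_part)
  then have fp: "fin_part \<in> borel_measurable (restrict_space \<mu> (lam_image UNIV))"
    by (rule measurable_restrict_space1)
  have le: "M1 \<le> scale_measure (ennreal b) M2"
  proof (subst le_measure)
    show "sets M1 = sets (scale_measure (ennreal b) M2)" by (simp add: M1_def M2_def)
    show "\<forall>A\<in>sets M1. emeasure M1 A \<le> emeasure (scale_measure (ennreal b) M2) A"
    proof
      fix A assume "A \<in> sets M1"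
      then have A: "A \<in> sets borel" by (simp add: M1_def)
      have "emeasure M1 A = emeasure \<nu> (A \<inter> space \<nu>)"
        unfolding M1_def using emeasure_distr[OF id A] by (simp add: vimage_def Int_def)
      also have "\<dots> = emeasure \<nu> (A \<inter> \<Delta>u)"
      proof (rule emeasure_eq_AE)
        show "AE x in \<nu>. x \<in> A \<inter> space \<nu> \<longleftrightarrow> x \<in> A \<inter> \<Delta>u"
          using \<nu>_\<Delta>u(3) AE_space by eventually_elim auto
        show "A \<inter> space \<nu> \<in> sets \<nu>" using measurable_sets[OF id A] by (simp add: vimage_def Int_def)
      qed (rule sets_\<nu>_borel[OF A])
      also have "\<dots> \<le> ennreal b * emeasure \<mu> (lam_image A)" by (rule b(2)[OF A])
      also have "emeasure \<mu> (lam_image A) = emeasure M2 A"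
      proof -
        have "fin_part -` A \<inter> space (restrict_space \<mu> (lam_image UNIV)) = lam_image A"
          by (auto simp: space_restrict_space space_\<mu> lam_image_def)
        then have "emeasure M2 A = emeasure (restrict_space \<mu> (lam_image UNIV)) (lam_image A)"
          unfolding M2_def using emeasure_distr[OF fp A] by simp
        also have "\<dots> = emeasure \<mu> (lam_image A)"
          using LU by (intro emeasure_restrict_space) (auto simp: lam_image_def)
        finally show ?thesis by simp
      qed
      finally show "emeasure M1 A \<le> emeasure (scale_measure (ennreal b) M2) A" by simp
    qed
  qed
  have "(\<integral>\<^sup>+q. ennreal (rf (fst q)) \<partial>\<nu>') = (\<integral>\<^sup>+x. ennreal (rf x) \<partial>distr \<nu>' \<nu> fst)"
    using fst_\<nu>'_\<nu> measurable_compose[OF id rf_borel] by (subst nn_integral_distr) auto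
  also have "\<dots> = (\<integral>\<^sup>+x. ennreal (rf x) \<partial>M1)"
    unfolding sm.projects M1_def using id by (subst nn_integral_distr) auto
  also have "\<dots> \<le> (\<integral>\<^sup>+x. ennreal (rf x) \<partial>scale_measure (ennreal b) M2)"
    using le by (intro nn_integral_mono_measure) (auto simp: M1_def M2_def)
  also have "\<dots> = ennreal b * (\<integral>\<^sup>+x. ennreal (rf x) \<partial>M2)"
    by (rule nn_integral_scale_measure) (simp add: M2_def)
  also have "(\<integral>\<^sup>+x. ennreal (rf x) \<partial>M2) = (\<integral>\<^sup>+\<xi>. ennreal (rf (fin_part \<xi>)) \<partial>restrict_space \<mu> (lam_image UNIV))"
    unfolding M2_def using fp by (subst nn_integral_distr) auto
  also have "\<dots> = (\<integral>\<^sup>+\<xi>. ennreal (rf (fin_part \<xi>)) * indicator (lam_image UNIV) \<xi> \<partial>\<mu>)"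
    using LU by (subst nn_integral_restrict_space) auto
  also have "\<dots> \<le> (\<integral>\<^sup>+\<xi>. ennreal (1 / eps) * (ennreal (exp (eps * roof T (fin_part \<xi>))) * indicator (Fin ` \<Delta>u) \<xi>) \<partial>\<mu>)"
  proof (rule nn_integral_mono)
    fix \<xi>
    show "ennreal (rf (fin_part \<xi>)) * indicator (lam_image UNIV) \<xi>
      \<le> ennreal (1 / eps) * (ennreal (exp (eps * roof T (fin_part \<xi>))) * indicator (Fin ` \<Delta>u) \<xi>)"
    proof (cases "\<xi> \<in> lam_image UNIV")
      case True
      then obtain x where x: "\<xi> = Fin x" "x \<in> \<Delta>u" by (auto simp: lam_image_def)
      \<comment> \<open>Exponential integrability implies integrability through u \<le> exp u, at
        the cost of the factor 1 / eps.\<close>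
      have "eps * roof T x \<le> exp (eps * roof T x)" using exp_ge_add_one_self[of "eps * roof T x"] by linarith
      then have "roof T x \<le> 1 / eps * exp (eps * roof T x)" using constants by (simp add: field_simps)
      then have "ennreal (roof T x) \<le> ennreal (1 / eps) * ennreal (exp (eps * roof T x))"
        using constants by (simp add: ennreal_mult'[symmetric] ennreal_leI)
      then show ?thesis using x True by (simp add: rf_eq)
    qed simp
  qed
  also have "\<dots> = ennreal (1 / eps) * (\<integral>\<^sup>+\<xi>. ennreal (exp (eps * roof T (fin_part \<xi>))) * indicator (Fin ` \<Delta>u) \<xi> \<partial>\<mu>)"
  proof (rule nn_integral_cmult)
    have "(\<lambda>\<xi>. ennreal (exp (eps * rf (fin_part \<xi>))) * indicator (Fin ` \<Delta>u) \<xi>) \<in> borel_measurable \<mu>"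
      using fp\<mu> sets_Fin_image[OF sets_\<Delta>u] \<mu>_facts(2) by measurable
    moreover have "ennreal (exp (eps * rf (fin_part \<xi>))) * indicator (Fin ` \<Delta>u) \<xi> = ennreal (exp (eps * roof T (fin_part \<xi>))) * indicator (Fin ` \<Delta>u) \<xi>" for \<xi>
    proof (cases "\<xi> \<in> Fin ` \<Delta>u")
      case True
      then obtain x where "\<xi> = Fin x" "x \<in> \<Delta>u" by auto
      then show ?thesis by (simp only: fin_part.simps rf_eq)
    qed simp
    ultimately show "(\<lambda>\<xi>. ennreal (exp (eps * roof T (fin_part \<xi>))) * indicator (Fin ` \<Delta>u) \<xi>) \<in> borel_measurable \<mu>"
      by simp
  qed
  finally have "(\<integral>\<^sup>+q. ennreal (rf (fst q)) \<partial>\<nu>') \<le> ennreal b * (ennreal (1 / eps) *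
     (\<integral>\<^sup>+\<xi>. ennreal (exp (eps * roof T (fin_part \<xi>))) * indicator (Fin ` \<Delta>u) \<xi> \<partial>\<mu>))"
    by (simp add: mult_left_mono)
  also have "\<dots> < \<infinity>" using exponential_tail by (simp add: ennreal_mult_less_top)
  finally show ?thesis .
qed

lemma rf_integrable: "integrable \<nu>' (\<lambda>q. rf (fst q))"
  using nn_integral_rf_finite rf_nonneg by (intro integrableI_nonneg) auto

definition Rbar :: real where "Rbar = (\<integral>q. roof T (fst q) \<partial>\<nu>')"

lemma rf_X: "q \<in> X \<Longrightarrow> rf (fst q) = roof T (fst q)"
  using X_D by (intro rf_eq) auto

lemma Rbar_eq: "Rbar = (\<integral>q. rf (fst q) \<partial>\<nu>')"
  unfolding Rbar_def by (intro Bochner_Integration.integral_cong) (auto simp: sm.space_sets(1) rf_X)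

text \<open>The roof is at least \<open>- ln lam\<close>, and averaging over a probability measure
  preserves this bound.\<close>

lemma Rbar_pos: "Rbar > 0"
proof -
  interpret prob_space \<nu>' by (rule sm.prob)
  have "(\<integral>q. - ln lam \<partial>\<nu>') \<le> (\<integral>q. rf (fst q) \<partial>\<nu>')"
  proof (rule integral_mono)
    fix q assume "q \<in> space \<nu>'"
    then have "q \<in> X" by (simp add: sm.space_sets(1))
    then show "- ln lam \<le> rf (fst q)" using roof_ge[of "fst q"] X_D[of q] by (simp add: rf_X)
  qed (use rf_integrable in auto)
  then have "- ln lam \<le> Rbar" by (simp add: Rbar_eq prob_space)
  then show ?thesis using minus_ln_lam_pos by linarith
qed

abbreviation S :: "'d susp set" where "S \<equiv> susp_space \<Gamma> \<Delta> \<Lambda>m T"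

abbreviation NS :: "'d susp measure" where "NS \<equiv> susp_measure \<Gamma> \<Delta> \<Lambda>m T \<nu>'"

lemma S_iff: "p \<in> S \<longleftrightarrow> fst p \<in> X \<and> 0 \<le> snd p \<and> snd p < rf (fst (fst p))"
  using rf_X[of "fst p"] by (cases p) (auto simp: susp_space_def)

lemma S_sets: "S \<in> sets (\<nu>' \<Otimes>\<^sub>M lborel)"
proof -
  have "S = {p \<in> space (\<nu>' \<Otimes>\<^sub>M (lborel :: real measure)). 0 \<le> snd p \<and> snd p < rf (fst (fst p))}"
    unfolding set_eq_iff S_iff space_pair_measure sm.space_sets(1) by auto
  also have "\<dots> \<in> sets (\<nu>' \<Otimes>\<^sub>M lborel)" by measurable
  finally show ?thesis .
qed

lemma space_NS: "space NS = S"
  using sets.sets_into_space[OF S_sets] by (simp add: susp_measure_def space_scale_measure space_restrict_space Int_absorb2)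

lemma sets_NS: "sets NS = sets (restrict_space (\<nu>' \<Otimes>\<^sub>M lborel) S)"
  by (simp add: susp_measure_def)

lemma nn_integral_NS:
  assumes F: "H \<in> borel_measurable (\<nu>' \<Otimes>\<^sub>M lborel)"
  shows "(\<integral>\<^sup>+p. H p \<partial>NS) = ennreal (1 / Rbar) * (\<integral>\<^sup>+q. \<integral>\<^sup>+s. H (q, s) * indicator {0..<rf (fst q)} s \<partial>lborel \<partial>\<nu>')"
proof -
  have "(\<integral>\<^sup>+p. H p \<partial>NS) = ennreal (1 / Rbar) * (\<integral>\<^sup>+p. H p \<partial>restrict_space (\<nu>' \<Otimes>\<^sub>M lborel) S)"
    unfolding susp_measure_def Rbar_def[symmetric]
    using F by (intro nn_integral_scale_measure measurable_restrict_space1)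
  also have "(\<integral>\<^sup>+p. H p \<partial>restrict_space (\<nu>' \<Otimes>\<^sub>M lborel) S) = (\<integral>\<^sup>+p. H p * indicator S p \<partial>(\<nu>' \<Otimes>\<^sub>M lborel))"
    using S_sets by (intro nn_integral_restrict_space) auto
  also have "\<dots> = (\<integral>\<^sup>+q. \<integral>\<^sup>+s. H (q, s) * indicator S (q, s) \<partial>lborel \<partial>\<nu>')"
    by (rule lborel.nn_integral_fst[of "\<lambda>p. H p * indicator S p", symmetric])
      (intro borel_measurable_times_ennreal F borel_measurable_indicator S_sets)
  also have "\<dots> = (\<integral>\<^sup>+q. \<integral>\<^sup>+s. H (q, s) * indicator {0..<rf (fst q)} s \<partial>lborel \<partial>\<nu>')"
  proof (intro nn_integral_cong)
    fix q and s :: real assume "q \<in> space \<nu>'"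
    then have "indicator S (q, s) = (indicator {0..<rf (fst q)} s :: ennreal)"
      using S_iff[of "(q, s)"] by (simp add: sm.space_sets(1) indicator_def)
    then show "H (q, s) * indicator S (q, s) = H (q, s) * indicator {0..<rf (fst q)} s" by simp
  qed
  finally show ?thesis .
qed

lemma emeasure_NS: "emeasure NS S = 1"
proof -
  have "emeasure NS S = (\<integral>\<^sup>+p. 1 \<partial>NS)" by (simp add: space_NS)
  also have "\<dots> = ennreal (1 / Rbar) * (\<integral>\<^sup>+q. ennreal (rf (fst q)) \<partial>\<nu>')"
    by (subst nn_integral_NS) (simp_all add: rf_nonneg)
  also have "(\<integral>\<^sup>+q. ennreal (rf (fst q)) \<partial>\<nu>') = ennreal Rbar"
    unfolding Rbar_eq using rf_integrable rf_nonneg by (intro nn_integral_eq_integral) auto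
  also have "ennreal (1 / Rbar) * ennreal Rbar = 1"
    using Rbar_pos by (simp add: ennreal_mult'[symmetric])
  finally show ?thesis .
qed

lemma lv_borel: "(\<lambda>p. lv (fst p) (snd p)) \<in> borel_measurable (\<nu>' \<Otimes>\<^sub>M lborel)"
proof -
  have "(\<lambda>p. (Fin (fst (fst p)), snd (fst p), snd p + ln (1 + (norm (fst (fst p)))\<^sup>2)))
      \<in> measurable (\<nu>' \<Otimes>\<^sub>M lborel) (borel \<Otimes>\<^sub>M (borel \<Otimes>\<^sub>M borel))"
    by measurable
  from measurable_compose[OF this borel_hinv] show ?thesis
    unfolding lv_def lift_map_eq .
qed

section \<open>Domain of the suspension flow and measurability of the factor map\<close>

definition orbits :: "((real ^ 'd) \<times> (real ^ 'd) bdry) set" where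
  "orbits = {q. \<forall>i. (F ^^ i) q \<in> X}"

lemma orbits_AE: "orbits \<in> sets \<nu>'" "AE q in \<nu>'. q \<in> orbits"
  unfolding orbits_def by (rule invariant_ae_orbit[OF sm.prob sm.invariant])+

text \<open>Roof sums grow at least linearly along a full orbit, so every finite time is passed
  after finitely many returns.\<close>

lemma flow_defined:
  assumes q: "q \<in> orbits" and s: "0 \<le> s" "s < rf (fst q)" and t: "t \<ge> 0"
  shows "(q, s) \<in> flow_dom \<Gamma> \<Delta> \<gamma> \<Lambda>m T t"
proof -
  have it: "(F ^^ i) q \<in> X" for i using q by (simp add: orbits_def)
  have grow: "real n * (- ln lam) \<le> Rn n q" for n
  proof (induction n)
    case (Suc n)
    have "- ln lam \<le> roof T (fst ((F ^^ n) q))" using X_D[OF it] by (intro roof_ge) auto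
    then show ?case using Suc by (simp add: Rn_Suc algebra_simps)
  qed simp
  obtain n0 :: nat where "s + t < real n0 * (- ln lam)"
    using reals_Archimedean3[OF minus_ln_lam_pos] by blast
  then have "s + t < Rn n0 q" using grow[of n0] by linarith
  then obtain n where n: "s + t < Rn n q" "\<And>k. k < n \<Longrightarrow> \<not> s + t < Rn k q"
    using exists_least_iff[of "\<lambda>n. s + t < Rn n q"] by blast
  \<comment> \<open>\<open>n\<close> is the first index whose roof sum exceeds \<open>s + t\<close>;
    the flow index is its predecessor.\<close>
  then have "n \<noteq> 0" using s t by (cases n) auto
  then obtain k where k: "n = Suc k" by (cases n) auto
  have "flow_index \<Gamma> \<Delta> \<gamma> \<Lambda>m T t (q, s) k"
    using n it by (auto simp: flow_index_def k Rn_Suc not_less)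
  moreover have "(q, s) \<in> S" using s it[of 0] by (simp add: S_iff)
  ultimately show ?thesis by (auto simp: flow_dom_def)
qed

lemma flow_defined_AE:
  assumes t: "t \<ge> 0"
  shows "AE p in NS. p \<in> flow_dom \<Gamma> \<Delta> \<gamma> \<Lambda>m T t"
proof -
  \<comment> \<open>Points of the suspension without defined flow lie over base points without a
    full orbit, and a product with a null base is null even though the time line is
    infinite.\<close>
  define B where "B = (space \<nu>' - orbits) \<times> (UNIV :: real set)"
  have Z: "emeasure \<nu>' (space \<nu>' - orbits) = 0"
    using orbits_AE by (simp add: AE_iff_measurable[of "space \<nu>' - orbits"] sets.compl_sets set_diff_eq)
  have B: "B \<in> sets (\<nu>' \<Otimes>\<^sub>M lborel)" unfolding B_def using orbits_AE(1) by auto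
  have "emeasure (\<nu>' \<Otimes>\<^sub>M lborel) B = 0"
    unfolding B_def using orbits_AE(1) by (subst lborel.emeasure_pair_measure_Times) (auto simp: Z)
  then have "emeasure (\<nu>' \<Otimes>\<^sub>M lborel) (B \<inter> S) = 0"
    using emeasure_mono[of "B \<inter> S" B "\<nu>' \<Otimes>\<^sub>M lborel"] B by simp
  moreover have BS: "B \<inter> S \<in> sets (\<nu>' \<Otimes>\<^sub>M lborel)" using B S_sets by auto
  ultimately have "emeasure NS (B \<inter> S) = 0"
    unfolding susp_measure_def using S_sets
    by (simp add: emeasure_scale_measure emeasure_restrict_space)
  moreover have "B \<inter> S \<in> sets NS" unfolding sets_NS using BS S_sets
    by (simp add: sets_restrict_space_iff)
  moreover have "{p \<in> space NS. p \<notin> flow_dom \<Gamma> \<Delta> \<gamma> \<Lambda>m T t} \<subseteq> B \<inter> S"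
  proof
    fix p assume p: "p \<in> {p \<in> space NS. p \<notin> flow_dom \<Gamma> \<Delta> \<gamma> \<Lambda>m T t}"
    obtain q s where ps: "p = (q, s)" by (cases p)
    have "p \<in> S" using p by (simp add: space_NS)
    moreover have "q \<notin> orbits" using flow_defined[of q s t] p t \<open>p \<in> S\<close> by (auto simp: ps S_iff)
    moreover have "q \<in> space \<nu>'" using \<open>p \<in> S\<close> by (simp add: ps S_iff sm.space_sets(1))
    ultimately show "p \<in> B \<inter> S" by (simp add: B_def ps)
  qed
  ultimately show ?thesis by (intro AE_I[of _ _ "B \<inter> S"])
qed

lemma factor_map_measurable: "factor_map \<Gamma> \<in> measurable NS m"
proof (rule measurableI)
  fix p assume "p \<in> space NS"
  then have "fst p \<in> X" by (simp add: space_NS S_iff)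
  then show "factor_map \<Gamma> p \<in> space m"
    using factor_map_lv[of "fst p" "snd p"] lv_UT by (simp add: space_m T1M_def)
next
  fix A assume A: "A \<in> sets m"
  define A' where "A' = {v\<in>UT. orb \<Gamma> v \<in> A}"
  have A': "A' \<in> sets borel" using A by (simp add: A'_def sets_m)
  have "factor_map \<Gamma> -` A \<inter> space NS = ((\<lambda>p. lv (fst p) (snd p)) -` A' \<inter> space (\<nu>' \<Otimes>\<^sub>M lborel)) \<inter> S"
  proof -
    have "factor_map \<Gamma> p \<in> A \<longleftrightarrow> lv (fst p) (snd p) \<in> A'" if "p \<in> S" for p
      using that factor_map_lv[of "fst p" "snd p"] lv_UT[of "fst p" "snd p"] by (simp add: S_iff A'_def)
    moreover have "S \<subseteq> space (\<nu>' \<Otimes>\<^sub>M lborel)" using sets.sets_into_space[OF S_sets] .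
    ultimately show ?thesis unfolding space_NS by blast
  qed
  also have "\<dots> \<in> sets NS"
    unfolding sets_NS using measurable_sets[OF lv_borel A'] S_sets by (simp add: sets_restrict_space_iff)
  finally show "factor_map \<Gamma> -` A \<inter> space NS \<in> sets NS" .
qed

section \<open>Birkhoff averages along the suspension\<close>

text \<open>A reference vector with forward endpoint \<open>x\<close>, asymptotic to every suspension point over \<open>x\<close>.\<close>

definition v0 :: "real ^ 'd \<Rightarrow> 'd uvec" where
  "v0 x = lv (x, Infty) 0"

lemma v0_UT: "v0 x \<in> UT"
  by (simp add: v0_def lv_def lift_map_eq hinv_UT)

lemma v0_plus: "fst (v0 x) + snd (v0 x) = (1 + (norm x)\<^sup>2) *\<^sub>R nhat (Fin x)"
  unfolding v0_def lv_plus by simp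

text \<open>The Birkhoff sum of the integrals over fibres is one integral along a single geodesic:
  each return changes the vector by a group element, to which \<open>f\<close> is blind.\<close>

lemma integral_Rn:
  assumes f: "test_fun f" and q: "q \<in> orbits"
  shows "(\<Sum>k<n. integral {0..rf (fst ((F ^^ k) q))} (\<lambda>u. f (lv ((F ^^ k) q) u))) = integral {0..Rn n q} (\<lambda>u. f (lv q u))"
    "Rn n q \<ge> 0"
proof -
  have it: "(F ^^ i) q \<in> X" for i using q by (simp add: orbits_def)
  have inv: "inv_fun f" using f by (simp add: test_fun_def)
  have cont: "continuous_on UNIV (\<lambda>u. f (lv q u))" if "q \<in> X" for q
    using test_fun_flow_continuous[OF f lv_UT[OF that, of 0]] that by (simp add: lv_flow)
  have "(\<Sum>k<n. integral {0..rf (fst ((F ^^ k) q))} (\<lambda>u. f (lv ((F ^^ k) q) u))) = integral {0..Rn n q} (\<lambda>u. f (lv q u)) \<and> Rn n q \<ge> 0"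
  proof (induction n)
    case (Suc n)
    define r where "r = rf (fst ((F ^^ n) q))"
    have r: "r \<ge> 0" "Rn (Suc n) q = Rn n q + r"
      unfolding r_def by (rule rf_nonneg) (simp only: Rn_Suc rf_X[OF it[of n]])
    have shift: "f (lv ((F ^^ n) q) u) = f (lv q (Rn n q + u))" for u
    proof -
      obtain g where "g \<in> \<Gamma>" "lv ((F ^^ n) q) (Rn n q + u - Rn n q) = gact g (lv q (Rn n q + u))"
        using lv_iterate[of n q "Rn n q + u"] it by blast
      then show ?thesis using inv lv_UT[OF it[of 0]] by (simp add: inv_fun_def)
    qed
    have "integral {0..r} (\<lambda>u. f (lv ((F ^^ n) q) u)) = integral {Rn n q..r + Rn n q} (\<lambda>u. f (lv q u))"
      using integral_shift_Icc_real[of 0 r "\<lambda>u. f (lv q u)" "Rn n q"] by (simp add: shift o_def)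
    moreover have "integral {0..Rn n q} (\<lambda>u. f (lv q u)) + integral {Rn n q..r + Rn n q} (\<lambda>u. f (lv q u)) = integral {0..r + Rn n q} (\<lambda>u. f (lv q u))"
      using Suc r cont[OF it[of 0]]
      by (intro Henstock_Kurzweil_Integration.integral_combine integrable_continuous_real) (auto intro: continuous_on_subset)
    ultimately show ?case using Suc r by (simp add: r_def[symmetric] add.commute)
  qed simp
  then show "(\<Sum>k<n. integral {0..rf (fst ((F ^^ k) q))} (\<lambda>u. f (lv ((F ^^ k) q) u))) = integral {0..Rn n q} (\<lambda>u. f (lv q u))"
    "Rn n q \<ge> 0" by auto
qed

text \<open>The Hopf argument for one test function: both integrals are identified with the number
  \<open>I\<close>, the left one by Fubini and the right one as the limit of time averages.\<close>

lemma nn_integral_test_fun: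
  assumes f: "test_fun f"
  shows "(\<integral>\<^sup>+p. ennreal (f (lv (fst p) (snd p))) \<partial>NS) = (\<integral>\<^sup>+V. ennreal (f (rep V)) \<partial>m)"
proof -
  interpret \<nu>': prob_space \<nu>' by (rule sm.prob)
  have inv: "inv_fun f" using f by (simp add: test_fun_def)
  have cont: "continuous_on UNIV (\<lambda>u. f (lv q u))" if "q \<in> X" for q
    using test_fun_flow_continuous[OF f lv_UT[OF that, of 0]] that by (simp add: lv_flow)
  have fl: "(\<lambda>p. f (lv (fst p) (snd p))) \<in> borel_measurable (\<nu>' \<Otimes>\<^sub>M lborel)"
    by (rule measurable_compose[OF lv_borel test_fun_borel[OF f]])
  define g where "g q = integral {0..rf (fst q)} (\<lambda>u. f (lv q u))" for q
  have inner: "(\<integral>\<^sup>+s. ennreal (f (lv q s)) * indicator {0..<rf (fst q)} s \<partial>lborel) = ennreal (g q)" if "q \<in> X" for q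
    unfolding g_def by (rule nn_integral_initial_segment[OF cont[OF that] test_fun_bounds(1)[OF f]])
  have g01: "0 \<le> g q" "g q \<le> rf (fst q)" if "q \<in> X" for q
    using integral_bounds_01[OF cont[OF that] test_fun_bounds[OF f] rf_nonneg[of "fst q"]] by (simp_all add: g_def)
  have gm: "g \<in> borel_measurable \<nu>'"
  proof -
    have "(\<lambda>p. ennreal (f (lv (fst p) (snd p))) * (if 0 \<le> snd p \<and> snd p < rf (fst (fst p)) then 1 else 0)) \<in> borel_measurable (\<nu>' \<Otimes>\<^sub>M lborel)"
      using fl by measurable
    moreover have "indicator {0..<a} s = (if 0 \<le> s \<and> s < a then 1 else 0 :: ennreal)" for a s :: real
      by (simp add: indicator_def)
    ultimately have "(\<lambda>p. ennreal (f (lv (fst p) (snd p))) * indicator {0..<rf (fst (fst p))} (snd p)) \<in> borel_measurable (\<nu>' \<Otimes>\<^sub>M lborel)"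
      by (simp only:)
    then have "(\<lambda>q. \<integral>\<^sup>+s. ennreal (f (lv q s)) * indicator {0..<rf (fst q)} s \<partial>lborel) \<in> borel_measurable \<nu>'"
      by (intro lborel.borel_measurable_nn_integral) (simp add: split_beta')
    then have "(\<lambda>q. enn2real (\<integral>\<^sup>+s. ennreal (f (lv q s)) * indicator {0..<rf (fst q)} s \<partial>lborel)) \<in> borel_measurable \<nu>'"
      by measurable
    then show ?thesis
      by (subst measurable_cong[where g="\<lambda>q. enn2real (\<integral>\<^sup>+s. ennreal (f (lv q s)) * indicator {0..<rf (fst q)} s \<partial>lborel)"])
        (auto simp: sm.space_sets(1) inner g01)
  qed
  have gi: "integrable \<nu>' g"
    using rf_integrable gm g01 by (rule_tac Bochner_Integration.integrable_bound) (auto intro!: AE_I2 simp: sm.space_sets(1) rf_nonneg)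
  define J where "J = (\<integral>q. g q \<partial>\<nu>')"
  define I where "I = J / Rbar"
  \<comment> \<open>The mean return time gives the common sequence of times, the same for every
    vector of the quotient.\<close>
  define t where "t n = real n * Rbar" for n
  have t: "filterlim t at_top sequentially" "\<And>n. t n \<ge> 0"
    unfolding t_def using Rbar_pos
    by (auto intro!: filterlim_tendsto_pos_mult_at_top filterlim_at_top_mult_tendsto_pos[OF tendsto_const] filterlim_real_sequentially)
  have NS: "(\<integral>\<^sup>+p. ennreal (f (lv (fst p) (snd p))) \<partial>NS) = ennreal I"
  proof -
    have "(\<integral>\<^sup>+p. ennreal (f (lv (fst p) (snd p))) \<partial>NS) = ennreal (1 / Rbar) * (\<integral>\<^sup>+q. ennreal (g q) \<partial>\<nu>')"
    proof -
      have "(\<integral>\<^sup>+q. \<integral>\<^sup>+s. ennreal (f (lv q s)) * indicator {0..<rf (fst q)} s \<partial>lborel \<partial>\<nu>') = (\<integral>\<^sup>+q. ennreal (g q) \<partial>\<nu>')"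
        by (rule nn_integral_cong) (rule inner, simp add: sm.space_sets(1))
      moreover have "(\<lambda>p. ennreal (f (lv (fst p) (snd p)))) \<in> borel_measurable (\<nu>' \<Otimes>\<^sub>M lborel)" using fl by measurable
      ultimately show ?thesis using nn_integral_NS[of "\<lambda>p. ennreal (f (lv (fst p) (snd p)))"] by simp
    qed
    also have "(\<integral>\<^sup>+q. ennreal (g q) \<partial>\<nu>') = ennreal J"
      unfolding J_def using gi g01 by (intro nn_integral_eq_integral) (auto intro!: AE_I2 simp: sm.space_sets(1))
    finally show ?thesis using Rbar_pos by (simp add: I_def ennreal_mult'[symmetric])
  qed
  \<comment> \<open>The averages are taken along the reference vector, so goodness is a condition on
    \<open>x\<close> alone and can be moved from \<open>\<nu>'\<close> to its projection.\<close>
  define avg where "avg x n = integral {0..t n} (\<lambda>u. f (geodesic_flow u (v0 x))) / t n" for x n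
  define Good where "Good = {x. avg x \<longlonglongrightarrow> I}"
  have v0c: "continuous_on UNIV (\<lambda>u. f (geodesic_flow u (v0 x)))" for x
    by (rule test_fun_flow_continuous[OF f v0_UT])
  have AE_Good: "AE q in \<nu>'. fst q \<in> Good"
    using birkhoff_ergodic_ae[OF sm.prob sm.invariant sm.ergodic gi]
      birkhoff_ergodic_ae[OF sm.prob sm.invariant sm.ergodic rf_integrable] orbits_AE(2)
  proof eventually_elim
    case (elim q)
    then have it: "(F ^^ i) q \<in> X" for i by (simp add: orbits_def)
    have q: "q \<in> X" using it[of 0] by simp
    have "(\<Sum>k<n. rf (fst ((F ^^ k) q))) = Rn n q" for n
      using it by (simp add: roof_sum_def rf_X)
    then have R: "(\<lambda>n. Rn n q / real n) \<longlonglongrightarrow> Rbar" using elim(2) by (simp add: Rbar_eq)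
    have "(\<lambda>n. integral {0..Rn n q} (\<lambda>u. f (lv q u)) / real n) \<longlonglongrightarrow> J"
      using elim(1) unfolding J_def g_def integral_Rn(1)[OF f elim(3)] .
    then have lim: "(\<lambda>n. integral {0..t n} (\<lambda>u. f (lv q u)) / t n) \<longlonglongrightarrow> I"
      unfolding t_def I_def
      by (intro average_at_multiple[OF cont[OF q] test_fun_bounds[OF f] integral_Rn(2)[OF f elim(3)] R Rbar_pos])
    have eq: "fst (v0 (fst q)) + snd (v0 (fst q)) = exp 0 *\<^sub>R (fst (lv q 0) + snd (lv q 0))"
      unfolding v0_plus lv_plus by simp
    have st: "((\<lambda>u. f (geodesic_flow u (v0 (fst q))) - f (lv q (u + 0))) \<longlongrightarrow> 0) at_top"
      using test_fun_stable[OF f v0_UT lv_UT[OF q, of 0] eq] q by (simp add: lv_flow)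
    have "avg (fst q) \<longlonglongrightarrow> I" unfolding avg_def
      by (rule average_asymptotic[OF v0c test_fun_bounds[OF f] cont[OF q] test_fun_bounds[OF f] st t(1) lim])
    then show ?case by (simp add: Good_def)
  qed
  have avgm: "(\<lambda>x. avg x n) \<in> borel_measurable borel" for n
  proof -
    have "(\<lambda>p :: (real ^ 'd) \<times> real. (Fin (fst p), Infty, snd p + ln (1 + (norm (fst p))\<^sup>2)))
      \<in> measurable (borel \<Otimes>\<^sub>M lborel) (borel \<Otimes>\<^sub>M (borel \<Otimes>\<^sub>M borel))" by measurable
    from measurable_compose[OF measurable_compose[OF this borel_hinv] test_fun_borel[OF f]]
    have "(\<lambda>p. f (lv (fst p, Infty) (snd p))) \<in> borel_measurable (borel \<Otimes>\<^sub>M lborel)"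
      by (simp add: lv_def lift_map_eq)
    moreover have "lv (x, Infty) u = geodesic_flow u (v0 x)" for x u
      by (simp add: v0_def lv_def lift_map_eq geodesic_flow_hinv add.commute)
    ultimately have "(\<lambda>p. f (geodesic_flow (snd p) (v0 (fst p)))) \<in> borel_measurable (borel \<Otimes>\<^sub>M lborel)" by simp
    then have "(\<lambda>p. ennreal (f (geodesic_flow (snd p) (v0 (fst p)))) * indicator {0..<t n} (snd p)) \<in> borel_measurable (borel \<Otimes>\<^sub>M lborel)"
      by measurable
    then have "(\<lambda>x. \<integral>\<^sup>+s. ennreal (f (geodesic_flow s (v0 x))) * indicator {0..<t n} s \<partial>lborel) \<in> borel_measurable borel"
      by (intro lborel.borel_measurable_nn_integral) (simp add: split_beta')
    then have "(\<lambda>x. enn2real (ennreal (integral {0..t n} (\<lambda>u. f (geodesic_flow u (v0 x))))) / t n) \<in> borel_measurable borel"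
      unfolding nn_integral_initial_segment[OF v0c test_fun_bounds(1)[OF f]] by measurable
    moreover have "integral {0..t n} (\<lambda>u. f (geodesic_flow u (v0 x))) \<ge> 0" for x
      by (rule integral_bounds_01(1)[OF v0c test_fun_bounds[OF f] t(2)])
    ultimately show ?thesis by (simp add: avg_def)
  qed
  \<comment> \<open>Measurability lets the null set be carried through the push-forward; for this
    the limit is rewritten with countable quantifiers.\<close>
  have Good: "Good \<in> sets borel"
  proof -
    have "Good = {x \<in> space borel. \<forall>k::nat. \<exists>N::nat. \<forall>n. N \<le> n \<longrightarrow> \<bar>avg x n - I\<bar> < 1 / real (Suc k)}"
    proof -
      have "avg x \<longlonglongrightarrow> I \<longleftrightarrow> (\<forall>k::nat. \<exists>N::nat. \<forall>n. N \<le> n \<longrightarrow> \<bar>avg x n - I\<bar> < 1 / real (Suc k))" for x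
      proof
        assume "avg x \<longlonglongrightarrow> I"
        then show "\<forall>k::nat. \<exists>N::nat. \<forall>n. N \<le> n \<longrightarrow> \<bar>avg x n - I\<bar> < 1 / real (Suc k)"
          unfolding LIMSEQ_def dist_real_def by (auto simp del: of_nat_Suc)
      next
        assume *: "\<forall>k::nat. \<exists>N::nat. \<forall>n. N \<le> n \<longrightarrow> \<bar>avg x n - I\<bar> < 1 / real (Suc k)"
        show "avg x \<longlonglongrightarrow> I"
        proof (rule LIMSEQ_I)
          fix e :: real assume "e > 0"
          then obtain k where k: "1 / real (Suc k) < e" by (metis nat_approx_posE)
          obtain N where N: "\<And>n. N \<le> n \<Longrightarrow> \<bar>avg x n - I\<bar> < 1 / real (Suc k)" using * by blast
          show "\<exists>N. \<forall>n\<ge>N. norm (avg x n - I) < e"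
          proof (intro exI allI impI)
            fix n assume "N \<le> n"
            then show "norm (avg x n - I) < e" using N[of n] k by simp
          qed
        qed
      qed
      then show ?thesis unfolding Good_def by simp
    qed
    also have "\<dots> \<in> sets borel" using avgm by measurable
    finally show ?thesis .
  qed
  define A where "A = - Good"
  have A: "A \<in> sets borel" using Good by (simp add: A_def borel_comp)
  have "emeasure \<nu> (A \<inter> \<Delta>u) = emeasure (distr \<nu>' \<nu> fst) (A \<inter> \<Delta>u)" by (simp add: sm.projects)
  also have "\<dots> = emeasure \<nu>' (fst -` (A \<inter> \<Delta>u) \<inter> space \<nu>')"
    by (rule emeasure_distr[OF fst_\<nu>'_\<nu> sets_\<nu>_borel[OF A]])
  also have "\<dots> = 0"
  proof -
    have "emeasure \<nu>' {q \<in> space \<nu>'. fst q \<in> A \<inter> \<Delta>u} = 0"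
      by (rule emeasure_eq_0_AE) (use AE_Good in eventually_elim, simp add: A_def)
    then show ?thesis by (simp add: vimage_def Int_def conj_commute)
  qed
  finally obtain N where N: "N \<in> null_sets \<mu>" "\<And>g \<xi>. g \<in> \<Gamma> \<Longrightarrow> \<xi> \<in> N \<Longrightarrow> bact g \<xi> \<in> N"
    "\<And>\<xi>. \<xi> \<notin> N \<Longrightarrow> \<exists>g\<in>\<Gamma>. \<exists>w\<in>\<Delta>u. bact g \<xi> = Fin w \<and> w \<notin> A"
    using spread_null[OF A] by metis
  have "AE V in m. bdry_of (fst (rep V) + snd (rep V)) \<notin> N"
    by (rule AE_m_forward[OF N(1)]) (rule N(2))
  then have "AE V in m. (\<lambda>n. integral {0..t n} (\<lambda>u. f (geodesic_flow u (rep V))) / t n) \<longlonglongrightarrow> I"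
    using AE_space
  proof eventually_elim
    case (elim V)
    then have r: "rep V \<in> UT" using rep by (simp add: space_m)
    obtain g w where g: "g \<in> \<Gamma>" and w: "bact g (bdry_of (fst (rep V) + snd (rep V))) = Fin w" "w \<in> Good"
      using N(3)[OF elim(1)] by (auto simp: A_def)
    define v where "v = gact g (rep V)"
    have v: "v \<in> UT" unfolding v_def using g r by (rule gact_UT')
    have bv: "bdry_of (fst v + snd v) = Fin w" unfolding v_def forward_gact[OF g r] by (rule w(1))
    define k where "k = 1 + (norm w)\<^sup>2"
    have k: "k > 0" by (simp add: k_def add_pos_nonneg)
    have c: "tm (fst v + snd v) > 0" by (rule UT_null(4)[OF v])
    have "fst v + snd v = tm (fst v + snd v) *\<^sub>R nhat (Fin w)"
      using UT_plus_minus(1)[OF v] unfolding bv .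
    \<comment> \<open>The ratio of the two scales on the same null ray is a time shift, which the
      averages do not see in the limit.\<close>
    also have "\<dots> = exp (ln (tm (fst v + snd v) / k)) *\<^sub>R (fst (v0 w) + snd (v0 w))"
      unfolding v0_plus k_def[symmetric] using k c by simp
    finally have "((\<lambda>u. f (geodesic_flow u v) - f (geodesic_flow (u + ln (tm (fst v + snd v) / k)) (v0 w))) \<longlongrightarrow> 0) at_top"
      by (rule test_fun_stable[OF f v v0_UT])
    then have "(\<lambda>n. integral {0..t n} (\<lambda>u. f (geodesic_flow u v)) / t n) \<longlonglongrightarrow> I"
      using w(2) unfolding Good_def avg_def mem_Collect_eq
      by (rule average_asymptotic[OF test_fun_flow_continuous[OF f v] test_fun_bounds[OF f] v0c test_fun_bounds[OF f] _ t(1)])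
    moreover have "f (geodesic_flow u v) = f (geodesic_flow u (rep V))" for u
      using inv g geodesic_flow_UT[OF r] by (simp add: v_def geodesic_flow_gact inv_fun_def)
    ultimately show ?case by simp
  qed
  then have "(\<integral>\<^sup>+V. ennreal (f (rep V)) \<partial>m) = ennreal I"
    by (rule nn_integral_of_averages[OF f t])
  then show ?thesis using NS by simp
qed

theorem factor_map_distr: "distr NS m (factor_map \<Gamma>) = m"
proof (rule measure_eq_test_fun)
  show "emeasure (distr NS m (factor_map \<Gamma>)) (T1M \<Gamma>) = 1"
  proof -
    have "T1M \<Gamma> \<in> sets m" using sets.top[of m] by (simp add: space_m)
    then have "emeasure (distr NS m (factor_map \<Gamma>)) (T1M \<Gamma>) = emeasure NS (factor_map \<Gamma> -` T1M \<Gamma> \<inter> space NS)"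
      by (rule emeasure_distr[OF factor_map_measurable])
    also have "factor_map \<Gamma> -` T1M \<Gamma> \<inter> space NS = S"
      using measurable_space[OF factor_map_measurable] by (auto simp: space_NS space_m)
    finally show ?thesis by (simp add: emeasure_NS)
  qed
  fix f assume f: "test_fun f"
  have fm: "(\<lambda>V. f (rep V)) \<in> borel_measurable m"
    using f by (intro inv_fun_measurable measurable_restrict_space1 test_fun_borel) (auto simp: test_fun_def)
  have "(\<integral>\<^sup>+V. ennreal (f (rep V)) \<partial>distr NS m (factor_map \<Gamma>)) = (\<integral>\<^sup>+p. ennreal (f (rep (factor_map \<Gamma> p))) \<partial>NS)"
    using fm factor_map_measurable by (subst nn_integral_distr) auto
  also have "\<dots> = (\<integral>\<^sup>+p. ennreal (f (lv (fst p) (snd p))) \<partial>NS)"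
  proof (rule nn_integral_cong)
    fix p assume "p \<in> space NS"
    then have "fst p \<in> X" by (simp add: space_NS S_iff)
    then show "ennreal (f (rep (factor_map \<Gamma> p))) = ennreal (f (lv (fst p) (snd p)))"
      using factor_map_lv[of "fst p" "snd p"] inv_fun_rep[of f] lv_UT f by (simp add: test_fun_def)
  qed
  also have "\<dots> = (\<integral>\<^sup>+V. ennreal (f (rep V)) \<partial>m)" by (rule nn_integral_test_fun[OF f])
  finally show "(\<integral>\<^sup>+V. ennreal (f (rep V)) \<partial>distr NS m (factor_map \<Gamma>)) = (\<integral>\<^sup>+V. ennreal (f (rep V)) \<partial>m)" .
qed simp

end

text \<open>The skew map is partial, so the flow identity is asserted where the flow is defined, and
  this set is shown to have full measure for each time. Measurability stands beside the equality of
  measures because it is what gives \<open>distr\<close> its meaning.\<close>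

theorem proposition4p15:
  fixes \<Gamma> :: "'d::finite lmat set"
    and \<mu> :: "(real ^ 'd) bdry measure"
    and m :: "'d uvec set measure"
    and Ginf :: "'d lmat set"
    and Z D' \<Delta>\<^sub>0 :: "(real ^ 'd) set"
    and k :: nat
    and C' C\<^sub>1 lam eps lam' :: real
    and \<Delta> :: "nat \<Rightarrow> (real ^ 'd) set"
    and \<gamma> :: "nat \<Rightarrow> 'd lmat"
    and T :: "real ^ 'd \<Rightarrow> real ^ 'd"
    and \<Lambda>m :: "(real ^ 'd) bdry set"
    and \<nu> :: "(real ^ 'd) measure"
    and \<nu>' :: "((real ^ 'd) \<times> (real ^ 'd) bdry) measure"
  assumes "subgroup \<Gamma> SO0"
    and "zariski_dense \<Gamma>"
    and "torsion_free \<Gamma>"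
    and "geometrically_finite \<Gamma>"
    and "parabolic_fixed_point \<Gamma> Infty"
    and "patterson_sullivan \<Gamma> \<mu>"
    and "bms_measure \<Gamma> \<mu> m"
    and "cusp_region \<Gamma> Ginf Z k C' D' \<Delta>\<^sub>0"
    and "coding \<Gamma> \<mu> \<Delta>\<^sub>0 \<Delta> \<gamma> T \<Lambda>m C\<^sub>1 lam eps lam'"
    and "coding_measure \<Gamma> \<mu> \<Delta>\<^sub>0 \<Delta> T \<nu>"
    and "skew_measure \<Gamma> \<Delta> \<gamma> \<Lambda>m \<nu> \<nu>'"
  shows "factor_map \<Gamma> \<in> measurable (susp_measure \<Gamma> \<Delta> \<Lambda>m T \<nu>') m
    \<and> distr (susp_measure \<Gamma> \<Delta> \<Lambda>m T \<nu>') m (factor_map \<Gamma>) = m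
    \<and> (\<forall>t\<ge>0. (AE p in susp_measure \<Gamma> \<Delta> \<Lambda>m T \<nu>'. p \<in> flow_dom \<Gamma> \<Delta> \<gamma> \<Lambda>m T t)
         \<and> (\<forall>p\<in>flow_dom \<Gamma> \<Delta> \<gamma> \<Lambda>m T t.
              factor_map \<Gamma> (skew_flow \<Gamma> \<Delta> \<gamma> \<Lambda>m T t p) = T1M_flow t (factor_map \<Gamma> p)))"
proof -
  interpret lorentz_group \<Gamma> by (rule subgroup_SO0_lorentz_group[OF assms(1)])
  have "discrete \<Gamma>" using assms(4) by (simp add: geometrically_finite_def)
  note ps = patterson_sullivan_facts[OF assms(6) lorp]
  interpret kleinian \<Gamma> using \<open>discrete \<Gamma>\<close> assms(3) by unfold_locales
  interpret coding \<Gamma> \<mu> \<Delta>\<^sub>0 \<Delta> \<gamma> T \<Lambda>m C\<^sub>1 lam eps lam' by fact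
  interpret cm: coding_measure \<Gamma> \<mu> \<Delta>\<^sub>0 \<Delta> T \<nu> by fact
  interpret sm: skew_measure \<Gamma> \<Delta> \<gamma> \<Lambda>m \<nu> \<nu>' by fact
  interpret fin: finite_measure \<mu> by (rule ps(1))
  interpret bms_system \<Gamma> \<mu> \<Delta>\<^sub>0 \<Delta> \<gamma> T \<Lambda>m C\<^sub>1 lam eps lam' \<nu> \<nu>' m
    using assms(5,6,7) ps(2) by unfold_locales
  show ?thesis
    using factor_map_measurable factor_map_distr flow_defined_AE semiconjugacy by blast
qed

end
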